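(* Suppose that there exists a morphism $\varphi:N\to M_{H,\mathcal O}$, where $N:\mathcal P(H,\Upsilon_{H,I})\to\mathcal O\text{-Mod}$ is a restricted tensor product $\otimes'_{v\in I}N_v$ of $\mathcal O$-torsion free CoMack functors $N_v$ on $(H_v,\Upsilon_{H_v})$ taken with respect to a collection $\{\phi_{U_v}\in N_v(U_v)\}_{v\in I}$ that satisfies $\varphi(\otimes_{v\in I}\phi_{U_v})=x_U$. If a zeta element $\zeta_v\in\mathcal C(G_v/K_v,\widehat N_{v,\Phi})$ exists for $(\phi_{U_v},\mathfrak H_v,L_v)$ for every $v\in I'$, then there exist classes $y_\nu\in M_{G,\mathcal O}(K[\nu])$ for each $\nu\in\mathcal N$ such that $y_\varnothing=y_K$ and $$\mathfrak H_{\mu\setminus\nu,*}(y_\nu)=\mathrm{pr}_{\mu,\nu,*}(y_\mu)$$ for all $\nu,\mu\in\mathcal N$ satisfying $\nu\subset\mu$.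
   Context: **RIC functors.** For a locally profinite group $G$, collections $\Upsilon$ of compact open subgroups are required to be non-empty and satisfy (T1) stability under conjugation; (T2) for $K,L\in\Upsilon$ there is $K'\in\Upsilon$, $K'\triangleleft K$, $K'\subset L$; (T3) stability under pairwise intersection. $\mathcal P(G,\Upsilon)$ has objects $\Upsilon$, $\mathrm{Hom}(L,K)=\{g\in G:g^{-1}Lg\subset K\}$, composition $(L\xrightarrow{g}K)\circ(L'\xrightarrow{h}L)=(L'\xrightarrow{hg}K)$. A RIC functor $M$ valued in $\mathcal O$-modules is a pair of functors $M^*:\mathcal P(G,\Upsilon)^{op}\to\mathcal O\text{-Mod}$, $M_*:\mathcal P(G,\Upsilon)\to\mathcal O\text{-Mod}$ agreeing on objects (value $M(K)$), with maps $[g]^*_{L,K}:M(K)\to M(L)$, $[g]_{L,K,*}:M(L)\to M(K)$ ($\mathrm{pr}_{L,K}$ for $g=e$), such that $[g]^*_{L,K}=[g^{-1}]_{K,L,*}$ if $g^{-1}Lg=K$ and $[\gamma]_{K,K,*}=\mathrm{id}$ for $\gamma\in K$. *CoMack* means cohomological ($\mathrm{pr}_{L,K,*}\mathrm{pr}_{L,K}^*=[K:L]$) and Mackey ($\mathrm{pr}_{L,K}^*\mathrm{pr}_{L',K,*}=\sum_{\gamma\in L\backslash K/L'}\mathrm{pr}_{L_\gamma,L,*}[\gamma]^*_{L_\gamma,L'}$, $L_\gamma=L\cap\gamma L'\gamma^{-1}$, for $L,L'\subset K$). A morphism of RIC functors is a family of maps $N(K)\to M(K)$ natural for both $(\cdot)^*$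 and $(\cdot)_*$. **Pushforwards.** For a closed subgroup $H\subset G$ and $\Upsilon_H\supset\{K\cap H:K\in\Upsilon_G\}$, a pushforward $\iota_*:N\to M$ is a family $\iota_{V,K',*}:N(V)\to M(K')$ ($V\in\Upsilon_H$, $K'\in\Upsilon_G$, $V\subset K'$) commuting with $[h]_*$ on both sides for $h\in H$ (whenever $h^{-1}V'h\subset V$, $h^{-1}L'h\subset K'$, $V'\subset L'$); it is *Mackey* if for $V,L'\subset K'$: $\mathrm{pr}^*_{L',K'}\circ\iota_{V,K',*}=\sum_{\gamma\in V\backslash K'/L'}[\gamma]_{\gamma L'\gamma^{-1},L',*}\circ\iota_{V_\gamma,\gamma L'\gamma^{-1},*}\circ\mathrm{pr}^*_{V_\gamma,V}$, $V_\gamma=V\cap\gamma L'\gamma^{-1}$. **Hecke correspondences.** $[K'\sigma K]:M(K)\to M(K')$ is $\mathrm{pr}_{K'\cap\sigma K\sigma^{-1},K',*}\circ[\sigma]^*\circ\mathrm{pr}^*_{K\cap\sigma^{-1}K'\sigma,K}$ and $[K'\sigma K]_*=[K\sigma^{-1}K']$. **Setting.** $I$ is an index set; for $v\in I$, $H_v\hookrightarrow G_v$ is a (closed) embedding of unimodular locally profinite groups, $K_v\subset G_v$ compact open, $U_v=H_v\cap K_v$. $G=\prod'G_v$, $H=\prod'H_v$ are restricted direct products with respect to $K_v$, $U_v$; $K=\prod K_v$, $U=\prod U_v$. For $v$ in a subset $I'\subset I$ with finite complement, $L_v$ is a compact open normal subgroup of $K_v$; $\mathcal N$ is the set of finite subsets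 of $I'$; for $\nu\in\mathcal N$, $K[\nu]=K^\nu\times\prod_{v\in\nu}L_v$ with $K^\nu=\prod_{v\notin\nu}K_v$. $\Upsilon_G$ satisfies (T1)-(T3) and contains $K$ and $L_vK^{v}$ for all $v\in I'$; $\Upsilon_H$ satisfies (T1)-(T3) and contains $\{K'\cap H:K'\in\Upsilon_G\}$. $\mathcal O$ is an integral domain whose field of fractions $\Phi$ is a $\mathbb Q$-algebra. $M_{H,\mathcal O}$ on $(H,\Upsilon_H)$ and $M_{G,\mathcal O}$ on $(G,\Upsilon_G)$ are CoMack functors, $\iota_*:M_{H,\mathcal O}\to M_{G,\mathcal O}$ is a Mackey pushforward, $x_U\in M_{H,\mathcal O}(U)$ and $y_K=\iota_{U,K,*}(x_U)$. For $v\in I'$, $\mathfrak H_v$ is a (non-zero) finite $\mathcal O$-linear combination of characteristic functions of double cosets in $K_v\backslash G_v/K_v$. For disjoint $\mu,\nu\in\mathcal N$, $\mathfrak H_{\mu,*}:M_{G,\mathcal O}(K[\nu])\to M_{G,\mathcal O}(K[\nu])$ is the composition over $v\in\mu$ of the (commuting) operators $\sum_\sigma c_\sigma[K[\nu]\sigma K[\nu]]_*$ where $\mathfrak H_v=\sum c_\sigma\mathrm{ch}(K_v\sigma K_v)$. $\mathrm{pr}_{\mu,\nu,*}=\mathrm{pr}_{K[\mu],K[\nu],*}$. $\Upsilon_{G_v}$ is the collection of finite intersections of conjugates of $K_v$ and (if $v\in I'$) $L_v$; $\Upsilon_{H_v}=\{K'\cap H_v:K'\in\Upsilon_{G_v}\}$;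 $\Upsilon_{H,I}$ is the collection of subgroups $\prod_vW_v$ with $W_v\in\Upsilon_{H_v}$ and $W_v=U_v$ for almost all $v$ (so $\Upsilon_{H,I}\subset\Upsilon_H$). The restricted tensor product $N=\otimes'N_v$ with respect to $\phi_{U_v}$ is the RIC functor with $N(\prod W_v)=\varinjlim_\mu\bigotimes_{v\in\mu}N_v(W_v)$, over finite $\mu\subset I$ containing all $v$ with $W_v\neq U_v$, transition maps $x\mapsto x\otimes\bigotimes\phi_{U_v}$; $\varphi:N\to M_{H,\mathcal O}$ is a morphism of functors on $\mathcal P(H,\Upsilon_{H,I})$. **Zeta elements at $v$.** $\widehat N_{v,\Phi}=\varinjlim_{V\in\Upsilon_{H_v}}N_v(V)\otimes_{\mathcal O}\Phi$ under restrictions, with maps $j_V$ from $N_v(V)$ and $H_v$-action $h\cdot j_V(x)=j_{hVh^{-1}}([h]^*_{hVh^{-1},V}x)$. $\mathcal C(G_v/K_v,\widehat N_{v,\Phi})$ is the space of right $K_v$-invariant compactly supported functions $\xi:G_v\to\widehat N_{v,\Phi}$ with $(h\xi)(g)=h\,\xi(h^{-1}g)$. Put $[V_1:V_2]=\mu(V_1)/\mu(V_2)$ for a Haar measure $\mu$ on $H_v$. A zeta element for $(\phi_{U_v},\mathfrak H_v,L_v)$ is a $\zeta$ in this space such that (i) for each $g\in G_v$ there are finitely many $V_i\in\Upsilon_{H_v}$, $V_i\subset gL_vg^{-1}$, $x_i\in N_v(V_i)$ with $\zeta(g)=\sum_i[U_v:V_i]j_{V_i}(x_i)$; (ii) $\zeta$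 and $g\mapsto\mathfrak H_v(g)j_{U_v}(\phi_{U_v})$ have the same class in $H_v$-coinvariants. *)

theory Defs
  imports "HOL-Analysis.Analysis" "HOL-Algebra.Module" "HOL-Algebra.QuotRing" "HOL-Algebra.Product_Groups"
begin

section \<open>Topological groups and Haar measures\<close>

definition topological_group :: "('a, 'b) monoid_scheme \<Rightarrow> 'a topology \<Rightarrow> bool" where
  "topological_group G T \<longleftrightarrow>
     Group.group G \<and> topspace T = carrier G \<and>
     continuous_map (prod_topology T T) T (\<lambda>(x, y). x \<otimes>\<^bsub>G\<^esub> y) \<and>
     continuous_map T T (\<lambda>x. inv\<^bsub>G\<^esub> x)"

definition compact_open_subgroup :: "('a, 'b) monoid_scheme \<Rightarrow> 'a topology \<Rightarrow> 'a set \<Rightarrow> bool" where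
  "compact_open_subgroup G T K \<longleftrightarrow> subgroup K G \<and> compactin T K \<and> openin T K"

definition locally_profinite :: "('a, 'b) monoid_scheme \<Rightarrow> 'a topology \<Rightarrow> bool" where
  "locally_profinite G T \<longleftrightarrow>
     topological_group G T \<and> Hausdorff_space T \<and>
     (\<forall>W. openin T W \<and> \<one>\<^bsub>G\<^esub> \<in> W \<longrightarrow> (\<exists>K. compact_open_subgroup G T K \<and> K \<subseteq> W))"

text \<open>Left Haar measures are Radon measures on the Borel sets (outer regular on all Borel sets, inner
  regular on open sets); second countability is not assumed.\<close>

definition left_haar_measure :: "('a, 'b) monoid_scheme \<Rightarrow> 'a topology \<Rightarrow> 'a measure \<Rightarrow> bool" where
  "left_haar_measure G T \<mu> \<longleftrightarrow>
     space \<mu> = topspace T \<and>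
     sets \<mu> = sigma_sets (topspace T) {W. openin T W} \<and>
     emeasure \<mu> (space \<mu>) \<noteq> 0 \<and>
     (\<forall>C. compactin T C \<longrightarrow> emeasure \<mu> C < \<infinity>) \<and>
     (\<forall>A\<in>sets \<mu>. emeasure \<mu> A = (INF W\<in>{W. openin T W \<and> A \<subseteq> W}. emeasure \<mu> W)) \<and>
     (\<forall>W. openin T W \<longrightarrow> emeasure \<mu> W = (SUP C\<in>{C. compactin T C \<and> C \<subseteq> W}. emeasure \<mu> C)) \<and>
     (\<forall>g\<in>carrier G. \<forall>A\<in>sets \<mu>. emeasure \<mu> (g <#\<^bsub>G\<^esub> A) = emeasure \<mu> A)"

text \<open>By uniqueness of Haar measure up to scaling, one right invariant left Haar measure suffices.\<close>

definition unimodular :: "('a, 'b) monoid_scheme \<Rightarrow> 'a topology \<Rightarrow> bool" where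
  "unimodular G T \<longleftrightarrow>
     (\<exists>\<mu>. left_haar_measure G T \<mu> \<and>
        (\<forall>g\<in>carrier G. \<forall>A\<in>sets \<mu>. emeasure \<mu> (A #>\<^bsub>G\<^esub> g) = emeasure \<mu> A))"

text \<open>The generalized index \<open>\<mu>(V\<^sub>1)/\<mu>(V\<^sub>2)\<close> of compact open subgroups, which is a rational number.\<close>

definition haar_index :: "'a measure \<Rightarrow> 'a set \<Rightarrow> 'a set \<Rightarrow> rat" where
  "haar_index \<mu> V1 V2 = (THE q. of_rat q = measure \<mu> V1 / measure \<mu> V2)"

definition conj_by :: "('a, 'b) monoid_scheme \<Rightarrow> 'a \<Rightarrow> 'a set \<Rightarrow> 'a set" where
  "conj_by G g A = (\<lambda>x. g \<otimes>\<^bsub>G\<^esub> x \<otimes>\<^bsub>G\<^esub> inv\<^bsub>G\<^esub> g) ` A"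

definition double_coset :: "('a, 'b) monoid_scheme \<Rightarrow> 'a set \<Rightarrow> 'a \<Rightarrow> 'a set \<Rightarrow> 'a set" where
  "double_coset G A g B = {a \<otimes>\<^bsub>G\<^esub> g \<otimes>\<^bsub>G\<^esub> b | a b. a \<in> A \<and> b \<in> B}"

text \<open>\<open>\<Gamma>\<close> is a set of representatives of the double cosets \<open>A k B\<close> in \<open>K\<close>.\<close>

definition double_coset_reps ::
    "('a, 'b) monoid_scheme \<Rightarrow> 'a set \<Rightarrow> 'a set \<Rightarrow> 'a set \<Rightarrow> 'a set \<Rightarrow> bool" where
  "double_coset_reps G A K B \<Gamma> \<longleftrightarrow> \<Gamma> \<subseteq> K \<and> (\<forall>k\<in>K. \<exists>!\<gamma>. \<gamma> \<in> \<Gamma> \<and> k \<in> double_coset G A \<gamma> B)"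

definition level_collection ::
    "('a, 'b) monoid_scheme \<Rightarrow> 'a topology \<Rightarrow> 'a set set \<Rightarrow> bool" where
  "level_collection G T \<Upsilon> \<longleftrightarrow>
     \<Upsilon> \<noteq> {} \<and> (\<forall>K\<in>\<Upsilon>. compact_open_subgroup G T K) \<and>
     (\<forall>g\<in>carrier G. \<forall>K\<in>\<Upsilon>. conj_by G g K \<in> \<Upsilon>) \<and>
     (\<forall>K\<in>\<Upsilon>. \<forall>L\<in>\<Upsilon>. \<exists>K'\<in>\<Upsilon>. K' \<lhd> G\<lparr>carrier := K\<rparr> \<and> K' \<subseteq> L) \<and>
     (\<forall>K\<in>\<Upsilon>. \<forall>L\<in>\<Upsilon>. K \<inter> L \<in> \<Upsilon>)"

definition conj_intersections :: "('a, 'b) monoid_scheme \<Rightarrow> 'a set set \<Rightarrow> 'a set set" where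
  "conj_intersections G \<B> =
     {\<Inter>F | F. finite F \<and> F \<noteq> {} \<and> F \<subseteq> {conj_by G g A | g A. g \<in> carrier G \<and> A \<in> \<B>}}"


section \<open>Restricted direct products\<close>

definition restricted_product ::
    "'i set \<Rightarrow> ('i \<Rightarrow> ('a, 'b) monoid_scheme) \<Rightarrow> ('i \<Rightarrow> 'a set) \<Rightarrow> ('i \<Rightarrow> 'a) monoid" where
  "restricted_product I G K =
     (product_group I G)
       \<lparr>carrier := {g \<in> carrier (product_group I G). finite {v\<in>I. g v \<notin> K v}}\<rparr>"

definition restricted_topology ::
    "'i set \<Rightarrow> ('i \<Rightarrow> 'a topology) \<Rightarrow> ('i \<Rightarrow> 'a set) \<Rightarrow> ('i \<Rightarrow> 'a) topology" where
  "restricted_topology I T K =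
     topology_generated_by
       {PiE I A | A. (\<forall>v\<in>I. openin (T v) (A v)) \<and> finite {v\<in>I. A v \<noteq> K v}}"

definition embed_at :: "'i set \<Rightarrow> ('i \<Rightarrow> ('a, 'b) monoid_scheme) \<Rightarrow> 'i \<Rightarrow> 'a \<Rightarrow> ('i \<Rightarrow> 'a)" where
  "embed_at I G v \<sigma> = (\<lambda>w\<in>I. if w = v then \<sigma> else \<one>\<^bsub>G w\<^esub>)"

definition product_levels :: "'i set \<Rightarrow> ('i \<Rightarrow> 'a set) \<Rightarrow> ('i \<Rightarrow> 'a set set) \<Rightarrow> ('i \<Rightarrow> 'a) set set" where
  "product_levels I U \<Upsilon> = {PiE I W | W. (\<forall>v\<in>I. W v \<in> \<Upsilon> v) \<and> finite {v\<in>I. W v \<noteq> U v}}"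

definition component :: "'i \<Rightarrow> ('i \<Rightarrow> 'a) set \<Rightarrow> 'a set" where
  "component v W = (\<lambda>w. w v) ` W"


section \<open>Modules: free modules, quotients, tensor products, direct limits\<close>

text \<open>The record type of modules extends that of rings; the fields \<open>mult\<close> and \<open>one\<close> are irrelevant.\<close>

definition linear_maps ::
    "('r, 'c) ring_scheme \<Rightarrow> ('r, 'm) module \<Rightarrow> ('r, 'n) module \<Rightarrow> ('m \<Rightarrow> 'n) set" where
  "linear_maps R M N =
     {f. f \<in> carrier M \<rightarrow> carrier N \<and>
         (\<forall>x\<in>carrier M. \<forall>y\<in>carrier M. f (x \<oplus>\<^bsub>M\<^esub> y) = f x \<oplus>\<^bsub>N\<^esub> f y) \<and>
         (\<forall>r\<in>carrier R. \<forall>x\<in>carrier M. f (r \<odot>\<^bsub>M\<^esub> x) = r \<odot>\<^bsub>N\<^esub> f x)}"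

definition torsion_free :: "('r, 'c) ring_scheme \<Rightarrow> ('r, 'm) module \<Rightarrow> bool" where
  "torsion_free R M \<longleftrightarrow>
     (\<forall>r\<in>carrier R. \<forall>x\<in>carrier M. r \<odot>\<^bsub>M\<^esub> x = \<zero>\<^bsub>M\<^esub> \<longrightarrow> r = \<zero>\<^bsub>R\<^esub> \<or> x = \<zero>\<^bsub>M\<^esub>)"

definition submodule_generated ::
    "('r, 'c) ring_scheme \<Rightarrow> ('r, 'm) module \<Rightarrow> 'm set \<Rightarrow> 'm set" where
  "submodule_generated R M S = \<Inter>{A. submodule A R M \<and> S \<subseteq> A}"

definition quotient_module :: "('r, 'm) module \<Rightarrow> 'm set \<Rightarrow> ('r, 'm set) module" where
  "quotient_module M A =
     \<lparr>carrier = a_rcosets\<^bsub>M\<^esub> A, mult = undefined, one = undefined,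
      zero = A, add = (<+>\<^bsub>M\<^esub>),
      smult = (\<lambda>r Q. \<Union>x\<in>Q. A +>\<^bsub>M\<^esub> (r \<odot>\<^bsub>M\<^esub> x))\<rparr>"

text \<open>The map into the quotient of \<open>N\<close> by \<open>B\<close> which a map \<open>f\<close> into \<open>N\<close> induces on cosets:
  all members of the union coincide if \<open>f\<close> respects the cosets.\<close>

definition quotient_map_induced :: "('r, 'n) module \<Rightarrow> 'n set \<Rightarrow> ('m \<Rightarrow> 'n) \<Rightarrow> 'm set \<Rightarrow> 'n set" where
  "quotient_map_induced N B f Q = (\<Union>x\<in>Q. B +>\<^bsub>N\<^esub> f x)"

definition free_module :: "('r, 'c) ring_scheme \<Rightarrow> 'x set \<Rightarrow> ('r, 'x \<Rightarrow> 'r) module" where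
  "free_module R Q =
     \<lparr>carrier = {c. (\<forall>x\<in>Q. c x \<in> carrier R) \<and> (\<forall>x. x \<notin> Q \<longrightarrow> c x = \<zero>\<^bsub>R\<^esub>) \<and>
                    finite {x. c x \<noteq> \<zero>\<^bsub>R\<^esub>}},
      mult = undefined, one = undefined,
      zero = (\<lambda>x. \<zero>\<^bsub>R\<^esub>), add = (\<lambda>c d x. c x \<oplus>\<^bsub>R\<^esub> d x), smult = (\<lambda>r c x. r \<otimes>\<^bsub>R\<^esub> c x)\<rparr>"

definition basis_vector :: "('r, 'c) ring_scheme \<Rightarrow> 'x \<Rightarrow> 'x \<Rightarrow> 'r" where
  "basis_vector R x = (\<lambda>y. if y = x then \<one>\<^bsub>R\<^esub> else \<zero>\<^bsub>R\<^esub>)"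

text \<open>Linear extension of a map between bases.\<close>

definition free_map :: "('r, 'c) ring_scheme \<Rightarrow> ('x \<Rightarrow> 'y) \<Rightarrow> ('x \<Rightarrow> 'r) \<Rightarrow> 'y \<Rightarrow> 'r" where
  "free_map R F c = (\<lambda>y. \<Oplus>\<^bsub>R\<^esub>x\<in>{x. c x \<noteq> \<zero>\<^bsub>R\<^esub> \<and> F x = y}. c x)"


subsection \<open>Tensor products of finite families\<close>

definition tensor_free ::
    "('r, 'c) ring_scheme \<Rightarrow> 'i set \<Rightarrow> ('i \<Rightarrow> ('r, 'm) module) \<Rightarrow> ('r, ('i \<Rightarrow> 'm) \<Rightarrow> 'r) module" where
  "tensor_free R J A = free_module R (\<Pi>\<^sub>E j\<in>J. carrier (A j))"

definition tensor_relations ::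
    "('r, 'c) ring_scheme \<Rightarrow> 'i set \<Rightarrow> ('i \<Rightarrow> ('r, 'm) module) \<Rightarrow> (('i \<Rightarrow> 'm) \<Rightarrow> 'r) set" where
  "tensor_relations R J A = (let F = tensor_free R J A; \<delta> = basis_vector R in
     submodule_generated R F
       ({\<delta> (f(j := a \<oplus>\<^bsub>A j\<^esub> b)) \<ominus>\<^bsub>F\<^esub> (\<delta> (f(j := a)) \<oplus>\<^bsub>F\<^esub> \<delta> (f(j := b))) | f j a b.
           f \<in> (\<Pi>\<^sub>E j\<in>J. carrier (A j)) \<and> j \<in> J \<and> a \<in> carrier (A j) \<and> b \<in> carrier (A j)} \<union>
        {\<delta> (f(j := r \<odot>\<^bsub>A j\<^esub> a)) \<ominus>\<^bsub>F\<^esub> (r \<odot>\<^bsub>F\<^esub> \<delta> (f(j := a))) | f j r a.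
           f \<in> (\<Pi>\<^sub>E j\<in>J. carrier (A j)) \<and> j \<in> J \<and> r \<in> carrier R \<and> a \<in> carrier (A j)}))"

definition tensor ::
    "('r, 'c) ring_scheme \<Rightarrow> 'i set \<Rightarrow> ('i \<Rightarrow> ('r, 'm) module) \<Rightarrow>
       ('r, (('i \<Rightarrow> 'm) \<Rightarrow> 'r) set) module" where
  "tensor R J A = quotient_module (tensor_free R J A) (tensor_relations R J A)"

definition pure_tensor ::
    "('r, 'c) ring_scheme \<Rightarrow> 'i set \<Rightarrow> ('i \<Rightarrow> ('r, 'm) module) \<Rightarrow> ('i \<Rightarrow> 'm) \<Rightarrow>
       (('i \<Rightarrow> 'm) \<Rightarrow> 'r) set" where
  "pure_tensor R J A x = tensor_relations R J A +>\<^bsub>tensor_free R J A\<^esub> basis_vector R (restrict x J)"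

text \<open>The tensor product of maps \<open>h j\<close> into modules \<open>B j\<close>.\<close>

definition tensor_map ::
    "('r, 'c) ring_scheme \<Rightarrow> 'i set \<Rightarrow> ('i \<Rightarrow> ('r, 'n) module) \<Rightarrow> ('i \<Rightarrow> 'm \<Rightarrow> 'n) \<Rightarrow>
       (('i \<Rightarrow> 'm) \<Rightarrow> 'r) set \<Rightarrow> (('i \<Rightarrow> 'n) \<Rightarrow> 'r) set" where
  "tensor_map R J B h =
     quotient_map_induced (tensor_free R J B) (tensor_relations R J B)
       (free_map R (\<lambda>f. \<lambda>j\<in>J. h j (f j)))"

text \<open>The map \<open>x \<mapsto> x \<otimes> \<Otimes>\<^sub>j \<phi>\<^sub>j\<close> with \<open>j\<close> running over \<open>J' - J\<close>, for \<open>J \<subseteq> J'\<close>.\<close>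

definition tensor_extend ::
    "('r, 'c) ring_scheme \<Rightarrow> ('i \<Rightarrow> ('r, 'm) module) \<Rightarrow> ('i \<Rightarrow> 'm) \<Rightarrow> 'i set \<Rightarrow> 'i set \<Rightarrow>
       (('i \<Rightarrow> 'm) \<Rightarrow> 'r) set \<Rightarrow> (('i \<Rightarrow> 'm) \<Rightarrow> 'r) set" where
  "tensor_extend R A \<phi> J J' =
     quotient_map_induced (tensor_free R J' A) (tensor_relations R J' A)
       (free_map R (\<lambda>f. \<lambda>j\<in>J'. if j \<in> J then f j else \<phi> j))"


subsection \<open>Extension of scalars to the field of fractions\<close>

definition fraction_field_of ::
    "('r, 'c) ring_scheme \<Rightarrow> ('k, 'd) ring_scheme \<Rightarrow> ('r \<Rightarrow> 'k) \<Rightarrow> bool" where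
  "fraction_field_of R \<Phi> e \<longleftrightarrow>
     field \<Phi> \<and> e \<in> ring_hom R \<Phi> \<and> inj_on e (carrier R) \<and>
     (\<forall>x\<in>carrier \<Phi>. \<exists>a\<in>carrier R. \<exists>b\<in>carrier R - {\<zero>\<^bsub>R\<^esub>}. x = e a \<otimes>\<^bsub>\<Phi>\<^esub> inv\<^bsub>\<Phi>\<^esub> (e b))"

definition rat_ring :: "rat ring" where
  "rat_ring = \<lparr>carrier = UNIV, mult = (*), one = 1, zero = 0, add = (+)\<rparr>"

definition tensor2_free ::
    "('r, 'c) ring_scheme \<Rightarrow> ('r, 'm) module \<Rightarrow> ('r, 'n) module \<Rightarrow> ('r, 'm \<times> 'n \<Rightarrow> 'r) module" where
  "tensor2_free R M N = free_module R (carrier M \<times> carrier N)"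

definition tensor2_relations ::
    "('r, 'c) ring_scheme \<Rightarrow> ('r, 'm) module \<Rightarrow> ('r, 'n) module \<Rightarrow> ('m \<times> 'n \<Rightarrow> 'r) set" where
  "tensor2_relations R M N = (let F = tensor2_free R M N; \<delta> = basis_vector R in
     submodule_generated R F
       ({\<delta> (x \<oplus>\<^bsub>M\<^esub> x', y) \<ominus>\<^bsub>F\<^esub> (\<delta> (x, y) \<oplus>\<^bsub>F\<^esub> \<delta> (x', y)) | x x' y.
           x \<in> carrier M \<and> x' \<in> carrier M \<and> y \<in> carrier N} \<union>
        {\<delta> (x, y \<oplus>\<^bsub>N\<^esub> y') \<ominus>\<^bsub>F\<^esub> (\<delta> (x, y) \<oplus>\<^bsub>F\<^esub> \<delta> (x, y')) | x y y'.
           x \<in> carrier M \<and> y \<in> carrier N \<and> y' \<in> carrier N} \<union>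
        {\<delta> (r \<odot>\<^bsub>M\<^esub> x, y) \<ominus>\<^bsub>F\<^esub> (r \<odot>\<^bsub>F\<^esub> \<delta> (x, y)) | r x y.
           r \<in> carrier R \<and> x \<in> carrier M \<and> y \<in> carrier N} \<union>
        {\<delta> (x, r \<odot>\<^bsub>N\<^esub> y) \<ominus>\<^bsub>F\<^esub> (r \<odot>\<^bsub>F\<^esub> \<delta> (x, y)) | r x y.
           r \<in> carrier R \<and> x \<in> carrier M \<and> y \<in> carrier N}))"

definition tensor2 ::
    "('r, 'c) ring_scheme \<Rightarrow> ('r, 'm) module \<Rightarrow> ('r, 'n) module \<Rightarrow>
       ('r, ('m \<times> 'n \<Rightarrow> 'r) set) module" where
  "tensor2 R M N = quotient_module (tensor2_free R M N) (tensor2_relations R M N)"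

definition pure_tensor2 ::
    "('r, 'c) ring_scheme \<Rightarrow> ('r, 'm) module \<Rightarrow> ('r, 'n) module \<Rightarrow> 'm \<Rightarrow> 'n \<Rightarrow>
       ('m \<times> 'n \<Rightarrow> 'r) set" where
  "pure_tensor2 R M N x y = tensor2_relations R M N +>\<^bsub>tensor2_free R M N\<^esub> basis_vector R (x, y)"

definition tensor2_map ::
    "('r, 'c) ring_scheme \<Rightarrow> ('r, 'm2) module \<Rightarrow> ('r, 'n2) module \<Rightarrow>
       ('m1 \<Rightarrow> 'm2) \<Rightarrow> ('n1 \<Rightarrow> 'n2) \<Rightarrow> ('m1 \<times> 'n1 \<Rightarrow> 'r) set \<Rightarrow> ('m2 \<times> 'n2 \<Rightarrow> 'r) set" where
  "tensor2_map R M N f g =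
     quotient_map_induced (tensor2_free R M N) (tensor2_relations R M N) (free_map R (map_prod f g))"

definition restrict_scalars :: "('r \<Rightarrow> 'k) \<Rightarrow> ('k, 'd) ring_scheme \<Rightarrow> ('r, 'k) module" where
  "restrict_scalars e \<Phi> =
     \<lparr>carrier = carrier \<Phi>, mult = mult \<Phi>, one = one \<Phi>, zero = zero \<Phi>, add = add \<Phi>,
      smult = (\<lambda>r a. e r \<otimes>\<^bsub>\<Phi>\<^esub> a)\<rparr>"

text \<open>The tensor product of \<open>M\<close> and \<open>\<Phi>\<close> over \<open>R\<close>, as a \<open>\<Phi>\<close>-module.\<close>

definition scalar_extension ::
    "('r, 'c) ring_scheme \<Rightarrow> ('k, 'd) ring_scheme \<Rightarrow> ('r \<Rightarrow> 'k) \<Rightarrow> ('r, 'm) module \<Rightarrow>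
       ('k, ('m \<times> 'k \<Rightarrow> 'r) set) module" where
  "scalar_extension R \<Phi> e M = (let P = restrict_scalars e \<Phi>; A = tensor2 R M P in
     \<lparr>carrier = carrier A, mult = undefined, one = undefined, zero = zero A, add = add A,
      smult = (\<lambda>c. tensor2_map R M P id (\<lambda>a. c \<otimes>\<^bsub>\<Phi>\<^esub> a))\<rparr>)"


subsection \<open>Direct limits\<close>

text \<open>For a directed set \<open>(J, below)\<close>, modules \<open>D i\<close> and transition maps \<open>f i j : D i \<rightarrow> D j\<close>
  for \<open>below i j\<close>.\<close>

definition dl_relation ::
    "'j set \<Rightarrow> ('j \<Rightarrow> 'j \<Rightarrow> bool) \<Rightarrow> ('j \<Rightarrow> ('r, 'm) module) \<Rightarrow> ('j \<Rightarrow> 'j \<Rightarrow> 'm \<Rightarrow> 'm) \<Rightarrow>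
       (('j \<times> 'm) \<times> ('j \<times> 'm)) set" where
  "dl_relation J below D f =
     {((i, x), (j, y)) | i x j y.
        i \<in> J \<and> x \<in> carrier (D i) \<and> j \<in> J \<and> y \<in> carrier (D j) \<and>
        (\<exists>k\<in>J. below i k \<and> below j k \<and> f i k x = f j k y)}"

definition dl_class ::
    "'j set \<Rightarrow> ('j \<Rightarrow> 'j \<Rightarrow> bool) \<Rightarrow> ('j \<Rightarrow> ('r, 'm) module) \<Rightarrow> ('j \<Rightarrow> 'j \<Rightarrow> 'm \<Rightarrow> 'm) \<Rightarrow>
       'j \<times> 'm \<Rightarrow> ('j \<times> 'm) set" where
  "dl_class J below D f p = dl_relation J below D f `` {p}"

definition direct_limit ::
    "'j set \<Rightarrow> ('j \<Rightarrow> 'j \<Rightarrow> bool) \<Rightarrow> ('j \<Rightarrow> ('r, 'm) module) \<Rightarrow> ('j \<Rightarrow> 'j \<Rightarrow> 'm \<Rightarrow> 'm) \<Rightarrow>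
       ('r, ('j \<times> 'm) set) module" where
  "direct_limit J below D f = (let cl = dl_class J below D f in
     \<lparr>carrier = (SIGMA i:J. carrier (D i)) // dl_relation J below D f,
      mult = undefined, one = undefined,
      zero = (\<Union>i\<in>J. cl (i, \<zero>\<^bsub>D i\<^esub>)),
      add = (\<lambda>Q Y. \<Union>(i, x)\<in>Q. \<Union>(j, y)\<in>Y. \<Union>k\<in>{k\<in>J. below i k \<and> below j k}.
               cl (k, f i k x \<oplus>\<^bsub>D k\<^esub> f j k y)),
      smult = (\<lambda>r Q. \<Union>(i, x)\<in>Q. cl (i, r \<odot>\<^bsub>D i\<^esub> x))\<rparr>)"


section \<open>RIC functors\<close>

text \<open>\<open>pull M L g K\<close> is \<open>[g]\<^sup>*\<close> from \<open>M(K)\<close> to \<open>M(L)\<close>, and \<open>push M L g K\<close> is \<open>[g]\<^sub>*\<close> from \<open>M(L)\<close>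
  to \<open>M(K)\<close>, for the morphism \<open>g\<close> from \<open>L\<close> to \<open>K\<close>. The restriction and trace maps \<open>pr\<close> are the case
  \<open>g = 1\<close>.\<close>

record ('g, 'r, 'm) ric =
  obj :: "'g set \<Rightarrow> ('r, 'm) module"
  pull :: "'g set \<Rightarrow> 'g \<Rightarrow> 'g set \<Rightarrow> 'm \<Rightarrow> 'm"
  push :: "'g set \<Rightarrow> 'g \<Rightarrow> 'g set \<Rightarrow> 'm \<Rightarrow> 'm"

definition level_hom :: "('g, 'b) monoid_scheme \<Rightarrow> 'g set \<Rightarrow> 'g \<Rightarrow> 'g set \<Rightarrow> bool" where
  "level_hom G L g K \<longleftrightarrow> g \<in> carrier G \<and> conj_by G (inv\<^bsub>G\<^esub> g) L \<subseteq> K"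

definition ric_functor ::
    "('r, 'c) ring_scheme \<Rightarrow> ('g, 'b) monoid_scheme \<Rightarrow> 'g set set \<Rightarrow> ('g, 'r, 'm) ric \<Rightarrow> bool" where
  "ric_functor R G \<Upsilon> M \<longleftrightarrow>
     (\<forall>K\<in>\<Upsilon>. Module.module R (obj M K)) \<and>
     (\<forall>L\<in>\<Upsilon>. \<forall>K\<in>\<Upsilon>. \<forall>g. level_hom G L g K \<longrightarrow>
        pull M L g K \<in> linear_maps R (obj M K) (obj M L) \<and>
        push M L g K \<in> linear_maps R (obj M L) (obj M K)) \<and>
     (\<forall>K\<in>\<Upsilon>. \<forall>x\<in>carrier (obj M K). pull M K \<one>\<^bsub>G\<^esub> K x = x \<and> push M K \<one>\<^bsub>G\<^esub> K x = x) \<and>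
     (\<forall>L'\<in>\<Upsilon>. \<forall>L\<in>\<Upsilon>. \<forall>K\<in>\<Upsilon>. \<forall>h g. level_hom G L' h L \<and> level_hom G L g K \<longrightarrow>
        (\<forall>x\<in>carrier (obj M K). pull M L' (h \<otimes>\<^bsub>G\<^esub> g) K x = pull M L' h L (pull M L g K x)) \<and>
        (\<forall>x\<in>carrier (obj M L'). push M L' (h \<otimes>\<^bsub>G\<^esub> g) K x = push M L g K (push M L' h L x))) \<and>
     (\<forall>L\<in>\<Upsilon>. \<forall>K\<in>\<Upsilon>. \<forall>g\<in>carrier G. conj_by G (inv\<^bsub>G\<^esub> g) L = K \<longrightarrow>
        (\<forall>x\<in>carrier (obj M K). pull M L g K x = push M K (inv\<^bsub>G\<^esub> g) L x)) \<and>
     (\<forall>K\<in>\<Upsilon>. \<forall>\<gamma>\<in>K. \<forall>x\<in>carrier (obj M K). push M K \<gamma> K x = x)"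

definition cohomological ::
    "('g, 'b) monoid_scheme \<Rightarrow> 'g set set \<Rightarrow> ('g, 'r, 'm) ric \<Rightarrow> bool" where
  "cohomological G \<Upsilon> M \<longleftrightarrow>
     (\<forall>L\<in>\<Upsilon>. \<forall>K\<in>\<Upsilon>. L \<subseteq> K \<longrightarrow>
        (\<forall>x\<in>carrier (obj M K).
           push M L \<one>\<^bsub>G\<^esub> K (pull M L \<one>\<^bsub>G\<^esub> K x) =
             [card (rcosets\<^bsub>G\<lparr>carrier := K\<rparr>\<^esub> L)] \<cdot>\<^bsub>obj M K\<^esub> x))"

definition mackey ::
    "('g, 'b) monoid_scheme \<Rightarrow> 'g set set \<Rightarrow> ('g, 'r, 'm) ric \<Rightarrow> bool" where
  "mackey G \<Upsilon> M \<longleftrightarrow>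
     (\<forall>K\<in>\<Upsilon>. \<forall>L\<in>\<Upsilon>. \<forall>L'\<in>\<Upsilon>. \<forall>\<Gamma>.
        L \<subseteq> K \<and> L' \<subseteq> K \<and> double_coset_reps G L K L' \<Gamma> \<longrightarrow>
        (\<forall>x\<in>carrier (obj M L').
           pull M L \<one>\<^bsub>G\<^esub> K (push M L' \<one>\<^bsub>G\<^esub> K x) =
             (\<Oplus>\<^bsub>obj M L\<^esub>\<gamma>\<in>\<Gamma>. let L\<gamma> = L \<inter> conj_by G \<gamma> L' in
                push M L\<gamma> \<one>\<^bsub>G\<^esub> L (pull M L\<gamma> \<gamma> L' x))))"

definition comack_functor ::
    "('r, 'c) ring_scheme \<Rightarrow> ('g, 'b) monoid_scheme \<Rightarrow> 'g set set \<Rightarrow> ('g, 'r, 'm) ric \<Rightarrow> bool" where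
  "comack_functor R G \<Upsilon> M \<longleftrightarrow> ric_functor R G \<Upsilon> M \<and> cohomological G \<Upsilon> M \<and> mackey G \<Upsilon> M"

definition ric_morphism ::
    "('r, 'c) ring_scheme \<Rightarrow> ('g, 'b) monoid_scheme \<Rightarrow> 'g set set \<Rightarrow>
       ('g, 'r, 'n) ric \<Rightarrow> ('g, 'r, 'm) ric \<Rightarrow> ('g set \<Rightarrow> 'n \<Rightarrow> 'm) \<Rightarrow> bool" where
  "ric_morphism R G \<Upsilon> N M \<psi> \<longleftrightarrow>
     (\<forall>K\<in>\<Upsilon>. \<psi> K \<in> linear_maps R (obj N K) (obj M K)) \<and>
     (\<forall>L\<in>\<Upsilon>. \<forall>K\<in>\<Upsilon>. \<forall>g. level_hom G L g K \<longrightarrow>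
        (\<forall>x\<in>carrier (obj N K). \<psi> L (pull N L g K x) = pull M L g K (\<psi> K x)) \<and>
        (\<forall>x\<in>carrier (obj N L). \<psi> K (push N L g K x) = push M L g K (\<psi> L x)))"

text \<open>Pushforwards from a functor \<open>N\<close> on a subgroup \<open>H\<close> of \<open>G\<close> to a functor \<open>M\<close> on \<open>G\<close>.\<close>

definition pushforward ::
    "('r, 'c) ring_scheme \<Rightarrow> ('g, 'b) monoid_scheme \<Rightarrow> 'g set \<Rightarrow> 'g set set \<Rightarrow> 'g set set \<Rightarrow>
       ('g, 'r, 'n) ric \<Rightarrow> ('g, 'r, 'm) ric \<Rightarrow> ('g set \<Rightarrow> 'g set \<Rightarrow> 'n \<Rightarrow> 'm) \<Rightarrow> bool" where
  "pushforward R G H \<Upsilon>H \<Upsilon>G N M \<iota> \<longleftrightarrow>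
     (\<forall>V\<in>\<Upsilon>H. \<forall>K'\<in>\<Upsilon>G. V \<subseteq> K' \<longrightarrow> \<iota> V K' \<in> linear_maps R (obj N V) (obj M K')) \<and>
     (\<forall>V\<in>\<Upsilon>H. \<forall>V'\<in>\<Upsilon>H. \<forall>K'\<in>\<Upsilon>G. \<forall>L'\<in>\<Upsilon>G. \<forall>h\<in>H.
        V \<subseteq> K' \<and> V' \<subseteq> L' \<and> conj_by G (inv\<^bsub>G\<^esub> h) V' \<subseteq> V \<and> conj_by G (inv\<^bsub>G\<^esub> h) L' \<subseteq> K' \<longrightarrow>
        (\<forall>x\<in>carrier (obj N V'). \<iota> V K' (push N V' h V x) = push M L' h K' (\<iota> V' L' x)))"

definition mackey_pushforward ::
    "('r, 'c) ring_scheme \<Rightarrow> ('g, 'b) monoid_scheme \<Rightarrow> 'g set \<Rightarrow> 'g set set \<Rightarrow> 'g set set \<Rightarrow>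
       ('g, 'r, 'n) ric \<Rightarrow> ('g, 'r, 'm) ric \<Rightarrow> ('g set \<Rightarrow> 'g set \<Rightarrow> 'n \<Rightarrow> 'm) \<Rightarrow> bool" where
  "mackey_pushforward R G H \<Upsilon>H \<Upsilon>G N M \<iota> \<longleftrightarrow>
     pushforward R G H \<Upsilon>H \<Upsilon>G N M \<iota> \<and>
     (\<forall>V\<in>\<Upsilon>H. \<forall>K'\<in>\<Upsilon>G. \<forall>L'\<in>\<Upsilon>G. \<forall>\<Gamma>.
        V \<subseteq> K' \<and> L' \<subseteq> K' \<and> double_coset_reps G V K' L' \<Gamma> \<longrightarrow>
        (\<forall>x\<in>carrier (obj N V).
           pull M L' \<one>\<^bsub>G\<^esub> K' (\<iota> V K' x) =
             (\<Oplus>\<^bsub>obj M L'\<^esub>\<gamma>\<in>\<Gamma>. let C = conj_by G \<gamma> L'; V\<gamma> = V \<inter> C in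
                push M C \<gamma> L' (\<iota> V\<gamma> C (pull N V\<gamma> \<one>\<^bsub>G\<^esub> V x)))))"


subsection \<open>Hecke correspondences\<close>

definition hecke ::
    "('g, 'b) monoid_scheme \<Rightarrow> ('g, 'r, 'm) ric \<Rightarrow> 'g set \<Rightarrow> 'g \<Rightarrow> 'g set \<Rightarrow> 'm \<Rightarrow> 'm" where
  "hecke G M K' \<sigma> K x =
     (let A = K' \<inter> conj_by G \<sigma> K; B = K \<inter> conj_by G (inv\<^bsub>G\<^esub> \<sigma>) K' in
        push M A \<one>\<^bsub>G\<^esub> K' (pull M A \<sigma> B (pull M B \<one>\<^bsub>G\<^esub> K x)))"

definition hecke_star ::
    "('g, 'b) monoid_scheme \<Rightarrow> ('g, 'r, 'm) ric \<Rightarrow> 'g set \<Rightarrow> 'g \<Rightarrow> 'g set \<Rightarrow> 'm \<Rightarrow> 'm" where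
  "hecke_star G M K' \<sigma> K = hecke G M K (inv\<^bsub>G\<^esub> \<sigma>) K'"

definition double_cosets :: "('a, 'b) monoid_scheme \<Rightarrow> 'a set \<Rightarrow> 'a set \<Rightarrow> 'a set set" where
  "double_cosets G A B = {double_coset G A g B | g. g \<in> carrier G}"

text \<open>Finite linear combinations of characteristic functions of double cosets of \<open>K\<close>.\<close>

definition hecke_functions ::
    "('r, 'c) ring_scheme \<Rightarrow> ('a, 'b) monoid_scheme \<Rightarrow> 'a set \<Rightarrow> ('a \<Rightarrow> 'r) set" where
  "hecke_functions R G K =
     {f \<in> carrier G \<rightarrow>\<^sub>E carrier R.
        \<exists>\<D> c. finite \<D> \<and> \<D> \<subseteq> double_cosets G K K \<and> c \<in> \<D> \<rightarrow> carrier R \<and>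
          (\<forall>g\<in>carrier G. f g = (\<Oplus>\<^bsub>R\<^esub>D\<in>\<D>. if g \<in> D then c D else \<zero>\<^bsub>R\<^esub>))}"

text \<open>The operator \<open>\<Sum>\<^sub>\<sigma> c\<^sub>\<sigma> [A \<sigma> A]\<^sub>*\<close> on the value of \<open>M\<close> at the level \<open>A\<close>, where \<open>f = \<Sum>\<^sub>\<sigma> c\<^sub>\<sigma> ch(K\<^sub>v \<sigma> K\<^sub>v)\<close>
  at the place \<open>v\<close> (so that \<open>c\<^sub>\<sigma> = f \<sigma>\<close>). The \<open>v\<close>-component of \<open>A\<close> is meant to be \<open>K\<^sub>v\<close>; then the
  summands do not depend on the chosen representatives.\<close>

definition hecke_operator ::
    "('r, 'c) ring_scheme \<Rightarrow> 'i set \<Rightarrow> ('i \<Rightarrow> ('a, 'b) monoid_scheme) \<Rightarrow> ('i \<Rightarrow> 'a set) \<Rightarrow>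
       ('i \<Rightarrow> 'a, 'r, 'm) ric \<Rightarrow> 'i \<Rightarrow> ('a \<Rightarrow> 'r) \<Rightarrow> ('i \<Rightarrow> 'a) set \<Rightarrow> 'm \<Rightarrow> 'm" where
  "hecke_operator R I G K M v f A x =
     (\<Oplus>\<^bsub>obj M A\<^esub>D\<in>{D \<in> double_cosets (G v) (K v) (K v). \<exists>\<sigma>\<in>D. f \<sigma> \<noteq> \<zero>\<^bsub>R\<^esub>}.
        let \<sigma> = (SOME \<sigma>. \<sigma> \<in> D) in
          f \<sigma> \<odot>\<^bsub>obj M A\<^esub> hecke_star (restricted_product I G K) M A (embed_at I G v \<sigma>) A x)"


section \<open>Restricted tensor products\<close>

definition rt_index :: "'i set \<Rightarrow> ('i \<Rightarrow> 'a set) \<Rightarrow> ('i \<Rightarrow> 'a) set \<Rightarrow> 'i set set" where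
  "rt_index I U W = {J. finite J \<and> J \<subseteq> I \<and> {v\<in>I. component v W \<noteq> U v} \<subseteq> J}"

definition rt_module ::
    "('r, 'c) ring_scheme \<Rightarrow> 'i set \<Rightarrow> ('i \<Rightarrow> 'a set) \<Rightarrow> ('i \<Rightarrow> ('a, 'r, 'n) ric) \<Rightarrow> ('i \<Rightarrow> 'n) \<Rightarrow>
       ('i \<Rightarrow> 'a) set \<Rightarrow> ('r, ('i set \<times> (('i \<Rightarrow> 'n) \<Rightarrow> 'r) set) set) module" where
  "rt_module R I U N \<phi> W =
     direct_limit (rt_index I U W) (\<subseteq>)
       (\<lambda>J. tensor R J (\<lambda>v. obj (N v) (component v W)))
       (tensor_extend R (\<lambda>v. obj (N v) (component v W)) \<phi>)"

definition rt_class ::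
    "('r, 'c) ring_scheme \<Rightarrow> 'i set \<Rightarrow> ('i \<Rightarrow> 'a set) \<Rightarrow> ('i \<Rightarrow> ('a, 'r, 'n) ric) \<Rightarrow> ('i \<Rightarrow> 'n) \<Rightarrow>
       ('i \<Rightarrow> 'a) set \<Rightarrow> 'i set \<times> (('i \<Rightarrow> 'n) \<Rightarrow> 'r) set \<Rightarrow> ('i set \<times> (('i \<Rightarrow> 'n) \<Rightarrow> 'r) set) set" where
  "rt_class R I U N \<phi> W =
     dl_class (rt_index I U W) (\<subseteq>)
       (\<lambda>J. tensor R J (\<lambda>v. obj (N v) (component v W)))
       (tensor_extend R (\<lambda>v. obj (N v) (component v W)) \<phi>)"

text \<open>The places which a representative of an element has to involve before the local maps of
  \<open>g\<close> from \<open>L\<close> to \<open>K\<close> can be applied to it: elsewhere, these maps fix \<open>\<phi> v\<close>.\<close>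

definition rt_support ::
    "'i set \<Rightarrow> ('i \<Rightarrow> 'a set) \<Rightarrow> ('i \<Rightarrow> 'a) set \<Rightarrow> ('i \<Rightarrow> 'a) \<Rightarrow> ('i \<Rightarrow> 'a) set \<Rightarrow> 'i set" where
  "rt_support I U L g K = {v\<in>I. component v L \<noteq> U v \<or> component v K \<noteq> U v \<or> g v \<notin> U v}"

definition restricted_tensor ::
    "('r, 'c) ring_scheme \<Rightarrow> 'i set \<Rightarrow> ('i \<Rightarrow> 'a set) \<Rightarrow> ('i \<Rightarrow> ('a, 'r, 'n) ric) \<Rightarrow> ('i \<Rightarrow> 'n) \<Rightarrow>
       ('i \<Rightarrow> 'a, 'r, ('i set \<times> (('i \<Rightarrow> 'n) \<Rightarrow> 'r) set) set) ric" where
  "restricted_tensor R I U N \<phi> =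
     \<lparr>obj = rt_module R I U N \<phi>,
      pull = (\<lambda>L g K Q. \<Union>(J, t)\<in>{(J, t)\<in>Q. rt_support I U L g K \<subseteq> J}.
        rt_class R I U N \<phi> L
          (J, tensor_map R J (\<lambda>v. obj (N v) (component v L))
                (\<lambda>v. pull (N v) (component v L) (g v) (component v K)) t)),
      push = (\<lambda>L g K Q. \<Union>(J, t)\<in>{(J, t)\<in>Q. rt_support I U L g K \<subseteq> J}.
        rt_class R I U N \<phi> K
          (J, tensor_map R J (\<lambda>v. obj (N v) (component v K))
                (\<lambda>v. push (N v) (component v L) (g v) (component v K)) t))\<rparr>"

text \<open>The element \<open>\<Otimes>\<^sub>v \<phi>\<^sub>v\<close> of the value at \<open>\<Prod>\<^sub>v U\<^sub>v\<close>; all members of the union coincide.\<close>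

definition rt_unit ::
    "('r, 'c) ring_scheme \<Rightarrow> 'i set \<Rightarrow> ('i \<Rightarrow> 'a set) \<Rightarrow> ('i \<Rightarrow> ('a, 'r, 'n) ric) \<Rightarrow> ('i \<Rightarrow> 'n) \<Rightarrow>
       ('i set \<times> (('i \<Rightarrow> 'n) \<Rightarrow> 'r) set) set" where
  "rt_unit R I U N \<phi> =
     (\<Union>J\<in>{J. finite J \<and> J \<subseteq> I}.
        rt_class R I U N \<phi> (PiE I U) (J, pure_tensor R J (\<lambda>v. obj (N v) (U v)) \<phi>))"


section \<open>Zeta elements\<close>

text \<open>The direct limit of the \<open>\<Phi>\<close>-modules \<open>N(V) \<otimes> \<Phi>\<close> under restriction to smaller levels, the
  canonical maps \<open>j\<^sub>V\<close>, and the group action.\<close>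

definition colimit_module ::
    "('r, 'c) ring_scheme \<Rightarrow> ('k, 'd) ring_scheme \<Rightarrow> ('r \<Rightarrow> 'k) \<Rightarrow> ('a, 'b) monoid_scheme \<Rightarrow>
       'a set set \<Rightarrow> ('a, 'r, 'n) ric \<Rightarrow> ('k, ('a set \<times> ('n \<times> 'k \<Rightarrow> 'r) set) set) module" where
  "colimit_module R \<Phi> e G \<Upsilon> N =
     direct_limit \<Upsilon> (\<supseteq>) (\<lambda>V. scalar_extension R \<Phi> e (obj N V))
       (\<lambda>V V'. tensor2_map R (obj N V') (restrict_scalars e \<Phi>) (pull N V' \<one>\<^bsub>G\<^esub> V) id)"

definition colimit_class ::
    "('r, 'c) ring_scheme \<Rightarrow> ('k, 'd) ring_scheme \<Rightarrow> ('r \<Rightarrow> 'k) \<Rightarrow> ('a, 'b) monoid_scheme \<Rightarrow>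
       'a set set \<Rightarrow> ('a, 'r, 'n) ric \<Rightarrow> 'a set \<times> ('n \<times> 'k \<Rightarrow> 'r) set \<Rightarrow>
       ('a set \<times> ('n \<times> 'k \<Rightarrow> 'r) set) set" where
  "colimit_class R \<Phi> e G \<Upsilon> N =
     dl_class \<Upsilon> (\<supseteq>) (\<lambda>V. scalar_extension R \<Phi> e (obj N V))
       (\<lambda>V V'. tensor2_map R (obj N V') (restrict_scalars e \<Phi>) (pull N V' \<one>\<^bsub>G\<^esub> V) id)"

definition colimit_map ::
    "('r, 'c) ring_scheme \<Rightarrow> ('k, 'd) ring_scheme \<Rightarrow> ('r \<Rightarrow> 'k) \<Rightarrow> ('a, 'b) monoid_scheme \<Rightarrow>
       'a set set \<Rightarrow> ('a, 'r, 'n) ric \<Rightarrow> 'a set \<Rightarrow> 'n \<Rightarrow> ('a set \<times> ('n \<times> 'k \<Rightarrow> 'r) set) set" where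
  "colimit_map R \<Phi> e G \<Upsilon> N V x =
     colimit_class R \<Phi> e G \<Upsilon> N (V, pure_tensor2 R (obj N V) (restrict_scalars e \<Phi>) x \<one>\<^bsub>\<Phi>\<^esub>)"

definition colimit_action ::
    "('r, 'c) ring_scheme \<Rightarrow> ('k, 'd) ring_scheme \<Rightarrow> ('r \<Rightarrow> 'k) \<Rightarrow> ('a, 'b) monoid_scheme \<Rightarrow>
       'a set set \<Rightarrow> ('a, 'r, 'n) ric \<Rightarrow> 'a \<Rightarrow> ('a set \<times> ('n \<times> 'k \<Rightarrow> 'r) set) set \<Rightarrow>
       ('a set \<times> ('n \<times> 'k \<Rightarrow> 'r) set) set" where
  "colimit_action R \<Phi> e G \<Upsilon> N h Q =
     (\<Union>(V, t)\<in>Q. let V' = conj_by G h V in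
        colimit_class R \<Phi> e G \<Upsilon> N
          (V', tensor2_map R (obj N V') (restrict_scalars e \<Phi>) (pull N V' h V) id t))"

text \<open>The space \<open>C(G/K, E)\<close> of right \<open>K\<close>-invariant compactly supported functions on \<open>G\<close>.\<close>

definition function_module ::
    "('a, 'b) monoid_scheme \<Rightarrow> 'a topology \<Rightarrow> 'a set \<Rightarrow> ('k, 'm) module \<Rightarrow> ('k, 'a \<Rightarrow> 'm) module" where
  "function_module G T K E =
     \<lparr>carrier = {\<xi> \<in> carrier G \<rightarrow>\<^sub>E carrier E.
        (\<forall>g\<in>carrier G. \<forall>k\<in>K. \<xi> (g \<otimes>\<^bsub>G\<^esub> k) = \<xi> g) \<and>
        compactin T (T closure_of {g \<in> carrier G. \<xi> g \<noteq> \<zero>\<^bsub>E\<^esub>})},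
      mult = undefined, one = undefined,
      zero = (\<lambda>g\<in>carrier G. \<zero>\<^bsub>E\<^esub>),
      add = (\<lambda>\<xi> \<eta>. \<lambda>g\<in>carrier G. \<xi> g \<oplus>\<^bsub>E\<^esub> \<eta> g),
      smult = (\<lambda>c \<xi>. \<lambda>g\<in>carrier G. c \<odot>\<^bsub>E\<^esub> \<xi> g)\<rparr>"

definition translate ::
    "('a, 'b) monoid_scheme \<Rightarrow> ('a \<Rightarrow> 'm \<Rightarrow> 'm) \<Rightarrow> 'a \<Rightarrow> ('a \<Rightarrow> 'm) \<Rightarrow> 'a \<Rightarrow> 'm" where
  "translate G act h \<xi> = (\<lambda>g\<in>carrier G. act h (\<xi> (inv\<^bsub>G\<^esub> h \<otimes>\<^bsub>G\<^esub> g)))"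

text \<open>The kernel of the projection of \<open>C(G/K, E)\<close> onto its \<open>H\<close>-coinvariants.\<close>

definition coinvariants_kernel ::
    "('k, 'd) ring_scheme \<Rightarrow> ('a, 'b) monoid_scheme \<Rightarrow> 'a topology \<Rightarrow> 'a set \<Rightarrow> 'a set \<Rightarrow>
       ('k, 'm) module \<Rightarrow> ('a \<Rightarrow> 'm \<Rightarrow> 'm) \<Rightarrow> ('a \<Rightarrow> 'm) set" where
  "coinvariants_kernel \<Phi> G T H K E act = (let C = function_module G T K E in
     submodule_generated \<Phi> C {translate G act h \<xi> \<ominus>\<^bsub>C\<^esub> \<xi> | h \<xi>. h \<in> H \<and> \<xi> \<in> carrier C})"

text \<open>Zeta elements for \<open>(\<phi>, f, L)\<close>, where \<open>\<phi>\<close> is an element of \<open>N(U)\<close> with \<open>U = H \<inter> K\<close>, and \<open>f\<close> is a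
  function in the Hecke algebra of \<open>K\<close>. The arguments \<open>e\<close> and \<open>\<rho>\<close> are the structure maps to \<open>\<Phi>\<close> from
  \<open>R\<close> and from the rational numbers, \<open>\<Upsilon>\<close> is the collection of levels of \<open>H\<close>, and \<open>\<mu>\<close> is a Haar measure
  on \<open>H\<close>.\<close>

definition zeta_element ::
    "('r, 'c) ring_scheme \<Rightarrow> ('k, 'd) ring_scheme \<Rightarrow> ('r \<Rightarrow> 'k) \<Rightarrow> (rat \<Rightarrow> 'k) \<Rightarrow>
       ('a, 'b) monoid_scheme \<Rightarrow> 'a topology \<Rightarrow> 'a set \<Rightarrow> 'a measure \<Rightarrow> 'a set set \<Rightarrow>
       ('a, 'r, 'n) ric \<Rightarrow> 'a set \<Rightarrow> 'a set \<Rightarrow> 'n \<Rightarrow> ('a \<Rightarrow> 'r) \<Rightarrow>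
       ('a \<Rightarrow> ('a set \<times> ('n \<times> 'k \<Rightarrow> 'r) set) set) \<Rightarrow> bool" where
  "zeta_element R \<Phi> e \<rho> G T H \<mu> \<Upsilon> N K L \<phi> f \<zeta> \<longleftrightarrow>
     (let U = H \<inter> K;
          E = colimit_module R \<Phi> e (G\<lparr>carrier := H\<rparr>) \<Upsilon> N;
          j = colimit_map R \<Phi> e (G\<lparr>carrier := H\<rparr>) \<Upsilon> N;
          C = function_module G T K E;
          Z = coinvariants_kernel \<Phi> G T H K E (colimit_action R \<Phi> e (G\<lparr>carrier := H\<rparr>) \<Upsilon> N)
      in \<zeta> \<in> carrier C \<and>
         (\<forall>g\<in>carrier G. \<exists>(n::nat) V x.
            (\<forall>i<n. V i \<in> \<Upsilon> \<and> V i \<subseteq> conj_by G g L \<and> x i \<in> carrier (obj N (V i))) \<and>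
            \<zeta> g = (\<Oplus>\<^bsub>E\<^esub>i\<in>{..<n}. \<rho> (haar_index \<mu> U (V i)) \<odot>\<^bsub>E\<^esub> j (V i) (x i))) \<and>
         Z +>\<^bsub>C\<^esub> \<zeta> = Z +>\<^bsub>C\<^esub> (\<lambda>g\<in>carrier G. e (f g) \<odot>\<^bsub>E\<^esub> j U \<phi>))"

end

theory Submission
 imports Defs
begin

text \<open>The classes are assembled from the zeta elements. For v in I', take one point g in each
  of the finitely many cosets g K_v in the support of a zeta element. By condition (i) its values
  there give a finite list J_v of triples (g, V, x) with V inside g L_v g^{-1} and x in N_v(V). For
  a finite subset \<nu> of I' and a choice of one triple at each place of \<nu>, complete it by (1,
  U_v, \<phi>_v) at all other places. The product W of the groups V lies in g K[\<nu>] g^{-1}, so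
  the tensor product of the x_v can be sent to M_H(W) by the morphism \<open>\<psi>\<close>, pushed
  to M_G(g K[\<nu>] g^{-1}) by \<open>\<iota>\<close>, and moved to M_G(K[\<nu>]) by
  \<open>[g]_*\<close>. This is the element \<open>B\<close>, and y_\<nu> is the sum of these
  elements over all choices.

  To compare y_\<nu> with y_\<mu>, let \<open>cls \<nu> \<k>\<close>, for \<nu> contained in \<k>,
  be the sum in which the zeta data are inserted at all places of \<k> but the result is pushed only
  to level K[\<nu>]. Functoriality of the pushforward gives pr(y_\<mu>) =
  \<open>cls \<nu> \<mu>\<close> (\<open>push_cls\<close>). The Hecke operator at a place v outside
  \<k> sends \<open>cls \<nu> \<k>\<close> to \<open>cls \<nu> (insert v \<k>)\<close>
  (\<open>hecke_cls\<close>). Applied successively for v in \<mu> - \<nu> to y_\<nu> =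
  \<open>cls \<nu> \<nu>\<close>, these operators also produce \<open>cls \<nu> \<mu>\<close>.
  Everything is thus reduced to one place.

  At that place the Mackey axiom for \<open>\<iota>\<close> turns the Hecke operator into a sum over
  representatives \<gamma> of the double cosets U_v \<gamma> K_v that cover the support of the Hecke
  function f, with terms f(\<gamma>) B(\<gamma>, restriction of \<phi>_v)
  (\<open>hecke_star_iota\<close>, \<open>embed_reps\<close>, \<open>hecke_op_B\<close>). What
  remains is a purely local identity (\<open>local_identity\<close>): the sum over these \<gamma>
  equals the sum over J_v, for every family b(g, V, x) that is linear in x and satisfies b(hgk, V,
  x) = b(g, S_g, [h]_* x), where S_g is the intersection of H_v with g K_v g^{-1}. The elements B
  form such a family (\<open>equivariant_B\<close>).

  By that equivariance the local identity follows from an identity in N_v(S_g) for each double coset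
  H_v g K_v (\<open>integral_identity\<close>). Its two sides are the values at the zeta element and
  at f times \<phi>_v of one functional \<open>lam g\<close>, which adds up over h in H_v / S_g the
  trace of the value at hg. The trace is normalized by ratios of Haar volumes. It is well defined on
  the colimit because N_v is cohomological (\<open>trace_map_compatible\<close>), and the functional
  is H_v-invariant because conjugation preserves volumes in a unimodular group
  (\<open>Tr_act\<close>, \<open>lam_translate\<close>). Hence it factors through coinvariants, and
  condition (ii) says that the two values agree. All volume factors cancel: [U:V][V:U] = 1 for the
  zeta element (\<open>lam_zeta\<close>), and a U-orbit of length [U : U meet S_\<gamma>] whose
  points are weighted by the inverse of that number for the Hecke function (\<open>lam_F\<close>).
  This gives the identity after tensoring with the fraction field, and torsion-freeness of N_v
  removes the denominators (\<open>SE_pure_inj\<close>).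

  The algebraic part serves to compute with the explicit models of tensor products and direct
  limits. Its main outcome is that restriction and trace maps act on pure restricted tensors place
  by place (\<open>transfer_maps\<close>).\<close>

notation l_coset (infixl "\<star>\<index>" 60)

section \<open>Linear maps, generated submodules, quotients and free modules over a ring R\<close>

context
 fixes R :: "('r, 'c) ring_scheme" (structure)
begin

lemma linear_maps_closed: "f \<in> linear_maps R M N ==> x \<in> carrier M ==> f x \<in> carrier N"
 by (auto simp: linear_maps_def)

lemma linear_maps_add:
 "f \<in> linear_maps R M N ==> x \<in> carrier M ==> y \<in> carrier M ==> f (x \<oplus>\<^bsub>M\<^esub> y) = f x \<oplus>\<^bsub>N\<^esub> f y"
 by (auto simp: linear_maps_def)

lemma linear_maps_smult:
 "f \<in> linear_maps R M N ==> r \<in> carrier R ==> x \<in> carrier M ==> f (r \<odot>\<^bsub>M\<^esub> x) = r \<odot>\<^bsub>N\<^esub> f x"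
 by (auto simp: linear_maps_def)

lemma linear_mapsI:
 assumes "\<And>x. x \<in> carrier M ==> f x \<in> carrier N"
  and "\<And>x y. x \<in> carrier M ==> y \<in> carrier M ==> f (x \<oplus>\<^bsub>M\<^esub> y) = f x \<oplus>\<^bsub>N\<^esub> f y"
  and "\<And>r x. r \<in> carrier R ==> x \<in> carrier M ==> f (r \<odot>\<^bsub>M\<^esub> x) = r \<odot>\<^bsub>N\<^esub> f x"
 shows "f \<in> linear_maps R M N"
 using assms by (auto simp: linear_maps_def)

lemma linear_maps_compose:
 "f \<in> linear_maps R M N ==> g \<in> linear_maps R N P ==> (%x. g (f x)) \<in> linear_maps R M P"
 by (auto simp: linear_maps_def Pi_iff)

lemma linear_maps_ident: "(%x. x) \<in> linear_maps R M M" "id \<in> linear_maps R M M"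
 by (auto simp: linear_maps_def)

lemma linear_maps_zero:
 assumes "Module.module R M" "Module.module R N" "f \<in> linear_maps R M N"
 shows "f \<zero>\<^bsub>M\<^esub> = \<zero>\<^bsub>N\<^esub>"
proof -
 interpret M: Module.module R M by fact
 interpret N: Module.module R N by fact
 have "f \<zero>\<^bsub>M\<^esub> = f (\<zero> \<odot>\<^bsub>M\<^esub> \<zero>\<^bsub>M\<^esub>)" by simp
 also have "\<dots> = \<zero> \<odot>\<^bsub>N\<^esub> f \<zero>\<^bsub>M\<^esub>"
  by (rule linear_maps_smult[OF assms(3)]) auto
 also have "\<dots> = \<zero>\<^bsub>N\<^esub>" using linear_maps_closed[OF assms(3)] by simp
 finally show ?thesis .
qed

lemma linear_maps_minus:
 assumes "Module.module R M" "Module.module R N" "f \<in> linear_maps R M N" "x \<in> carrier M"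
 shows "f (\<ominus>\<^bsub>M\<^esub> x) = \<ominus>\<^bsub>N\<^esub> f x"
proof -
 interpret M: Module.module R M by fact
 interpret N: Module.module R N by fact
 have fx: "f x \<in> carrier N" using linear_maps_closed[OF assms(3,4)] .
 have "f (\<ominus>\<^bsub>M\<^esub> x) = f ((\<ominus> \<one>) \<odot>\<^bsub>M\<^esub> x)" using assms(4) by (simp add: M.smult_l_minus)
 also have "\<dots> = (\<ominus> \<one>) \<odot>\<^bsub>N\<^esub> f x"
  by (rule linear_maps_smult[OF assms(3)]) (use assms(4) in auto)
 also have "\<dots> = \<ominus>\<^bsub>N\<^esub> f x" using fx by (simp add: N.smult_l_minus)
 finally show ?thesis .
qed

lemma linear_maps_diff:
 assumes "Module.module R M" "Module.module R N" "f \<in> linear_maps R M N" "x \<in> carrier M" "y \<in> carrier M"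
 shows "f (x \<ominus>\<^bsub>M\<^esub> y) = f x \<ominus>\<^bsub>N\<^esub> f y"
proof -
 interpret M: Module.module R M by fact
 show ?thesis using assms(4,5)
  by (simp add: a_minus_def linear_maps_add[OF assms(3)] linear_maps_minus[OF assms(1-3)])
qed

lemma linear_maps_finsum:
 assumes "Module.module R M" "Module.module R N" "f \<in> linear_maps R M N"
  and "finite A" "g \<in> A \<rightarrow> carrier M"
 shows "f (\<Oplus>\<^bsub>M\<^esub>i\<in>A. g i) = (\<Oplus>\<^bsub>N\<^esub>i\<in>A. f (g i))"
proof -
 interpret M: Module.module R M by fact
 interpret N: Module.module R N by fact
 show ?thesis using assms(4,5)
 proof (induction A rule: finite_induct)
  case empty
  show ?case using linear_maps_zero[OF assms(1-3)] by simp
 next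
  case (insert a A)
  have g: "g \<in> A \<rightarrow> carrier M" "g a \<in> carrier M" using insert.prems by auto
  have fg: "(%i. f (g i)) \<in> A \<rightarrow> carrier N" "f (g a) \<in> carrier N"
   using g linear_maps_closed[OF assms(3)] by (auto simp: Pi_iff)
  show ?case using insert g fg
   by (simp add: linear_maps_add[OF assms(3)] M.finsum_closed)
 qed
qed

lemma linear_maps_nat_mult:
 assumes "Module.module R M" "Module.module R N" "f \<in> linear_maps R M N" "x \<in> carrier M"
 shows "f ([(n::nat)] \<cdot>\<^bsub>M\<^esub> x) = [n] \<cdot>\<^bsub>N\<^esub> f x"
proof -
 interpret M: Module.module R M by fact
 interpret N: Module.module R N by fact
 show ?thesis
  by (induction n) (use assms(4) linear_maps_zero[OF assms(1-3)] in
    \<open>simp_all add: linear_maps_add[OF assms(3)]\<close>)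
qed

lemma linear_maps_smult_left:
 assumes "Module.module R N" "f \<in> linear_maps R M N" "r \<in> carrier R"
 shows "(%x. r \<odot>\<^bsub>N\<^esub> f x) \<in> linear_maps R M N"
proof -
 interpret N: Module.module R N by fact
 show ?thesis
 proof (rule linear_mapsI)
  fix s x assume "s \<in> carrier R" "x \<in> carrier M"
  then show "r \<odot>\<^bsub>N\<^esub> f (s \<odot>\<^bsub>M\<^esub> x) = s \<odot>\<^bsub>N\<^esub> (r \<odot>\<^bsub>N\<^esub> f x)"
   using assms by (simp add: linear_maps_smult[OF assms(2)] linear_maps_closed[OF assms(2)]
     N.smult_assoc1[symmetric] N.R.m_comm)
 qed (use assms in \<open>auto simp: linear_maps_add[OF assms(2)] linear_maps_closed[OF assms(2)] N.smult_r_distr\<close>)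
qed

lemma submodule_preimage:
 assumes "Module.module R M" "Module.module R N" "f \<in> linear_maps R M N" "submodule B R N"
 shows "submodule {x \<in> carrier M. f x \<in> B} R M"
proof -
 interpret M: Module.module R M by fact
 interpret N: Module.module R N by fact
 note B = N.submoduleE[OF assms(4)]
 have "\<zero>\<^bsub>N\<^esub> \<in> B" using assms(4) submodule.axioms(1) subgroup.one_closed by fastforce
 then show ?thesis
  by (intro M.submoduleI)
   (auto simp: linear_maps_zero[OF assms(1-3)] linear_maps_minus[OF assms(1-3)]
    linear_maps_add[OF assms(3)] linear_maps_smult[OF assms(3)] B)
qed

lemma submodule_zero_mem: "submodule A R M ==> \<zero>\<^bsub>M\<^esub> \<in> A"
 using submodule.axioms(1) subgroup.one_closed by fastforce

lemma submodule_zero: "Module.module R M ==> submodule {\<zero>\<^bsub>M\<^esub>} R M"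
proof -
 assume "Module.module R M"
 then interpret M: Module.module R M .
 show ?thesis by (rule M.submoduleI) auto
qed

lemma submodule_generated_least:
 "submodule A R M ==> S \<subseteq> A ==> submodule_generated R M S \<subseteq> A"
 unfolding submodule_generated_def by blast

lemma submodule_generated_incl: "S \<subseteq> submodule_generated R M S"
 unfolding submodule_generated_def by blast

lemma submodule_generated_submodule:
 assumes "Module.module R M" "S \<subseteq> carrier M"
 shows "submodule (submodule_generated R M S) R M"
proof -
 interpret M: Module.module R M by fact
 have c: "submodule_generated R M S \<subseteq> carrier M"
  by (rule submodule_generated_least[OF M.carrier_is_submodule assms(2)])
 show ?thesis
 proof (rule M.submoduleI[OF c])
  show "\<zero>\<^bsub>M\<^esub> \<in> submodule_generated R M S"
   unfolding submodule_generated_def using submodule_zero_mem by blast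
 qed (auto simp: submodule_generated_def M.submoduleE)
qed

text \<open>The preimage of \<open>B\<close> is a submodule, so it contains the generated submodule
  as soon as it contains \<open>S\<close>. Maps out of modules given by generators and relations are
  checked in this way: only the generating relations have to be examined.\<close>

lemma submodule_generated_linear_image:
 assumes "Module.module R M" "Module.module R N" "f \<in> linear_maps R M N" "submodule B R N"
  and "S \<subseteq> carrier M" "\<And>s. s \<in> S ==> f s \<in> B" "x \<in> submodule_generated R M S"
 shows "f x \<in> B"
 using submodule_generated_least[OF submodule_preimage[OF assms(1-4)], of S] assms(5-7) by blast

subsection \<open>Quotients\<close>

text \<open>Maps on quotients, direct limits and restricted tensor products are defined as unions
  over all representatives. Such a union is evaluated by showing that its members coincide.\<close>

lemma UN_eq_const: "q \<in> Q ==> (\<And>y. y \<in> Q ==> F y = c) ==> (\<Union>y\<in>Q. F y) = c"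
 by auto

lemma submodule_abelian_subgroup:
 assumes "Module.module R M" "submodule A R M"
 shows "abelian_subgroup A M"
proof -
 interpret M: Module.module R M by fact
 show ?thesis
  using assms(2) by (intro abelian_subgroupI3 additive_subgroup.intro M.abelian_group_axioms)
   (simp add: submodule_def)
qed

lemma quotient_coset_eq_iff:
 assumes "Module.module R M" "submodule A R M" "x \<in> carrier M" "y \<in> carrier M"
 shows "A +>\<^bsub>M\<^esub> x = A +>\<^bsub>M\<^esub> y \<longleftrightarrow> x \<ominus>\<^bsub>M\<^esub> y \<in> A"
proof -
 interpret A: abelian_subgroup A M by (rule submodule_abelian_subgroup) fact+
 show ?thesis
  using assms(3,4) A.a_rcos_module[of y x] A.a_rcos_self[of x] A.a_repr_independence'[of x y]
  by (auto simp: a_minus_def)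
qed

lemma quotient_coset_self:
 assumes "Module.module R M" "submodule A R M" "x \<in> carrier M"
 shows "x \<in> A +>\<^bsub>M\<^esub> x"
proof -
 interpret A: abelian_subgroup A M by (rule submodule_abelian_subgroup) fact+
 show ?thesis using assms A.a_rcos_self by auto
qed

lemma quotient_carrier: "carrier (quotient_module M A) = (%x. A +>\<^bsub>M\<^esub> x) ` carrier M"
 by (auto simp: quotient_module_def A_RCOSETS_def RCOSETS_def a_r_coset_def)

lemma quotient_add:
 assumes "Module.module R M" "submodule A R M" "x \<in> carrier M" "y \<in> carrier M"
 shows "(A +>\<^bsub>M\<^esub> x) \<oplus>\<^bsub>quotient_module M A\<^esub> (A +>\<^bsub>M\<^esub> y) = A +>\<^bsub>M\<^esub> (x \<oplus>\<^bsub>M\<^esub> y)"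
proof -
 interpret A: abelian_subgroup A M by (rule submodule_abelian_subgroup) fact+
 show ?thesis using assms A.a_rcos_sum by (simp add: quotient_module_def)
qed

text \<open>Two representatives of a coset differ by an element of \<open>A\<close>, which
  \<open>f\<close> sends into \<open>B\<close>; so all members of the defining union are the same
  coset of \<open>B\<close>.\<close>

lemma quotient_map_induced_coset:
 assumes "Module.module R M" "Module.module R N" "submodule A R M" "submodule B R N"
  and "f \<in> linear_maps R M N" "f ` A \<subseteq> B" "x \<in> carrier M"
 shows "quotient_map_induced N B f (A +>\<^bsub>M\<^esub> x) = B +>\<^bsub>N\<^esub> f x"
proof -
 interpret A: abelian_subgroup A M by (rule submodule_abelian_subgroup) fact+
 have "B +>\<^bsub>N\<^esub> f y = B +>\<^bsub>N\<^esub> f x" if "y \<in> A +>\<^bsub>M\<^esub> x" for y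
 proof -
  have y: "y \<in> carrier M" using that assms(7) A.a_elemrcos_carrier by auto
  have "A +>\<^bsub>M\<^esub> y = A +>\<^bsub>M\<^esub> x" using A.a_repr_independence' that assms(7) by simp
  then have "y \<ominus>\<^bsub>M\<^esub> x \<in> A" using quotient_coset_eq_iff[OF assms(1,3)] y assms(7) by auto
  then have "f y \<ominus>\<^bsub>N\<^esub> f x \<in> B"
   using assms(6) linear_maps_diff[OF assms(1,2,5) y assms(7)] by auto
  then show ?thesis
   using quotient_coset_eq_iff[OF assms(2,4)] linear_maps_closed[OF assms(5)] y assms(7) by auto
 qed
 then show ?thesis
  unfolding quotient_map_induced_def by (rule UN_eq_const[OF quotient_coset_self[OF assms(1,3,7)]])
qed

lemma quotient_smult:
 assumes "Module.module R M" "submodule A R M" "r \<in> carrier R" "x \<in> carrier M"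
 shows "r \<odot>\<^bsub>quotient_module M A\<^esub> (A +>\<^bsub>M\<^esub> x) = A +>\<^bsub>M\<^esub> (r \<odot>\<^bsub>M\<^esub> x)"
proof -
 \<comment> \<open>Scalar multiplication on the quotient is literally the map induced by
   multiplication with \<open>r\<close>, so its well-definedness is an instance of the lemma on
   induced maps with equal source and target.\<close>
 have "quotient_map_induced M A (%x. r \<odot>\<^bsub>M\<^esub> x) (A +>\<^bsub>M\<^esub> x) = A +>\<^bsub>M\<^esub> (r \<odot>\<^bsub>M\<^esub> x)"
  using linear_maps_smult_left[OF assms(1) linear_maps_ident(1) assms(3)]
   submodule.smult_closed[OF assms(2,3)] assms
  by (intro quotient_map_induced_coset) auto
 then show ?thesis by (simp add: quotient_module_def quotient_map_induced_def)
qed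

lemma quotient_zero: "\<zero>\<^bsub>quotient_module M A\<^esub> = A"
 by (simp add: quotient_module_def)

lemma quotient_zero_coset:
 assumes "Module.module R M" "submodule A R M"
 shows "\<zero>\<^bsub>quotient_module M A\<^esub> = A +>\<^bsub>M\<^esub> \<zero>\<^bsub>M\<^esub>"
proof -
 interpret A: abelian_subgroup A M by (rule submodule_abelian_subgroup) fact+
 show ?thesis by (simp add: quotient_zero A.a_subset)
qed

lemma quotient_module_module:
 assumes "Module.module R M" "submodule A R M"
 shows "Module.module R (quotient_module M A)"
proof -
 interpret M: Module.module R M by fact
 interpret A: abelian_subgroup A M by (rule submodule_abelian_subgroup) fact+
 have grp: "abelian_group (quotient_module M A)"
 proof (rule abelian_groupI)
  fix X assume "X \<in> carrier (quotient_module M A)"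
  then obtain x where x: "x \<in> carrier M" "X = A +>\<^bsub>M\<^esub> x" by (auto simp: quotient_carrier)
  show "\<exists>Y\<in>carrier (quotient_module M A). Y \<oplus>\<^bsub>quotient_module M A\<^esub> X = \<zero>\<^bsub>quotient_module M A\<^esub>"
   by (rule bexI[of _ "A +>\<^bsub>M\<^esub> (\<ominus>\<^bsub>M\<^esub> x)"])
    (use x in \<open>auto simp: quotient_carrier quotient_add[OF assms] M.l_neg quotient_zero_coset[OF assms]\<close>)
 qed (auto simp: quotient_carrier quotient_add[OF assms] quotient_zero_coset[OF assms] M.a_ac)
 show ?thesis
  by (rule moduleI[OF M.is_cring grp])
   (auto simp: quotient_carrier quotient_add[OF assms] quotient_smult[OF assms]
    M.smult_l_distr M.smult_r_distr M.smult_assoc1)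
qed

lemma quotient_projection_linear:
 assumes "Module.module R M" "submodule A R M"
 shows "(%x. A +>\<^bsub>M\<^esub> x) \<in> linear_maps R M (quotient_module M A)"
 by (rule linear_mapsI) (auto simp: quotient_carrier quotient_add[OF assms] quotient_smult[OF assms])

lemma quotient_map_induced_linear:
 assumes "Module.module R M" "Module.module R N" "submodule A R M" "submodule B R N"
  and "f \<in> linear_maps R M N" "f ` A \<subseteq> B"
 shows "quotient_map_induced N B f \<in> linear_maps R (quotient_module M A) (quotient_module N B)"
proof -
 interpret M: Module.module R M by fact
 note [simp] = quotient_map_induced_coset[OF assms] quotient_add[OF assms(1,3)] quotient_add[OF assms(2,4)]
  quotient_smult[OF assms(1,3)] quotient_smult[OF assms(2,4)] linear_maps_closed[OF assms(5)]
  linear_maps_add[OF assms(5)] linear_maps_smult[OF assms(5)]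
 show ?thesis
  by (rule linear_mapsI) (auto simp: quotient_carrier)
qed

subsection \<open>Free modules\<close>

lemma free_module_carrierI:
 "(\<And>x. x \<in> Q ==> c x \<in> carrier R) ==> (\<And>x. x \<notin> Q ==> c x = \<zero>) ==>
   finite {x. c x ~= \<zero>} ==> c \<in> carrier (free_module R Q)"
 by (simp add: free_module_def)

lemma free_module_module:
 assumes "cring R"
 shows "Module.module R (free_module R Q)"
proof -
 interpret R: cring R by fact
 let ?F = "free_module R Q"
 have inR: "c x \<in> carrier R" if "c \<in> carrier ?F" for c x
  using that by (cases "x \<in> Q") (auto simp: free_module_def)
 have ops: "c \<oplus>\<^bsub>?F\<^esub> d = (%x. c x \<oplus> d x)" "r \<odot>\<^bsub>?F\<^esub> c = (%x. r \<otimes> c x)" "\<zero>\<^bsub>?F\<^esub> = (%x. \<zero>)" for c d r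
  by (simp_all add: free_module_def)
 have mem: "(%x. h (c x) (d x)) \<in> carrier ?F"
  if cd: "c \<in> carrier ?F" "d \<in> carrier ?F" and h: "\<And>a b. a \<in> carrier R ==> b \<in> carrier R ==> h a b \<in> carrier R" "h \<zero> \<zero> = \<zero>" for h c d
 proof (rule free_module_carrierI)
  show "h (c x) (d x) \<in> carrier R" for x by (rule h(1)[OF inR[OF cd(1)] inR[OF cd(2)]])
  show "h (c x) (d x) = \<zero>" if "x \<notin> Q" for x using cd h(2) that by (simp add: free_module_def)
  have "finite ({x. c x ~= \<zero>} \<union> {x. d x ~= \<zero>})" using cd by (simp add: free_module_def)
  then show "finite {x. h (c x) (d x) ~= \<zero>}" by (rule rev_finite_subset) (use h(2) in auto)
 qed
 show ?thesis
 proof (rule moduleI[OF assms abelian_groupI])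
  show "\<zero>\<^bsub>?F\<^esub> \<in> carrier ?F" by (simp add: free_module_def)
  show "x \<oplus>\<^bsub>?F\<^esub> y \<in> carrier ?F" if "x \<in> carrier ?F" "y \<in> carrier ?F" for x y
   unfolding ops by (rule mem[OF that]) simp_all
  show "r \<odot>\<^bsub>?F\<^esub> x \<in> carrier ?F" if "r \<in> carrier R" "x \<in> carrier ?F" for r x
   unfolding ops using mem[OF that(2,2), of "%a b. r \<otimes> a"] that(1) by simp
  show "\<exists>y\<in>carrier ?F. y \<oplus>\<^bsub>?F\<^esub> x = \<zero>\<^bsub>?F\<^esub>" if "x \<in> carrier ?F" for x
   using mem[OF that that, of "%a b. \<ominus> a"] inR[OF that]
   by (intro bexI[of _ "%z. \<ominus> x z"]) (simp_all add: ops R.l_neg)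
  fix x assume x: "x \<in> carrier ?F"
  note [simp] = inR[OF x]
  show "\<zero>\<^bsub>?F\<^esub> \<oplus>\<^bsub>?F\<^esub> x = x" "\<one> \<odot>\<^bsub>?F\<^esub> x = x" by (simp_all add: ops)
  show "(a \<oplus> b) \<odot>\<^bsub>?F\<^esub> x = a \<odot>\<^bsub>?F\<^esub> x \<oplus>\<^bsub>?F\<^esub> b \<odot>\<^bsub>?F\<^esub> x" "(a \<otimes> b) \<odot>\<^bsub>?F\<^esub> x = a \<odot>\<^bsub>?F\<^esub> (b \<odot>\<^bsub>?F\<^esub> x)"
   if "a \<in> carrier R" "b \<in> carrier R" for a b using that by (simp_all add: ops R.l_distr R.m_assoc)
  fix y assume y: "y \<in> carrier ?F"
  note [simp] = inR[OF y]
  show "x \<oplus>\<^bsub>?F\<^esub> y = y \<oplus>\<^bsub>?F\<^esub> x" by (simp add: ops R.a_comm)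
  show "a \<odot>\<^bsub>?F\<^esub> (x \<oplus>\<^bsub>?F\<^esub> y) = a \<odot>\<^bsub>?F\<^esub> x \<oplus>\<^bsub>?F\<^esub> a \<odot>\<^bsub>?F\<^esub> y" if "a \<in> carrier R" for a
   using that by (simp add: ops R.r_distr)
  fix z assume z: "z \<in> carrier ?F"
  show "x \<oplus>\<^bsub>?F\<^esub> y \<oplus>\<^bsub>?F\<^esub> z = x \<oplus>\<^bsub>?F\<^esub> (y \<oplus>\<^bsub>?F\<^esub> z)" using inR[OF z] by (simp add: ops R.a_assoc)
 qed
qed

lemma free_module_coeff_closed:
 "cring R ==> c \<in> carrier (free_module R Q) ==> c x \<in> carrier R"
 by (cases "x \<in> Q") (auto simp: free_module_def cring_def ring.ring_simprules(2))

lemma basis_vector_closed: "cring R ==> x \<in> Q ==> basis_vector R x \<in> carrier (free_module R Q)"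
proof -
 assume "cring R" "x \<in> Q"
 then interpret R: cring R by simp
 have "finite {y. basis_vector R x y ~= \<zero>}"
  by (rule finite_subset[of _ "{x}"]) (auto simp: basis_vector_def)
 then show ?thesis using \<open>x \<in> Q\<close> by (auto simp: free_module_def basis_vector_def)
qed

text \<open>Induction on the size of the support: one nonzero coefficient is split off as a multiple
  of a basis vector.\<close>

lemma free_module_induct [consumes 2, case_names zero add]:
 assumes "cring R" "c \<in> carrier (free_module R Q)"
  and "P \<zero>\<^bsub>free_module R Q\<^esub>"
  and step: "\<And>x r c. x \<in> Q ==> r \<in> carrier R ==> c \<in> carrier (free_module R Q) ==> P c ==>
    P (r \<odot>\<^bsub>free_module R Q\<^esub> basis_vector R x \<oplus>\<^bsub>free_module R Q\<^esub> c)"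
 shows "P c"
proof -
 interpret R: cring R by fact
 show ?thesis using assms(2)
 proof (induction "card {x. c x ~= \<zero>}" arbitrary: c)
  case 0
  then have "{x. c x ~= \<zero>} = {}" by (auto simp: free_module_def)
  then have "c = \<zero>\<^bsub>free_module R Q\<^esub>" by (auto simp: free_module_def)
  then show ?case using assms(3) by simp
 next
  case (Suc n)
  obtain x where x: "c x ~= \<zero>" using Suc.hyps(2) by (metis (mono_tags) Collect_empty_eq card.empty nat.distinct(1))
  let ?c = "c(x := \<zero>)"
  have xQ: "x \<in> Q" and cx: "c x \<in> carrier R" and fin: "finite {x. c x ~= \<zero>}"
   using x Suc.prems by (auto simp: free_module_def)
  have s: "{y. ?c y ~= \<zero>} = {x. c x ~= \<zero>} - {x}" by auto
  have c': "?c \<in> carrier (free_module R Q)"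
   using Suc.prems s fin by (auto simp: free_module_def)
  have "n = card {y. ?c y ~= \<zero>}" using s x fin Suc.hyps(2) by simp
  then have "P ?c" using Suc.hyps(1) c' by blast
  then have "P (c x \<odot>\<^bsub>free_module R Q\<^esub> basis_vector R x \<oplus>\<^bsub>free_module R Q\<^esub> ?c)"
   using step xQ cx c' by blast
  also have "c x \<odot>\<^bsub>free_module R Q\<^esub> basis_vector R x \<oplus>\<^bsub>free_module R Q\<^esub> ?c = c"
   using free_module_coeff_closed[OF assms(1) Suc.prems]
   by (auto simp: free_module_def basis_vector_def fun_eq_iff)
  finally show ?case .
 qed
qed

lemma linear_maps_free_ext:
 assumes "cring R" "Module.module R P" "f \<in> linear_maps R (free_module R Q) P" "g \<in> linear_maps R (free_module R Q) P"
  and "\<And>x. x \<in> Q ==> f (basis_vector R x) = g (basis_vector R x)" "c \<in> carrier (free_module R Q)"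
 shows "f c = g c"
proof -
 note m = free_module_module[OF assms(1), of Q]
 interpret F: Module.module R "free_module R Q" by (rule m)
 show ?thesis using assms(1,6)
 proof (induction c rule: free_module_induct)
  case zero
  show ?case using linear_maps_zero[OF m assms(2,3)] linear_maps_zero[OF m assms(2,4)] by simp
 next
  case (add x r c)
  then show ?case
   by (simp add: linear_maps_add[OF assms(3)] linear_maps_add[OF assms(4)]
    linear_maps_smult[OF assms(3)] linear_maps_smult[OF assms(4)] basis_vector_closed[OF assms(1)] assms(5))
 qed
qed

text \<open>The support of a sum can be smaller than the union of the supports. Summing over a
  common finite superset lets the linearity of \<open>free_map\<close> be proved term by
  term.\<close>

lemma free_map_superset:
 assumes "cring R" "finite S" "{x. c x ~= \<zero>} \<subseteq> S" "\<And>x. c x \<in> carrier R"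
 shows "free_map R F c y = (\<Oplus>x\<in>{x\<in>S. F x = y}. c x)"
proof -
 interpret R: cring R by fact
 show ?thesis unfolding free_map_def
  by (rule R.add.finprod_mono_neutral_cong_left) (use assms in auto)
qed

lemma free_map_linear:
 assumes "cring R" "F \<in> Q \<rightarrow> Q'"
 shows "free_map R F \<in> linear_maps R (free_module R Q) (free_module R Q')"
proof -
 interpret R: cring R by fact
 have inR: "c x \<in> carrier R" if "c \<in> carrier (free_module R Q)" for c x
  by (rule free_module_coeff_closed[OF assms(1) that])
 have fin: "finite {x. c x ~= \<zero>}" if "c \<in> carrier (free_module R Q)" for c
  using that by (auto simp: free_module_def)
 show ?thesis
 proof (rule linear_mapsI)
  fix c assume c: "c \<in> carrier (free_module R Q)"
  have z: "free_map R F c y = \<zero>" if "y \<notin> F ` {x. c x ~= \<zero>}" for y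
  proof -
   have e: "{x. c x ~= \<zero> \<and> F x = y} = {}" using that by auto
   show ?thesis unfolding free_map_def e by simp
  qed
  have "finite {y. free_map R F c y ~= \<zero>}"
   by (rule finite_subset[OF _ finite_imageI[OF fin[OF c], of F]]) (use z in auto)
  moreover have "F ` {x. c x ~= \<zero>} \<subseteq> Q'"
   using c assms(2) by (auto simp: free_module_def)
  moreover have "free_map R F c y \<in> carrier R" for y
   unfolding free_map_def by (rule R.finsum_closed) (use inR[OF c] in auto)
  ultimately show "free_map R F c \<in> carrier (free_module R Q')"
   using z by (intro free_module_carrierI) blast+
 next
  fix c d assume c: "c \<in> carrier (free_module R Q)" and d: "d \<in> carrier (free_module R Q)"
  let ?S = "{x. c x ~= \<zero>} \<union> {x. d x ~= \<zero>}"
  have S: "finite ?S" using fin c d by simp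
  have cd: "c \<oplus>\<^bsub>free_module R Q\<^esub> d = (%x. c x \<oplus> d x)" by (simp add: free_module_def)
  have "free_map R F (%x. c x \<oplus> d x) y = free_map R F c y \<oplus> free_map R F d y" for y
  proof -
   have "free_map R F (%x. c x \<oplus> d x) y = (\<Oplus>x\<in>{x\<in>?S. F x = y}. c x \<oplus> d x)"
    by (rule free_map_superset[OF assms(1) S]) (use inR c d in auto)
   also have "\<dots> = (\<Oplus>x\<in>{x\<in>?S. F x = y}. c x) \<oplus> (\<Oplus>x\<in>{x\<in>?S. F x = y}. d x)"
    by (rule R.finsum_addf) (use inR c d in auto)
   also have "(\<Oplus>x\<in>{x\<in>?S. F x = y}. c x) = free_map R F c y"
    by (rule free_map_superset[symmetric, OF assms(1) S]) (use inR c in auto)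
   also have "(\<Oplus>x\<in>{x\<in>?S. F x = y}. d x) = free_map R F d y"
    by (rule free_map_superset[symmetric, OF assms(1) S]) (use inR d in auto)
   finally show ?thesis .
  qed
  then show "free_map R F (c \<oplus>\<^bsub>free_module R Q\<^esub> d) = free_map R F c \<oplus>\<^bsub>free_module R Q'\<^esub> free_map R F d"
   unfolding cd by (simp add: free_module_def fun_eq_iff)
 next
  fix r c assume r: "r \<in> carrier R" and c: "c \<in> carrier (free_module R Q)"
  have rc: "r \<odot>\<^bsub>free_module R Q\<^esub> c = (%x. r \<otimes> c x)" by (simp add: free_module_def)
  have "free_map R F (%x. r \<otimes> c x) y = r \<otimes> free_map R F c y" for y
  proof -
   have "free_map R F (%x. r \<otimes> c x) y = (\<Oplus>x\<in>{x\<in>{x. c x ~= \<zero>}. F x = y}. r \<otimes> c x)"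
    by (rule free_map_superset[OF assms(1) fin[OF c]]) (use inR c r in auto)
   also have "\<dots> = r \<otimes> (\<Oplus>x\<in>{x\<in>{x. c x ~= \<zero>}. F x = y}. c x)"
    by (rule R.finsum_rdistr[symmetric]) (use inR c r fin in auto)
   finally show ?thesis by (simp add: free_map_def)
  qed
  then show "free_map R F (r \<odot>\<^bsub>free_module R Q\<^esub> c) = r \<odot>\<^bsub>free_module R Q'\<^esub> free_map R F c"
   unfolding rc by (simp add: free_module_def fun_eq_iff)
 qed
qed

lemma free_map_basis_vector:
 assumes "cring R"
 shows "free_map R F (basis_vector R x) = basis_vector R (F x)"
proof
 fix y
 interpret R: cring R by fact
 have "free_map R F (basis_vector R x) y = (\<Oplus>z\<in>{z\<in>{x}. F z = y}. basis_vector R x z)"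
  by (rule free_map_superset[OF assms]) (auto simp: basis_vector_def)
 also have "{z\<in>{x}. F z = y} = (if F x = y then {x} else {})" by auto
 also have "(\<Oplus>z\<in>(if F x = y then {x} else {}). basis_vector R x z) = basis_vector R (F x) y"
  by (auto simp: basis_vector_def)
 finally show "free_map R F (basis_vector R x) y = basis_vector R (F x) y" .
qed

text \<open>A quotient of a free module is generated by the classes of basis vectors. Tensor
  products of finite families are presented in this way, so linear maps on them are compared on pure
  tensors only.\<close>

lemma quotient_free_ext:
 assumes "cring R" "submodule A R (free_module R Q)" "Module.module R P"
  and "f \<in> linear_maps R (quotient_module (free_module R Q) A) P"
  and "g \<in> linear_maps R (quotient_module (free_module R Q) A) P"
  and "\<And>x. x \<in> Q ==> f (A +>\<^bsub>free_module R Q\<^esub> basis_vector R x) = g (A +>\<^bsub>free_module R Q\<^esub> basis_vector R x)"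
  and "t \<in> carrier (quotient_module (free_module R Q) A)"
 shows "f t = g t"
proof -
 let ?p = "%x. A +>\<^bsub>free_module R Q\<^esub> x"
 have p: "?p \<in> linear_maps R (free_module R Q) (quotient_module (free_module R Q) A)"
  by (rule quotient_projection_linear[OF free_module_module]) fact+
 obtain c where c: "c \<in> carrier (free_module R Q)" "t = ?p c" using assms(7) by (auto simp: quotient_carrier)
 have "f (?p c) = g (?p c)"
  by (rule linear_maps_free_ext[OF assms(1,3) linear_maps_compose[OF p assms(4)] linear_maps_compose[OF p assms(5)]])
   (use assms(6) c in auto)
 then show ?thesis using c by simp
qed

end

text \<open>The functoriality of a module given by generators and relations: a map of generators
  whose linear extension respects the relations descends to the quotients. Both kinds of tensor
  product obtain their induced maps from it.\<close>

lemma free_quotient_map: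
 assumes "cring R" "F \<in> Q \<rightarrow> Q'" "S \<subseteq> carrier (free_module R Q)" "S' \<subseteq> carrier (free_module R Q')"
  and "\<And>s. s \<in> S ==> free_map R F s \<in> submodule_generated R (free_module R Q') S'"
 defines "A \<equiv> submodule_generated R (free_module R Q) S" and "B \<equiv> submodule_generated R (free_module R Q') S'"
 defines "q \<equiv> quotient_map_induced (free_module R Q') B (free_map R F)"
 shows "q \<in> linear_maps R (quotient_module (free_module R Q) A) (quotient_module (free_module R Q') B)"
  and "x \<in> Q ==> q (A +>\<^bsub>free_module R Q\<^esub> basis_vector R x) = B +>\<^bsub>free_module R Q'\<^esub> basis_vector R (F x)"
proof -
 note m = free_module_module[OF assms(1)]
 have A: "submodule A R (free_module R Q)" and B: "submodule B R (free_module R Q')"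
  unfolding A_def B_def by (rule submodule_generated_submodule[OF m]; fact)+
 note l = free_map_linear[OF assms(1,2)]
 have AB: "free_map R F ` A \<subseteq> B"
  using submodule_generated_linear_image[OF m m l B assms(3)] assms(5) unfolding A_def B_def by blast
 show "q \<in> linear_maps R (quotient_module (free_module R Q) A) (quotient_module (free_module R Q') B)"
  unfolding q_def by (rule quotient_map_induced_linear[OF m m A B l AB])
 show "q (A +>\<^bsub>free_module R Q\<^esub> basis_vector R x) = B +>\<^bsub>free_module R Q'\<^esub> basis_vector R (F x)" if "x \<in> Q"
  unfolding q_def using quotient_map_induced_coset[OF m m A B l AB basis_vector_closed[OF assms(1) that]]
  by (simp add: free_map_basis_vector[OF assms(1)])
qed

lemma quotient_generated_relation:
 assumes "Module.module R M" "S \<subseteq> carrier M" "x \<in> carrier M" "y \<in> carrier M" "x \<ominus>\<^bsub>M\<^esub> y \<in> S"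
 shows "submodule_generated R M S +>\<^bsub>M\<^esub> x = submodule_generated R M S +>\<^bsub>M\<^esub> y"
 using quotient_coset_eq_iff[OF assms(1) submodule_generated_submodule[OF assms(1,2)] assms(3,4)]
  submodule_generated_incl[of S] assms(5) by blast

subsection \<open>Tensor products\<close>

text \<open>The generating relations are split off from the submodule
  \<open>tensor_relations\<close> that they generate, so that a map can be tested on them
  alone.\<close>

definition tensor_gens ::
  "('r, 'c) ring_scheme => 'i set => ('i => ('r, 'm) module) => (('i => 'm) => 'r) set" where
 "tensor_gens R J A = (let F = tensor_free R J A; \<delta> = basis_vector R in
    ({\<delta> (f(j := a \<oplus>\<^bsub>A j\<^esub> b)) \<ominus>\<^bsub>F\<^esub> (\<delta> (f(j := a)) \<oplus>\<^bsub>F\<^esub> \<delta> (f(j := b))) | f j a b.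
      f \<in> (\<Pi>\<^sub>E j\<in>J. carrier (A j)) \<and> j \<in> J \<and> a \<in> carrier (A j) \<and> b \<in> carrier (A j)} \<union>
    {\<delta> (f(j := r \<odot>\<^bsub>A j\<^esub> a)) \<ominus>\<^bsub>F\<^esub> (r \<odot>\<^bsub>F\<^esub> \<delta> (f(j := a))) | f j r a.
      f \<in> (\<Pi>\<^sub>E j\<in>J. carrier (A j)) \<and> j \<in> J \<and> r \<in> carrier R \<and> a \<in> carrier (A j)}))"

lemma tensor_relations_gens:
 "tensor_relations R J A = submodule_generated R (tensor_free R J A) (tensor_gens R J A)"
 by (simp add: tensor_relations_def tensor_gens_def Let_def)

lemma PiE_upd_same: "f \<in> PiE J B ==> j \<in> J ==> a \<in> B j ==> f(j := a) \<in> PiE J B"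
 using PiE_fun_upd[of a B j f J] by (simp add: insert_absorb)

locale tensor_family =
 fixes R :: "('r, 'c) ring_scheme" and J :: "'i set" and A :: "'i => ('r, 'm) module"
 assumes R: "cring R" and A: "\<And>j. j \<in> J ==> Module.module R (A j)"
begin

lemma free: "Module.module R (tensor_free R J A)"
 unfolding tensor_free_def by (rule free_module_module[OF R])

lemma basis_closed: "x \<in> (\<Pi>\<^sub>E j\<in>J. carrier (A j)) ==> basis_vector R x \<in> carrier (tensor_free R J A)"
 unfolding tensor_free_def by (rule basis_vector_closed[OF R])

lemma factor_closed:
 assumes "j \<in> J" "a \<in> carrier (A j)"
 shows "b \<in> carrier (A j) ==> a \<oplus>\<^bsub>A j\<^esub> b \<in> carrier (A j)"
  and "r \<in> carrier R ==> r \<odot>\<^bsub>A j\<^esub> a \<in> carrier (A j)"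
proof -
 interpret Aj: Module.module R "A j" by (rule A[OF assms(1)])
 show "b \<in> carrier (A j) ==> a \<oplus>\<^bsub>A j\<^esub> b \<in> carrier (A j)"
  and "r \<in> carrier R ==> r \<odot>\<^bsub>A j\<^esub> a \<in> carrier (A j)"
  using assms(2) by auto
qed

lemma gens_closed: "tensor_gens R J A \<subseteq> carrier (tensor_free R J A)"
proof -
 interpret F: Module.module R "tensor_free R J A" by (rule free)
 show ?thesis
  unfolding tensor_gens_def Let_def
  by (auto intro!: F.minus_closed F.a_closed F.smult_closed basis_closed PiE_upd_same factor_closed)
qed

lemma gens_addI:
 "f \<in> (\<Pi>\<^sub>E j\<in>J. carrier (A j)) ==> j \<in> J ==> a \<in> carrier (A j) ==> b \<in> carrier (A j) ==>
   basis_vector R (f(j := a \<oplus>\<^bsub>A j\<^esub> b)) \<ominus>\<^bsub>tensor_free R J A\<^esub>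
    (basis_vector R (f(j := a)) \<oplus>\<^bsub>tensor_free R J A\<^esub> basis_vector R (f(j := b))) \<in> tensor_gens R J A"
 unfolding tensor_gens_def Let_def by blast

lemma gens_smultI:
 "f \<in> (\<Pi>\<^sub>E j\<in>J. carrier (A j)) ==> j \<in> J ==> r \<in> carrier R ==> a \<in> carrier (A j) ==>
   basis_vector R (f(j := r \<odot>\<^bsub>A j\<^esub> a)) \<ominus>\<^bsub>tensor_free R J A\<^esub>
    (r \<odot>\<^bsub>tensor_free R J A\<^esub> basis_vector R (f(j := a))) \<in> tensor_gens R J A"
 unfolding tensor_gens_def Let_def by blast

lemma relations: "submodule (tensor_relations R J A) R (tensor_free R J A)"
 unfolding tensor_relations_gens by (rule submodule_generated_submodule[OF free gens_closed])

lemma tensor: "Module.module R (tensor R J A)"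
 unfolding tensor_def by (rule quotient_module_module[OF free relations])

lemma pure_closed:
 assumes "\<And>j. j \<in> J ==> x j \<in> carrier (A j)"
 shows "pure_tensor R J A x \<in> carrier (tensor R J A)"
 unfolding pure_tensor_def tensor_def quotient_carrier using assms by (auto intro!: imageI basis_closed)

lemma restrict_upd_mem:
 assumes "\<And>j. j \<in> J ==> x j \<in> carrier (A j)" "j \<in> J" "a \<in> carrier (A j)"
 shows "restrict (x(j := a)) J = (restrict x J)(j := a)" "(restrict x J)(j := a) \<in> (\<Pi>\<^sub>E j\<in>J. carrier (A j))"
 using assms by (auto simp: fun_eq_iff intro!: PiE_upd_same)

lemma pure_add:
 assumes "\<And>j. j \<in> J ==> x j \<in> carrier (A j)" "j \<in> J" "a \<in> carrier (A j)" "b \<in> carrier (A j)"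
 shows "pure_tensor R J A (x(j := a \<oplus>\<^bsub>A j\<^esub> b)) =
  pure_tensor R J A (x(j := a)) \<oplus>\<^bsub>tensor R J A\<^esub> pure_tensor R J A (x(j := b))"
proof -
 interpret F: Module.module R "tensor_free R J A" by (rule free)
 let ?f = "restrict x J"
 have f: "?f \<in> (\<Pi>\<^sub>E j\<in>J. carrier (A j))" using assms by auto
 note ab = factor_closed(1)[OF assms(2-4)]
 have m: "basis_vector R (?f(j := a)) \<in> carrier (tensor_free R J A)"
  "basis_vector R (?f(j := b)) \<in> carrier (tensor_free R J A)"
  "basis_vector R (?f(j := a \<oplus>\<^bsub>A j\<^esub> b)) \<in> carrier (tensor_free R J A)"
  using f assms ab by (auto intro!: basis_closed PiE_upd_same)
 have "tensor_relations R J A +>\<^bsub>tensor_free R J A\<^esub> basis_vector R (?f(j := a \<oplus>\<^bsub>A j\<^esub> b)) =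
  tensor_relations R J A +>\<^bsub>tensor_free R J A\<^esub>
   (basis_vector R (?f(j := a)) \<oplus>\<^bsub>tensor_free R J A\<^esub> basis_vector R (?f(j := b)))"
  unfolding tensor_relations_gens
  by (rule quotient_generated_relation[OF free gens_closed])
   (use m f assms in \<open>auto intro: gens_addI\<close>)
 then show ?thesis
  using assms ab m
  by (simp add: pure_tensor_def tensor_def restrict_upd_mem(1) quotient_add[OF free relations])
qed

lemma pure_smult:
 assumes "\<And>j. j \<in> J ==> x j \<in> carrier (A j)" "j \<in> J" "a \<in> carrier (A j)" "r \<in> carrier R"
 shows "pure_tensor R J A (x(j := r \<odot>\<^bsub>A j\<^esub> a)) = r \<odot>\<^bsub>tensor R J A\<^esub> pure_tensor R J A (x(j := a))"
proof -
 interpret F: Module.module R "tensor_free R J A" by (rule free)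
 let ?f = "restrict x J"
 have f: "?f \<in> (\<Pi>\<^sub>E j\<in>J. carrier (A j))" using assms by auto
 note ab = factor_closed(2)[OF assms(2-4)]
 have m: "basis_vector R (?f(j := a)) \<in> carrier (tensor_free R J A)"
  "basis_vector R (?f(j := r \<odot>\<^bsub>A j\<^esub> a)) \<in> carrier (tensor_free R J A)"
  using f assms ab by (auto intro!: basis_closed PiE_upd_same)
 have "tensor_relations R J A +>\<^bsub>tensor_free R J A\<^esub> basis_vector R (?f(j := r \<odot>\<^bsub>A j\<^esub> a)) =
  tensor_relations R J A +>\<^bsub>tensor_free R J A\<^esub> (r \<odot>\<^bsub>tensor_free R J A\<^esub> basis_vector R (?f(j := a)))"
  unfolding tensor_relations_gens
  by (rule quotient_generated_relation[OF free gens_closed])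
   (use m f assms in \<open>auto intro: gens_smultI\<close>)
 then show ?thesis
  using assms ab m
  by (simp add: pure_tensor_def tensor_def restrict_upd_mem(1) quotient_smult[OF free relations])
qed

lemma linear_ext:
 assumes "Module.module R P" "f \<in> linear_maps R (tensor R J A) P" "g \<in> linear_maps R (tensor R J A) P"
  and "\<And>x. x \<in> (\<Pi>\<^sub>E j\<in>J. carrier (A j)) ==> f (pure_tensor R J A x) = g (pure_tensor R J A x)"
  and "t \<in> carrier (tensor R J A)"
 shows "f t = g t"
 using assms relations
 unfolding pure_tensor_def tensor_def tensor_free_def
 by (intro quotient_free_ext[OF R, of "tensor_relations R J A" "\<Pi>\<^sub>E j\<in>J. carrier (A j)" P f g t])
  (auto simp: PiE_restrict)

end

text \<open>Both \<open>tensor_map\<close> and \<open>tensor_extend\<close> are instances.\<close>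

definition tensor_affine ::
  "('r, 'c) ring_scheme => 'i set => 'i set => ('i => ('r, 'n) module) => ('i => 'm => 'n) => ('i => 'n) =>
    (('i => 'm) => 'r) set => (('i => 'n) => 'r) set" where
 "tensor_affine R J J' B h \<phi> =
   quotient_map_induced (tensor_free R J' B) (tensor_relations R J' B)
    (free_map R (%f. \<lambda>j\<in>J'. if j \<in> J then h j (f j) else \<phi> j))"

lemma tensor_map_affine: "tensor_map R J B h = tensor_affine R J J B h \<phi>"
proof -
 have "(%f. \<lambda>j\<in>J. h j (f j)) = (%f. \<lambda>j\<in>J. if j \<in> J then h j (f j) else \<phi> j)" by (auto simp: fun_eq_iff)
 then show ?thesis by (simp add: tensor_map_def tensor_affine_def)
qed

lemma tensor_extend_affine: "tensor_extend R A \<phi> J J' = tensor_affine R J J' A (%j x. x) \<phi>"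
 by (simp add: tensor_extend_def tensor_affine_def)

lemma tensor_affine:
 fixes R :: "('r, 'c) ring_scheme" and A :: "'i => ('r, 'm) module" and B :: "'i => ('r, 'n) module"
 assumes "tensor_family R J A" "tensor_family R J' B" "J \<subseteq> J'"
  and h: "\<And>j. j \<in> J ==> h j \<in> linear_maps R (A j) (B j)"
  and \<phi>: "\<And>j. j \<in> J' ==> j \<notin> J ==> \<phi> j \<in> carrier (B j)"
 shows tensor_affine_linear: "tensor_affine R J J' B h \<phi> \<in> linear_maps R (tensor R J A) (tensor R J' B)"
  and tensor_affine_pure: "(\<And>j. j \<in> J ==> x j \<in> carrier (A j)) ==> tensor_affine R J J' B h \<phi> (pure_tensor R J A x) =
      pure_tensor R J' B (%j. if j \<in> J then h j (x j) else \<phi> j)"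
proof -
 interpret A: tensor_family R J A by fact
 interpret B: tensor_family R J' B by fact
 interpret FA: Module.module R "tensor_free R J A" by (rule A.free)
 interpret FB: Module.module R "tensor_free R J' B" by (rule B.free)
 let ?F = "%f. \<lambda>j\<in>J'. if j \<in> J then h j (f j) else \<phi> j"
 let ?PA = "\<Pi>\<^sub>E j\<in>J. carrier (A j)" and ?PB = "\<Pi>\<^sub>E j\<in>J'. carrier (B j)"
 have hc: "h j a \<in> carrier (B j)" if "j \<in> J" "a \<in> carrier (A j)" for j a
  using linear_maps_closed[OF h] that by blast
 have F: "?F \<in> ?PA \<rightarrow> ?PB" using assms(3) \<phi> by (auto intro!: hc dest: PiE_mem)
 have lin: "free_map R ?F \<in> linear_maps R (tensor_free R J A) (tensor_free R J' B)"
  unfolding tensor_free_def by (rule free_map_linear[OF A.R F])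
 \<comment> \<open>Changing the coordinate j in \<open>J\<close> before or after \<open>?F\<close>
   is the same. A multilinearity relation in slot j is therefore sent to a relation in the same
   slot; the slots outside \<open>J\<close> hold the constants \<phi>_j and create no further
   conditions.\<close>
 have upd: "?F (f(j := a)) = (?F f)(j := h j a)" if "j \<in> J" for f j a
  using that assms(3) by (auto simp: fun_eq_iff)
 have bA: "basis_vector R (f(j := a)) \<in> carrier (tensor_free R J A)" if "f \<in> ?PA" "j \<in> J" "a \<in> carrier (A j)" for f j a
  using that by (intro A.basis_closed PiE_upd_same) auto
 have Fb: "free_map R ?F (basis_vector R (f(j := a))) = basis_vector R ((?F f)(j := h j a))"
  if "j \<in> J" for f j a
  unfolding free_map_basis_vector[OF A.R] upd[OF that] ..
 have rel: "free_map R ?F s \<in> tensor_relations R J' B" if s: "s \<in> tensor_gens R J A" for s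
 proof -
  from s consider (a) f j a b where
    "s = basis_vector R (f(j := a \<oplus>\<^bsub>A j\<^esub> b)) \<ominus>\<^bsub>tensor_free R J A\<^esub>
      (basis_vector R (f(j := a)) \<oplus>\<^bsub>tensor_free R J A\<^esub> basis_vector R (f(j := b)))"
    "f \<in> ?PA" "j \<in> J" "a \<in> carrier (A j)" "b \<in> carrier (A j)"
   | (s) f j r a where
    "s = basis_vector R (f(j := r \<odot>\<^bsub>A j\<^esub> a)) \<ominus>\<^bsub>tensor_free R J A\<^esub>
      (r \<odot>\<^bsub>tensor_free R J A\<^esub> basis_vector R (f(j := a)))"
    "f \<in> ?PA" "j \<in> J" "r \<in> carrier R" "a \<in> carrier (A j)"
   unfolding tensor_gens_def Let_def by blast
  then have "free_map R ?F s \<in> tensor_gens R J' B"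
  proof cases
   case a
   note ab = A.factor_closed(1)[OF a(3,4,5)]
   have "free_map R ?F s = basis_vector R ((?F f)(j := h j a \<oplus>\<^bsub>B j\<^esub> h j b)) \<ominus>\<^bsub>tensor_free R J' B\<^esub>
      (basis_vector R ((?F f)(j := h j a)) \<oplus>\<^bsub>tensor_free R J' B\<^esub> basis_vector R ((?F f)(j := h j b)))"
    unfolding a(1)
    by (subst linear_maps_diff[OF A.free B.free lin])
     (simp_all only: linear_maps_add[OF lin] linear_maps_add[OF h[OF a(3)]] bA a ab Fb FA.a_closed)
   also have "\<dots> \<in> tensor_gens R J' B"
    using funcset_mem[OF F a(2)] hc[OF a(3,4)] hc[OF a(3,5)] subsetD[OF assms(3) a(3)] by (intro B.gens_addI)
   finally show ?thesis .
  next
   case s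
   note ab = A.factor_closed(2)[OF s(3,5,4)]
   have "free_map R ?F s = basis_vector R ((?F f)(j := r \<odot>\<^bsub>B j\<^esub> h j a)) \<ominus>\<^bsub>tensor_free R J' B\<^esub>
      (r \<odot>\<^bsub>tensor_free R J' B\<^esub> basis_vector R ((?F f)(j := h j a)))"
    unfolding s(1)
    by (subst linear_maps_diff[OF A.free B.free lin])
     (simp_all only: linear_maps_smult[OF lin] linear_maps_smult[OF h[OF s(3)]] bA s ab Fb FA.smult_closed)
   also have "\<dots> \<in> tensor_gens R J' B"
    using funcset_mem[OF F s(2)] hc[OF s(3,5)] subsetD[OF assms(3) s(3)] s(4) by (intro B.gens_smultI)
   finally show ?thesis .
  qed
  then show ?thesis unfolding tensor_relations_gens by (rule subsetD[OF submodule_generated_incl])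
 qed
 note q = free_quotient_map[OF A.R F, of "tensor_gens R J A" "tensor_gens R J' B",
   folded tensor_free_def, folded tensor_relations_gens, OF A.gens_closed B.gens_closed rel]
 show "tensor_affine R J J' B h \<phi> \<in> linear_maps R (tensor R J A) (tensor R J' B)"
  unfolding tensor_affine_def tensor_def by (rule q(1))
 show "tensor_affine R J J' B h \<phi> (pure_tensor R J A x) = pure_tensor R J' B (%j. if j \<in> J then h j (x j) else \<phi> j)"
  if "\<And>j. j \<in> J ==> x j \<in> carrier (A j)"
 proof -
  have e: "?F (restrict x J) = restrict (%j. if j \<in> J then h j (x j) else \<phi> j) J'" by (auto simp: fun_eq_iff)
  have m: "restrict x J \<in> ?PA" using that by auto
  show ?thesis unfolding tensor_affine_def pure_tensor_def
   by (rule HOL.trans[OF q(2)[OF _ m]]) (simp_all only: e)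
 qed
qed

subsection \<open>Direct limits\<close>

text \<open>Used for two limits: over the levels of H_v under reverse inclusion, for the colimit in
  which zeta elements take values, and over finite sets of places under inclusion, for the
  restricted tensor product.\<close>

locale directed_system =
 fixes R :: "('r, 'c) ring_scheme" and J :: "'j set" and below :: "'j => 'j => bool"
  and D :: "'j => ('r, 'm) module" and f :: "'j => 'j => 'm => 'm"
 assumes R: "cring R" and nonempty: "J ~= {}"
  and directed: "\<And>i j. i \<in> J ==> j \<in> J ==> \<exists>k\<in>J. below i k \<and> below j k"
  and refl: "\<And>i. i \<in> J ==> below i i"
  and trans: "\<And>i j k. i \<in> J ==> j \<in> J ==> k \<in> J ==> below i j ==> below j k ==> below i k"
  and D: "\<And>i. i \<in> J ==> Module.module R (D i)"
  and f: "\<And>i j. i \<in> J ==> j \<in> J ==> below i j ==> f i j \<in> linear_maps R (D i) (D j)"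
  and f_refl: "\<And>i x. i \<in> J ==> x \<in> carrier (D i) ==> f i i x = x"
  and f_trans: "\<And>i j k x. i \<in> J ==> j \<in> J ==> k \<in> J ==> below i j ==> below j k ==> x \<in> carrier (D i) ==>
      f j k (f i j x) = f i k x"
begin

abbreviation "cl \<equiv> dl_class J below D f"
abbreviation "DL \<equiv> direct_limit J below D f"

lemma f_closed: "i \<in> J ==> j \<in> J ==> below i j ==> x \<in> carrier (D i) ==> f i j x \<in> carrier (D j)"
 using linear_maps_closed[OF f] by blast

lemma relation_equiv: "equiv (SIGMA i:J. carrier (D i)) (dl_relation J below D f)"
proof (rule equivI)
 show "dl_relation J below D f \<subseteq> (SIGMA i:J. carrier (D i)) \<times> (SIGMA i:J. carrier (D i))"
  by (auto simp: dl_relation_def)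
 show "refl_on (SIGMA i:J. carrier (D i)) (dl_relation J below D f)"
 proof (rule refl_onI, clarify)
  fix i x assume "i \<in> J" "x \<in> carrier (D i)"
  then show "((i, x), (i, x)) \<in> dl_relation J below D f"
   unfolding dl_relation_def using refl[of i] by blast
 qed
 show "sym (dl_relation J below D f)"
  by (rule symI) (auto simp: dl_relation_def; metis)
 show "trans (dl_relation J below D f)"
 proof (rule transI)
  fix p q s assume "(p, q) \<in> dl_relation J below D f" "(q, s) \<in> dl_relation J below D f"
  then obtain i x j y l z k n where
   *: "p = (i, x)" "q = (j, y)" "s = (l, z)" "i \<in> J" "j \<in> J" "l \<in> J" "k \<in> J" "n \<in> J"
    "x \<in> carrier (D i)" "y \<in> carrier (D j)" "z \<in> carrier (D l)"
    "below i k" "below j k" "f i k x = f j k y" "below j n" "below l n" "f j n y = f l n z"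
   by (fastforce simp: dl_relation_def)
  obtain m where m: "m \<in> J" "below k m" "below n m" using directed * by blast
  have "f i m x = f l m z"
   using f_trans[of i k m x] f_trans[of j k m y] f_trans[of j n m y] f_trans[of l n m z] * m by metis
  moreover have "below i m" "below l m" using trans * m by metis+
  ultimately show "(p, s) \<in> dl_relation J below D f" using * m by (auto simp: dl_relation_def)
 qed
qed

lemma cl_eq_iff:
 assumes "i \<in> J" "x \<in> carrier (D i)" "j \<in> J" "y \<in> carrier (D j)"
 shows "cl (i, x) = cl (j, y) \<longleftrightarrow> (\<exists>k\<in>J. below i k \<and> below j k \<and> f i k x = f j k y)"
proof -
 have "cl (i, x) = cl (j, y) \<longleftrightarrow> ((i, x), (j, y)) \<in> dl_relation J below D f"
  unfolding dl_class_def using assms by (intro eq_equiv_class_iff[OF relation_equiv]) auto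
 then show ?thesis using assms by (auto simp: dl_relation_def)
qed

lemma cl_self: "i \<in> J ==> x \<in> carrier (D i) ==> (i, x) \<in> cl (i, x)"
 unfolding dl_class_def by (rule equiv_class_self[OF relation_equiv]) auto

lemma cl_mem:
 assumes "i \<in> J" "x \<in> carrier (D i)" "(j, y) \<in> cl (i, x)"
 shows "j \<in> J" "y \<in> carrier (D j)" "cl (j, y) = cl (i, x)"
proof -
 have r: "((i, x), (j, y)) \<in> dl_relation J below D f" using assms(3) by (simp add: dl_class_def)
 then show "j \<in> J" "y \<in> carrier (D j)" by (auto simp: dl_relation_def)
 show "cl (j, y) = cl (i, x)" unfolding dl_class_def using equiv_class_eq[OF relation_equiv r] by simp
qed

lemma cl_transition: "i \<in> J ==> k \<in> J ==> below i k ==> x \<in> carrier (D i) ==> cl (k, f i k x) = cl (i, x)"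
 by (subst cl_eq_iff) (auto intro!: bexI[of _ k] simp: f_closed f_refl refl)

lemma carrier_Lim: "carrier DL = {cl (i, x) | i x. i \<in> J \<and> x \<in> carrier (D i)}"
 by (auto simp: direct_limit_def Let_def quotient_def dl_class_def)

lemma cl_closed: "i \<in> J ==> x \<in> carrier (D i) ==> cl (i, x) \<in> carrier DL"
 by (auto simp: carrier_Lim)

text \<open>Addition in \<open>direct_limit\<close> is a union over all pairs of representatives and
  all their upper bounds. Any two such choices become equal at an index above everything involved:
  above the indices where the representatives are identified, and above both upper bounds.\<close>

lemma Lim_add_general:
 assumes i: "i \<in> J" "x \<in> carrier (D i)" and j: "j \<in> J" "y \<in> carrier (D j)"
  and k: "k \<in> J" "below i k" "below j k"
 shows "cl (i, x) \<oplus>\<^bsub>DL\<^esub> cl (j, y) = cl (k, f i k x \<oplus>\<^bsub>D k\<^esub> f j k y)"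
proof -
 have main: "cl (k', f i' k' x' \<oplus>\<^bsub>D k'\<^esub> f j' k' y') = cl (k, f i k x \<oplus>\<^bsub>D k\<^esub> f j k y)"
  if "(i', x') \<in> cl (i, x)" "(j', y') \<in> cl (j, y)" "k' \<in> J" "below i' k'" "below j' k'" for i' x' j' y' k'
 proof -
  note i' = cl_mem[OF i that(1)] and j' = cl_mem[OF j that(2)] and k' = that(3)
  obtain l where l: "l \<in> J" "below i' l" "below i l" "f i' l x' = f i l x"
   using i'(3) cl_eq_iff[OF i'(1,2) i] by auto
  obtain m where m: "m \<in> J" "below j' m" "below j m" "f j' m y' = f j m y"
   using j'(3) cl_eq_iff[OF j'(1,2) j] by auto
  obtain a where a: "a \<in> J" "below l a" "below m a" using directed[OF l(1) m(1)] by blast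
  obtain b where b: "b \<in> J" "below k b" "below k' b" using directed[OF k(1) k'] by blast
  obtain n where n: "n \<in> J" "below a n" "below b n" using directed[OF a(1) b(1)] by blast
  note ij = i(1) j(1) i'(1) j'(1)
  have n': "below l n" "below m n" "below k n" "below k' n"
   using trans[of l a n] trans[of m a n] trans[of k b n] trans[of k' b n] a b n l m k that(3) by blast+
  have n'': "below i n" "below j n" "below i' n" "below j' n"
   using trans[of i k n] trans[of j k n] trans[of i' k' n] trans[of j' k' n] n n' k that(3-5) ij by blast+
  interpret Dk: Module.module R "D k" by (rule D[OF k(1)])
  interpret Dk': Module.module R "D k'" by (rule D[OF that(3)])
  have c: "f i k x \<in> carrier (D k)" "f j k y \<in> carrier (D k)" "f i' k' x' \<in> carrier (D k')" "f j' k' y' \<in> carrier (D k')"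
   using f_closed i j i' j' k that by auto
  have "f k' n (f i' k' x' \<oplus>\<^bsub>D k'\<^esub> f j' k' y') = f i' n x' \<oplus>\<^bsub>D n\<^esub> f j' n y'"
   using linear_maps_add[OF f[OF that(3) n(1) n'(4)] c(3,4)]
    f_trans[OF i'(1) that(3) n(1) that(4) n'(4) i'(2)] f_trans[OF j'(1) that(3) n(1) that(5) n'(4) j'(2)] by simp
  also have "f i' n x' = f i n x"
   using f_trans[OF i'(1) l(1) n(1) l(2) n'(1) i'(2)] f_trans[OF i(1) l(1) n(1) l(3) n'(1) i(2)] l(4) by simp
  also have "f j' n y' = f j n y"
   using f_trans[OF j'(1) m(1) n(1) m(2) n'(2) j'(2)] f_trans[OF j(1) m(1) n(1) m(3) n'(2) j(2)] m(4) by simp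
  also have "f i n x \<oplus>\<^bsub>D n\<^esub> f j n y = f k n (f i k x \<oplus>\<^bsub>D k\<^esub> f j k y)"
   using linear_maps_add[OF f[OF k(1) n(1) n'(3)] c(1,2)]
    f_trans[OF i(1) k(1) n(1) k(2) n'(3) i(2)] f_trans[OF j(1) k(1) n(1) k(3) n'(3) j(2)] by simp
  finally show ?thesis using c that(3) k n n' by (subst cl_eq_iff) auto
 qed
 have inner: "(\<Union>k'\<in>{k' \<in> J. below i' k' \<and> below j' k'}. cl (k', f i' k' x' \<oplus>\<^bsub>D k'\<^esub> f j' k' y')) =
   cl (k, f i k x \<oplus>\<^bsub>D k\<^esub> f j k y)" if ij: "(i', x') \<in> cl (i, x)" "(j', y') \<in> cl (j, y)" for i' x' j' y'
 proof -
  obtain k' where k': "k' \<in> J" "below i' k'" "below j' k'"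
   using directed[OF cl_mem(1)[OF i ij(1)] cl_mem(1)[OF j ij(2)]] by blast
  show ?thesis by (rule UN_eq_const[of k']) (use k' main[OF ij] in auto)
 qed
 show ?thesis
  unfolding direct_limit_def Let_def ring.simps
 proof (rule UN_eq_const[OF cl_self[OF i]], split prod.split, intro allI impI)
  fix p i' x' assume p: "p \<in> cl (i, x)" "p = (i', x')"
  show "(\<Union>(j', y')\<in>cl (j, y). \<Union>k'\<in>{k' \<in> J. below i' k' \<and> below j' k'}. cl (k', f i' k' x' \<oplus>\<^bsub>D k'\<^esub> f j' k' y')) =
   cl (k, f i k x \<oplus>\<^bsub>D k\<^esub> f j k y)"
  proof (rule UN_eq_const[OF cl_self[OF j]], split prod.split, intro allI impI)
   fix q j' y' assume q: "q \<in> cl (j, y)" "q = (j', y')"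
   show "(\<Union>k'\<in>{k' \<in> J. below i' k' \<and> below j' k'}. cl (k', f i' k' x' \<oplus>\<^bsub>D k'\<^esub> f j' k' y')) =
    cl (k, f i k x \<oplus>\<^bsub>D k\<^esub> f j k y)"
    using p q by (intro inner) simp_all
  qed
 qed
qed

lemma Lim_add:
 assumes "i \<in> J" "x \<in> carrier (D i)" "y \<in> carrier (D i)"
 shows "cl (i, x) \<oplus>\<^bsub>DL\<^esub> cl (i, y) = cl (i, x \<oplus>\<^bsub>D i\<^esub> y)"
 using Lim_add_general[OF assms(1,2,1,3,1)] assms refl f_refl by simp

lemma Lim_smult:
 assumes r: "r \<in> carrier R" and i: "i \<in> J" "x \<in> carrier (D i)"
 shows "r \<odot>\<^bsub>DL\<^esub> cl (i, x) = cl (i, r \<odot>\<^bsub>D i\<^esub> x)"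
proof -
 have main: "cl (j, r \<odot>\<^bsub>D j\<^esub> y) = cl (i, r \<odot>\<^bsub>D i\<^esub> x)" if "(j, y) \<in> cl (i, x)" for j y
 proof -
  note j = cl_mem[OF i that]
  interpret Di: Module.module R "D i" by (rule D[OF i(1)])
  interpret Dj: Module.module R "D j" by (rule D[OF j(1)])
  obtain l where l: "l \<in> J" "below j l" "below i l" "f j l y = f i l x"
   using j(3) cl_eq_iff[OF j(1,2) i] by auto
  have "f j l (r \<odot>\<^bsub>D j\<^esub> y) = f i l (r \<odot>\<^bsub>D i\<^esub> x)"
   using linear_maps_smult[OF f r] i j l by simp
  then show ?thesis using i j l r by (subst cl_eq_iff) auto
 qed
 show ?thesis
  unfolding direct_limit_def Let_def module.simps
  by (rule UN_eq_const[OF cl_self[OF i]]) (auto simp: main)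
qed

lemma Lim_zero: "i \<in> J ==> \<zero>\<^bsub>DL\<^esub> = cl (i, \<zero>\<^bsub>D i\<^esub>)"
proof -
 assume i: "i \<in> J"
 have z: "\<zero>\<^bsub>D j\<^esub> \<in> carrier (D j)" if "j \<in> J" for j
 proof -
  interpret Dj: Module.module R "D j" by (rule D[OF that])
  show ?thesis by simp
 qed
 have main: "cl (j, \<zero>\<^bsub>D j\<^esub>) = cl (i, \<zero>\<^bsub>D i\<^esub>)" if j: "j \<in> J" for j
 proof -
  obtain k where k: "k \<in> J" "below i k" "below j k" using directed i j by blast
  then have "f i k \<zero>\<^bsub>D i\<^esub> = f j k \<zero>\<^bsub>D j\<^esub>"
   using linear_maps_zero[OF D D f] i j by simp
  then show ?thesis using i j k z by (subst cl_eq_iff) auto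
 qed
 show ?thesis unfolding direct_limit_def Let_def ring.simps by (rule UN_eq_const[OF i main])
qed

lemma Lim_module: "Module.module R DL"
proof -
 have two: "\<exists>k x y. k \<in> J \<and> x \<in> carrier (D k) \<and> y \<in> carrier (D k) \<and> X = cl (k, x) \<and> Y = cl (k, y)"
  if X: "X \<in> carrier DL" and Y: "Y \<in> carrier DL" for X Y
 proof -
  from X Y obtain i x j y where *: "i \<in> J" "x \<in> carrier (D i)" "X = cl (i, x)"
   "j \<in> J" "y \<in> carrier (D j)" "Y = cl (j, y)"
   unfolding carrier_Lim by blast
  obtain k where "k \<in> J" "below i k" "below j k" using directed * by blast
  then show ?thesis using cl_transition[of i k x] cl_transition[of j k y] f_closed * by metis
 qed
 have three: "\<exists>k x y z. k \<in> J \<and> x \<in> carrier (D k) \<and> y \<in> carrier (D k) \<and> z \<in> carrier (D k) \<and>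
   X = cl (k, x) \<and> Y = cl (k, y) \<and> Z = cl (k, z)"
  if X: "X \<in> carrier DL" and Y: "Y \<in> carrier DL" and Z: "Z \<in> carrier DL" for X Y Z
 proof -
  from two[OF X Y] Z obtain i x y j z where *: "i \<in> J" "x \<in> carrier (D i)" "y \<in> carrier (D i)" "X = cl (i, x)"
   "Y = cl (i, y)" "j \<in> J" "z \<in> carrier (D j)" "Z = cl (j, z)"
   unfolding carrier_Lim by blast
  obtain k where "k \<in> J" "below i k" "below j k" using directed * by blast
  then show ?thesis
   using cl_transition[of i k x] cl_transition[of i k y] cl_transition[of j k z] f_closed * by metis
 qed
 have one: "\<exists>k x. k \<in> J \<and> x \<in> carrier (D k) \<and> X = cl (k, x)" if "X \<in> carrier DL" for X
  using that unfolding carrier_Lim by blast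
 have Dg: "abelian_group (D k)" if "k \<in> J" for k
  using D[OF that] by (simp add: Module.module_def)
 show ?thesis
 proof (rule moduleI[OF R])
  show "abelian_group DL"
  proof (rule abelian_groupI)
   fix X Y assume "X \<in> carrier DL" "Y \<in> carrier DL"
   from two[OF this] obtain k x y where k: "k \<in> J" "x \<in> carrier (D k)" "y \<in> carrier (D k)" "X = cl (k, x)" "Y = cl (k, y)"
    by blast
   interpret Dk: Module.module R "D k" by (rule D[OF k(1)])
   show "X \<oplus>\<^bsub>DL\<^esub> Y \<in> carrier DL" using k by (simp add: Lim_add cl_closed)
   show "X \<oplus>\<^bsub>DL\<^esub> Y = Y \<oplus>\<^bsub>DL\<^esub> X" using k by (simp add: Lim_add Dk.a_comm)
  next
   obtain i where i: "i \<in> J" using nonempty by blast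
   interpret Di: Module.module R "D i" by (rule D[OF i])
   show "\<zero>\<^bsub>DL\<^esub> \<in> carrier DL" using i by (simp add: Lim_zero[OF i] cl_closed)
  next
   fix X Y Z assume "X \<in> carrier DL" "Y \<in> carrier DL" "Z \<in> carrier DL"
   from three[OF this] obtain k x y z where k: "k \<in> J" "x \<in> carrier (D k)" "y \<in> carrier (D k)" "z \<in> carrier (D k)"
     "X = cl (k, x)" "Y = cl (k, y)" "Z = cl (k, z)" by blast
   interpret Dk: Module.module R "D k" by (rule D[OF k(1)])
   show "X \<oplus>\<^bsub>DL\<^esub> Y \<oplus>\<^bsub>DL\<^esub> Z = X \<oplus>\<^bsub>DL\<^esub> (Y \<oplus>\<^bsub>DL\<^esub> Z)" using k by (simp add: Lim_add Dk.a_assoc)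
  next
   fix X assume "X \<in> carrier DL"
   from one[OF this] obtain k x where k: "k \<in> J" "x \<in> carrier (D k)" "X = cl (k, x)" by blast
   interpret Dk: Module.module R "D k" by (rule D[OF k(1)])
   show "\<zero>\<^bsub>DL\<^esub> \<oplus>\<^bsub>DL\<^esub> X = X" using k by (simp add: Lim_zero[OF k(1)] Lim_add)
   show "\<exists>Y\<in>carrier DL. Y \<oplus>\<^bsub>DL\<^esub> X = \<zero>\<^bsub>DL\<^esub>"
    by (rule bexI[of _ "cl (k, \<ominus>\<^bsub>D k\<^esub> x)"])
     (use k in \<open>simp_all add: Lim_zero[OF k(1)] Lim_add Dk.l_neg cl_closed\<close>)
  qed
 next
  fix a X assume a: "a \<in> carrier R" and X: "X \<in> carrier DL"
  from one[OF X] obtain k x where k: "k \<in> J" "x \<in> carrier (D k)" "X = cl (k, x)" by blast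
  interpret Dk: Module.module R "D k" by (rule D[OF k(1)])
  show "a \<odot>\<^bsub>DL\<^esub> X \<in> carrier DL" using k a by (simp add: Lim_smult cl_closed)
  fix b assume b: "b \<in> carrier R"
  show "(a \<oplus>\<^bsub>R\<^esub> b) \<odot>\<^bsub>DL\<^esub> X = a \<odot>\<^bsub>DL\<^esub> X \<oplus>\<^bsub>DL\<^esub> b \<odot>\<^bsub>DL\<^esub> X"
   using k a b by (simp add: Lim_smult Lim_add Dk.smult_l_distr)
  show "(a \<otimes>\<^bsub>R\<^esub> b) \<odot>\<^bsub>DL\<^esub> X = a \<odot>\<^bsub>DL\<^esub> (b \<odot>\<^bsub>DL\<^esub> X)"
   using k a b by (simp add: Lim_smult Dk.smult_assoc1)
 next
  fix a X Y assume a: "a \<in> carrier R" and X: "X \<in> carrier DL" and Y: "Y \<in> carrier DL"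
  from two[OF X Y] obtain k x y where k: "k \<in> J" "x \<in> carrier (D k)" "y \<in> carrier (D k)" "X = cl (k, x)" "Y = cl (k, y)"
   by blast
  interpret Dk: Module.module R "D k" by (rule D[OF k(1)])
  show "a \<odot>\<^bsub>DL\<^esub> (X \<oplus>\<^bsub>DL\<^esub> Y) = a \<odot>\<^bsub>DL\<^esub> X \<oplus>\<^bsub>DL\<^esub> a \<odot>\<^bsub>DL\<^esub> Y"
   using k a by (simp add: Lim_smult Lim_add Dk.smult_r_distr)
 next
  fix X assume X: "X \<in> carrier DL"
  from one[OF X] obtain k x where k: "k \<in> J" "x \<in> carrier (D k)" "X = cl (k, x)" by blast
  interpret Dk: Module.module R "D k" by (rule D[OF k(1)])
  show "\<one>\<^bsub>R\<^esub> \<odot>\<^bsub>DL\<^esub> X = X" using k by (simp add: Lim_smult)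
 qed
qed

text \<open>The universal property of the direct limit. The map is evaluated at an arbitrarily
  chosen representative; two representatives agree at some later index, and compatibility of the
  \<open>T i\<close> carries this back.\<close>

lemma Lim_lift:
 assumes P: "Module.module R P" and T: "\<And>i. i \<in> J ==> T i \<in> linear_maps R (D i) P"
  and comp: "\<And>i j x. i \<in> J ==> j \<in> J ==> below i j ==> x \<in> carrier (D i) ==> T j (f i j x) = T i x"
 obtains T' where "T' \<in> linear_maps R DL P" "\<And>i x. i \<in> J ==> x \<in> carrier (D i) ==> T' (cl (i, x)) = T i x"
proof -
 define T' where "T' Q = (case SOME p. p \<in> Q of (i, x) => T i x)" for Q
 have T': "T' (cl (i, x)) = T i x" if i: "i \<in> J" "x \<in> carrier (D i)" for i x
 proof -
  obtain j y where p: "(SOME p. p \<in> cl (i, x)) = (j, y)" by (cases "SOME p. p \<in> cl (i, x)")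
  have "(j, y) \<in> cl (i, x)" using someI[of "%p. p \<in> cl (i, x)", OF cl_self[OF i]] p by simp
  note j = cl_mem[OF i this]
  obtain l where l: "l \<in> J" "below j l" "below i l" "f j l y = f i l x"
   using j(3) cl_eq_iff[OF j(1,2) i] by auto
  have "T j y = T i x" using comp[of j l y] comp[of i l x] i j l by simp
  then show ?thesis unfolding T'_def p by simp
 qed
 have "T' \<in> linear_maps R DL P"
 proof (rule linear_mapsI)
  fix X Y assume X: "X \<in> carrier DL" and Y: "Y \<in> carrier DL"
  from X Y obtain i x j y where *: "i \<in> J" "x \<in> carrier (D i)" "X = cl (i, x)"
   "j \<in> J" "y \<in> carrier (D j)" "Y = cl (j, y)"
   unfolding carrier_Lim by blast
  obtain k where k: "k \<in> J" "below i k" "below j k" using directed * by blast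
  interpret Dk: Module.module R "D k" by (rule D[OF k(1)])
  have c: "f i k x \<in> carrier (D k)" "f j k y \<in> carrier (D k)" using f_closed * k by auto
  show "T' (X \<oplus>\<^bsub>DL\<^esub> Y) = T' X \<oplus>\<^bsub>P\<^esub> T' Y"
   using * k c T' comp by (simp add: Lim_add_general[of i x j y k] linear_maps_add[OF T])
 next
  fix r X assume r: "r \<in> carrier R" and X: "X \<in> carrier DL"
  from X obtain i x where *: "i \<in> J" "x \<in> carrier (D i)" "X = cl (i, x)" unfolding carrier_Lim by blast
  interpret Di: Module.module R "D i" by (rule D[OF *(1)])
  show "T' (r \<odot>\<^bsub>DL\<^esub> X) = r \<odot>\<^bsub>P\<^esub> T' X" using * r T' by (simp add: Lim_smult linear_maps_smult[OF T])
 next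
  fix X assume X: "X \<in> carrier DL"
  then show "T' X \<in> carrier P" using T' linear_maps_closed[OF T] unfolding carrier_Lim by auto
 qed
 then show ?thesis using that T' by blast
qed

end

subsection \<open>Extension of scalars\<close>

definition tensor2_gens ::
  "('r, 'c) ring_scheme => ('r, 'm) module => ('r, 'n) module => ('m \<times> 'n => 'r) set" where
 "tensor2_gens R M N = (let F = tensor2_free R M N; \<delta> = basis_vector R in
    ({\<delta> (x \<oplus>\<^bsub>M\<^esub> x', y) \<ominus>\<^bsub>F\<^esub> (\<delta> (x, y) \<oplus>\<^bsub>F\<^esub> \<delta> (x', y)) | x x' y.
      x \<in> carrier M \<and> x' \<in> carrier M \<and> y \<in> carrier N} \<union>
    {\<delta> (x, y \<oplus>\<^bsub>N\<^esub> y') \<ominus>\<^bsub>F\<^esub> (\<delta> (x, y) \<oplus>\<^bsub>F\<^esub> \<delta> (x, y')) | x y y'.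
      x \<in> carrier M \<and> y \<in> carrier N \<and> y' \<in> carrier N} \<union>
    {\<delta> (r \<odot>\<^bsub>M\<^esub> x, y) \<ominus>\<^bsub>F\<^esub> (r \<odot>\<^bsub>F\<^esub> \<delta> (x, y)) | r x y.
      r \<in> carrier R \<and> x \<in> carrier M \<and> y \<in> carrier N} \<union>
    {\<delta> (x, r \<odot>\<^bsub>N\<^esub> y) \<ominus>\<^bsub>F\<^esub> (r \<odot>\<^bsub>F\<^esub> \<delta> (x, y)) | r x y.
      r \<in> carrier R \<and> x \<in> carrier M \<and> y \<in> carrier N}))"

lemma tensor2_relations_gens:
 "tensor2_relations R M N = submodule_generated R (tensor2_free R M N) (tensor2_gens R M N)"
 by (simp add: tensor2_relations_def tensor2_gens_def Let_def)

lemma tensor2_gensE: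
 assumes "s \<in> tensor2_gens R M N"
 obtains (add1) x x' y where "s = basis_vector R (x \<oplus>\<^bsub>M\<^esub> x', y) \<ominus>\<^bsub>tensor2_free R M N\<^esub>
    (basis_vector R (x, y) \<oplus>\<^bsub>tensor2_free R M N\<^esub> basis_vector R (x', y))"
   "x \<in> carrier M" "x' \<in> carrier M" "y \<in> carrier N"
  | (add2) x y y' where "s = basis_vector R (x, y \<oplus>\<^bsub>N\<^esub> y') \<ominus>\<^bsub>tensor2_free R M N\<^esub>
    (basis_vector R (x, y) \<oplus>\<^bsub>tensor2_free R M N\<^esub> basis_vector R (x, y'))"
   "x \<in> carrier M" "y \<in> carrier N" "y' \<in> carrier N"
  | (smult1) r x y where "s = basis_vector R (r \<odot>\<^bsub>M\<^esub> x, y) \<ominus>\<^bsub>tensor2_free R M N\<^esub>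
    (r \<odot>\<^bsub>tensor2_free R M N\<^esub> basis_vector R (x, y))"
   "r \<in> carrier R" "x \<in> carrier M" "y \<in> carrier N"
  | (smult2) r x y where "s = basis_vector R (x, r \<odot>\<^bsub>N\<^esub> y) \<ominus>\<^bsub>tensor2_free R M N\<^esub>
    (r \<odot>\<^bsub>tensor2_free R M N\<^esub> basis_vector R (x, y))"
   "r \<in> carrier R" "x \<in> carrier M" "y \<in> carrier N"
 using assms unfolding tensor2_gens_def Let_def by blast

lemma tensor2_gensI:
 shows "x \<in> carrier M ==> x' \<in> carrier M ==> y \<in> carrier N ==>
   basis_vector R (x \<oplus>\<^bsub>M\<^esub> x', y) \<ominus>\<^bsub>tensor2_free R M N\<^esub>
    (basis_vector R (x, y) \<oplus>\<^bsub>tensor2_free R M N\<^esub> basis_vector R (x', y)) \<in> tensor2_gens R M N"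
  and "x \<in> carrier M ==> y \<in> carrier N ==> y' \<in> carrier N ==>
   basis_vector R (x, y \<oplus>\<^bsub>N\<^esub> y') \<ominus>\<^bsub>tensor2_free R M N\<^esub>
    (basis_vector R (x, y) \<oplus>\<^bsub>tensor2_free R M N\<^esub> basis_vector R (x, y')) \<in> tensor2_gens R M N"
  and "r \<in> carrier R ==> x \<in> carrier M ==> y \<in> carrier N ==>
   basis_vector R (r \<odot>\<^bsub>M\<^esub> x, y) \<ominus>\<^bsub>tensor2_free R M N\<^esub>
    (r \<odot>\<^bsub>tensor2_free R M N\<^esub> basis_vector R (x, y)) \<in> tensor2_gens R M N"
  and "r \<in> carrier R ==> x \<in> carrier M ==> y \<in> carrier N ==>
   basis_vector R (x, r \<odot>\<^bsub>N\<^esub> y) \<ominus>\<^bsub>tensor2_free R M N\<^esub>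
    (r \<odot>\<^bsub>tensor2_free R M N\<^esub> basis_vector R (x, y)) \<in> tensor2_gens R M N"
 unfolding tensor2_gens_def Let_def by blast+

locale tensor2_pair =
 fixes R :: "('r, 'c) ring_scheme" and M :: "('r, 'm) module" and N :: "('r, 'n) module"
 assumes M: "Module.module R M" and N: "Module.module R N"
begin

sublocale M: Module.module R M by (rule M)
sublocale N: Module.module R N by (rule N)

lemma free: "Module.module R (tensor2_free R M N)"
 unfolding tensor2_free_def by (rule free_module_module[OF M.is_cring])

sublocale F: Module.module R "tensor2_free R M N" by (rule free)

lemma basis_closed: "x \<in> carrier M ==> y \<in> carrier N ==> basis_vector R (x, y) \<in> carrier (tensor2_free R M N)"
 unfolding tensor2_free_def by (rule basis_vector_closed[OF M.is_cring]) simp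

lemma gens_closed: "tensor2_gens R M N \<subseteq> carrier (tensor2_free R M N)"
proof
 fix s assume "s \<in> tensor2_gens R M N"
 then show "s \<in> carrier (tensor2_free R M N)"
  by (cases rule: tensor2_gensE) (simp_all add: basis_closed)
qed

lemma relations: "submodule (tensor2_relations R M N) R (tensor2_free R M N)"
 unfolding tensor2_relations_gens by (rule submodule_generated_submodule[OF free gens_closed])

lemma tensor2: "Module.module R (tensor2 R M N)"
 unfolding tensor2_def by (rule quotient_module_module[OF free relations])

sublocale T: Module.module R "tensor2 R M N" by (rule tensor2)

lemma pure_closed: "x \<in> carrier M ==> y \<in> carrier N ==> pure_tensor2 R M N x y \<in> carrier (tensor2 R M N)"
 unfolding pure_tensor2_def tensor2_def quotient_carrier by (auto intro!: imageI basis_closed)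

lemma pure_add1:
 assumes "x \<in> carrier M" "x' \<in> carrier M" "y \<in> carrier N"
 shows "pure_tensor2 R M N (x \<oplus>\<^bsub>M\<^esub> x') y = pure_tensor2 R M N x y \<oplus>\<^bsub>tensor2 R M N\<^esub> pure_tensor2 R M N x' y"
 unfolding pure_tensor2_def tensor2_def using assms
 unfolding tensor2_relations_gens
 by (subst quotient_add[OF free relations[unfolded tensor2_relations_gens]])
  (rule quotient_generated_relation[OF free gens_closed] | simp add: basis_closed tensor2_gensI)+

lemma pure_add2:
 assumes "x \<in> carrier M" "y \<in> carrier N" "y' \<in> carrier N"
 shows "pure_tensor2 R M N x (y \<oplus>\<^bsub>N\<^esub> y') = pure_tensor2 R M N x y \<oplus>\<^bsub>tensor2 R M N\<^esub> pure_tensor2 R M N x y'"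
 unfolding pure_tensor2_def tensor2_def using assms
 unfolding tensor2_relations_gens
 by (subst quotient_add[OF free relations[unfolded tensor2_relations_gens]])
  (rule quotient_generated_relation[OF free gens_closed] | simp add: basis_closed tensor2_gensI)+

lemma pure_smult1:
 assumes "r \<in> carrier R" "x \<in> carrier M" "y \<in> carrier N"
 shows "pure_tensor2 R M N (r \<odot>\<^bsub>M\<^esub> x) y = r \<odot>\<^bsub>tensor2 R M N\<^esub> pure_tensor2 R M N x y"
 unfolding pure_tensor2_def tensor2_def using assms
 unfolding tensor2_relations_gens
 by (subst quotient_smult[OF free relations[unfolded tensor2_relations_gens]])
  (rule quotient_generated_relation[OF free gens_closed] | simp add: basis_closed tensor2_gensI)+

lemma pure_smult2:
 assumes "r \<in> carrier R" "x \<in> carrier M" "y \<in> carrier N"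
 shows "pure_tensor2 R M N x (r \<odot>\<^bsub>N\<^esub> y) = r \<odot>\<^bsub>tensor2 R M N\<^esub> pure_tensor2 R M N x y"
 unfolding pure_tensor2_def tensor2_def using assms
 unfolding tensor2_relations_gens
 by (subst quotient_smult[OF free relations[unfolded tensor2_relations_gens]])
  (rule quotient_generated_relation[OF free gens_closed] | simp add: basis_closed tensor2_gensI)+

lemma pure_zero: "y \<in> carrier N ==> pure_tensor2 R M N \<zero>\<^bsub>M\<^esub> y = \<zero>\<^bsub>tensor2 R M N\<^esub>"
 using pure_smult1[of "\<zero>\<^bsub>R\<^esub>" "\<zero>\<^bsub>M\<^esub>" y] by (simp add: pure_closed)

text \<open>Coefficients can be absorbed into the first factor, so every element is a sum of pure
  tensors and no step for scalar multiples has to be considered.\<close>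

lemma tensor2_induct [consumes 1, case_names pure add]:
 assumes "t \<in> carrier (tensor2 R M N)"
  and pure: "\<And>x y. x \<in> carrier M ==> y \<in> carrier N ==> Q (pure_tensor2 R M N x y)"
  and add: "\<And>s t. s \<in> carrier (tensor2 R M N) ==> t \<in> carrier (tensor2 R M N) ==> Q s ==> Q t ==>
   Q (s \<oplus>\<^bsub>tensor2 R M N\<^esub> t)"
 shows "Q t"
proof -
 let ?p = "%c. tensor2_relations R M N +>\<^bsub>tensor2_free R M N\<^esub> c"
 have p: "?p \<in> linear_maps R (tensor2_free R M N) (tensor2 R M N)"
  unfolding tensor2_def by (rule quotient_projection_linear[OF free relations])
 obtain c where c: "c \<in> carrier (tensor2_free R M N)" "t = ?p c"
  using assms(1) by (auto simp: tensor2_def quotient_carrier)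
 have "Q (?p c)" using M.is_cring c(1)[unfolded tensor2_free_def]
 proof (induction c rule: free_module_induct)
  case zero
  then show ?case using pure[of "\<zero>\<^bsub>M\<^esub>" "\<zero>\<^bsub>N\<^esub>"] linear_maps_zero[OF free tensor2 p]
   by (simp add: pure_zero tensor2_free_def)
 next
  case (add xy r c)
  obtain x y where xy: "xy = (x, y)" "x \<in> carrier M" "y \<in> carrier N" using add.hyps by auto
  note c = add.hyps(3)[folded tensor2_free_def]
  have "?p (r \<odot>\<^bsub>tensor2_free R M N\<^esub> basis_vector R xy \<oplus>\<^bsub>tensor2_free R M N\<^esub> c) =
   pure_tensor2 R M N (r \<odot>\<^bsub>M\<^esub> x) y \<oplus>\<^bsub>tensor2 R M N\<^esub> ?p c"
   using xy c add.hyps(2) by (simp add: linear_maps_add[OF p] linear_maps_smult[OF p] basis_closed pure_smult1)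
    (simp add: pure_tensor2_def)
  moreover have "Q (pure_tensor2 R M N (r \<odot>\<^bsub>M\<^esub> x) y \<oplus>\<^bsub>tensor2 R M N\<^esub> ?p c)"
   using xy c add.hyps(2) add.IH linear_maps_closed[OF p]
   by (intro assms(3) pure pure_closed) (simp_all add: tensor2_free_def)
  ultimately show ?case by (simp add: tensor2_free_def)
 qed
 then show ?thesis using c by simp
qed

end

lemma tensor2_map:
 fixes R :: "('r, 'c) ring_scheme" and M :: "('r, 'm) module" and N :: "('r, 'n) module"
  and M' :: "('r, 'p) module" and N' :: "('r, 'q) module"
 assumes "tensor2_pair R M N" "tensor2_pair R M' N'"
  and f: "f \<in> linear_maps R M M'" and g: "g \<in> linear_maps R N N'"
 shows tensor2_map_linear: "tensor2_map R M' N' f g \<in> linear_maps R (tensor2 R M N) (tensor2 R M' N')"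
  and tensor2_map_pure: "x \<in> carrier M ==> y \<in> carrier N ==>
    tensor2_map R M' N' f g (pure_tensor2 R M N x y) = pure_tensor2 R M' N' (f x) (g y)"
proof -
 interpret A: tensor2_pair R M N by fact
 interpret B: tensor2_pair R M' N' by fact
 let ?Q = "carrier M \<times> carrier N" and ?Q' = "carrier M' \<times> carrier N'"
 note R = A.M.is_cring
 have F: "map_prod f g \<in> ?Q \<rightarrow> ?Q'" using linear_maps_closed[OF f] linear_maps_closed[OF g] by auto
 have lin: "free_map R (map_prod f g) \<in> linear_maps R (tensor2_free R M N) (tensor2_free R M' N')"
  unfolding tensor2_free_def by (rule free_map_linear[OF R F])
 have fb: "free_map R (map_prod f g) (basis_vector R (x, y)) = basis_vector R (f x, g y)" for x y
  by (simp add: free_map_basis_vector[OF R])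
 note [simp] = linear_maps_diff[OF A.free B.free lin] linear_maps_add[OF lin] linear_maps_smult[OF lin]
  fb A.basis_closed linear_maps_closed[OF f] linear_maps_closed[OF g] linear_maps_add[OF f] linear_maps_add[OF g]
  linear_maps_smult[OF f] linear_maps_smult[OF g]
 have rel: "free_map R (map_prod f g) s \<in> tensor2_relations R M' N'" if "s \<in> tensor2_gens R M N" for s
 proof -
  from that have "free_map R (map_prod f g) s \<in> tensor2_gens R M' N'"
   by (cases rule: tensor2_gensE) (simp_all add: tensor2_gensI)
  then show ?thesis unfolding tensor2_relations_gens by (rule subsetD[OF submodule_generated_incl])
 qed
 note q = free_quotient_map[OF R F, of "tensor2_gens R M N" "tensor2_gens R M' N'",
   folded tensor2_free_def, folded tensor2_relations_gens, OF A.gens_closed B.gens_closed rel]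
 show "tensor2_map R M' N' f g \<in> linear_maps R (tensor2 R M N) (tensor2 R M' N')"
  unfolding tensor2_map_def tensor2_def by (rule q(1))
 show "tensor2_map R M' N' f g (pure_tensor2 R M N x y) = pure_tensor2 R M' N' (f x) (g y)"
  if "x \<in> carrier M" "y \<in> carrier N"
  unfolding tensor2_map_def pure_tensor2_def
  by (rule trans[OF q(2)]) (use that in simp_all)
qed

text \<open>The universal property of a free module with an arbitrary module as target, whereas
  \<open>free_map\<close> only leads to free modules. It supplies the functionals that clear
  denominators in the proof that M embeds into its extension of scalars.\<close>

lemma free_lift_linear:
 assumes M: "Module.module R M" and w: "w \<in> Q \<rightarrow> carrier M"
 defines "l \<equiv> %c. \<Oplus>\<^bsub>M\<^esub>x\<in>{x. c x ~= \<zero>\<^bsub>R\<^esub>}. c x \<odot>\<^bsub>M\<^esub> w x"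
 shows "l \<in> linear_maps R (free_module R Q) M" and "x \<in> Q ==> l (basis_vector R x) = w x"
proof -
 interpret M: Module.module R M by fact
 note inR = free_module_coeff_closed[OF M.is_cring, of _ Q]
 have fin: "finite {x. c x ~= \<zero>\<^bsub>R\<^esub>}" "{x. c x ~= \<zero>\<^bsub>R\<^esub>} \<subseteq> Q" if "c \<in> carrier (free_module R Q)" for c
  using that by (auto simp: free_module_def)
 have super: "l c = (\<Oplus>\<^bsub>M\<^esub>x\<in>S. c x \<odot>\<^bsub>M\<^esub> w x)"
  if "finite S" "S \<subseteq> Q" "{x. c x ~= \<zero>\<^bsub>R\<^esub>} \<subseteq> S" "\<And>x. c x \<in> carrier R" for S c
  unfolding l_def
  by (rule M.add.finprod_mono_neutral_cong_left) (use that funcset_mem[OF w] in \<open>auto intro!: M.smult_closed\<close>)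
 show "l \<in> linear_maps R (free_module R Q) M"
 proof (rule linear_mapsI)
  fix c assume c: "c \<in> carrier (free_module R Q)"
  show "l c \<in> carrier M" unfolding l_def
   using fin[OF c] inR[OF c] funcset_mem[OF w] by (intro M.finsum_closed) (auto intro!: M.smult_closed)
 next
  fix c d assume c: "c \<in> carrier (free_module R Q)" and d: "d \<in> carrier (free_module R Q)"
  let ?S = "{x. c x ~= \<zero>\<^bsub>R\<^esub>} \<union> {x. d x ~= \<zero>\<^bsub>R\<^esub>}"
  have S: "finite ?S" "?S \<subseteq> Q" using fin c d by auto
  have w': "w x \<in> carrier M" if "x \<in> ?S" for x using w S that by auto
  have cd: "c \<oplus>\<^bsub>free_module R Q\<^esub> d = (%x. c x \<oplus>\<^bsub>R\<^esub> d x)" by (simp add: free_module_def)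
  have "l (%x. c x \<oplus>\<^bsub>R\<^esub> d x) = (\<Oplus>\<^bsub>M\<^esub>x\<in>?S. (c x \<oplus>\<^bsub>R\<^esub> d x) \<odot>\<^bsub>M\<^esub> w x)"
   by (rule super[OF S]) (use inR[OF c] inR[OF d] in auto)
  also have "\<dots> = (\<Oplus>\<^bsub>M\<^esub>x\<in>?S. c x \<odot>\<^bsub>M\<^esub> w x \<oplus>\<^bsub>M\<^esub> d x \<odot>\<^bsub>M\<^esub> w x)"
   by (rule M.finsum_cong') (use inR[OF c] inR[OF d] w' in \<open>auto simp: M.smult_l_distr\<close>)
  also have "\<dots> = (\<Oplus>\<^bsub>M\<^esub>x\<in>?S. c x \<odot>\<^bsub>M\<^esub> w x) \<oplus>\<^bsub>M\<^esub> (\<Oplus>\<^bsub>M\<^esub>x\<in>?S. d x \<odot>\<^bsub>M\<^esub> w x)"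
   by (rule M.finsum_addf) (use inR[OF c] inR[OF d] w' in auto)
  also have "(\<Oplus>\<^bsub>M\<^esub>x\<in>?S. c x \<odot>\<^bsub>M\<^esub> w x) = l c"
   by (rule super[OF S, symmetric]) (use inR[OF c] in auto)
  also have "(\<Oplus>\<^bsub>M\<^esub>x\<in>?S. d x \<odot>\<^bsub>M\<^esub> w x) = l d"
   by (rule super[OF S, symmetric]) (use inR[OF d] in auto)
  finally show "l (c \<oplus>\<^bsub>free_module R Q\<^esub> d) = l c \<oplus>\<^bsub>M\<^esub> l d" unfolding cd .
 next
  fix r c assume r: "r \<in> carrier R" and c: "c \<in> carrier (free_module R Q)"
  have w': "w x \<in> carrier M" if "c x ~= \<zero>\<^bsub>R\<^esub>" for x using w fin[OF c] that by auto
  have rc: "r \<odot>\<^bsub>free_module R Q\<^esub> c = (%x. r \<otimes>\<^bsub>R\<^esub> c x)" by (simp add: free_module_def)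
  have "l (%x. r \<otimes>\<^bsub>R\<^esub> c x) = (\<Oplus>\<^bsub>M\<^esub>x\<in>{x. c x ~= \<zero>\<^bsub>R\<^esub>}. (r \<otimes>\<^bsub>R\<^esub> c x) \<odot>\<^bsub>M\<^esub> w x)"
   by (rule super[OF fin[OF c]]) (use inR[OF c] r in auto)
  also have "\<dots> = (\<Oplus>\<^bsub>M\<^esub>x\<in>{x. c x ~= \<zero>\<^bsub>R\<^esub>}. r \<odot>\<^bsub>M\<^esub> (c x \<odot>\<^bsub>M\<^esub> w x))"
   by (rule M.finsum_cong') (use inR[OF c] r w' in \<open>auto simp: M.smult_assoc1\<close>)
  also have "\<dots> = r \<odot>\<^bsub>M\<^esub> l c" unfolding l_def
   by (rule M.finsum_smult_ldistr[symmetric]) (use inR[OF c] r w' fin[OF c] in auto)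
  finally show "l (r \<odot>\<^bsub>free_module R Q\<^esub> c) = r \<odot>\<^bsub>M\<^esub> l c" unfolding rc .
 qed
 show "l (basis_vector R x) = w x" if x: "x \<in> Q"
 proof -
  have "l (basis_vector R x) = (\<Oplus>\<^bsub>M\<^esub>y\<in>{x}. basis_vector R x y \<odot>\<^bsub>M\<^esub> w y)"
   by (rule super) (use x in \<open>auto simp: basis_vector_def\<close>)
  moreover have "w x \<in> carrier M" using x w by auto
  ultimately show ?thesis
   using M.finsum_insert[of "{}" x "%y. basis_vector R x y \<odot>\<^bsub>M\<^esub> w y"] by (simp add: basis_vector_def)
 qed
qed

locale fraction_scalars =
 fixes R :: "('r, 'c) ring_scheme" (structure) and \<Phi> :: "('k, 'd) ring_scheme" and e :: "'r => 'k"
 assumes R_domain: "domain R" and frac: "fraction_field_of R \<Phi> e"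
begin

sublocale R: domain R by (rule R_domain)
sublocale \<Phi>: field \<Phi> using frac by (simp add: fraction_field_of_def)
sublocale e: ring_hom_cring R \<Phi> e
 using frac R.is_cring \<Phi>.is_cring by (simp add: fraction_field_of_def ring_hom_cring_def ring_hom_cring_axioms_def)

abbreviation "P \<equiv> restrict_scalars e \<Phi>"
abbreviation "SE \<equiv> scalar_extension R \<Phi> e"

lemma e_inj: "a \<in> carrier R ==> b \<in> carrier R ==> e a = e b ==> a = b"
 using frac by (auto simp: fraction_field_of_def inj_on_def)

lemma P_simps [simp]: "carrier P = carrier \<Phi>" "add P = add \<Phi>" "zero P = zero \<Phi>" "smult P = (%r a. e r \<otimes>\<^bsub>\<Phi>\<^esub> a)"
 by (simp_all add: restrict_scalars_def)

lemma P: "Module.module R P"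
proof (rule moduleI[OF R.is_cring])
 show "abelian_group P"
  by (rule abelian_groupI) (auto simp: \<Phi>.a_ac intro: \<Phi>.l_neg \<Phi>.a_inv_closed)
qed (auto simp: \<Phi>.l_distr \<Phi>.r_distr \<Phi>.m_assoc)

lemma pair: "Module.module R M ==> tensor2_pair R M P"
 by (simp add: tensor2_pair_def P)

lemma P_mult_linear: "c \<in> carrier \<Phi> ==> (%a. c \<otimes>\<^bsub>\<Phi>\<^esub> a) \<in> linear_maps R P P"
 by (rule linear_mapsI) (auto simp: \<Phi>.r_distr \<Phi>.m_lcomm)

lemma SE_simps [simp]:
 "carrier (SE M) = carrier (tensor2 R M P)" "zero (SE M) = zero (tensor2 R M P)" "add (SE M) = add (tensor2 R M P)"
 by (simp_all add: scalar_extension_def Let_def)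

lemma SE_smult: "c \<odot>\<^bsub>SE M\<^esub> t = tensor2_map R M P id (%a. c \<otimes>\<^bsub>\<Phi>\<^esub> a) t"
 by (simp add: scalar_extension_def Let_def)

context
 fixes M :: "('r, 'm) module"
 assumes M: "Module.module R M"
begin

interpretation T: tensor2_pair R M P by (rule pair[OF M])

lemma SE_pure_closed: "x \<in> carrier M ==> a \<in> carrier \<Phi> ==> pure_tensor2 R M P x a \<in> carrier (SE M)"
 using T.pure_closed by simp

lemma SE_smult_linear: "c \<in> carrier \<Phi> ==> (%t. c \<odot>\<^bsub>SE M\<^esub> t) \<in> linear_maps R (tensor2 R M P) (tensor2 R M P)"
 unfolding SE_smult by (rule tensor2_map_linear[OF pair[OF M] pair[OF M] linear_maps_ident(2) P_mult_linear])

lemma SE_smult_pure: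
 "c \<in> carrier \<Phi> ==> x \<in> carrier M ==> a \<in> carrier \<Phi> ==>
   c \<odot>\<^bsub>SE M\<^esub> pure_tensor2 R M P x a = pure_tensor2 R M P x (c \<otimes>\<^bsub>\<Phi>\<^esub> a)"
 unfolding SE_smult
 by (subst tensor2_map_pure[OF pair[OF M] pair[OF M] linear_maps_ident(2) P_mult_linear]) auto

lemma SE_module: "Module.module \<Phi> (SE M)"
proof (rule moduleI[OF \<Phi>.is_cring])
 show "abelian_group (SE M)"
 proof (rule abelian_groupI)
  fix x assume "x \<in> carrier (SE M)"
  then show "\<exists>y\<in>carrier (SE M). y \<oplus>\<^bsub>SE M\<^esub> x = \<zero>\<^bsub>SE M\<^esub>"
   by (intro bexI[of _ "\<ominus>\<^bsub>tensor2 R M P\<^esub> x"]) (auto simp: T.T.l_neg)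
 qed (auto simp: T.T.a_ac)
 fix a assume a: "a \<in> carrier \<Phi>"
 show cl: "a \<odot>\<^bsub>SE M\<^esub> x \<in> carrier (SE M)" if "x \<in> carrier (SE M)" for x
  using linear_maps_closed[OF SE_smult_linear[OF a]] that by simp
 show add: "a \<odot>\<^bsub>SE M\<^esub> (x \<oplus>\<^bsub>SE M\<^esub> y) = a \<odot>\<^bsub>SE M\<^esub> x \<oplus>\<^bsub>SE M\<^esub> a \<odot>\<^bsub>SE M\<^esub> y"
  if "x \<in> carrier (SE M)" "y \<in> carrier (SE M)" for x y
  using linear_maps_add[OF SE_smult_linear[OF a]] that by simp
next
 fix a b x assume a: "a \<in> carrier \<Phi>" and b: "b \<in> carrier \<Phi>" and x: "x \<in> carrier (SE M)"
 have ab: "a \<oplus>\<^bsub>\<Phi>\<^esub> b \<in> carrier \<Phi>" "a \<otimes>\<^bsub>\<Phi>\<^esub> b \<in> carrier \<Phi>" using a b by auto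
 note l = SE_smult_linear[OF a] SE_smult_linear[OF b] SE_smult_linear[OF ab(1)] SE_smult_linear[OF ab(2)]
 note [simp] = l[THEN linear_maps_add] l[THEN linear_maps_closed] SE_smult_pure
 show "(a \<oplus>\<^bsub>\<Phi>\<^esub> b) \<odot>\<^bsub>SE M\<^esub> x = a \<odot>\<^bsub>SE M\<^esub> x \<oplus>\<^bsub>SE M\<^esub> b \<odot>\<^bsub>SE M\<^esub> x"
  using x unfolding SE_simps
 proof (induction x rule: T.tensor2_induct)
  case (pure x y)
  then show ?case using a b T.pure_add2[of x "a \<otimes>\<^bsub>\<Phi>\<^esub> y" "b \<otimes>\<^bsub>\<Phi>\<^esub> y"] by (simp add: \<Phi>.l_distr)
 next
  case (add s t)
  then show ?case using a b by (simp add: T.T.a_ac)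
 qed
 show "(a \<otimes>\<^bsub>\<Phi>\<^esub> b) \<odot>\<^bsub>SE M\<^esub> x = a \<odot>\<^bsub>SE M\<^esub> (b \<odot>\<^bsub>SE M\<^esub> x)"
  using x unfolding SE_simps
 proof (induction x rule: T.tensor2_induct)
  case (pure x y)
  then show ?case using a b by (simp add: \<Phi>.m_assoc)
 next
  case (add s t)
  then show ?case using a b by simp
 qed
next
 fix x assume x: "x \<in> carrier (SE M)"
 note l = SE_smult_linear[OF \<Phi>.one_closed]
 show "\<one>\<^bsub>\<Phi>\<^esub> \<odot>\<^bsub>SE M\<^esub> x = x"
  using x unfolding SE_simps
  by (induction x rule: T.tensor2_induct) (simp_all add: SE_smult_pure linear_maps_add[OF l])
qed

lemma SE_pure_smult:
 "r \<in> carrier R ==> x \<in> carrier M ==> a \<in> carrier \<Phi> ==>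
   pure_tensor2 R M P (r \<odot>\<^bsub>M\<^esub> x) a = e r \<odot>\<^bsub>SE M\<^esub> pure_tensor2 R M P x a"
 using T.pure_smult1[of r x a] T.pure_smult2[of r x a] by (simp add: SE_smult_pure)

lemma SE_pure_finsum:
 "finite A ==> x \<in> A \<rightarrow> carrier M ==> a \<in> carrier \<Phi> ==>
   pure_tensor2 R M P (\<Oplus>\<^bsub>M\<^esub>i\<in>A. x i) a = (\<Oplus>\<^bsub>SE M\<^esub>i\<in>A. pure_tensor2 R M P (x i) a)"
proof (induction A rule: finite_induct)
 interpret S: Module.module \<Phi> "SE M" by (rule SE_module)
 {
  case empty
  then show ?case using T.pure_zero by simp
 next
  case (insert i A)
  have "(%i. pure_tensor2 R M P (x i) a) \<in> A \<rightarrow> carrier (SE M)" "pure_tensor2 R M P (x i) a \<in> carrier (SE M)"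
   using insert.prems T.pure_closed by auto
  then show ?case using insert T.pure_add1[of "x i" "\<Oplus>\<^bsub>M\<^esub>i\<in>A. x i" a]
   by (simp add: S.finsum_insert T.M.finsum_insert T.M.finsum_closed Pi_iff del: SE_simps(1))
 }
qed

lemma SE_pure_nat_mult:
 "x \<in> carrier M ==> a \<in> carrier \<Phi> ==>
  pure_tensor2 R M P ([(n::nat)] \<cdot>\<^bsub>M\<^esub> x) a = ([n] \<cdot>\<^bsub>\<Phi>\<^esub> \<one>\<^bsub>\<Phi>\<^esub>) \<odot>\<^bsub>SE M\<^esub> pure_tensor2 R M P x a"
proof (induction n)
 interpret S: Module.module \<Phi> "SE M" by (rule SE_module)
 {
  case 0
  then show ?case using T.pure_zero S.smult_l_null SE_pure_closed by simp
 next
  case (Suc n)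
  then show ?case using T.pure_add1[of "[n] \<cdot>\<^bsub>M\<^esub> x" x a] SE_pure_closed
    S.smult_l_distr[of "[n] \<cdot>\<^bsub>\<Phi>\<^esub> \<one>\<^bsub>\<Phi>\<^esub>" "\<one>\<^bsub>\<Phi>\<^esub>" "pure_tensor2 R M P x a"] S.smult_one
   by simp
 }
qed

end

text \<open>The map on tensor products is at first only known to be R-linear. It is linear over the
  fraction field because those scalars act on the second factor, which on pure tensors is left
  untouched.\<close>

lemma SE_map:
 fixes M :: "('r, 'm) module" and M' :: "('r, 'n) module"
 assumes M: "Module.module R M" and M': "Module.module R M'" and f: "f \<in> linear_maps R M M'"
 shows SE_map_linear: "tensor2_map R M' P f id \<in> linear_maps \<Phi> (SE M) (SE M')"
  and SE_map_pure: "x \<in> carrier M ==> a \<in> carrier \<Phi> ==>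
   tensor2_map R M' P f id (pure_tensor2 R M P x a) = pure_tensor2 R M' P (f x) a"
proof -
 interpret T: tensor2_pair R M P by (rule pair[OF M])
 interpret T': tensor2_pair R M' P by (rule pair[OF M'])
 define F where "F = tensor2_map R M' P f id"
 have l: "F \<in> linear_maps R (tensor2 R M P) (tensor2 R M' P)"
  unfolding F_def by (rule tensor2_map_linear[OF pair[OF M] pair[OF M'] f linear_maps_ident(2)])
 have p: "F (pure_tensor2 R M P x a) = pure_tensor2 R M' P (f x) a" if "x \<in> carrier M" "a \<in> carrier \<Phi>" for x a
  using tensor2_map_pure[OF pair[OF M] pair[OF M'] f linear_maps_ident(2)] that by (simp add: F_def)
 then show "x \<in> carrier M ==> a \<in> carrier \<Phi> ==> tensor2_map R M' P f id (pure_tensor2 R M P x a) = pure_tensor2 R M' P (f x) a"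
  by (simp only: F_def)
 have "F \<in> linear_maps \<Phi> (SE M) (SE M')"
 proof (rule linear_mapsI)
  fix c x assume c: "c \<in> carrier \<Phi>" and x: "x \<in> carrier (SE M)"
  note lc = SE_smult_linear[OF M c] SE_smult_linear[OF M' c]
  show "F (c \<odot>\<^bsub>SE M\<^esub> x) = c \<odot>\<^bsub>SE M'\<^esub> F x"
   using x unfolding SE_simps
  proof (induction x rule: T.tensor2_induct)
   case (pure x y)
   then show ?case using c linear_maps_closed[OF f] by (simp add: SE_smult_pure[OF M] SE_smult_pure[OF M'] p)
  next
   case (add s t)
   then show ?case
    by (simp add: linear_maps_add[OF l] lc[THEN linear_maps_add] lc[THEN linear_maps_closed] linear_maps_closed[OF l])
  qed
 qed (simp_all add: linear_maps_closed[OF l] linear_maps_add[OF l])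
 then show "tensor2_map R M' P f id \<in> linear_maps \<Phi> (SE M) (SE M')" by (simp only: F_def)
qed

text \<open>Since x \<otimes> a = a (x \<otimes> 1), the elements x \<otimes> 1 span the extension
  over the fraction field. Identities between maps out of M \<otimes> \<Phi> are thus verified on
  elements of M.\<close>

lemma SE_linear_ext:
 fixes M :: "('r, 'm) module"
 assumes M: "Module.module R M" and f: "f \<in> linear_maps \<Phi> (SE M) E" and g: "g \<in> linear_maps \<Phi> (SE M) E"
  and eq: "\<And>x. x \<in> carrier M ==> f (pure_tensor2 R M P x \<one>\<^bsub>\<Phi>\<^esub>) = g (pure_tensor2 R M P x \<one>\<^bsub>\<Phi>\<^esub>)"
  and t: "t \<in> carrier (SE M)"
 shows "f t = g t"
proof -
 interpret T: tensor2_pair R M P by (rule pair[OF M])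
 show ?thesis using t unfolding SE_simps
 proof (induction t rule: T.tensor2_induct)
  case (pure x a)
  have "pure_tensor2 R M P x a = a \<odot>\<^bsub>SE M\<^esub> pure_tensor2 R M P x \<one>\<^bsub>\<Phi>\<^esub>"
   using pure SE_smult_pure[OF M] by simp
  then show ?case using pure eq SE_pure_closed[OF M]
   by (simp add: linear_maps_smult[OF f] linear_maps_smult[OF g])
 next
  case (add s t)
  then show ?case using linear_maps_add[OF f] linear_maps_add[OF g] by simp
 qed
qed

text \<open>Clearing denominators: the elements of the free module which vanish after multiplication with a
 common denominator \<open>s\<close> of their second entries form a submodule containing the relations.\<close>

lemma SE_pure_inj:
 fixes M :: "('r, 'm) module"
 assumes M: "Module.module R M" and tf: "torsion_free R M"
  and x: "x \<in> carrier M" and x0: "pure_tensor2 R M P x \<one>\<^bsub>\<Phi>\<^esub> = \<zero>\<^bsub>SE M\<^esub>"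
 shows "x = \<zero>\<^bsub>M\<^esub>"
proof -
 interpret T: tensor2_pair R M P by (rule pair[OF M])
 let ?F = "tensor2_free R M P"
 \<comment> \<open>\<open>num s a\<close> is the numerator of the fraction a over the denominator s,
   that is, the element r with e r = (e s) a; \<open>good s a\<close> states that s is a denominator
   of a.\<close>
 define num where "num s a = inv_into (carrier R) e (e s \<otimes>\<^bsub>\<Phi>\<^esub> a)" for s a
 define good where "good s a \<longleftrightarrow> e s \<otimes>\<^bsub>\<Phi>\<^esub> a \<in> e ` carrier R" for s a
 have num: "num s a \<in> carrier R" "e (num s a) = e s \<otimes>\<^bsub>\<Phi>\<^esub> a" if "good s a" for s a
  using that unfolding num_def good_def by (auto intro: inv_into_into f_inv_into_f)
 have numI: "good s a \<and> num s a = r" if "r \<in> carrier R" "e r = e s \<otimes>\<^bsub>\<Phi>\<^esub> a" for s a r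
 proof -
  have "good s a" using that unfolding good_def by force
  then show ?thesis using num[of s a] that e_inj by metis
 qed
 \<comment> \<open>The value of s (y \<otimes> a), computed inside M as (s a) y. The default zero is
   a dummy: it is excluded by \<open>ok\<close> below.\<close>
 define w where "w s p = (if good s (snd p) then num s (snd p) \<odot>\<^bsub>M\<^esub> fst p else \<zero>\<^bsub>M\<^esub>)" for s p
 have w: "w s \<in> carrier M \<times> carrier \<Phi> \<rightarrow> carrier M" for s
  using num by (auto simp: w_def)
 define l where "l s c = (\<Oplus>\<^bsub>M\<^esub>x\<in>{x. c x ~= \<zero>}. c x \<odot>\<^bsub>M\<^esub> w s x)" for s c
 have l: "l s \<in> linear_maps R ?F M" and lb: "y \<in> carrier M ==> a \<in> carrier \<Phi> ==> l s (basis_vector R (y, a)) = w s (y, a)" for s y a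
  using free_lift_linear[OF M w[of s]] unfolding l_def[abs_def] tensor2_free_def by auto
 \<comment> \<open>\<open>ok s c\<close> makes s a common denominator of all second entries in the
   support of c. \<open>K\<close> collects the elements that die in M after multiplication with some
   such nonzero s; it is closed under addition because the product of two denominators is again one
   and is nonzero in a domain.\<close>
 define ok where "ok s c \<longleftrightarrow> (\<forall>y a. c (y, a) ~= \<zero> --> good s a)" for s and c :: "'m \<times> 'k => 'r"
 define K where "K = {c \<in> carrier ?F. \<exists>s\<in>carrier R - {\<zero>}. ok s c \<and> l s c = \<zero>\<^bsub>M\<^esub>}"
 have scale_good: "good (t \<otimes> s) a \<and> num (t \<otimes> s) a = t \<otimes> num s a"
  if "good s a" "s \<in> carrier R" "t \<in> carrier R" "a \<in> carrier \<Phi>" for s t a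
  by (rule numI) (use num[OF that(1)] that in \<open>auto simp: \<Phi>.m_assoc\<close>)
 have supp: "y \<in> carrier M \<and> a \<in> carrier \<Phi>" if "c \<in> carrier ?F" "c (y, a) ~= \<zero>" for c y a
  using that by (auto simp: tensor2_free_def free_module_def)
 have scale: "ok (t \<otimes> s) c \<and> l (t \<otimes> s) c = t \<odot>\<^bsub>M\<^esub> l s c"
  if c: "c \<in> carrier ?F" and "ok s c" "s \<in> carrier R" "t \<in> carrier R" for s t c
 proof
  show "ok (t \<otimes> s) c"
   using that scale_good supp[OF c] unfolding ok_def by blast
  have cR: "c p \<in> carrier R" for p by (rule free_module_coeff_closed[OF R.is_cring c[unfolded tensor2_free_def]])
  have fin: "finite {p. c p ~= \<zero>}" using c by (auto simp: tensor2_free_def free_module_def)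
  have wM: "w s p \<in> carrier M" if "c p ~= \<zero>" for p s
   using supp[OF c] that funcset_mem[OF w] by (cases p) auto
  have "w (t \<otimes> s) p = t \<odot>\<^bsub>M\<^esub> w s p" if p: "c p ~= \<zero>" for p
  proof -
   obtain y a where pa: "p = (y, a)" by (cases p)
   have "good s a" using \<open>ok s c\<close> p pa by (auto simp: ok_def)
   then show ?thesis using scale_good[of s a t] supp[OF c, of y a] p pa num[of s a] \<open>s \<in> carrier R\<close> \<open>t \<in> carrier R\<close>
    by (auto simp: w_def T.M.smult_assoc1)
  qed
  then have "l (t \<otimes> s) c = (\<Oplus>\<^bsub>M\<^esub>p\<in>{p. c p ~= \<zero>}. t \<odot>\<^bsub>M\<^esub> (c p \<odot>\<^bsub>M\<^esub> w s p))"
   unfolding l_def using cR wM \<open>t \<in> carrier R\<close>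
   by (intro T.M.finsum_cong') (auto simp: T.M.smult_assoc1[symmetric] R.m_comm)
  also have "\<dots> = t \<odot>\<^bsub>M\<^esub> l s c"
   unfolding l_def using fin cR wM \<open>t \<in> carrier R\<close> by (intro T.M.finsum_smult_ldistr[symmetric]) auto
  finally show "l (t \<otimes> s) c = t \<odot>\<^bsub>M\<^esub> l s c" .
 qed
 have ok_add: "ok s (c \<oplus>\<^bsub>?F\<^esub> d)" if "ok s c" "ok s d" for s c d
  using that R.l_zero by (auto simp: ok_def tensor2_free_def free_module_def)
   (metis R.r_zero R.zero_closed)
 have ok_smult: "ok s (r \<odot>\<^bsub>?F\<^esub> c)" if "ok s c" "r \<in> carrier R" for s c r
  using that by (auto simp: ok_def tensor2_free_def free_module_def) (metis R.r_null)
 have ok_basis: "ok s (basis_vector R (y, a))" if "good s a" for s y a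
  using that by (auto simp: ok_def basis_vector_def)
 have ok_minus: "ok s (\<ominus>\<^bsub>?F\<^esub> c)" if "ok s c" "c \<in> carrier ?F" for s c
 proof -
  have "\<ominus>\<^bsub>?F\<^esub> c = (\<ominus> \<one>) \<odot>\<^bsub>?F\<^esub> c" using that(2) by (simp add: T.F.smult_l_minus)
  then show ?thesis using ok_smult[OF that(1)] by simp
 qed
 have K: "submodule K R ?F"
 proof (rule T.F.submoduleI)
  have "ok \<one> \<zero>\<^bsub>?F\<^esub>" by (simp add: ok_def tensor2_free_def free_module_def)
  then show "\<zero>\<^bsub>?F\<^esub> \<in> K" using linear_maps_zero[OF T.free M l] by (auto simp: K_def)
  show "a \<oplus>\<^bsub>?F\<^esub> b \<in> K" if ab: "a \<in> K" "b \<in> K" for a b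
  proof -
   obtain s t where st: "s \<in> carrier R" "s ~= \<zero>" "ok s a" "l s a = \<zero>\<^bsub>M\<^esub>" "a \<in> carrier ?F"
    "t \<in> carrier R" "t ~= \<zero>" "ok t b" "l t b = \<zero>\<^bsub>M\<^esub>" "b \<in> carrier ?F"
    using ab unfolding K_def by blast
   have "ok (t \<otimes> s) a \<and> l (t \<otimes> s) a = \<zero>\<^bsub>M\<^esub>" using scale[of a s t] st by simp
   moreover have "ok (t \<otimes> s) b \<and> l (t \<otimes> s) b = \<zero>\<^bsub>M\<^esub>" using scale[of b t s] st by (simp add: R.m_comm)
   moreover have "t \<otimes> s ~= \<zero>" using st R.integral by blast
   ultimately show ?thesis using st ok_add by (auto simp: K_def linear_maps_add[OF l] intro!: bexI[of _ "t \<otimes> s"])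
  qed
  show "\<ominus>\<^bsub>?F\<^esub> a \<in> K" if a: "a \<in> K" for a
  proof -
   obtain s where "s \<in> carrier R - {\<zero>}" "ok s a" "l s a = \<zero>\<^bsub>M\<^esub>" "a \<in> carrier ?F"
    using a unfolding K_def by blast
   then show ?thesis by (auto simp: K_def linear_maps_minus[OF T.free M l] ok_minus intro!: bexI[of _ s])
  qed
  show "r \<odot>\<^bsub>?F\<^esub> a \<in> K" if a: "r \<in> carrier R" "a \<in> K" for r a
  proof -
   obtain s where "s \<in> carrier R - {\<zero>}" "ok s a" "l s a = \<zero>\<^bsub>M\<^esub>" "a \<in> carrier ?F"
    using a unfolding K_def by blast
   then show ?thesis using a(1) by (auto simp: K_def linear_maps_smult[OF l] ok_smult intro!: bexI[of _ s])
  qed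
 qed (auto simp: K_def)
 have common: "\<exists>s\<in>carrier R - {\<zero>}. good s a \<and> good s b" if a: "a \<in> carrier \<Phi>" and b: "b \<in> carrier \<Phi>" for a b
 proof -
  have "\<exists>s\<in>carrier R - {\<zero>}. good s a" if a: "a \<in> carrier \<Phi>" for a
  proof -
   obtain r s where rs: "r \<in> carrier R" "s \<in> carrier R - {\<zero>}" "a = e r \<otimes>\<^bsub>\<Phi>\<^esub> inv\<^bsub>\<Phi>\<^esub> (e s)"
    using frac a unfolding fraction_field_of_def by blast
   have es: "e s \<in> carrier \<Phi>" "e s ~= \<zero>\<^bsub>\<Phi>\<^esub>" using rs e_inj[of s "\<zero>"] by auto
   then have u: "e s \<in> Units \<Phi>" using \<Phi>.field_Units by auto
   have "e r = e s \<otimes>\<^bsub>\<Phi>\<^esub> a" using rs es u by (simp add: \<Phi>.m_lcomm)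
   then show ?thesis using numI rs by blast
  qed
  then obtain s t where "s \<in> carrier R - {\<zero>}" "good s a" "t \<in> carrier R - {\<zero>}" "good t b"
   using a b by meson
  then show ?thesis using scale_good[of s a t] scale_good[of t b s] R.integral a b
   by (intro bexI[of _ "t \<otimes> s"]) (auto simp: R.m_comm)
 qed
 have sub_self: "y \<ominus>\<^bsub>M\<^esub> y = \<zero>\<^bsub>M\<^esub>" if "y \<in> carrier M" for y using that by (simp add: a_minus_def T.M.r_neg)
 have "tensor2_gens R M P \<subseteq> K"
 proof
  fix g assume g: "g \<in> tensor2_gens R M P"
  then have gF: "g \<in> carrier ?F" using T.gens_closed by blast
  note [simp] = linear_maps_diff[OF T.free M l] linear_maps_add[OF l] linear_maps_smult[OF l] lb T.basis_closed
  from g show "g \<in> K"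
  proof (cases rule: tensor2_gensE)
   case (add1 y y' a)
   then obtain s where s: "s \<in> carrier R - {\<zero>}" "good s a" using common[of a a] by auto
   have "l s g = \<zero>\<^bsub>M\<^esub>" using add1 s num[OF s(2)] by (simp add: w_def T.M.smult_r_distr sub_self)
   moreover have "ok s g" unfolding add1(1) a_minus_def using s(2) add1 by (intro ok_add ok_minus ok_basis) auto
   ultimately show ?thesis using s gF by (auto simp: K_def)
  next
   case (add2 y a b)
   then obtain s where s: "s \<in> carrier R - {\<zero>}" "good s a" "good s b" using common[of a b] by auto
   have sum: "good s (a \<oplus>\<^bsub>\<Phi>\<^esub> b) \<and> num s (a \<oplus>\<^bsub>\<Phi>\<^esub> b) = num s a \<oplus> num s b"
    by (rule numI) (use s num[OF s(2)] num[OF s(3)] add2 in \<open>auto simp: \<Phi>.r_distr\<close>)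
   have "l s g = \<zero>\<^bsub>M\<^esub>" using add2 s sum num[OF s(2)] num[OF s(3)]
    by (simp add: w_def T.M.smult_l_distr sub_self)
   moreover have "ok s g" unfolding add2(1) a_minus_def using s sum add2 by (intro ok_add ok_minus ok_basis) auto
   ultimately show ?thesis using s gF by (auto simp: K_def)
  next
   case (smult1 r y a)
   then obtain s where s: "s \<in> carrier R - {\<zero>}" "good s a" using common[of a a] by auto
   have "num s a \<odot>\<^bsub>M\<^esub> (r \<odot>\<^bsub>M\<^esub> y) = r \<odot>\<^bsub>M\<^esub> (num s a \<odot>\<^bsub>M\<^esub> y)"
    using smult1 num[OF s(2)] by (simp add: T.M.smult_assoc1[symmetric] R.m_comm)
   then have "l s g = \<zero>\<^bsub>M\<^esub>" using smult1 s num[OF s(2)] by (simp add: w_def sub_self)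
   moreover have "ok s g" unfolding smult1(1) a_minus_def using s(2) smult1
    by (intro ok_add ok_minus ok_basis ok_smult) auto
   ultimately show ?thesis using s gF by (auto simp: K_def)
  next
   case (smult2 r y a)
   then obtain s where s: "s \<in> carrier R - {\<zero>}" "good s a" using common[of a a] by auto
   have sm: "good s (e r \<otimes>\<^bsub>\<Phi>\<^esub> a) \<and> num s (e r \<otimes>\<^bsub>\<Phi>\<^esub> a) = r \<otimes> num s a"
    by (rule numI) (use s num[OF s(2)] smult2 in \<open>auto simp: \<Phi>.m_lcomm\<close>)
   then have "l s g = \<zero>\<^bsub>M\<^esub>" using smult2 s num[OF s(2)]
    by (simp add: w_def sub_self T.M.smult_assoc1)
   moreover have "ok s g" unfolding smult2(1) a_minus_def using s(2) smult2 sm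
    by (intro ok_add ok_minus ok_basis ok_smult) auto
   ultimately show ?thesis using s gF by (auto simp: K_def)
  qed
 qed
 then have rel: "tensor2_relations R M P \<subseteq> K"
  unfolding tensor2_relations_gens by (rule submodule_generated_least[OF K])
 have "tensor2_relations R M P +>\<^bsub>?F\<^esub> basis_vector R (x, \<one>\<^bsub>\<Phi>\<^esub>) = tensor2_relations R M P"
  using x0 unfolding pure_tensor2_def SE_simps tensor2_def quotient_zero .
 \<comment> \<open>A representative of the zero class lies in the relations, hence in
   \<open>K\<close>: some nonzero s satisfies s x = 0, and torsion-freeness applies.\<close>
 then have "basis_vector R (x, \<one>\<^bsub>\<Phi>\<^esub>) \<in> K"
  using quotient_coset_self[OF T.free T.relations T.basis_closed[OF x, of "\<one>\<^bsub>\<Phi>\<^esub>"]] rel by auto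
 then obtain s where s: "s \<in> carrier R" "s ~= \<zero>" "l s (basis_vector R (x, \<one>\<^bsub>\<Phi>\<^esub>)) = \<zero>\<^bsub>M\<^esub>"
  by (auto simp: K_def)
 have "good s \<one>\<^bsub>\<Phi>\<^esub> \<and> num s \<one>\<^bsub>\<Phi>\<^esub> = s" by (rule numI) (use s in auto)
 then have "s \<odot>\<^bsub>M\<^esub> x = \<zero>\<^bsub>M\<^esub>" using s lb[OF x, of "\<one>\<^bsub>\<Phi>\<^esub>" s] by (simp add: w_def)
 then show ?thesis using tf s x by (auto simp: torsion_free_def)
qed

lemma SE_pure_inj_eq:
 fixes M :: "('r, 'm) module"
 assumes M: "Module.module R M" and "torsion_free R M" and xy: "x \<in> carrier M" "y \<in> carrier M"
  and eq: "pure_tensor2 R M P x \<one>\<^bsub>\<Phi>\<^esub> = pure_tensor2 R M P y \<one>\<^bsub>\<Phi>\<^esub>"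
 shows "x = y"
proof -
 interpret T: tensor2_pair R M P by (rule pair[OF M])
 have m: "(%x. pure_tensor2 R M P x \<one>\<^bsub>\<Phi>\<^esub>) \<in> linear_maps R M (tensor2 R M P)"
  by (rule linear_mapsI) (simp_all add: T.pure_closed T.pure_add1 T.pure_smult1)
 have "pure_tensor2 R M P (x \<ominus>\<^bsub>M\<^esub> y) \<one>\<^bsub>\<Phi>\<^esub> = \<zero>\<^bsub>SE M\<^esub>"
  using linear_maps_diff[OF M T.tensor2 m xy] eq xy T.pure_closed[of y "\<one>\<^bsub>\<Phi>\<^esub>"] by (simp add: a_minus_def T.T.r_neg)
 then have "x \<ominus>\<^bsub>M\<^esub> y = \<zero>\<^bsub>M\<^esub>" using SE_pure_inj[OF assms(1,2)] xy by simp
 then have "\<ominus>\<^bsub>M\<^esub> (\<ominus>\<^bsub>M\<^esub> y) = x" using xy by (intro T.M.minus_equality) (simp_all add: a_minus_def)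
 then show ?thesis using xy by simp
qed

end

section \<open>Conjugation, cosets and Haar measures\<close>

text \<open>Two maps on \<open>A\<close> with the same fibres have equally large images. This
  compares coset counts that are written with different groups or different sides.\<close>

lemma card_image_eq_kernel:
 assumes "\<And>u u'. u \<in> A ==> u' \<in> A ==> p u = p u' \<longleftrightarrow> q u = q u'"
 shows "card (p ` A) = card (q ` A)"
proof (rule bij_betw_same_card)
 show "bij_betw (%y. q (inv_into A p y)) (p ` A) (q ` A)"
  unfolding bij_betw_def
 proof
  have *: "q (inv_into A p (p u)) = q u" if "u \<in> A" for u
   using assms[of "inv_into A p (p u)" u] that by (simp add: inv_into_into f_inv_into_f)
  show "inj_on (%y. q (inv_into A p y)) (p ` A)"
   by (rule inj_onI) (use * assms in auto)
  show "(%y. q (inv_into A p y)) ` p ` A = q ` A" using * by (auto simp: image_image)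
 qed
qed

context group
begin

lemma conj_by_closed: "g \<in> carrier G ==> A \<subseteq> carrier G ==> conj_by G g A \<subseteq> carrier G"
 by (auto simp: conj_by_def)

lemma mem_conj_by:
 assumes "g \<in> carrier G" "A \<subseteq> carrier G" "x \<in> carrier G"
 shows "x \<in> conj_by G g A \<longleftrightarrow> inv g \<otimes> x \<otimes> g \<in> A"
proof
 assume "x \<in> conj_by G g A"
 then obtain a where a: "a \<in> A" "x = g \<otimes> a \<otimes> inv g" by (auto simp: conj_by_def)
 have "inv g \<otimes> (g \<otimes> a \<otimes> inv g) \<otimes> g = a" using assms a(1)
  by (smt (verit, ccfv_SIG) in_mono inv_closed l_inv l_one m_assoc m_closed r_one)
 then show "inv g \<otimes> x \<otimes> g \<in> A" using a by simp
next
 assume *: "inv g \<otimes> x \<otimes> g \<in> A"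
 have "g \<otimes> (inv g \<otimes> x \<otimes> g) \<otimes> inv g = x" using assms
  by (smt (verit, ccfv_SIG) inv_closed l_one m_assoc m_closed r_inv r_one)
 then show "x \<in> conj_by G g A" using * unfolding conj_by_def by (metis (no_types, lifting) image_eqI)
qed

lemma conj_by_one: "A \<subseteq> carrier G ==> conj_by G \<one> A = A"
 by (force simp: conj_by_def image_iff)

lemma conj_by_conj_by:
 assumes "g \<in> carrier G" "h \<in> carrier G" "A \<subseteq> carrier G"
 shows "conj_by G g (conj_by G h A) = conj_by G (g \<otimes> h) A"
 unfolding conj_by_def image_image
 by (rule image_cong) (use assms in \<open>auto simp: inv_mult_group m_assoc subset_iff\<close>)

lemma conj_by_mono: "A \<subseteq> B ==> conj_by G g A \<subseteq> conj_by G g B"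
 by (auto simp: conj_by_def)

lemma conj_by_inv_subset:
 assumes "g \<in> carrier G" "A \<subseteq> carrier G" "B \<subseteq> carrier G"
 shows "conj_by G (inv g) A \<subseteq> B \<longleftrightarrow> A \<subseteq> conj_by G g B"
proof
 assume "conj_by G (inv g) A \<subseteq> B"
 from conj_by_mono[OF this, of g] show "A \<subseteq> conj_by G g B"
  using assms by (simp add: conj_by_conj_by conj_by_one)
next
 assume "A \<subseteq> conj_by G g B"
 from conj_by_mono[OF this, of "inv g"] show "conj_by G (inv g) A \<subseteq> B"
  using assms by (simp add: conj_by_conj_by conj_by_one)
qed

lemma conj_by_inv_eq:
 assumes "g \<in> carrier G" "A \<subseteq> carrier G" "B \<subseteq> carrier G"
 shows "conj_by G (inv g) A = B \<longleftrightarrow> A = conj_by G g B"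
 using assms by (auto simp: conj_by_conj_by conj_by_one)

lemma conj_by_Int:
 assumes "g \<in> carrier G" "A \<subseteq> carrier G" "B \<subseteq> carrier G"
 shows "conj_by G g (A \<inter> B) = conj_by G g A \<inter> conj_by G g B"
proof -
 have AB: "A \<inter> B \<subseteq> carrier G" using assms by auto
 show ?thesis
 proof (rule Set.set_eqI)
  fix x
  show "x \<in> conj_by G g (A \<inter> B) \<longleftrightarrow> x \<in> conj_by G g A \<inter> conj_by G g B"
  proof (cases "x \<in> carrier G")
   case True
   then show ?thesis using mem_conj_by[OF assms(1) AB True] mem_conj_by[OF assms(1,2) True] mem_conj_by[OF assms(1,3) True] by simp
  next
   case False
   then show ?thesis
    using conj_by_closed[OF assms(1) AB] conj_by_closed[OF assms(1,2)] conj_by_closed[OF assms(1,3)] by auto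
  qed
 qed
qed

lemma conj_by_self:
 assumes "subgroup A G" "g \<in> A"
 shows "conj_by G g A = A"
proof -
 have A: "A \<subseteq> carrier G" using assms subgroup.subset by blast
 have sub: "conj_by G h A \<subseteq> A" if "h \<in> A" for h
  using that assms(1) by (auto simp: conj_by_def intro!: subgroup.m_closed subgroup.m_inv_closed)
 have "inv g \<in> A" using assms by (simp add: subgroup.m_inv_closed)
 from sub[OF this] have "A \<subseteq> conj_by G g A" using conj_by_inv_subset A assms(2) by blast
 then show ?thesis using sub[OF assms(2)] by auto
qed

lemma conj_by_subgroup:
 assumes "subgroup A G" "g \<in> carrier G"
 shows "subgroup (conj_by G g A) G"
proof -
 have A: "A \<subseteq> carrier G" using assms subgroup.subset by blast
 have e: "g \<otimes> a \<otimes> inv g \<otimes> (g \<otimes> b \<otimes> inv g) = g \<otimes> (a \<otimes> b) \<otimes> inv g" if "a \<in> A" "b \<in> A" for a b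
  using that A assms(2) by (smt (verit, ccfv_SIG) in_mono inv_closed l_inv l_one m_assoc m_closed)
 have i: "inv (g \<otimes> a \<otimes> inv g) = g \<otimes> inv a \<otimes> inv g" if "a \<in> A" for a
  using that A assms(2) by (auto simp: inv_mult_group m_assoc subset_iff)
 show ?thesis
 proof (rule subgroupI)
  show "conj_by G g A ~= {}" using subgroup.one_closed[OF assms(1)] by (auto simp: conj_by_def)
  show "inv a \<in> conj_by G g A" if "a \<in> conj_by G g A" for a
   using that i subgroup.m_inv_closed[OF assms(1)] unfolding conj_by_def by (auto intro!: image_eqI)
  show "a \<otimes> b \<in> conj_by G g A" if "a \<in> conj_by G g A" "b \<in> conj_by G g A" for a b
   using that e subgroup.m_closed[OF assms(1)] unfolding conj_by_def by (auto intro!: image_eqI)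
 qed (rule conj_by_closed[OF assms(2) A])
qed

lemma mem_l_coset:
 assumes "x \<in> carrier G" "A \<subseteq> carrier G" "y \<in> carrier G"
 shows "y \<in> x \<star> A \<longleftrightarrow> inv x \<otimes> y \<in> A"
proof
 assume "y \<in> x \<star> A"
 then show "inv x \<otimes> y \<in> A" using assms by (auto simp: l_coset_def m_assoc[symmetric] subset_iff)
next
 assume "inv x \<otimes> y \<in> A"
 moreover have "y = x \<otimes> (inv x \<otimes> y)" using assms by (simp add: m_assoc[symmetric])
 ultimately show "y \<in> x \<star> A" unfolding l_coset_def by blast
qed

lemma l_coset_self: "subgroup A G ==> x \<in> carrier G ==> x \<in> x \<star> A"
 using mem_l_coset[of x A x] subgroup.subset subgroup.one_closed by fastforce

lemma l_coset_eq_iff: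
 assumes "subgroup A G" "x \<in> carrier G" "y \<in> carrier G"
 shows "x \<star> A = y \<star> A \<longleftrightarrow> inv x \<otimes> y \<in> A"
proof -
 have A: "A \<subseteq> carrier G" using assms subgroup.subset by blast
 show ?thesis
 proof
  assume "x \<star> A = y \<star> A"
  then show "inv x \<otimes> y \<in> A" using mem_l_coset[OF assms(2) A assms(3)] l_coset_self[OF assms(1,3)] by simp
 next
  assume "inv x \<otimes> y \<in> A"
  then have "y \<in> x \<star> A" using mem_l_coset[OF assms(2) A assms(3)] by simp
  then show "x \<star> A = y \<star> A" using l_repr_independence[of y x A] assms by simp
 qed
qed

text \<open>Inversion exchanges left and right cosets. The cohomological axiom is phrased with right
  cosets, while orbits in G/K and Haar measure call for left cosets.\<close>

lemma card_rcosets_eq_lcosets: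
 assumes "subgroup B G" "subgroup A G" "A \<subseteq> B"
 shows "card (rcosets\<^bsub>G\<lparr>carrier := B\<rparr>\<^esub> A) = card ((%u. u \<star> A) ` B)"
proof -
 have B: "B \<subseteq> carrier G" using assms subgroup.subset by blast
 have "rcosets\<^bsub>G\<lparr>carrier := B\<rparr>\<^esub> A = (%u. A #> u) ` B"
  by (auto simp: RCOSETS_def r_coset_def)
 also have "\<dots> = (%u. A #> inv u) ` B"
 proof -
  have "B = (%u. inv u) ` B"
   using B subgroup.m_inv_closed[OF assms(1)] by (force simp: image_iff subset_iff)
  then show ?thesis by (metis (no_types, lifting) image_cong image_image)
 qed
 also have "card \<dots> = card ((%u. u \<star> A) ` B)"
 proof (rule card_image_eq_kernel)
  fix u u' assume u: "u \<in> B" "u' \<in> B"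
  then have c: "u \<in> carrier G" "u' \<in> carrier G" using B by auto
  have A: "A \<subseteq> carrier G" using assms subgroup.subset by blast
  have "A #> inv u = A #> inv u' \<longleftrightarrow> inv u' \<otimes> inv (inv u) \<in> A"
  proof
   assume "A #> inv u = A #> inv u'"
   then have "inv u' \<in> A #> inv u" using rcos_self[of "inv u'" A] c assms by simp
   then show "inv u' \<otimes> inv (inv u) \<in> A" using c A by (auto simp: r_coset_def m_assoc subset_iff)
  next
   assume "inv u' \<otimes> inv (inv u) \<in> A"
   then have "inv u' \<in> A #> inv u" using c A unfolding r_coset_def
    by (auto intro!: bexI[of _ "inv u' \<otimes> u"] simp: m_assoc)
   then show "A #> inv u = A #> inv u'" using repr_independence[of "inv u'" A "inv u"] c assms by simp
  qed
  also have "\<dots> \<longleftrightarrow> u' \<star> A = u \<star> A" using l_coset_eq_iff[OF assms(2), of u' u] c by simp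
  finally show "A #> inv u = A #> inv u' \<longleftrightarrow> u \<star> A = u' \<star> A" by auto
 qed
 finally show ?thesis .
qed

lemma l_coset_partition:
 assumes "subgroup B G" "subgroup A G" "A \<subseteq> B"
 shows "\<Union>((%u. u \<star> A) ` B) = B" "disjoint ((%u. u \<star> A) ` B)"
proof -
 have B: "B \<subseteq> carrier G" using assms subgroup.subset by blast
 have "u \<star> A \<subseteq> B" if "u \<in> B" for u
  using that assms subgroup.m_closed[OF assms(1)] by (auto simp: l_coset_def)
 then show "\<Union>((%u. u \<star> A) ` B) = B" using l_coset_self[OF assms(2)] B by blast
 show "disjoint ((%u. u \<star> A) ` B)"
 proof (rule disjointI)
  fix a b assume ab: "a \<in> (%u. u \<star> A) ` B" "b \<in> (%u. u \<star> A) ` B" "a ~= b"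
  then obtain u u' where u: "a = u \<star> A" "b = u' \<star> A" "u \<in> carrier G" "u' \<in> carrier G" using B by auto
  show "a \<inter> b = {}"
  proof (rule ccontr)
   assume "a \<inter> b ~= {}"
   then obtain y where "y \<in> u \<star> A" "y \<in> u' \<star> A" using u by auto
   then have "u \<star> A = y \<star> A" "u' \<star> A = y \<star> A"
    using l_repr_independence[of y u A] l_repr_independence[of y u' A] u assms by auto
   then show False using ab u by simp
  qed
 qed
qed

end

section \<open>Haar measures on groups with continuous left translations\<close>

locale left_translation_group = group G for G :: "('a, 'b) monoid_scheme" (structure) +
 fixes T :: "'a topology"
 assumes topspace: "topspace T = carrier G"
  and translation: "\<And>u. u \<in> carrier G ==> continuous_map T T (%x. u \<otimes> x)"
begin

lemma open_l_coset:
 assumes "openin T A" "u \<in> carrier G"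
 shows "openin T (u \<star> A)"
proof -
 have A: "A \<subseteq> carrier G" using openin_subset[OF assms(1)] topspace by simp
 have "u \<star> A = {x \<in> topspace T. inv u \<otimes> x \<in> A}"
  using mem_l_coset[OF assms(2) A] l_coset_subset_G[OF A assms(2)] topspace by blast
 then show ?thesis using openin_continuous_map_preimage[OF translation[OF inv_closed[OF assms(2)]] assms(1)] by simp
qed

lemma finite_cosets_of_compact:
 assumes A: "subgroup A G" "openin T A" and C: "compactin T C"
 obtains F where "finite F" "F \<subseteq> carrier G" "C \<subseteq> (\<Union>u\<in>F. u \<star> A)"
proof -
 have CG: "C \<subseteq> carrier G" using compactin_subset_topspace[OF C] topspace by simp
 have "C \<subseteq> \<Union>((%u. u \<star> A) ` C)" using l_coset_self[OF A(1)] CG by blast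
 moreover have "\<And>B. B \<in> (%u. u \<star> A) ` C ==> openin T B" using open_l_coset[OF A(2)] CG by auto
 ultimately obtain \<F> where F: "finite \<F>" "\<F> \<subseteq> (%u. u \<star> A) ` C" "C \<subseteq> \<Union>\<F>"
  using compactinD[OF C, of "(%u. u \<star> A) ` C"] by blast
 then obtain D where "finite D" "D \<subseteq> C" "\<F> = (%u. u \<star> A) ` D" by (meson finite_subset_image)
 then show ?thesis using that[of D] F CG by auto
qed

lemma finite_lcosets:
 assumes A: "subgroup A G" "openin T A" and C: "compactin T C"
 shows "finite ((%u. u \<star> A) ` C)"
proof -
 obtain F where F: "finite F" "F \<subseteq> carrier G" "C \<subseteq> (\<Union>u\<in>F. u \<star> A)"
  using finite_cosets_of_compact[OF assms] by blast
 have CG: "C \<subseteq> carrier G" using compactin_subset_topspace[OF C] topspace by simp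
 have "(%u. u \<star> A) ` C \<subseteq> (%u. u \<star> A) ` F"
 proof
  fix D assume "D \<in> (%u. u \<star> A) ` C"
  then obtain c where c: "c \<in> C" "D = c \<star> A" by auto
  then obtain u where u: "u \<in> F" "c \<in> u \<star> A" using F by auto
  then have "u \<star> A = c \<star> A" using l_repr_independence[of c u A] A F by auto
  then show "D \<in> (%u. u \<star> A) ` F" using c u by auto
 qed
 then show ?thesis using F(1) finite_surj by blast
qed

context
 fixes \<mu>
 assumes haar: "left_haar_measure G T \<mu>"
begin

lemma haar_sets: "openin T A ==> A \<in> sets \<mu>"
 using haar by (auto simp: left_haar_measure_def intro: sigma_sets.Basic)

lemma haar_coset: "u \<in> carrier G ==> A \<in> sets \<mu> ==> emeasure \<mu> (u \<star> A) = emeasure \<mu> A"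
 using haar by (auto simp: left_haar_measure_def)

lemma haar_finite: "compactin T A ==> emeasure \<mu> A < \<infinity>"
 using haar by (auto simp: left_haar_measure_def)

text \<open>\<open>B\<close> is a finite disjoint union of left translates of the open subgroup
  \<open>A\<close>, and each translate has the measure of \<open>A\<close>; finiteness is
  compactness of \<open>B\<close>.\<close>

lemma haar_index_eq:
 assumes A: "compact_open_subgroup G T A" and B: "compact_open_subgroup G T B" and "A \<subseteq> B"
 shows "finite ((%u. u \<star> A) ` B)"
  and "measure \<mu> B = real (card ((%u. u \<star> A) ` B)) * measure \<mu> A"
proof -
 note AB = A[unfolded compact_open_subgroup_def] B[unfolded compact_open_subgroup_def]
 have BG: "B \<subseteq> carrier G" using AB subgroup.subset by blast
 show fin: "finite ((%u. u \<star> A) ` B)" using finite_lcosets AB by blast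
 note p = l_coset_partition[of B A] AB \<open>A \<subseteq> B\<close>
 let ?C = "(%u. u \<star> A) ` B"
 have e: "emeasure \<mu> c = emeasure \<mu> A" if "c \<in> ?C" for c using that haar_coset haar_sets AB BG by auto
 have s: "(%c. c) ` ?C \<subseteq> sets \<mu>" using haar_sets open_l_coset AB BG by auto
 have "disjoint ?C" using p by blast
 then have "disjoint_family_on (%c. c) ?C"
  unfolding disjoint_family_on_def disjoint_def pairwise_def disjnt_def by blast
 then have "emeasure \<mu> (\<Union>c\<in>?C. c) = (\<Sum>c\<in>?C. emeasure \<mu> c)"
  by (rule sum_emeasure[symmetric, OF s _ fin])
 also have "\<dots> = of_nat (card ?C) * emeasure \<mu> A" using e by simp
 finally have "emeasure \<mu> B = of_nat (card ?C) * emeasure \<mu> A" using p by simp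
 then show "measure \<mu> B = real (card ?C) * measure \<mu> A"
  by (simp add: measure_def enn2real_mult)
qed

text \<open>If the open subgroup \<open>A\<close> were null, then every compact set, being covered
  by finitely many translates of \<open>A\<close>, would be null, and inner regularity on the whole
  space would make the total measure zero.\<close>

lemma haar_pos:
 assumes A: "compact_open_subgroup G T A"
 shows "0 < measure \<mu> A"
proof -
 note A' = A[unfolded compact_open_subgroup_def]
 have "emeasure \<mu> A ~= 0"
 proof
  assume z: "emeasure \<mu> A = 0"
  have "emeasure \<mu> C = 0" if C: "compactin T C" for C
  proof -
   obtain F where F: "finite F" "F \<subseteq> carrier G" "C \<subseteq> (\<Union>u\<in>F. u \<star> A)"
    using finite_cosets_of_compact[of A C] A' C by blast
   have s: "(%u. u \<star> A) ` F \<subseteq> sets \<mu>" using haar_sets open_l_coset A' F by auto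
   have "emeasure \<mu> C \<le> emeasure \<mu> (\<Union>u\<in>F. u \<star> A)" using F s by (intro emeasure_mono) auto
   also have "\<dots> \<le> (\<Sum>u\<in>F. emeasure \<mu> (u \<star> A))" by (rule emeasure_subadditive_finite) fact+
   also have "\<dots> = 0" using haar_coset haar_sets A' F z by (intro sum.neutral) auto
   finally show ?thesis by simp
  qed
  then have "(SUP C\<in>{C. compactin T C \<and> C \<subseteq> topspace T}. emeasure \<mu> C) = 0"
   by (intro SUP_eq_const) (auto intro: exI[of _ "{}"])
  moreover have "\<forall>W. openin T W --> emeasure \<mu> W = (SUP C\<in>{C. compactin T C \<and> C \<subseteq> W}. emeasure \<mu> C)"
   using haar unfolding left_haar_measure_def by (elim conjE)
  moreover have "space \<mu> = topspace T"
   using haar unfolding left_haar_measure_def by (elim conjE)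
  moreover have "emeasure \<mu> (space \<mu>) ~= 0"
   using haar unfolding left_haar_measure_def by (elim conjE)
  ultimately show False using openin_topspace[of T] by metis
 qed
 then show ?thesis using haar_finite[of A] A' by (simp add: measure_def enn2real_positive_iff zero_less_iff_neq_zero less_top)
qed

end

text \<open>Uniqueness of Haar measure, in the weak form that ratios of volumes of compact open subgroups
 are determined by indices.\<close>

lemma haar_conj_invariant:
 assumes haar: "left_haar_measure G T \<mu>" and uni: "unimodular G T"
  and A: "compact_open_subgroup G T A" and h: "h \<in> carrier G"
  and B: "compact_open_subgroup G T (conj_by G h A)" "compact_open_subgroup G T (A \<inter> conj_by G h A)"
 shows "measure \<mu> (conj_by G h A) = measure \<mu> A"
proof -
 obtain \<mu>' where \<mu>': "left_haar_measure G T \<mu>'"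
  and r: "\<And>g A. g \<in> carrier G ==> A \<in> sets \<mu>' ==> emeasure \<mu>' (A #> g) = emeasure \<mu>' A"
  using uni by (auto simp: unimodular_def)
 let ?B = "conj_by G h A" and ?C = "A \<inter> conj_by G h A"
 note A' = A[unfolded compact_open_subgroup_def]
 have AG: "A \<subseteq> carrier G" using A' subgroup.subset by blast
 have "?B = (h \<star> A) #> inv h" by (auto simp: conj_by_def l_coset_def r_coset_def)
 moreover have "h \<star> A \<in> sets \<mu>'" using haar_sets[OF \<mu>'] open_l_coset A' h by auto
 ultimately have "emeasure \<mu>' ?B = emeasure \<mu>' A"
  using r h haar_coset[OF \<mu>'] haar_sets[OF \<mu>'] A' by simp
 then have e: "measure \<mu>' ?B = measure \<mu>' A" by (simp add: measure_def)
 \<comment> \<open>Both measures are compared through the intersection C of A with its conjugate. A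
   bi-invariant measure gives A and its conjugate the same volume, so C has the same index in both;
   this statement about indices then applies to the given left Haar measure.\<close>
 note i = haar_index_eq(2)[OF haar B(2) A] haar_index_eq(2)[OF haar B(2) B(1)]
  haar_index_eq(2)[OF \<mu>' B(2) A] haar_index_eq(2)[OF \<mu>' B(2) B(1)]
 have "real (card ((%u. u \<star> ?C) ` ?B)) = real (card ((%u. u \<star> ?C) ` A))"
  using i(3,4) e haar_pos[OF \<mu>' B(2)] by simp
 then show ?thesis using i(1,2) by simp
qed

end

section \<open>RIC functors\<close>

locale ric_on = group G for G :: "('g, 'b) monoid_scheme" (structure) +
 fixes R :: "('r, 'c) ring_scheme" and \<L> :: "'g set set" and M :: "('g, 'r, 'm) ric"
 assumes ric: "ric_functor R G \<L> M" and level: "\<And>K. K \<in> \<L> ==> subgroup K G"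
begin

lemma level_carrier: "K \<in> \<L> ==> K \<subseteq> carrier G"
 using level subgroup.subset by blast

text \<open>The morphism condition g^{-1} L g \<subseteq> K is used in the equivalent form L
  \<subseteq> g K g^{-1}, which composes without inverses and matches the way stabilizers
  appear.\<close>

lemma level_homI: "L \<in> \<L> ==> K \<in> \<L> ==> g \<in> carrier G ==> L \<subseteq> conj_by G g K ==> level_hom G L g K"
 by (simp add: level_hom_def conj_by_inv_subset level_carrier)

lemma obj_module: "K \<in> \<L> ==> Module.module R (obj M K)"
 using ric by (simp add: ric_functor_def)

lemma push_pull_linear:
 assumes "L \<in> \<L>" "K \<in> \<L>" "g \<in> carrier G" "L \<subseteq> conj_by G g K"
 shows "pull M L g K \<in> linear_maps R (obj M K) (obj M L) \<and> push M L g K \<in> linear_maps R (obj M L) (obj M K)"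
proof -
 have "\<forall>L\<in>\<L>. \<forall>K\<in>\<L>. \<forall>g. level_hom G L g K -->
    pull M L g K \<in> linear_maps R (obj M K) (obj M L) \<and>
    push M L g K \<in> linear_maps R (obj M L) (obj M K)"
  using ric unfolding ric_functor_def by (elim conjE)
 then show ?thesis using assms level_homI by blast
qed

lemma push_pull_comp:
 assumes "L' \<in> \<L>" "L \<in> \<L>" "K \<in> \<L>" "h \<in> carrier G" "g \<in> carrier G" "L' \<subseteq> conj_by G h L" "L \<subseteq> conj_by G g K"
 shows "(\<forall>x\<in>carrier (obj M K). pull M L' (h \<otimes> g) K x = pull M L' h L (pull M L g K x)) \<and>
    (\<forall>x\<in>carrier (obj M L'). push M L' (h \<otimes> g) K x = push M L g K (push M L' h L x))"
proof -
 have "\<forall>L'\<in>\<L>. \<forall>L\<in>\<L>. \<forall>K\<in>\<L>. \<forall>h g. level_hom G L' h L \<and> level_hom G L g K -->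
    (\<forall>x\<in>carrier (obj M K). pull M L' (h \<otimes> g) K x = pull M L' h L (pull M L g K x)) \<and>
    (\<forall>x\<in>carrier (obj M L'). push M L' (h \<otimes> g) K x = push M L g K (push M L' h L x))"
  using ric unfolding ric_functor_def by (elim conjE)
 moreover have "level_hom G L' h L" "level_hom G L g K" using assms level_homI by blast+
 ultimately show ?thesis using assms(1-3) by blast
qed

lemma push_linear: "L \<in> \<L> ==> K \<in> \<L> ==> g \<in> carrier G ==> L \<subseteq> conj_by G g K ==>
  push M L g K \<in> linear_maps R (obj M L) (obj M K)"
 and pull_linear: "L \<in> \<L> ==> K \<in> \<L> ==> g \<in> carrier G ==> L \<subseteq> conj_by G g K ==>
  pull M L g K \<in> linear_maps R (obj M K) (obj M L)"
 using push_pull_linear by blast+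

lemma push_comp: "L' \<in> \<L> ==> L \<in> \<L> ==> K \<in> \<L> ==> h \<in> carrier G ==> g \<in> carrier G ==>
  L' \<subseteq> conj_by G h L ==> L \<subseteq> conj_by G g K ==> x \<in> carrier (obj M L') ==>
  push M L g K (push M L' h L x) = push M L' (h \<otimes> g) K x"
 and pull_comp: "L' \<in> \<L> ==> L \<in> \<L> ==> K \<in> \<L> ==> h \<in> carrier G ==> g \<in> carrier G ==>
  L' \<subseteq> conj_by G h L ==> L \<subseteq> conj_by G g K ==> x \<in> carrier (obj M K) ==>
  pull M L' h L (pull M L g K x) = pull M L' (h \<otimes> g) K x"
 using push_pull_comp by metis+

lemma push_one: "K \<in> \<L> ==> x \<in> carrier (obj M K) ==> push M K \<one> K x = x"
 and pull_one: "K \<in> \<L> ==> x \<in> carrier (obj M K) ==> pull M K \<one> K x = x"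
 and push_mem: "K \<in> \<L> ==> \<g> \<in> K ==> x \<in> carrier (obj M K) ==> push M K \<g> K x = x"
 using ric by (simp_all add: ric_functor_def)

lemma pull_eq_push: "L \<in> \<L> ==> K \<in> \<L> ==> g \<in> carrier G ==> L = conj_by G g K ==> x \<in> carrier (obj M K) ==>
  pull M L g K x = push M K (inv g) L x"
proof -
 have "\<forall>L\<in>\<L>. \<forall>K\<in>\<L>. \<forall>g\<in>carrier G. conj_by G (inv g) L = K -->
    (\<forall>x\<in>carrier (obj M K). pull M L g K x = push M K (inv g) L x)"
  using ric unfolding ric_functor_def by (elim conjE)
 moreover
 assume a: "L \<in> \<L>" "K \<in> \<L>" "g \<in> carrier G" "L = conj_by G g K" "x \<in> carrier (obj M K)"
 then have "conj_by G (inv g) L = K" using conj_by_inv_eq level_carrier by metis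
 ultimately show ?thesis using a(1-3,5) by blast
qed

lemma conj_by_inv_level: "L \<in> \<L> ==> K \<in> \<L> ==> g \<in> carrier G ==> L = conj_by G g K ==> K = conj_by G (inv g) L"
 using conj_by_inv_eq level_carrier by metis

lemma push_pull_cancel:
 assumes a: "L \<in> \<L>" "K \<in> \<L>" "g \<in> carrier G" "L = conj_by G g K" "x \<in> carrier (obj M K)"
 shows "push M L g K (pull M L g K x) = x"
proof -
 have "push M L g K (push M K (inv g) L x) = push M K (inv g \<otimes> g) K x"
  using a(4) conj_by_inv_level[OF a(1-4)] by (intro push_comp a inv_closed) simp_all
 then show ?thesis using pull_eq_push[OF a] push_one[OF a(2,5)] a(3) by simp
qed

lemma push_eq_pull:
 assumes a: "L \<in> \<L>" "K \<in> \<L>" "g \<in> carrier G" "L = conj_by G g K" "x \<in> carrier (obj M L)"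
 shows "push M L g K x = pull M K (inv g) L x"
 using pull_eq_push[OF a(2,1) inv_closed[OF a(3)] conj_by_inv_level[OF a(1-4)] a(5)] inv_inv[OF a(3)] by (simp only:)

lemma push_closed: "L \<in> \<L> ==> K \<in> \<L> ==> g \<in> carrier G ==> L \<subseteq> conj_by G g K ==> x \<in> carrier (obj M L) ==>
  push M L g K x \<in> carrier (obj M K)"
 and pull_closed: "L \<in> \<L> ==> K \<in> \<L> ==> g \<in> carrier G ==> L \<subseteq> conj_by G g K ==> x \<in> carrier (obj M K) ==>
  pull M L g K x \<in> carrier (obj M L)"
 using linear_maps_closed[OF push_linear] linear_maps_closed[OF pull_linear] by blast+

end

section \<open>The local identity\<close>

text \<open>A single place, with its index suppressed. Haar measure enters through the properties
  \<open>meas_pos\<close>, \<open>meas_index\<close> and \<open>meas_conj\<close> of volumes of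
  levels, and compactness of the support of the Hecke function through the finite number of cosets
  in \<open>f_fin\<close>.\<close>

locale local_data = fraction_scalars R \<Phi> e
 for R :: "('r, 'c) ring_scheme" and \<Phi> :: "('k, 'd) ring_scheme" and e :: "'r => 'k" +
 fixes \<rho> :: "rat => 'k" and G :: "('a, 'b) monoid_scheme" (structure) and T :: "'a topology" and H K :: "'a set"
  and \<mu> :: "'a measure" and \<L> :: "'a set set" and N :: "('a, 'r, 'n) ric"
  and \<phi> :: 'n and f :: "'a => 'r"
 assumes rho: "\<rho> \<in> ring_hom rat_ring \<Phi>"
  and G_top: "topological_group G T" "Hausdorff_space T"
  and H: "subgroup H G" and K: "compact_open_subgroup G T K"
  and levels_ne: "\<L> ~= {}"
  and levels_sub: "\<And>V. V \<in> \<L> ==> V \<subseteq> H" "\<And>V. V \<in> \<L> ==> subgroup V G"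
  and levels_Int: "\<And>V W. V \<in> \<L> ==> W \<in> \<L> ==> V \<inter> W \<in> \<L>"
  and levels_conj: "\<And>h V. h \<in> H ==> V \<in> \<L> ==> conj_by G h V \<in> \<L>"
  and levels_stab: "\<And>g. g \<in> carrier G ==> H \<inter> conj_by G g K \<in> \<L>"
  and meas_pos: "\<And>V. V \<in> \<L> ==> 0 < measure \<mu> V"
  and index_finite: "\<And>V W. V \<in> \<L> ==> W \<in> \<L> ==> V \<subseteq> W ==> finite ((%u. u \<star> V) ` W)"
  and meas_index: "\<And>V W. V \<in> \<L> ==> W \<in> \<L> ==> V \<subseteq> W ==>
     measure \<mu> W = real (card ((%u. u \<star> V) ` W)) * measure \<mu> V"
  and meas_conj: "\<And>h V. h \<in> H ==> V \<in> \<L> ==> measure \<mu> (conj_by G h V) = measure \<mu> V"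
  and N_ric: "ric_functor R (G\<lparr>carrier := H\<rparr>) \<L> N"
  and N_coh: "cohomological (G\<lparr>carrier := H\<rparr>) \<L> N"
  and N_tf: "\<And>V. V \<in> \<L> ==> torsion_free R (obj N V)"
  and \<phi>: "\<phi> \<in> carrier (obj N (H \<inter> K))"
  and f_closed: "f \<in> carrier G \<rightarrow> carrier R"
  and f_inv: "\<And>g k k'. g \<in> carrier G ==> k \<in> K ==> k' \<in> K ==> f (k \<otimes> g \<otimes> k') = f g"
  and f_fin: "finite ((%g. g \<star> K) ` {g \<in> carrier G. f g ~= \<zero>\<^bsub>R\<^esub>})"
begin

abbreviation "Hm \<equiv> G\<lparr>carrier := H\<rparr>"
abbreviation "U \<equiv> H \<inter> K"

sublocale G: group G using G_top by (simp add: topological_group_def)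

lemma Hm_group: "group Hm"
 using H G.subgroup_imp_group by blast

lemma H_carrier: "h \<in> H ==> h \<in> carrier G" and H_sub: "H \<subseteq> carrier G"
 using subgroup.subset[OF H] by auto

lemma H_closed: "h \<in> H ==> h' \<in> H ==> h \<otimes> h' \<in> H" "h \<in> H ==> inv h \<in> H" "\<one> \<in> H"
 using H by (auto simp: subgroup.m_closed subgroup.m_inv_closed subgroup.one_closed)

lemma K_subgroup: "subgroup K G" using K by (simp add: compact_open_subgroup_def)

lemma K_sub: "K \<subseteq> carrier G" using subgroup.subset[OF K_subgroup] .

lemma K_closed: "k \<in> K ==> k' \<in> K ==> k \<otimes> k' \<in> K" "k \<in> K ==> inv k \<in> K" "\<one> \<in> K"
 using K_subgroup by (auto simp: subgroup.m_closed subgroup.m_inv_closed subgroup.one_closed)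

lemma K_carrier: "k \<in> K ==> k \<in> carrier G" using K_sub by auto

lemma conj_by_Hm: "h \<in> H ==> conj_by Hm h A = conj_by G h A"
 by (simp add: conj_by_def G.m_inv_consistent[OF H])

lemma level_carrier: "V \<in> \<L> ==> V \<subseteq> carrier G"
 using levels_sub H_sub by blast

sublocale N: ric_on Hm R \<L> N
proof (rule ric_on.intro[OF Hm_group ric_on_axioms.intro[OF N_ric]])
 fix V assume "V \<in> \<L>"
 then show "subgroup V Hm"
  using levels_sub[of V] H G.subgroup_incl by blast
qed

lemmas N_module = N.obj_module

lemma push_linear: "V \<in> \<L> ==> W \<in> \<L> ==> h \<in> H ==> V \<subseteq> conj_by G h W ==> push N V h W \<in> linear_maps R (obj N V) (obj N W)"
 and pull_linear: "V \<in> \<L> ==> W \<in> \<L> ==> h \<in> H ==> V \<subseteq> conj_by G h W ==> pull N V h W \<in> linear_maps R (obj N W) (obj N V)"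
 and push_closed: "V \<in> \<L> ==> W \<in> \<L> ==> h \<in> H ==> V \<subseteq> conj_by G h W ==> x \<in> carrier (obj N V) ==>
  push N V h W x \<in> carrier (obj N W)"
 and pull_closed: "V \<in> \<L> ==> W \<in> \<L> ==> h \<in> H ==> V \<subseteq> conj_by G h W ==> x \<in> carrier (obj N W) ==>
  pull N V h W x \<in> carrier (obj N V)"
 using N.push_linear[of V W h] N.pull_linear[of V W h] N.push_closed[of V W h x] N.pull_closed[of V W h x]
 by (simp_all add: conj_by_Hm)

lemma push_comp: "V \<in> \<L> ==> W \<in> \<L> ==> X \<in> \<L> ==> h \<in> H ==> h' \<in> H ==> V \<subseteq> conj_by G h W ==> W \<subseteq> conj_by G h' X ==>
  x \<in> carrier (obj N V) ==> push N W h' X (push N V h W x) = push N V (h \<otimes> h') X x"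
 using N.push_comp[of V W X h h' x] by (simp add: conj_by_Hm)

lemma pull_comp: "V \<in> \<L> ==> W \<in> \<L> ==> X \<in> \<L> ==> h \<in> H ==> h' \<in> H ==> V \<subseteq> conj_by G h W ==> W \<subseteq> conj_by G h' X ==>
  x \<in> carrier (obj N X) ==> pull N V h W (pull N W h' X x) = pull N V (h \<otimes> h') X x"
 using N.pull_comp[of V W X h h' x] by (simp add: conj_by_Hm)

lemma push_pull_cancel: "V \<in> \<L> ==> h \<in> H ==> x \<in> carrier (obj N V) ==>
  push N (conj_by G h V) h V (pull N (conj_by G h V) h V x) = x"
proof -
 assume h: "h \<in> H" and V: "V \<in> \<L>" and x: "x \<in> carrier (obj N V)"
 show ?thesis
  by (rule N.push_pull_cancel[OF levels_conj[OF h V] V _ conj_by_Hm[OF h, symmetric] x]) (simp add: h)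
qed

lemma push_one: "V \<in> \<L> ==> x \<in> carrier (obj N V) ==> push N V \<one> V x = x"
 and pull_one: "V \<in> \<L> ==> x \<in> carrier (obj N V) ==> pull N V \<one> V x = x"
 and push_mem: "V \<in> \<L> ==> \<g> \<in> V ==> x \<in> carrier (obj N V) ==> push N V \<g> V x = x"
 using N.push_one[of V x] N.pull_one[of V x] N.push_mem[of V \<g> x] by simp_all

text \<open>The axioms state the triviality of elements of V only for covariant maps. An element of
  V normalizes V, so its covariant and contravariant maps are inverse to each other, and the latter
  is trivial too.\<close>

lemma pull_mem:
 assumes V: "V \<in> \<L>" "\<g> \<in> V" "x \<in> carrier (obj N V)"
 shows "pull N V \<g> V x = x"
proof -
 have g: "\<g> \<in> H" using V levels_sub(1) by blast
 have c: "conj_by G \<g> V = V" using G.conj_by_self levels_sub(2) V by blast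
 have p: "pull N V \<g> V x \<in> carrier (obj N V)" by (rule pull_closed[OF V(1) V(1) g _ V(3)]) (simp only: c)
 have "push N V \<g> V (pull N V \<g> V x) = x" using push_pull_cancel[OF V(1) g V(3)] unfolding c .
 then show ?thesis by (rule trans[OF push_mem[OF V(1,2) p, symmetric]])
qed

lemma sub_conj_one: "W \<in> \<L> ==> V \<subseteq> W ==> V \<subseteq> conj_by G \<one> W"
 using level_carrier G.conj_by_one by simp

subsection \<open>Stabilizers\<close>

text \<open>The stabilizer in H of the point gK of G/K. All traces are collected in N(S g), the
  deepest common target for the H-orbit of gK.\<close>

definition "S g = H \<inter> conj_by G g K"

lemma S_level: "g \<in> carrier G ==> S g \<in> \<L>"
 unfolding S_def by (rule levels_stab)

lemma U_level: "U \<in> \<L>"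
 using levels_stab[of "\<one>"] G.conj_by_one[OF K_sub] by simp

lemma mem_S: "g \<in> carrier G ==> h \<in> H ==> h \<in> S g \<longleftrightarrow> inv g \<otimes> h \<otimes> g \<in> K"
 using G.mem_conj_by[OF _ K_sub, of g h] H_carrier[of h] by (simp add: S_def)

lemma S_H: "s \<in> S g ==> s \<in> H" by (simp add: S_def)

lemma S_mult: "h \<in> H ==> g \<in> carrier G ==> S (h \<otimes> g) = conj_by G h (S g)"
proof -
 assume h: "h \<in> H" and g: "g \<in> carrier G"
 have hG: "h \<in> carrier G" using h by (rule H_carrier)
 show ?thesis
  unfolding S_def
  using G.conj_by_Int[OF hG H_sub G.conj_by_closed[OF g K_sub]] G.conj_by_self[OF H h]
   G.conj_by_conj_by[OF hG g K_sub] by simp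
qed

lemma S_K: "k \<in> K ==> g \<in> carrier G ==> S (g \<otimes> k) = S g"
 unfolding S_def using G.conj_by_conj_by[OF _ K_carrier K_sub, of g k] G.conj_by_self[OF K_subgroup, of k] by simp

text \<open>The orbit-stabilizer correspondence: h S_g \<mapsto> hgK identifies H/S_g with the
  H-orbit of gK in G/K.\<close>

lemma coset_S_iff:
 assumes "h \<in> H" "h' \<in> H" "g \<in> carrier G"
 shows "h \<star> S g = h' \<star> S g \<longleftrightarrow> (h \<otimes> g) \<star> K = (h' \<otimes> g) \<star> K"
proof -
 note c = H_carrier[OF assms(1)] H_carrier[OF assms(2)] assms(3)
 have "h \<star> S g = h' \<star> S g \<longleftrightarrow> inv h \<otimes> h' \<in> S g"
  by (rule G.l_coset_eq_iff[OF levels_sub(2)[OF S_level[OF assms(3)]] c(1,2)])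
 also have "\<dots> \<longleftrightarrow> inv g \<otimes> (inv h \<otimes> h') \<otimes> g \<in> K"
  using assms H_closed by (intro mem_S) auto
 also have "inv g \<otimes> (inv h \<otimes> h') \<otimes> g = inv (h \<otimes> g) \<otimes> (h' \<otimes> g)"
  using c by (simp add: G.inv_mult_group G.m_assoc)
 also have "\<dots> \<in> K \<longleftrightarrow> (h \<otimes> g) \<star> K = (h' \<otimes> g) \<star> K"
  using G.l_coset_eq_iff[OF K_subgroup, of "h \<otimes> g" "h' \<otimes> g"] c by simp
 finally show ?thesis .
qed

subsection \<open>Generalized indices\<close>

abbreviation "ix \<equiv> haar_index \<mu>"

text \<open>Both volumes are integer multiples of the volume of the level V \<inter> W. Their ratio
  is therefore rational, and the definite description in \<open>haar_index\<close> denotes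
  it.\<close>

lemma haar_index_real:
 assumes V: "V \<in> \<L>" and W: "W \<in> \<L>"
 shows "of_rat (ix V W) = measure \<mu> V / measure \<mu> W"
proof -
 let ?X = "V \<inter> W"
 have X: "?X \<in> \<L>" using levels_Int V W .
 obtain a b :: nat where "measure \<mu> V = real a * measure \<mu> ?X" "measure \<mu> W = real b * measure \<mu> ?X"
  using meas_index[OF X V Int_lower1] meas_index[OF X W Int_lower2] that by blast
 then have q: "of_rat (of_nat a / of_nat b) = measure \<mu> V / measure \<mu> W"
  using meas_pos[OF X] by (cases "b = 0") (simp_all add: of_rat_divide field_simps)
 have "ix V W = of_nat a / of_nat b" unfolding haar_index_def
 proof (rule the_equality)
  fix r assume "of_rat r = measure \<mu> V / measure \<mu> W"
  then show "r = of_nat a / of_nat b" unfolding q[symmetric] by (simp only: of_rat_eq_iff)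
 qed (rule q)
 then show ?thesis using q by simp
qed

lemma haar_index_inverse: "V \<in> \<L> ==> W \<in> \<L> ==> ix V W * ix W V = 1"
proof -
 assume V: "V \<in> \<L>" and W: "W \<in> \<L>"
 have "(of_rat (ix V W * ix W V) :: real) = of_rat 1"
  using meas_pos[OF V] meas_pos[OF W] by (simp add: of_rat_mult haar_index_real V W)
 then show ?thesis by (simp only: of_rat_eq_iff)
qed

lemma haar_index_card:
 assumes "V \<in> \<L>" "W \<in> \<L>" "X \<in> \<L>" "V \<subseteq> W"
 shows "ix W X = of_nat (card ((%u. u \<star> V) ` W)) * ix V X"
proof -
 have "(of_rat (ix W X) :: real) = of_rat (of_nat (card ((%u. u \<star> V) ` W)) * ix V X)"
  using meas_index[OF assms(1,2,4)] by (simp add: of_rat_mult haar_index_real assms(1-3))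
 then show ?thesis by (simp only: of_rat_eq_iff)
qed

lemma haar_index_conj: "h \<in> H ==> V \<in> \<L> ==> ix (conj_by G h V) W = ix V W"
 by (simp add: haar_index_def meas_conj)

lemma rho_closed: "\<rho> q \<in> carrier \<Phi>"
 using ring_hom_closed[OF rho] by (simp add: rat_ring_def)

lemma rho_mult: "\<rho> (a * b) = \<rho> a \<otimes>\<^bsub>\<Phi>\<^esub> \<rho> b"
 using ring_hom_mult[OF rho, of a b] by (simp add: rat_ring_def)

lemma rho_one: "\<rho> 1 = \<one>\<^bsub>\<Phi>\<^esub>"
 using ring_hom_one[OF rho] by (simp add: rat_ring_def)

lemma rho_add: "\<rho> (a + b) = \<rho> a \<oplus>\<^bsub>\<Phi>\<^esub> \<rho> b"
 using ring_hom_add[OF rho, of a b] by (simp add: rat_ring_def)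

lemma rho_of_nat: "\<rho> (of_nat n) = [n] \<cdot>\<^bsub>\<Phi>\<^esub> \<one>\<^bsub>\<Phi>\<^esub>"
proof (induction n)
 case 0
 have "\<rho> 0 \<oplus>\<^bsub>\<Phi>\<^esub> \<rho> 0 = \<rho> 0" using rho_add[of 0 0] by simp
 then show ?case using rho_closed[of 0] \<Phi>.add.l_cancel_one by simp
next
 case (Suc n)
 then show ?case by (simp add: rho_add rho_one \<Phi>.a_comm)
qed

lemma push_pull_index:
 assumes "V \<in> \<L>" "W \<in> \<L>" "V \<subseteq> W" "x \<in> carrier (obj N W)"
 shows "push N V \<one> W (pull N V \<one> W x) = [card ((%u. u \<star> V) ` W)] \<cdot>\<^bsub>obj N W\<^esub> x"
proof -
 have "card (rcosets\<^bsub>Hm\<lparr>carrier := W\<rparr>\<^esub> V) = card ((%u. u \<star> V) ` W)"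
  using G.card_rcosets_eq_lcosets[of W V] levels_sub(2) assms by simp
 then show ?thesis using N_coh assms by (simp add: cohomological_def)
qed

subsection \<open>The colimit and its traces\<close>

abbreviation "DV V \<equiv> scalar_extension R \<Phi> e (obj N V)"
abbreviation "res V V' \<equiv> tensor2_map R (obj N V') (restrict_scalars e \<Phi>) (pull N V' \<one>\<^bsub>G\<lparr>carrier := H\<rparr>\<^esub> V) id"
abbreviation "pt V x \<equiv> pure_tensor2 R (obj N V) (restrict_scalars e \<Phi>) x \<one>\<^bsub>\<Phi>\<^esub>"
abbreviation "E \<equiv> colimit_module R \<Phi> e (G\<lparr>carrier := H\<rparr>) \<L> N"
abbreviation "j \<equiv> colimit_map R \<Phi> e (G\<lparr>carrier := H\<rparr>) \<L> N"
abbreviation "act \<equiv> colimit_action R \<Phi> e (G\<lparr>carrier := H\<rparr>) \<L> N"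

lemma pt_closed: "V \<in> \<L> ==> x \<in> carrier (obj N V) ==> pt V x \<in> carrier (DV V)"
 by (rule SE_pure_closed[OF N_module]) auto

lemma DV_module: "V \<in> \<L> ==> Module.module \<Phi> (DV V)"
 by (rule SE_module[OF N_module])

lemma restriction_linear:
 "V \<in> \<L> ==> V' \<in> \<L> ==> V' \<subseteq> V ==> pull N V' \<one>\<^bsub>Hm\<^esub> V \<in> linear_maps R (obj N V) (obj N V')"
 using pull_linear[OF _ _ H_closed(3) sub_conj_one, of V' V] by simp

lemma restriction_closed:
 "V \<in> \<L> ==> V' \<in> \<L> ==> V' \<subseteq> V ==> x \<in> carrier (obj N V) ==> pull N V' \<one> V x \<in> carrier (obj N V')"
 using linear_maps_closed[OF restriction_linear[of V V'], of x] by simp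

lemma res_linear: "V \<in> \<L> ==> V' \<in> \<L> ==> V' \<subseteq> V ==> res V V' \<in> linear_maps \<Phi> (DV V) (DV V')"
 by (rule SE_map_linear[OF N_module N_module restriction_linear])

lemma res_pt: "V \<in> \<L> ==> V' \<in> \<L> ==> V' \<subseteq> V ==> x \<in> carrier (obj N V) ==> res V V' (pt V x) = pt V' (pull N V' \<one> V x)"
 by (subst SE_map_pure[OF N_module N_module restriction_linear]) simp_all

sublocale E: directed_system \<Phi> \<L> "(\<supseteq>)" DV res
proof (rule directed_system.intro)
 show "cring \<Phi>" by (rule \<Phi>.is_cring)
 show "\<L> ~= {}" by (rule levels_ne)
 show "\<exists>k\<in>\<L>. k \<subseteq> i \<and> k \<subseteq> j" if "i \<in> \<L>" "j \<in> \<L>" for i j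
  using levels_Int[OF that] by blast
 show "Module.module \<Phi> (DV i)" if "i \<in> \<L>" for i using DV_module[OF that] .
 show "res i j \<in> linear_maps \<Phi> (DV i) (DV j)" if "i \<in> \<L>" "j \<in> \<L>" "j \<subseteq> i" for i j using res_linear[OF that] .
 show "res i i t = t" if "i \<in> \<L>" "t \<in> carrier (DV i)" for i t
  by (rule SE_linear_ext[OF N_module[OF that(1)] res_linear[OF that(1) that(1) order_refl] linear_maps_ident(1) _ that(2)])
   (use that in \<open>simp only: res_pt pull_one order_refl\<close>)
 show "res j k (res i j t) = res i k t"
  if "i \<in> \<L>" "j \<in> \<L>" "k \<in> \<L>" "j \<subseteq> i" "k \<subseteq> j" "t \<in> carrier (DV i)" for i j k t
 proof -
  have ki: "k \<subseteq> i" using that by blast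
  show ?thesis
  proof (rule SE_linear_ext[OF N_module[OF that(1)] linear_maps_compose[OF res_linear[OF that(1,2,4)] res_linear[OF that(2,3,5)]]
    res_linear[OF that(1,3) ki] _ that(6)])
   fix x assume x: "x \<in> carrier (obj N i)"
   have "pull N j \<one> i x \<in> carrier (obj N j)"
    using that x by (intro restriction_closed)
   moreover have "pull N k \<one> j (pull N j \<one> i x) = pull N k \<one> i x"
    using pull_comp[of k j i "\<one>" "\<one>" x] that x by (simp add: sub_conj_one H_closed)
   ultimately show "res j k (res i j (pt i x)) = res i k (pt i x)"
    using that x ki by (simp only: res_pt)
  qed
 qed
qed auto

lemma E_eq: "E.DL = E" by (simp add: colimit_module_def)

lemma j_eq: "j V x = E.cl (V, pt V x)" by (simp add: colimit_map_def colimit_class_def)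

lemma E_module: "Module.module \<Phi> E"
 using E.Lim_module unfolding E_eq .

lemma E_carrier: "carrier E = {E.cl (V, t) | V t. V \<in> \<L> \<and> t \<in> carrier (DV V)}"
 using E.carrier_Lim unfolding E_eq .

lemma j_closed: "V \<in> \<L> ==> x \<in> carrier (obj N V) ==> j V x \<in> carrier E"
 unfolding j_eq E_eq[symmetric] by (rule E.cl_closed[OF _ pt_closed])

lemma E_ext:
 assumes "Module.module \<Phi> Q" "p \<in> linear_maps \<Phi> E Q" "q \<in> linear_maps \<Phi> E Q"
  and "\<And>V x. V \<in> \<L> ==> x \<in> carrier (obj N V) ==> p (j V x) = q (j V x)" "X \<in> carrier E"
 shows "p X = q X"
proof -
 obtain V t where V: "V \<in> \<L>" "t \<in> carrier (DV V)" "X = E.cl (V, t)"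
  using assms(5) unfolding E_carrier by blast
 have cl: "(%t. E.cl (V, t)) \<in> linear_maps \<Phi> (DV V) E"
  unfolding E_eq[symmetric]
  by (rule linear_mapsI) (simp_all only: E.Lim_add[OF V(1)] E.Lim_smult[OF _ V(1)] E.cl_closed[OF V(1)])
 show ?thesis unfolding V(3)
  by (rule SE_linear_ext[OF N_module[OF V(1)] linear_maps_compose[OF cl assms(2)] linear_maps_compose[OF cl assms(3)] _ V(2)])
   (use assms(4)[OF V(1)] in \<open>simp add: j_eq\<close>)
qed

text \<open>Combines the universal properties of the direct limit and of extension of scalars:
  compatibility with restriction is only asked on elements x \<otimes> 1.\<close>

lemma E_lift:
 assumes P: "Module.module \<Phi> Q" and T: "\<And>V. V \<in> \<L> ==> t V \<in> linear_maps \<Phi> (DV V) Q"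
  and comp: "\<And>V V' x. V \<in> \<L> ==> V' \<in> \<L> ==> V' \<subseteq> V ==> x \<in> carrier (obj N V) ==>
    t V' (pt V' (pull N V' \<one> V x)) = t V (pt V x)"
 obtains t' where "t' \<in> linear_maps \<Phi> E Q" "\<And>V x. V \<in> \<L> ==> x \<in> carrier (DV V) ==> t' (E.cl (V, x)) = t V x"
proof -
 have c: "t V' (res V V' x) = t V x" if "V \<in> \<L>" "V' \<in> \<L>" "V' \<subseteq> V" "x \<in> carrier (DV V)" for V V' x
  by (rule SE_linear_ext[OF N_module[OF that(1)] linear_maps_compose[OF res_linear[OF that(1-3)] T[OF that(2)]] T[OF that(1)] _ that(4)])
   (use comp that in \<open>simp only: res_pt\<close>)
 show ?thesis
  using E.Lim_lift[of Q t thesis, OF P T c, unfolded E_eq] that by blast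
qed

text \<open>The action of h is given as a union over all representatives of a class. The lifting
  property first yields a linear map \<open>t\<close> with the expected value at every
  representative; since \<open>t\<close> depends on the class only, the union collapses to its
  value.\<close>

lemma act:
 assumes h: "h \<in> H"
 shows act_linear: "act h \<in> linear_maps \<Phi> E E"
  and act_j: "V \<in> \<L> ==> x \<in> carrier (obj N V) ==> act h (j V x) = j (conj_by G h V) (pull N (conj_by G h V) h V x)"
proof -
 define a where "a V = tensor2_map R (obj N (conj_by G h V)) (restrict_scalars e \<Phi>) (pull N (conj_by G h V) h V) id" for V
 note hG = H_carrier[OF h]
 have pl: "pull N (conj_by G h V) h V \<in> linear_maps R (obj N V) (obj N (conj_by G h V))" if "V \<in> \<L>" for V
  using that h levels_conj by (intro pull_linear) auto
 have a: "a V \<in> linear_maps \<Phi> (DV V) (DV (conj_by G h V))" if "V \<in> \<L>" for V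
  unfolding a_def using that levels_conj[OF h] by (intro SE_map_linear N_module pl) auto
 have a_pt: "a V (pt V x) = pt (conj_by G h V) (pull N (conj_by G h V) h V x)" if "V \<in> \<L>" "x \<in> carrier (obj N V)" for V x
  unfolding a_def using that levels_conj[OF h] by (intro SE_map_pure N_module pl) auto
 have cl: "(%t. E.cl (conj_by G h V, a V t)) \<in> linear_maps \<Phi> (DV V) E" if V: "V \<in> \<L>" for V
 proof -
  note V' = levels_conj[OF h V]
  have "(%t. E.cl (conj_by G h V, t)) \<in> linear_maps \<Phi> (DV (conj_by G h V)) E"
   unfolding E_eq[symmetric]
   by (rule linear_mapsI) (simp_all only: E.Lim_add[OF V'] E.Lim_smult[OF _ V'] E.cl_closed[OF V'])
  then show ?thesis by (rule linear_maps_compose[OF a[OF V]])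
 qed
 obtain t where t: "t \<in> linear_maps \<Phi> E E"
  "\<And>V x. V \<in> \<L> ==> x \<in> carrier (DV V) ==> t (E.cl (V, x)) = E.cl (conj_by G h V, a V x)"
 proof (rule E_lift[OF E_module cl])
  fix V V' x assume V: "V \<in> \<L>" "V' \<in> \<L>" "V' \<subseteq> V" and x: "x \<in> carrier (obj N V)"
  let ?W = "conj_by G h V" and ?W' = "conj_by G h V'"
  note W = levels_conj[OF h V(1)] levels_conj[OF h V(2)]
  have WW: "?W' \<subseteq> ?W" using V G.conj_by_mono by blast
  have p: "pull N V' \<one> V x \<in> carrier (obj N V')" using V x by (intro restriction_closed)
  have "pull N ?W' h V' (pull N V' \<one> V x) = pull N ?W' (h \<otimes> \<one>) V x"
   using V W h x by (intro pull_comp sub_conj_one H_closed) auto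
  also have "\<dots> = pull N ?W' (\<one> \<otimes> h) V x" using hG by simp
  also have "\<dots> = pull N ?W' \<one> ?W (pull N ?W h V x)"
   using V W WW h x by (intro pull_comp[symmetric] sub_conj_one H_closed) auto
  finally have eq: "pull N ?W' h V' (pull N V' \<one> V x) = pull N ?W' \<one> ?W (pull N ?W h V x)" .
  have q: "pull N ?W h V x \<in> carrier (obj N ?W)" using linear_maps_closed[OF pl] V x by blast
  have "E.cl (?W', a V' (pt V' (pull N V' \<one> V x))) = E.cl (?W', res ?W ?W' (pt ?W (pull N ?W h V x)))"
   using V W WW p q by (simp only: a_pt eq res_pt)
  also have "\<dots> = E.cl (?W, pt ?W (pull N ?W h V x))"
   by (rule E.cl_transition[OF W WW pt_closed[OF W(1) q]])
  finally show "E.cl (?W', a V' (pt V' (pull N V' \<one> V x))) = E.cl (?W, a V (pt V x))"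
   using V x by (simp only: a_pt)
 qed (simp_all)
 have act: "act h X = t X" if X: "X \<in> carrier E" for X
 proof -
  obtain V x where V: "V \<in> \<L>" "x \<in> carrier (DV V)" "X = E.cl (V, x)"
   using X unfolding E_carrier by blast
  have F: "(case p of (V, t) => let V' = conj_by Hm h V in E.cl (V', tensor2_map R (obj N V') (restrict_scalars e \<Phi>) (pull N V' h V) id t)) = t X"
   if p: "p \<in> X" for p
  proof -
   obtain W y where Wy: "p = (W, y)" by (cases p)
   note m = E.cl_mem[OF V(1,2), of W y]
   have "(W, y) \<in> E.cl (V, x)" using p V(3) Wy by simp
   note m = m[OF this]
   show ?thesis using t(2)[OF m(1,2)] m(3) V(3) Wy h by (simp add: Let_def conj_by_Hm a_def)
  qed
  have "(V, x) \<in> X" using E.cl_self[OF V(1,2)] V(3) by simp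
  from UN_eq_const[OF this F] show ?thesis
   unfolding colimit_action_def colimit_class_def .
 qed
 show "act h \<in> linear_maps \<Phi> E E"
 proof (rule linear_mapsI)
  interpret E': Module.module \<Phi> E by (rule E_module)
  fix X Y assume X: "X \<in> carrier E" and Y: "Y \<in> carrier E"
  show "act h (X \<oplus>\<^bsub>E\<^esub> Y) = act h X \<oplus>\<^bsub>E\<^esub> act h Y"
   using X Y E'.a_closed[OF X Y] by (simp only: act linear_maps_add[OF t(1)])
 next
  interpret E': Module.module \<Phi> E by (rule E_module)
  fix r X assume r: "r \<in> carrier \<Phi>" and X: "X \<in> carrier E"
  show "act h (r \<odot>\<^bsub>E\<^esub> X) = r \<odot>\<^bsub>E\<^esub> act h X"
   using r X E'.smult_closed[OF r X] by (simp only: act linear_maps_smult[OF t(1)])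
 qed (simp only: act linear_maps_closed[OF t(1)])
 show "act h (j V x) = j (conj_by G h V) (pull N (conj_by G h V) h V x)" if "V \<in> \<L>" "x \<in> carrier (obj N V)"
  using act[OF j_closed[OF that]] t(2)[OF that(1) pt_closed[OF that]] a_pt[OF that] by (simp only: j_eq)
qed

text \<open>Restrict from V to the part fixing hgK, translate by h into S g, and multiply by the
  volume of that part relative to U. The volume factor is what makes the result independent of the
  level V at which an element of the colimit is represented.\<close>

definition trace_map where
 "trace_map h g V t = \<rho> (ix (V \<inter> S (h \<otimes> g)) U) \<odot>\<^bsub>DV (S g)\<^esub>
   tensor2_map R (obj N (S g)) (restrict_scalars e \<Phi>)
    (%x. push N (V \<inter> S (h \<otimes> g)) h (S g) (pull N (V \<inter> S (h \<otimes> g)) \<one> V x)) id t"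

context
 fixes h g
 assumes h: "h \<in> H" and g: "g \<in> carrier G"
begin

lemma hg: "h \<otimes> g \<in> carrier G" using h g H_carrier by simp

lemma VS: "V \<in> \<L> ==> V \<inter> S (h \<otimes> g) \<in> \<L>" "V \<inter> S (h \<otimes> g) \<subseteq> conj_by G h (S g)"
 using levels_Int S_level[OF hg] S_mult[OF h g] by auto

lemma trace_push_linear:
 "V \<in> \<L> ==> (%x. push N (V \<inter> S (h \<otimes> g)) h (S g) (pull N (V \<inter> S (h \<otimes> g)) \<one> V x))
   \<in> linear_maps R (obj N V) (obj N (S g))"
 using linear_maps_compose[OF restriction_linear[of V "V \<inter> S (h \<otimes> g)"]
   push_linear[of "V \<inter> S (h \<otimes> g)" "S g" h]] VS[of V] h S_level[OF g] by simp

lemma trace_map_linear: "V \<in> \<L> ==> trace_map h g V \<in> linear_maps \<Phi> (DV V) (DV (S g))"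
 unfolding trace_map_def[abs_def]
 by (intro linear_maps_smult_left DV_module S_level g rho_closed SE_map_linear N_module trace_push_linear)

lemma trace_map_pt: "V \<in> \<L> ==> x \<in> carrier (obj N V) ==>
  trace_map h g V (pt V x) = \<rho> (ix (V \<inter> S (h \<otimes> g)) U) \<odot>\<^bsub>DV (S g)\<^esub>
   pt (S g) (push N (V \<inter> S (h \<otimes> g)) h (S g) (pull N (V \<inter> S (h \<otimes> g)) \<one> V x))"
 unfolding trace_map_def
 by (subst SE_map_pure) (simp_all add: N_module S_level g trace_push_linear)

text \<open>When V shrinks, the intersection with S(hg) shrinks from W to W'. Restriction to W'
  followed by trace to W multiplies by the index [W:W'], by the cohomological axiom, and the volume
  factor changes by exactly the inverse.\<close>

lemma trace_map_compatible:
 assumes V: "V \<in> \<L>" "V' \<in> \<L>" "V' \<subseteq> V" and x: "x \<in> carrier (obj N V)"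
 shows "trace_map h g V' (pt V' (pull N V' \<one> V x)) = trace_map h g V (pt V x)"
proof -
 interpret S: Module.module \<Phi> "DV (S g)" by (rule DV_module[OF S_level[OF g]])
 let ?W = "V \<inter> S (h \<otimes> g)" and ?W' = "V' \<inter> S (h \<otimes> g)"
 note W = VS(1)[OF V(1)] VS(2)[of V] and W' = VS(1)[OF V(2)] VS(2)[of V']
 have WW: "?W' \<subseteq> ?W" using V by blast
 note S = S_level[OF g]
 have p: "pull N V' \<one> V x \<in> carrier (obj N V')" using V x by (intro restriction_closed)
 define y where "y = pull N ?W \<one> V x"
 have y: "y \<in> carrier (obj N ?W)" unfolding y_def using V W x by (intro restriction_closed) auto
 define z where "z = push N ?W h (S g) y"
 have z: "z \<in> carrier (obj N (S g))" unfolding z_def using W S h y by (intro push_closed) auto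
 let ?n = "card ((%u. u \<star> ?W') ` ?W)"
 have "pull N ?W' \<one> V' (pull N V' \<one> V x) = pull N ?W' \<one> ?W y"
  unfolding y_def
  using pull_comp[of ?W' V' V "\<one>" "\<one>" x] pull_comp[of ?W' ?W V "\<one>" "\<one>" x] V W W' WW x
  by (simp add: sub_conj_one H_closed)
 moreover have "push N ?W' h (S g) (pull N ?W' \<one> ?W y) = push N ?W h (S g) (push N ?W' \<one> ?W (pull N ?W' \<one> ?W y))"
  using push_comp[of ?W' ?W "S g" "\<one>" h "pull N ?W' \<one> ?W y"] W W' WW S h H_carrier[OF h]
   pull_closed[of ?W' ?W "\<one>" y] y by (simp add: sub_conj_one H_closed)
 moreover have "push N ?W h (S g) (push N ?W' \<one> ?W (pull N ?W' \<one> ?W y)) = [?n] \<cdot>\<^bsub>obj N (S g)\<^esub> z"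
  unfolding z_def push_pull_index[OF W'(1) W(1) WW y]
  by (rule linear_maps_nat_mult[OF N_module[OF W(1)] N_module[OF S] push_linear[OF W(1) S h W(2)] y])
 ultimately have "trace_map h g V' (pt V' (pull N V' \<one> V x)) =
   \<rho> (ix ?W' U) \<odot>\<^bsub>DV (S g)\<^esub> (([?n] \<cdot>\<^bsub>\<Phi>\<^esub> \<one>\<^bsub>\<Phi>\<^esub>) \<odot>\<^bsub>DV (S g)\<^esub> pt (S g) z)"
  using trace_map_pt[OF V(2) p] SE_pure_nat_mult[OF N_module[OF S] z \<Phi>.one_closed] by simp
 also have "\<dots> = \<rho> (ix ?W U) \<odot>\<^bsub>DV (S g)\<^esub> pt (S g) z"
  unfolding rho_of_nat[symmetric]
  by (subst S.smult_assoc1[symmetric])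
   (use pt_closed[OF S z] in \<open>simp_all only: rho_closed rho_mult[symmetric] haar_index_card[OF W'(1) W(1) U_level WW] mult.commute\<close>)
 also have "\<dots> = trace_map h g V (pt V x)" unfolding z_def y_def by (rule trace_map_pt[OF V(1) x, symmetric])
 finally show ?thesis .
qed

lemma trace_exists: "\<exists>t. t \<in> linear_maps \<Phi> E (DV (S g)) \<and>
  (\<forall>V\<in>\<L>. \<forall>x\<in>carrier (obj N V). t (j V x) = trace_map h g V (pt V x))"
proof -
 obtain t where "t \<in> linear_maps \<Phi> E (DV (S g))"
  "\<And>V x. V \<in> \<L> ==> x \<in> carrier (DV V) ==> t (E.cl (V, x)) = trace_map h g V x"
  by (rule E_lift[OF DV_module[OF S_level[OF g]] trace_map_linear trace_map_compatible]) auto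
 then show ?thesis unfolding j_eq using pt_closed by blast
qed

end

definition "Tr h g = (SOME t. t \<in> linear_maps \<Phi> E (DV (S g)) \<and>
  (\<forall>V\<in>\<L>. \<forall>x\<in>carrier (obj N V). t (j V x) = trace_map h g V (pt V x)))"

lemma Tr_linear: "h \<in> H ==> g \<in> carrier G ==> Tr h g \<in> linear_maps \<Phi> E (DV (S g))"
 using someI_ex[OF trace_exists, of h g] unfolding Tr_def by blast

lemma Tr_j:
 assumes "h \<in> H" "g \<in> carrier G" "V \<in> \<L>" "x \<in> carrier (obj N V)"
 shows "Tr h g (j V x) = \<rho> (ix (V \<inter> S (h \<otimes> g)) U) \<odot>\<^bsub>DV (S g)\<^esub>
   pt (S g) (push N (V \<inter> S (h \<otimes> g)) h (S g) (pull N (V \<inter> S (h \<otimes> g)) \<one> V x))"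
proof -
 have "Tr h g (j V x) = trace_map h g V (pt V x)"
  using someI_ex[OF trace_exists, of h g] assms unfolding Tr_def by blast
 then show ?thesis using trace_map_pt assms by simp
qed

text \<open>Passing from h to hs composes the pushforward with the map of s on N(S g), which is the
  identity since s lies in S g. Thus \<open>Tr h g\<close> depends only on the coset of h modulo S
  g, and a sum over H/S_g makes sense.\<close>

lemma Tr_stab:
 assumes h: "h \<in> H" and g: "g \<in> carrier G" and s: "s \<in> S g" and X: "X \<in> carrier E"
 shows "Tr (h \<otimes> s) g X = Tr h g X"
proof (rule E_ext[OF DV_module[OF S_level[OF g]] Tr_linear[OF H_closed(1)[OF h S_H[OF s]] g] Tr_linear[OF h g] _ X])
 fix V x assume V: "V \<in> \<L>" and x: "x \<in> carrier (obj N V)"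
 have sG: "s \<in> carrier G" "s \<in> H" using S_H[OF s] H_carrier by auto
 have "S (h \<otimes> s \<otimes> g) = conj_by G h (conj_by G s (S g))"
  using S_mult[OF h, of "s \<otimes> g"] S_mult[OF sG(2) g] sG g H_carrier[OF h] by (simp add: G.m_assoc)
 also have "\<dots> = S (h \<otimes> g)"
  using G.conj_by_self[OF levels_sub(2)[OF S_level[OF g]] s] S_mult[OF h g] by simp
 finally have e: "S (h \<otimes> s \<otimes> g) = S (h \<otimes> g)" .
 let ?W = "V \<inter> S (h \<otimes> g)"
 note W = VS[OF h g] and S = S_level[OF g]
 define y where "y = pull N ?W \<one> V x"
 have y: "y \<in> carrier (obj N ?W)" unfolding y_def using V W x by (intro restriction_closed) auto
 have "push N ?W (h \<otimes> s) (S g) y = push N (S g) s (S g) (push N ?W h (S g) y)"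
  using W(1)[OF V] W(2) S h sG y G.conj_by_self[OF levels_sub(2)[OF S] s] by (intro push_comp[symmetric]) auto
 also have "\<dots> = push N ?W h (S g) y"
  using W(1)[OF V] W(2) S h y by (intro push_mem s push_closed) auto
 finally show "Tr (h \<otimes> s) g (j V x) = Tr h g (j V x)"
  by (simp add: Tr_j[OF H_closed(1)[OF h sG(2)] g V x] Tr_j[OF h g V x] e y_def)
qed

text \<open>Acting by \<open>h\<^sub>0\<close> conjugates every level in the construction. Volumes
  are unchanged by conjugation, and the pullback along \<open>h\<^sub>0\<close> is undone by the
  corresponding pushforward.\<close>

lemma Tr_act:
 assumes h0: "h\<^sub>0 \<in> H" and h: "h \<in> H" and g: "g \<in> carrier G" and X: "X \<in> carrier E"
 shows "Tr (h\<^sub>0 \<otimes> h) g (act h\<^sub>0 X) = Tr h g X"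
proof (rule E_ext[OF DV_module[OF S_level[OF g]] linear_maps_compose[OF act_linear[OF h0] Tr_linear[OF H_closed(1)[OF h0 h] g]]
   Tr_linear[OF h g] _ X])
 fix V x assume V: "V \<in> \<L>" and x: "x \<in> carrier (obj N V)"
 let ?W = "V \<inter> S (h \<otimes> g)" and ?V = "conj_by G h\<^sub>0 V"
 note W = VS(1)[OF h g V] VS(2)[OF h g, of V] and S = S_level[OF g]
 let ?W' = "conj_by G h\<^sub>0 ?W"
 note hG = H_carrier[OF h] H_carrier[OF h0]
 note W' = levels_conj[OF h0 W(1)] and V' = levels_conj[OF h0 V]
 have e: "?V \<inter> S (h\<^sub>0 \<otimes> h \<otimes> g) = ?W'"
  using S_mult[OF h0 hg[OF h g]] hG g G.conj_by_Int[OF hG(2) level_carrier[OF V] level_carrier[OF S_level[OF hg[OF h g]]]]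
  by (simp add: G.m_assoc)
 have WV: "?W \<subseteq> V" "?W' \<subseteq> ?V" using G.conj_by_mono by auto
 define y where "y = pull N ?W \<one> V x"
 have y: "y \<in> carrier (obj N ?W)" unfolding y_def using V W x WV by (intro restriction_closed) auto
 have "pull N ?W' \<one> ?V (pull N ?V h\<^sub>0 V x) = pull N ?W' (\<one> \<otimes> h\<^sub>0) V x"
  using V V' W' WV h0 x by (intro pull_comp sub_conj_one H_closed) auto
 also have "\<dots> = pull N ?W' (h\<^sub>0 \<otimes> \<one>) V x" using hG by simp
 also have "\<dots> = pull N ?W' h\<^sub>0 ?W y" unfolding y_def
  using V W W' WV h0 x by (intro pull_comp[symmetric] sub_conj_one H_closed) auto
 finally have p: "pull N ?W' \<one> ?V (pull N ?V h\<^sub>0 V x) = pull N ?W' h\<^sub>0 ?W y" .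
 have "push N ?W' (h\<^sub>0 \<otimes> h) (S g) (pull N ?W' h\<^sub>0 ?W y) = push N ?W h (S g) (push N ?W' h\<^sub>0 ?W (pull N ?W' h\<^sub>0 ?W y))"
  using W W' S h h0 y by (intro push_comp[symmetric] pull_closed) auto
 also have "\<dots> = push N ?W h (S g) y" using push_pull_cancel[OF W(1) h0 y] by simp
 finally have q: "push N ?W' (h\<^sub>0 \<otimes> h) (S g) (pull N ?W' h\<^sub>0 ?W y) = push N ?W h (S g) y" .
 have x': "pull N ?V h\<^sub>0 V x \<in> carrier (obj N ?V)" using V V' h0 x by (intro pull_closed) auto
 show "Tr (h\<^sub>0 \<otimes> h) g (act h\<^sub>0 (j V x)) = Tr h g (j V x)"
  by (simp only: act_j[OF h0 V x] Tr_j[OF H_closed(1)[OF h0 h] g V' x'] Tr_j[OF h g V x] e p q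
    haar_index_conj[OF h0 W(1)] y_def[symmetric])
qed

end

section \<open>Functions on G/K with values in the colimit, and their traces along H-orbits\<close>

context local_data
begin

declare SE_simps [simp del]

lemma left_translation: "left_translation_group G T"
proof (rule left_translation_group.intro[OF G.group_axioms left_translation_group_axioms.intro])
 show top: "topspace T = carrier G" using G_top by (simp add: topological_group_def)
 fix u assume u: "u \<in> carrier G"
 have m: "continuous_map (prod_topology T T) T (%(x, y). x \<otimes> y)" using G_top by (simp add: topological_group_def)
 have "continuous_map T (prod_topology T T) (%x. (u, x))"
  using u top by (simp add: continuous_map_paired)
 from continuous_map_compose[OF this m] show "continuous_map T T (%x. u \<otimes> x)" by (simp add: o_def)
qed

sublocale LT: left_translation_group G T by (rule left_translation)

sublocale EM: Module.module \<Phi> E by (rule E_module)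

subsection \<open>Compactly supported functions\<close>

abbreviation "C \<equiv> function_module G T K E"

definition "cosets \<xi> = (%g. g \<star> K) ` {g \<in> carrier G. \<xi> g ~= \<zero>\<^bsub>E\<^esub>}"

lemma K_coset_clopen:
 assumes "g \<in> carrier G"
 shows "compactin T (g \<star> K)"
proof -
 have "g \<star> K = (%x. g \<otimes> x) ` K" by (auto simp: l_coset_def)
 then show ?thesis
  using image_compactin[OF _ LT.translation[OF assms]] K by (simp add: compact_open_subgroup_def)
qed

lemma l_coset_K_mem: "g \<in> carrier G ==> y \<in> g \<star> K ==> \<exists>k\<in>K. y = g \<otimes> k"
 by (auto simp: l_coset_def)

text \<open>The set where a right K-invariant function is nonzero is a union of compact open cosets.
  A compact set meets only finitely many of them; conversely, a finite union of them is compact,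
  hence closed in a Hausdorff space, and equals its closure.\<close>

lemma compact_support_iff:
 assumes inv: "\<And>g k. g \<in> carrier G ==> k \<in> K ==> \<xi> (g \<otimes> k) = \<xi> g"
 shows "compactin T (T closure_of {g \<in> carrier G. \<xi> g ~= \<zero>\<^bsub>E\<^esub>}) \<longleftrightarrow> finite (cosets \<xi>)"
proof
 let ?A = "{g \<in> carrier G. \<xi> g ~= \<zero>\<^bsub>E\<^esub>}"
 {
  assume c: "compactin T (T closure_of ?A)"
  have "?A \<subseteq> T closure_of ?A" by (rule closure_of_subset) (use LT.topspace in auto)
  moreover have "finite ((%u. u \<star> K) ` (T closure_of ?A))"
   using LT.finite_lcosets[OF K_subgroup _ c] K by (simp add: compact_open_subgroup_def)
  ultimately show "finite (cosets \<xi>)" unfolding cosets_def by (meson finite_subset image_mono)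
 next
  assume fin: "finite (cosets \<xi>)"
  have "\<Union>(cosets \<xi>) = ?A"
  proof
   show "\<Union>(cosets \<xi>) \<subseteq> ?A"
   proof
    fix y assume "y \<in> \<Union>(cosets \<xi>)"
    then obtain g where g: "g \<in> carrier G" "\<xi> g ~= \<zero>\<^bsub>E\<^esub>" "y \<in> g \<star> K" by (auto simp: cosets_def)
    then obtain k where "k \<in> K" "y = g \<otimes> k" using l_coset_K_mem by blast
    then show "y \<in> ?A" using g inv K_carrier by simp
   qed
   show "?A \<subseteq> \<Union>(cosets \<xi>)" using G.l_coset_self[OF K_subgroup] by (auto simp: cosets_def)
  qed
  moreover have "compactin T (\<Union>(cosets \<xi>))"
   by (rule compactin_Union[OF fin]) (auto simp: cosets_def K_coset_clopen)
  ultimately have c: "compactin T ?A" by simp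
  then have "closedin T ?A" using compactin_imp_closedin G_top(2) by blast
  then show "compactin T (T closure_of ?A)" using c by (simp add: closure_of_closedin)
 }
qed

lemma C_iff: "\<xi> \<in> carrier C \<longleftrightarrow> \<xi> \<in> carrier G \<rightarrow>\<^sub>E carrier E \<and>
  (\<forall>g\<in>carrier G. \<forall>k\<in>K. \<xi> (g \<otimes> k) = \<xi> g) \<and> finite (cosets \<xi>)"
 using compact_support_iff[of \<xi>] by (auto simp: function_module_def)

lemma C_simps:
 "\<zero>\<^bsub>C\<^esub> = (\<lambda>g\<in>carrier G. \<zero>\<^bsub>E\<^esub>)"
 "\<xi> \<oplus>\<^bsub>C\<^esub> \<eta> = (\<lambda>g\<in>carrier G. \<xi> g \<oplus>\<^bsub>E\<^esub> \<eta> g)"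
 "c \<odot>\<^bsub>C\<^esub> \<xi> = (\<lambda>g\<in>carrier G. c \<odot>\<^bsub>E\<^esub> \<xi> g)"
 by (simp_all add: function_module_def)

lemma C_val: "\<xi> \<in> carrier C ==> g \<in> carrier G ==> \<xi> g \<in> carrier E"
 unfolding C_iff by (auto simp: PiE_iff)

lemma C_inv: "\<xi> \<in> carrier C ==> g \<in> carrier G ==> k \<in> K ==> \<xi> (g \<otimes> k) = \<xi> g"
 unfolding C_iff by blast

lemma C_fin: "\<xi> \<in> carrier C ==> finite (cosets \<xi>)"
 unfolding C_iff by blast

lemma C_I:
 assumes "\<And>g. g \<in> carrier G ==> F g \<in> carrier E"
  and "\<And>g k. g \<in> carrier G ==> k \<in> K ==> F (g \<otimes> k) = F g"
  and "finite A" "\<And>g. g \<in> carrier G ==> F g ~= \<zero>\<^bsub>E\<^esub> ==> g \<star> K \<in> A"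
 shows "(\<lambda>g\<in>carrier G. F g) \<in> carrier C"
proof -
 have "cosets (\<lambda>g\<in>carrier G. F g) \<subseteq> A" using assms(4) by (auto simp: cosets_def)
 then have "finite (cosets (\<lambda>g\<in>carrier G. F g))" using assms(3) finite_subset by blast
 then show ?thesis unfolding C_iff using assms(1,2) K_carrier by auto
qed

lemma C_supp: "\<xi> g ~= \<zero>\<^bsub>E\<^esub> ==> g \<in> carrier G ==> g \<star> K \<in> cosets \<xi>"
 by (auto simp: cosets_def)

lemma C_ext:
 assumes "\<xi> \<in> carrier C" "\<eta> \<in> carrier C" "\<And>g. g \<in> carrier G ==> \<xi> g = \<eta> g"
 shows "\<xi> = \<eta>"
proof (rule PiE_ext[of \<xi> "carrier G" "%_. carrier E" \<eta>])
 show "\<xi> \<in> carrier G \<rightarrow>\<^sub>E carrier E" "\<eta> \<in> carrier G \<rightarrow>\<^sub>E carrier E" using assms(1,2) unfolding C_iff by blast+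
qed (rule assms(3))

lemma C_add_closed: "\<xi> \<in> carrier C ==> \<eta> \<in> carrier C ==> \<xi> \<oplus>\<^bsub>C\<^esub> \<eta> \<in> carrier C"
proof -
 assume a: "\<xi> \<in> carrier C" "\<eta> \<in> carrier C"
 have "g \<star> K \<in> cosets \<xi> \<union> cosets \<eta>" if "g \<in> carrier G" "\<xi> g \<oplus>\<^bsub>E\<^esub> \<eta> g ~= \<zero>\<^bsub>E\<^esub>" for g
 proof -
  have "\<xi> g ~= \<zero>\<^bsub>E\<^esub> \<or> \<eta> g ~= \<zero>\<^bsub>E\<^esub>" using that by auto
  then show ?thesis using C_supp that(1) by blast
 qed
 then show ?thesis unfolding C_simps
  by (intro C_I[where A = "cosets \<xi> \<union> cosets \<eta>"]) (simp_all add: C_val[OF a(1)] C_val[OF a(2)] C_inv[OF a(1)] C_inv[OF a(2)]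
    C_fin[OF a(1)] C_fin[OF a(2)])
qed

lemma C_smult_closed: "c \<in> carrier \<Phi> ==> \<xi> \<in> carrier C ==> c \<odot>\<^bsub>C\<^esub> \<xi> \<in> carrier C"
proof -
 assume a: "c \<in> carrier \<Phi>" "\<xi> \<in> carrier C"
 have "g \<star> K \<in> cosets \<xi>" if "g \<in> carrier G" "c \<odot>\<^bsub>E\<^esub> \<xi> g ~= \<zero>\<^bsub>E\<^esub>" for g
 proof -
  have "\<xi> g ~= \<zero>\<^bsub>E\<^esub>"
  proof
   assume "\<xi> g = \<zero>\<^bsub>E\<^esub>"
   then show False using that(2) EM.smult_r_null[OF a(1)] by simp
  qed
  then show ?thesis using C_supp that(1) by blast
 qed
 then show ?thesis unfolding C_simps
  by (intro C_I[where A = "cosets \<xi>"]) (simp_all add: a C_val[OF a(2)] C_inv[OF a(2)] C_fin[OF a(2)])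
qed

lemma C_zero_closed: "\<zero>\<^bsub>C\<^esub> \<in> carrier C"
 unfolding C_simps by (intro C_I[where A = "{}"]) simp_all

lemma C_module: "Module.module \<Phi> C"
proof (rule moduleI[OF \<Phi>.is_cring])
 show "abelian_group C"
 proof (rule abelian_groupI)
  fix x assume x: "x \<in> carrier C"
  let ?y = "(\<ominus>\<^bsub>\<Phi>\<^esub> \<one>\<^bsub>\<Phi>\<^esub>) \<odot>\<^bsub>C\<^esub> x"
  have y: "?y \<in> carrier C" using x by (intro C_smult_closed) auto
  have "?y \<oplus>\<^bsub>C\<^esub> x = \<zero>\<^bsub>C\<^esub>"
   by (rule C_ext[OF C_add_closed[OF y x] C_zero_closed])
    (simp add: C_simps C_val[OF x] EM.smult_l_minus EM.l_neg)
  then show "\<exists>y\<in>carrier C. y \<oplus>\<^bsub>C\<^esub> x = \<zero>\<^bsub>C\<^esub>" using y by blast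
 next
  fix x assume x: "x \<in> carrier C"
  show "\<zero>\<^bsub>C\<^esub> \<oplus>\<^bsub>C\<^esub> x = x"
   by (rule C_ext[OF C_add_closed[OF C_zero_closed x] x]) (simp add: C_simps C_val[OF x])
 next
  fix x y z assume x: "x \<in> carrier C" and y: "y \<in> carrier C" and z: "z \<in> carrier C"
  show "x \<oplus>\<^bsub>C\<^esub> y \<oplus>\<^bsub>C\<^esub> z = x \<oplus>\<^bsub>C\<^esub> (y \<oplus>\<^bsub>C\<^esub> z)"
   by (intro C_ext C_add_closed x y z) (simp add: C_simps C_val[OF x] C_val[OF y] C_val[OF z] EM.a_assoc)
 next
  fix x y assume x: "x \<in> carrier C" and y: "y \<in> carrier C"
  show "x \<oplus>\<^bsub>C\<^esub> y = y \<oplus>\<^bsub>C\<^esub> x"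
   by (intro C_ext C_add_closed x y) (simp add: C_simps C_val[OF x] C_val[OF y] EM.a_comm)
 qed (rule C_add_closed C_zero_closed; assumption)+
next
 fix a b x assume a: "a \<in> carrier \<Phi>" and b: "b \<in> carrier \<Phi>" and x: "x \<in> carrier C"
 show "(a \<oplus>\<^bsub>\<Phi>\<^esub> b) \<odot>\<^bsub>C\<^esub> x = a \<odot>\<^bsub>C\<^esub> x \<oplus>\<^bsub>C\<^esub> b \<odot>\<^bsub>C\<^esub> x"
  by (intro C_ext C_add_closed C_smult_closed \<Phi>.a_closed a b x) (simp add: C_simps C_val[OF x] EM.smult_l_distr a b)
 show "(a \<otimes>\<^bsub>\<Phi>\<^esub> b) \<odot>\<^bsub>C\<^esub> x = a \<odot>\<^bsub>C\<^esub> (b \<odot>\<^bsub>C\<^esub> x)"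
  by (intro C_ext C_add_closed C_smult_closed \<Phi>.m_closed a b x) (simp add: C_simps C_val[OF x] EM.smult_assoc1 a b)
next
 fix a x y assume a: "a \<in> carrier \<Phi>" and x: "x \<in> carrier C" and y: "y \<in> carrier C"
 show "a \<odot>\<^bsub>C\<^esub> (x \<oplus>\<^bsub>C\<^esub> y) = a \<odot>\<^bsub>C\<^esub> x \<oplus>\<^bsub>C\<^esub> a \<odot>\<^bsub>C\<^esub> y"
  by (intro C_ext C_add_closed C_smult_closed a x y) (simp add: C_simps C_val[OF x] C_val[OF y] EM.smult_r_distr a)
next
 fix x assume x: "x \<in> carrier C"
 show "\<one>\<^bsub>\<Phi>\<^esub> \<odot>\<^bsub>C\<^esub> x = x"
  by (intro C_ext C_smult_closed \<Phi>.one_closed x) (simp add: C_simps C_val[OF x])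
qed (rule C_smult_closed)

sublocale CM: Module.module \<Phi> C by (rule C_module)

lemma translate_closed:
 assumes h: "h \<in> H" and x: "\<xi> \<in> carrier C"
 shows "translate G act h \<xi> \<in> carrier C"
proof -
 note hG = H_carrier[OF h]
 have zero: "act h \<zero>\<^bsub>E\<^esub> = \<zero>\<^bsub>E\<^esub>" by (rule linear_maps_zero[OF E_module E_module act_linear[OF h]])
 have "g \<star> K \<in> (%D. (%x. h \<otimes> x) ` D) ` cosets \<xi>"
  if g: "g \<in> carrier G" and n: "act h (\<xi> (inv h \<otimes> g)) ~= \<zero>\<^bsub>E\<^esub>" for g
 proof -
  have "\<xi> (inv h \<otimes> g) ~= \<zero>\<^bsub>E\<^esub>" using n zero by metis
  then have "(inv h \<otimes> g) \<star> K \<in> cosets \<xi>" using C_supp g hG by simp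
  moreover have "g \<star> K = (%x. h \<otimes> x) ` ((inv h \<otimes> g) \<star> K)"
  proof -
   have "(%x. h \<otimes> x) ` ((inv h \<otimes> g) \<star> K) = h \<star> ((inv h \<otimes> g) \<star> K)"
    by (auto simp: l_coset_def)
   also have "\<dots> = (h \<otimes> (inv h \<otimes> g)) \<star> K" using G.lcos_m_assoc[OF K_sub] hG g by simp
   also have "h \<otimes> (inv h \<otimes> g) = g" using hG g by (simp add: G.m_assoc[symmetric])
   finally show ?thesis by simp
  qed
  ultimately show ?thesis by blast
 qed
 then show ?thesis unfolding translate_def
  by (intro C_I[where A = "(%D. (%x. h \<otimes> x) ` D) ` cosets \<xi>"])
   (simp_all add: C_fin[OF x] linear_maps_closed[OF act_linear[OF h]] C_val[OF x] hG K_carrier G.m_assoc[symmetric] C_inv[OF x])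
qed

subsection \<open>The trace of a function along an orbit\<close>

definition "orbit_cosets g = (%h. h \<star> S g) ` H"

definition rep :: "'a set => 'a" where "rep D = (SOME h. h \<in> D)"

definition "trace_at g \<xi> h = Tr h g (\<xi> (h \<otimes> g))"

text \<open>The trace of \<xi> along the H-orbit of gK: a sum over H/S_g of normalized traces of the
  values of \<xi>. The restriction to cosets where \<xi> is nonzero keeps the sum finite; the chosen
  \<open>rep D\<close> does not affect the summand, by \<open>trace_at_rep\<close>.\<close>

definition "lam g \<xi> = (\<Oplus>\<^bsub>DV (S g)\<^esub>D\<in>{D \<in> orbit_cosets g. \<xi> (rep D \<otimes> g) ~= \<zero>\<^bsub>E\<^esub>}. trace_at g \<xi> (rep D))"

context
 fixes g
 assumes g: "g \<in> carrier G"
begin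

interpretation M: Module.module \<Phi> "DV (S g)" by (rule DV_module[OF S_level[OF g]])

lemma S_subgroup: "subgroup (S g) G" by (rule levels_sub(2)[OF S_level[OF g]])

lemma S_carrier: "s \<in> S g ==> s \<in> carrier G" using S_H H_carrier by blast

lemma rep_coset:
 assumes "h \<in> H"
 obtains s where "s \<in> S g" "rep (h \<star> S g) = h \<otimes> s"
proof -
 have "rep (h \<star> S g) \<in> h \<star> S g"
  unfolding rep_def using G.l_coset_self[OF S_subgroup H_carrier[OF assms]] by (rule someI)
 then show ?thesis using that by (auto simp: l_coset_def)
qed

lemma rep_props:
 assumes "D \<in> orbit_cosets g"
 shows "rep D \<in> H" "rep D \<star> S g = D"
proof -
 obtain h where h: "h \<in> H" "D = h \<star> S g" using assms by (auto simp: orbit_cosets_def)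
 obtain s where s: "s \<in> S g" "rep D = h \<otimes> s" using rep_coset[OF h(1)] h(2) by blast
 show "rep D \<in> H" using s h S_H H_closed by auto
 have "rep D \<in> h \<star> S g" using s by (auto simp: l_coset_def)
 then show "rep D \<star> S g = D"
  using G.l_repr_independence[of "rep D" h "S g"] S_subgroup H_carrier[OF h(1)] h(2) by simp
qed

lemma trace_at_closed: "\<xi> \<in> carrier C ==> h \<in> H ==> trace_at g \<xi> h \<in> carrier (DV (S g))"
 unfolding trace_at_def by (rule linear_maps_closed[OF Tr_linear[OF _ g] C_val]) (simp_all add: g H_carrier)

lemma C_stab:
 assumes x: "\<xi> \<in> carrier C" and h: "h \<in> H" and s: "s \<in> S g"
 shows "\<xi> (h \<otimes> s \<otimes> g) = \<xi> (h \<otimes> g)"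
proof -
 note c = H_carrier[OF h] S_carrier[OF s] g
 have k: "inv g \<otimes> s \<otimes> g \<in> K" using mem_S[OF g S_H[OF s]] s by simp
 have "h \<otimes> s \<otimes> g = (h \<otimes> g) \<otimes> (inv g \<otimes> s \<otimes> g)"
 proof -
  have "g \<otimes> (inv g \<otimes> (s \<otimes> g)) = s \<otimes> g" using c by (simp add: G.m_assoc[symmetric])
  then show ?thesis using c by (simp add: G.m_assoc)
 qed
 then show ?thesis using C_inv[OF x _ k, of "h \<otimes> g"] c by simp
qed

lemma trace_at_stab:
 assumes "\<xi> \<in> carrier C" "h \<in> H" "s \<in> S g"
 shows "trace_at g \<xi> (h \<otimes> s) = trace_at g \<xi> h"
 unfolding trace_at_def C_stab[OF assms] using assms g H_carrier by (intro Tr_stab C_val) auto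

lemma trace_at_rep: "\<xi> \<in> carrier C ==> h \<in> H ==> trace_at g \<xi> (rep (h \<star> S g)) = trace_at g \<xi> h"
 using rep_coset[of h] trace_at_stab by metis

lemma C_rep: "\<xi> \<in> carrier C ==> h \<in> H ==> \<xi> (rep (h \<star> S g) \<otimes> g) = \<xi> (h \<otimes> g)"
 using rep_coset[of h] C_stab by metis

lemma lam_finite:
 assumes "\<xi> \<in> carrier C"
 shows "finite {D \<in> orbit_cosets g. \<xi> (rep D \<otimes> g) ~= \<zero>\<^bsub>E\<^esub>}" (is "finite ?A")
proof (rule inj_on_finite[OF _ _ C_fin[OF assms]])
 show "inj_on (%D. (rep D \<otimes> g) \<star> K) ?A"
 proof (rule inj_onI)
  fix D D' assume D: "D \<in> ?A" "D' \<in> ?A" and e: "(rep D \<otimes> g) \<star> K = (rep D' \<otimes> g) \<star> K"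
  then have o: "D \<in> orbit_cosets g" "D' \<in> orbit_cosets g" by auto
  show "D = D'" using coset_S_iff[OF rep_props(1)[OF o(1)] rep_props(1)[OF o(2)] g] e rep_props(2)[OF o(1)] rep_props(2)[OF o(2)] by simp
 qed
 show "(%D. (rep D \<otimes> g) \<star> K) ` ?A \<subseteq> cosets \<xi>"
 proof (rule image_subsetI)
  fix D assume "D \<in> ?A"
  then have D: "D \<in> orbit_cosets g" "\<xi> (rep D \<otimes> g) ~= \<zero>\<^bsub>E\<^esub>" by auto
  show "(rep D \<otimes> g) \<star> K \<in> cosets \<xi>"
   by (rule C_supp[of \<xi>, OF D(2)]) (use H_carrier[OF rep_props(1)[OF D(1)]] g in simp)
 qed
qed

text \<open>Cosets where \<xi> vanishes contribute zero, so functions with different supports can be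
  summed over one index set; this is how additivity is obtained.\<close>

lemma lam_superset:
 assumes x: "\<xi> \<in> carrier C" and A: "finite A" "A \<subseteq> orbit_cosets g"
  and "\<And>D. D \<in> orbit_cosets g ==> \<xi> (rep D \<otimes> g) ~= \<zero>\<^bsub>E\<^esub> ==> D \<in> A"
 shows "lam g \<xi> = (\<Oplus>\<^bsub>DV (S g)\<^esub>D\<in>A. trace_at g \<xi> (rep D))"
 unfolding lam_def
proof (rule M.add.finprod_mono_neutral_cong_left[OF A(1)])
 show "trace_at g \<xi> (rep D) = \<zero>\<^bsub>DV (S g)\<^esub>" if "D \<in> A - {D \<in> orbit_cosets g. \<xi> (rep D \<otimes> g) ~= \<zero>\<^bsub>E\<^esub>}" for D
 proof -
  have D: "D \<in> orbit_cosets g" "\<xi> (rep D \<otimes> g) = \<zero>\<^bsub>E\<^esub>" using that A by auto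
  then show ?thesis unfolding trace_at_def
   using linear_maps_zero[OF E_module DV_module[OF S_level[OF g]] Tr_linear[OF rep_props(1) g]] by simp
 qed
 show "(%D. trace_at g \<xi> (rep D)) \<in> A \<rightarrow> carrier (DV (S g))"
  using A trace_at_closed[OF x rep_props(1)] by (intro funcsetI) blast
qed (use assms in auto)

lemma lam_linear: "lam g \<in> linear_maps \<Phi> C (DV (S g))"
proof (rule linear_mapsI)
 have cl: "(%D. trace_at g \<xi> (rep D)) \<in> A \<rightarrow> carrier (DV (S g))" if "\<xi> \<in> carrier C" "A \<subseteq> orbit_cosets g" for \<xi> A
  using that(2) trace_at_closed[OF that(1) rep_props(1)] by (intro funcsetI) blast
 let ?s = "%\<xi>. {D \<in> orbit_cosets g. \<xi> (rep D \<otimes> g) ~= \<zero>\<^bsub>E\<^esub>}"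
 show "lam g \<xi> \<in> carrier (DV (S g))" if "\<xi> \<in> carrier C" for \<xi>
  unfolding lam_def by (rule M.finsum_closed[OF cl[OF that]]) auto
 show "lam g (\<xi> \<oplus>\<^bsub>C\<^esub> \<eta>) = lam g \<xi> \<oplus>\<^bsub>DV (S g)\<^esub> lam g \<eta>" if x: "\<xi> \<in> carrier C" and y: "\<eta> \<in> carrier C" for \<xi> \<eta>
 proof -
  let ?A = "?s \<xi> \<union> ?s \<eta>"
  have A: "finite ?A" "?A \<subseteq> orbit_cosets g" using lam_finite x y by auto
  have rg: "rep D \<otimes> g \<in> carrier G" if "D \<in> orbit_cosets g" for D using rep_props(1)[OF that] H_carrier g by simp
  have "lam g (\<xi> \<oplus>\<^bsub>C\<^esub> \<eta>) = (\<Oplus>\<^bsub>DV (S g)\<^esub>D\<in>?A. trace_at g (\<xi> \<oplus>\<^bsub>C\<^esub> \<eta>) (rep D))"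
   by (rule lam_superset[OF CM.a_closed[OF x y] A]) (use rg in \<open>auto simp: C_simps\<close>)
  also have "\<dots> = (\<Oplus>\<^bsub>DV (S g)\<^esub>D\<in>?A. trace_at g \<xi> (rep D) \<oplus>\<^bsub>DV (S g)\<^esub> trace_at g \<eta> (rep D))"
  proof (rule M.finsum_cong'[OF refl])
   show "(%D. trace_at g \<xi> (rep D) \<oplus>\<^bsub>DV (S g)\<^esub> trace_at g \<eta> (rep D)) \<in> ?A \<rightarrow> carrier (DV (S g))"
    using A(2) trace_at_closed[OF x rep_props(1)] trace_at_closed[OF y rep_props(1)] M.a_closed by (intro funcsetI) blast
   fix D assume "D \<in> ?A"
   then have D: "D \<in> orbit_cosets g" by blast
   show "trace_at g (\<xi> \<oplus>\<^bsub>C\<^esub> \<eta>) (rep D) = trace_at g \<xi> (rep D) \<oplus>\<^bsub>DV (S g)\<^esub> trace_at g \<eta> (rep D)"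
    unfolding trace_at_def C_simps using rg[OF D] linear_maps_add[OF Tr_linear[OF rep_props(1)[OF D] g]] C_val[OF x] C_val[OF y]
    by simp
  qed
  also have "\<dots> = (\<Oplus>\<^bsub>DV (S g)\<^esub>D\<in>?A. trace_at g \<xi> (rep D)) \<oplus>\<^bsub>DV (S g)\<^esub> (\<Oplus>\<^bsub>DV (S g)\<^esub>D\<in>?A. trace_at g \<eta> (rep D))"
   by (rule M.finsum_addf[OF cl[OF x A(2)] cl[OF y A(2)]])
  also have "(\<Oplus>\<^bsub>DV (S g)\<^esub>D\<in>?A. trace_at g \<xi> (rep D)) = lam g \<xi>" by (rule lam_superset[OF x A, symmetric]) auto
  also have "(\<Oplus>\<^bsub>DV (S g)\<^esub>D\<in>?A. trace_at g \<eta> (rep D)) = lam g \<eta>" by (rule lam_superset[OF y A, symmetric]) auto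
  finally show ?thesis .
 qed
 show "lam g (c \<odot>\<^bsub>C\<^esub> \<xi>) = c \<odot>\<^bsub>DV (S g)\<^esub> lam g \<xi>" if c: "c \<in> carrier \<Phi>" and x: "\<xi> \<in> carrier C" for c \<xi>
 proof -
  have A: "finite (?s \<xi>)" "?s \<xi> \<subseteq> orbit_cosets g" using lam_finite x by auto
  have rg: "rep D \<otimes> g \<in> carrier G" if "D \<in> orbit_cosets g" for D using rep_props(1)[OF that] H_carrier g by simp
  have "lam g (c \<odot>\<^bsub>C\<^esub> \<xi>) = (\<Oplus>\<^bsub>DV (S g)\<^esub>D\<in>?s \<xi>. trace_at g (c \<odot>\<^bsub>C\<^esub> \<xi>) (rep D))"
   by (rule lam_superset[OF CM.smult_closed[OF c x] A]) (use rg c in \<open>auto simp: C_simps\<close>)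
  also have "\<dots> = (\<Oplus>\<^bsub>DV (S g)\<^esub>D\<in>?s \<xi>. c \<odot>\<^bsub>DV (S g)\<^esub> trace_at g \<xi> (rep D))"
  proof (rule M.finsum_cong'[OF refl])
   show "(%D. c \<odot>\<^bsub>DV (S g)\<^esub> trace_at g \<xi> (rep D)) \<in> ?s \<xi> \<rightarrow> carrier (DV (S g))"
    using A(2) trace_at_closed[OF x rep_props(1)] M.smult_closed[OF c] by (intro funcsetI) blast
   fix D assume "D \<in> ?s \<xi>"
   then have D: "D \<in> orbit_cosets g" by blast
   show "trace_at g (c \<odot>\<^bsub>C\<^esub> \<xi>) (rep D) = c \<odot>\<^bsub>DV (S g)\<^esub> trace_at g \<xi> (rep D)"
    unfolding trace_at_def C_simps using rg[OF D] linear_maps_smult[OF Tr_linear[OF rep_props(1)[OF D] g] c] C_val[OF x]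
    by simp
  qed
  also have "\<dots> = c \<odot>\<^bsub>DV (S g)\<^esub> lam g \<xi>"
   unfolding lam_def by (rule M.finsum_smult_ldistr[OF A(1) c cl[OF x A(2)], symmetric])
  finally show ?thesis .
 qed
qed

text \<open>Left multiplication by h permutes the cosets in H/S_g. The summand of the translate at h
  h' is the trace of h acting on \<xi>(h'g), which by \<open>Tr_act\<close> is the summand of \<xi>
  at h'.\<close>

lemma lam_translate:
 assumes h: "h \<in> H" and x: "\<xi> \<in> carrier C"
 shows "lam g (translate G act h \<xi>) = lam g \<xi>"
proof -
 note hG = H_carrier[OF h]
 let ?t = "translate G act h \<xi>"
 let ?B = "{D \<in> orbit_cosets g. \<xi> (rep D \<otimes> g) ~= \<zero>\<^bsub>E\<^esub>}"
 have zero: "act h \<zero>\<^bsub>E\<^esub> = \<zero>\<^bsub>E\<^esub>" by (rule linear_maps_zero[OF E_module E_module act_linear[OF h]])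
 have assoc: "h \<otimes> (inv h \<otimes> y) = y" "inv h \<otimes> (h \<otimes> y) = y" if "y \<in> carrier G" for y
  using hG that by (simp_all add: G.m_assoc[symmetric])
 have coset: "h \<star> D = (h \<otimes> rep D) \<star> S g" if "D \<in> orbit_cosets g" for D
  using G.lcos_m_assoc[OF subgroup.subset[OF S_subgroup] hG H_carrier[OF rep_props(1)[OF that]]] rep_props(2)[OF that] by simp
 have t: "?t (h \<otimes> y) = act h (\<xi> y)" if "y \<in> carrier G" for y
  using that hG by (simp add: translate_def assoc)
 have T: "trace_at g ?t (h \<otimes> h') = trace_at g \<xi> h'" if h': "h' \<in> H" for h'
  unfolding trace_at_def using t[of "h' \<otimes> g"] Tr_act[OF h h' g C_val[OF x]] H_carrier[OF h'] hG g by (simp add: G.m_assoc)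
 have inj: "inj_on (%D. h \<star> D) ?B"
 proof (rule inj_onI)
  fix D D' assume "D \<in> ?B" "D' \<in> ?B" and e: "h \<star> D = h \<star> D'"
  then have o: "D \<in> orbit_cosets g" "D' \<in> orbit_cosets g" by auto
  have sub: "D \<subseteq> carrier G" "D' \<subseteq> carrier G"
   using rep_props[OF o(1)] rep_props[OF o(2)] G.l_coset_subset_G[OF subgroup.subset[OF S_subgroup]] H_carrier by metis+
  have "inv h \<star> (h \<star> D) = inv h \<star> (h \<star> D')" using e by simp
  then show "D = D'" using G.lcos_m_assoc[OF sub(1), of "inv h" h] G.lcos_m_assoc[OF sub(2), of "inv h" h] hG sub
   by (simp add: G.lcos_mult_one)
 qed
 have "lam g ?t = (\<Oplus>\<^bsub>DV (S g)\<^esub>D\<in>(%D. h \<star> D) ` ?B. trace_at g ?t (rep D))"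
 proof (rule lam_superset[OF translate_closed[OF h x]])
  show "finite ((%D. h \<star> D) ` ?B)" using lam_finite[OF x] by simp
  show "(%D. h \<star> D) ` ?B \<subseteq> orbit_cosets g"
  proof (rule image_subsetI)
   fix D assume "D \<in> ?B"
   then have D: "D \<in> orbit_cosets g" by blast
   show "h \<star> D \<in> orbit_cosets g" unfolding coset[OF D] orbit_cosets_def
    using H_closed(1)[OF h rep_props(1)[OF D]] by blast
  qed
  fix D assume D: "D \<in> orbit_cosets g" and n: "?t (rep D \<otimes> g) ~= \<zero>\<^bsub>E\<^esub>"
  note r = rep_props[OF D]
  let ?h = "inv h \<otimes> rep D"
  have h': "?h \<in> H" using H_closed h r by blast
  have o: "?h \<star> S g \<in> orbit_cosets g" using h' by (auto simp: orbit_cosets_def)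
  have eq: "h \<otimes> ?h = rep D" using assoc H_carrier[OF r(1)] by simp
  have "?t (rep D \<otimes> g) = act h (\<xi> (?h \<otimes> g))"
   using t[of "?h \<otimes> g"] eq H_carrier[OF h'] hG g G.m_assoc[of h ?h g] by simp
  then have "\<xi> (?h \<otimes> g) ~= \<zero>\<^bsub>E\<^esub>" using n zero by metis
  then have B: "?h \<star> S g \<in> ?B" using o C_rep[OF x h'] by simp
  have "h \<star> (?h \<star> S g) = D"
   using G.lcos_m_assoc[OF subgroup.subset[OF S_subgroup] hG H_carrier[OF h']] eq r(2) by simp
  then show "D \<in> (%D. h \<star> D) ` ?B" using B by blast
 qed
 also have "\<dots> = (\<Oplus>\<^bsub>DV (S g)\<^esub>D\<in>?B. trace_at g ?t (rep (h \<star> D)))"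
 proof (rule M.finsum_reindex[OF _ inj], rule funcsetI, elim imageE)
  fix X D assume "D \<in> ?B" "X = h \<star> D"
  then have D: "D \<in> orbit_cosets g" "X = (h \<otimes> rep D) \<star> S g" using coset by auto
  have "X \<in> orbit_cosets g" unfolding D(2) orbit_cosets_def using H_closed(1)[OF h rep_props(1)[OF D(1)]] by blast
  then show "trace_at g ?t (rep X) \<in> carrier (DV (S g))" by (rule trace_at_closed[OF translate_closed[OF h x] rep_props(1)])
 qed
 also have "\<dots> = (\<Oplus>\<^bsub>DV (S g)\<^esub>D\<in>?B. trace_at g \<xi> (rep D))"
 proof (rule M.finsum_cong'[OF refl])
  fix D assume "D \<in> ?B"
  then have D: "D \<in> orbit_cosets g" by blast
  show "trace_at g ?t (rep (h \<star> D)) = trace_at g \<xi> (rep D)"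
   unfolding coset[OF D] using trace_at_rep[OF translate_closed[OF h x] H_closed(1)[OF h rep_props(1)[OF D]]] T[OF rep_props(1)[OF D]] by simp
 qed (use trace_at_closed[OF x rep_props(1)] in auto)
 finally show ?thesis unfolding lam_def .
qed

abbreviation "Z \<equiv> coinvariants_kernel \<Phi> G T H K E act"

lemma kernel_gens_closed: "{translate G act h \<xi> \<ominus>\<^bsub>C\<^esub> \<xi> | h \<xi>. h \<in> H \<and> \<xi> \<in> carrier C} \<subseteq> carrier C"
 using translate_closed CM.minus_closed by blast

lemma lam_kernel:
 assumes "z \<in> Z"
 shows "lam g z = \<zero>\<^bsub>DV (S g)\<^esub>"
proof -
 have "lam g z \<in> {\<zero>\<^bsub>DV (S g)\<^esub>}"
 proof (rule submodule_generated_linear_image[OF C_module M.module_axioms lam_linear submodule_zero[OF M.module_axioms] kernel_gens_closed])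
  show "z \<in> submodule_generated \<Phi> C {translate G act h \<xi> \<ominus>\<^bsub>C\<^esub> \<xi> | h \<xi>. h \<in> H \<and> \<xi> \<in> carrier C}"
   using assms by (simp add: coinvariants_kernel_def Let_def)
  fix s assume "s \<in> {translate G act h \<xi> \<ominus>\<^bsub>C\<^esub> \<xi> | h \<xi>. h \<in> H \<and> \<xi> \<in> carrier C}"
  then obtain h \<xi> where s: "s = translate G act h \<xi> \<ominus>\<^bsub>C\<^esub> \<xi>" "h \<in> H" "\<xi> \<in> carrier C" by blast
  have "lam g s = lam g \<xi> \<ominus>\<^bsub>DV (S g)\<^esub> lam g \<xi>"
   unfolding s(1) using linear_maps_diff[OF C_module M.module_axioms lam_linear translate_closed[OF s(2,3)] s(3)] lam_translate[OF s(2,3)]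
   by simp
  then show "lam g s \<in> {\<zero>\<^bsub>DV (S g)\<^esub>}"
   using linear_maps_closed[OF lam_linear s(3)] by (simp add: a_minus_def M.r_neg)
 qed
 then show ?thesis by simp
qed

lemma Z_submodule: "submodule Z \<Phi> C"
 using submodule_generated_submodule[OF C_module kernel_gens_closed] by (simp add: coinvariants_kernel_def Let_def)

text \<open>\<open>lam g\<close> is linear and kills the generators h\<xi> - \<xi>, so it factors
  through H-coinvariants. This is how condition (ii) on zeta elements is exploited.\<close>

lemma lam_coinvariants:
 assumes "\<xi> \<in> carrier C" "\<eta> \<in> carrier C" "Z +>\<^bsub>C\<^esub> \<xi> = Z +>\<^bsub>C\<^esub> \<eta>"
 shows "lam g \<xi> = lam g \<eta>"
proof -
 have "\<xi> \<ominus>\<^bsub>C\<^esub> \<eta> \<in> Z" using quotient_coset_eq_iff[OF C_module Z_submodule assms(1,2)] assms(3) by simp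
 then have z: "lam g \<xi> \<ominus>\<^bsub>DV (S g)\<^esub> lam g \<eta> = \<zero>\<^bsub>DV (S g)\<^esub>"
  using lam_kernel linear_maps_diff[OF C_module M.module_axioms lam_linear assms(1,2)] by simp
 note c = linear_maps_closed[OF lam_linear assms(1)] linear_maps_closed[OF lam_linear assms(2)]
 have "\<ominus>\<^bsub>DV (S g)\<^esub> (\<ominus>\<^bsub>DV (S g)\<^esub> lam g \<eta>) = lam g \<xi>"
  using c z by (intro M.minus_equality) (simp_all add: a_minus_def)
 then show ?thesis using c by simp
qed

end

end

lemma module_nat_mult:
 assumes "Module.module R M" "a \<in> carrier M"
 shows "[(n::nat)] \<cdot>\<^bsub>M\<^esub> a = ([n] \<cdot>\<^bsub>R\<^esub> \<one>\<^bsub>R\<^esub>) \<odot>\<^bsub>M\<^esub> a"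
proof -
 interpret M: Module.module R M by fact
 show ?thesis
  by (induction n) (use assms(2) M.smult_l_distr[OF _ M.R.one_closed assms(2)] in simp_all)
qed

context local_data
begin

declare SE_simps [simp del]

subsection \<open>Integral trace identities\<close>

text \<open>p lies in the double coset HgK, equivalently pK is in the H-orbit of gK;
  \<open>hh g p\<close> below is a chosen h with p in hgK.\<close>

definition "orb g p \<longleftrightarrow> (\<exists>h\<in>H. \<exists>k\<in>K. p = h \<otimes> g \<otimes> k)"
definition "hh g p = (SOME h. h \<in> H \<and> (\<exists>k\<in>K. p = h \<otimes> g \<otimes> k))"

lemma hh:
 assumes "orb g p"
 obtains k where "hh g p \<in> H" "k \<in> K" "p = hh g p \<otimes> g \<otimes> k"
proof -
 have "hh g p \<in> H \<and> (\<exists>k\<in>K. p = hh g p \<otimes> g \<otimes> k)"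
  unfolding hh_def by (rule someI_ex) (use assms in \<open>auto simp: orb_def\<close>)
 then show ?thesis using that by blast
qed

lemma orb_sym: "g \<in> carrier G ==> orb g p ==> orb p g"
proof -
 assume g: "g \<in> carrier G" and "orb g p"
 then obtain h k where hk: "h \<in> H" "k \<in> K" "p = h \<otimes> g \<otimes> k" by (auto simp: orb_def)
 then have "g = inv h \<otimes> p \<otimes> inv k"
  using H_carrier[of h] K_carrier[of k] g G.inv_solve_right[of g "inv h \<otimes> p" k] G.inv_solve_left[of "g \<otimes> k" h p]
  by (simp add: G.m_assoc)
 then show ?thesis using hk H_closed K_closed unfolding orb_def by blast
qed

lemma orb_trans: "g \<in> carrier G ==> orb g p ==> orb p q ==> orb g q"
proof -
 assume g: "g \<in> carrier G" and "orb g p" "orb p q"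
 then obtain h k h' k' where hk: "h \<in> H" "k \<in> K" "p = h \<otimes> g \<otimes> k" "h' \<in> H" "k' \<in> K" "q = h' \<otimes> p \<otimes> k'"
  by (auto simp: orb_def)
 then have "q = (h' \<otimes> h) \<otimes> g \<otimes> (k \<otimes> k')"
  using H_carrier[of h] K_carrier[of k] H_carrier[of h'] K_carrier[of k'] g by (simp add: G.m_assoc)
 then show ?thesis using hk H_closed K_closed unfolding orb_def by blast
qed

lemma orb_refl: "g \<in> carrier G ==> orb g g"
 unfolding orb_def using H_closed(3) K_closed(3) by (intro bexI[of _ "\<one>"]) auto

lemma S_orb:
 assumes "g \<in> carrier G" "orb g p"
 shows "S p = S (hh g p \<otimes> g)" "hh g p \<in> H" "S p \<subseteq> conj_by G (hh g p) (S g)" "p \<in> carrier G"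
proof -
 obtain k where k: "hh g p \<in> H" "k \<in> K" "p = hh g p \<otimes> g \<otimes> k" using hh[OF assms(2)] .
 show "hh g p \<in> H" by fact
 have "S (hh g p \<otimes> g \<otimes> k) = S (hh g p \<otimes> g)" by (rule S_K[OF k(2) hg[OF k(1) assms(1)]])
 then show "S p = S (hh g p \<otimes> g)" using k(3) by simp
 then show "S p \<subseteq> conj_by G (hh g p) (S g)" using S_mult[OF k(1) assms(1)] by simp
 show "p \<in> carrier G" using k H_carrier K_carrier assms(1) by (metis G.m_closed)
qed

lemma C_orb: "\<xi> \<in> carrier C ==> g \<in> carrier G ==> orb g p ==> \<xi> p = \<xi> (hh g p \<otimes> g)"
 using hh[of g p] C_inv[of \<xi> "hh g p \<otimes> g"] hg[of "hh g p" g] by metis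

definition "F\<^sub>f = (\<lambda>g\<in>carrier G. e (f g) \<odot>\<^bsub>E\<^esub> j U \<phi>)"

lemma f_mem: "g \<in> carrier G ==> f g \<in> carrier R" using f_closed by auto

lemma f_left: "g \<in> carrier G ==> k \<in> K ==> f (k \<otimes> g) = f g"
 using f_inv[of g k "\<one>"] K_closed(3) K_carrier by simp

lemma f_right: "g \<in> carrier G ==> k \<in> K ==> f (g \<otimes> k) = f g"
 using f_inv[of g "\<one>" k] K_closed(3) K_carrier by simp

lemma jU_closed: "j U \<phi> \<in> carrier E" by (rule j_closed[OF U_level \<phi>])

lemma F_closed: "F\<^sub>f \<in> carrier C"
 unfolding F\<^sub>f_def
proof (rule C_I[where A = "(%g. g \<star> K) ` {g \<in> carrier G. f g ~= \<zero>\<^bsub>R\<^esub>}"])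
 show "finite ((%g. g \<star> K) ` {g \<in> carrier G. f g ~= \<zero>\<^bsub>R\<^esub>})" by (rule f_fin)
 fix g assume g: "g \<in> carrier G"
 show "e (f g) \<odot>\<^bsub>E\<^esub> j U \<phi> \<in> carrier E" using f_mem[OF g] jU_closed by simp
 show "e (f (g \<otimes> k)) \<odot>\<^bsub>E\<^esub> j U \<phi> = e (f g) \<odot>\<^bsub>E\<^esub> j U \<phi>" if "k \<in> K" for k
  using f_right[OF g that] by simp
 assume n: "e (f g) \<odot>\<^bsub>E\<^esub> j U \<phi> ~= \<zero>\<^bsub>E\<^esub>"
 have "f g ~= \<zero>\<^bsub>R\<^esub>"
 proof
  assume "f g = \<zero>\<^bsub>R\<^esub>"
  then show False using n EM.smult_l_null[OF jU_closed] by simp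
 qed
 then show "g \<star> K \<in> (%g. g \<star> K) ` {g \<in> carrier G. f g ~= \<zero>\<^bsub>R\<^esub>}" using g by blast
qed

abbreviation "\<phi>r \<g> \<equiv> pull N (U \<inter> S \<g>) \<one> U \<phi>"
text \<open>What the coset \<gamma>K contributes at level S g: \<phi> restricted to the stabilizer
  of \<gamma>K in U, pushed forward along an element h that moves gK to \<gamma>K.\<close>

definition "w g \<g> = push N (U \<inter> S \<g>) (hh g \<g>) (S g) (\<phi>r \<g>)"

lemma US_level: "\<g> \<in> carrier G ==> U \<inter> S \<g> \<in> \<L>"
 by (rule levels_Int[OF U_level S_level])

lemma \<phi>r_closed: "\<g> \<in> carrier G ==> \<phi>r \<g> \<in> carrier (obj N (U \<inter> S \<g>))"
 by (rule restriction_closed[OF U_level US_level _ \<phi>]) auto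

lemma w_closed: "g \<in> carrier G ==> orb g \<g> ==> w g \<g> \<in> carrier (obj N (S g))"
 unfolding w_def using S_orb[of g \<g>]
 by (intro push_closed US_level S_level \<phi>r_closed) auto

text \<open>The trace is constant along the U-orbit of \<gamma>K: f is left invariant under u, and u
  fixes the class of \<phi> in the colimit because \<phi> lives at level U, so that
  \<open>Tr_act\<close> removes u.\<close>

lemma trace_at_F:
 assumes g: "g \<in> carrier G" and ob: "orb g \<g>" and u: "u \<in> U"
 shows "trace_at g F\<^sub>f (u \<otimes> hh g \<g>) = (e (f \<g>) \<otimes>\<^bsub>\<Phi>\<^esub> \<rho> (ix (U \<inter> S \<g>) U)) \<odot>\<^bsub>DV (S g)\<^esub> pt (S g) (w g \<g>)"
proof -
 interpret M: Module.module \<Phi> "DV (S g)" by (rule DV_module[OF S_level[OF g]])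
 let ?h = "hh g \<g>"
 obtain k where k: "?h \<in> H" "k \<in> K" "\<g> = ?h \<otimes> g \<otimes> k" using hh[OF ob] .
 have uHK: "u \<in> H" "u \<in> K" using u by auto
 note c = H_carrier[OF k(1)] H_carrier[OF uHK(1)] g
 have hgc: "?h \<otimes> g \<in> carrier G" using c by simp
 have "f (u \<otimes> (?h \<otimes> g)) = f (?h \<otimes> g)" by (rule f_left[OF hgc uHK(2)])
 also have "\<dots> = f (?h \<otimes> g \<otimes> k)" by (rule f_right[OF hgc k(2), symmetric])
 finally have ff: "f (u \<otimes> ?h \<otimes> g) = f \<g>" using k(3) c by (simp add: G.m_assoc)
 have U_sub: "subgroup U G" by (rule levels_sub(2)[OF U_level])
 have "act u (j U \<phi>) = j U \<phi>"
  using act_j[OF uHK(1) U_level \<phi>] G.conj_by_self[OF U_sub u] pull_mem[OF U_level u \<phi>] by simp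
 then have T: "Tr (u \<otimes> ?h) g (j U \<phi>) = Tr ?h g (j U \<phi>)"
  using Tr_act[OF uHK(1) k(1) g jU_closed] by simp
 have "trace_at g F\<^sub>f (u \<otimes> ?h) = Tr (u \<otimes> ?h) g (e (f \<g>) \<odot>\<^bsub>E\<^esub> j U \<phi>)"
  unfolding trace_at_def F\<^sub>f_def using c ff by simp
 also have "\<dots> = e (f \<g>) \<odot>\<^bsub>DV (S g)\<^esub> Tr (u \<otimes> ?h) g (j U \<phi>)"
  by (rule linear_maps_smult[OF Tr_linear[OF H_closed(1)[OF uHK(1) k(1)] g] _ jU_closed])
   (simp add: f_mem S_orb(4)[OF g ob])
 also have "\<dots> = e (f \<g>) \<odot>\<^bsub>DV (S g)\<^esub> (\<rho> (ix (U \<inter> S \<g>) U) \<odot>\<^bsub>DV (S g)\<^esub> pt (S g) (w g \<g>))"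
  unfolding T Tr_j[OF k(1) g U_level \<phi>] S_orb(1)[OF g ob, symmetric] w_def ..
 also have "\<dots> = (e (f \<g>) \<otimes>\<^bsub>\<Phi>\<^esub> \<rho> (ix (U \<inter> S \<g>) U)) \<odot>\<^bsub>DV (S g)\<^esub> pt (S g) (w g \<g>)"
  by (rule M.smult_assoc1[symmetric])
   (use f_mem S_orb(4)[OF g ob] rho_closed pt_closed[OF S_level[OF g] w_closed[OF g ob]] in auto)
 finally show ?thesis .
qed

lemma double_cosetI: "a \<in> A ==> b \<in> B ==> x = a \<otimes> g \<otimes> b ==> x \<in> double_coset G A g B"
 by (auto simp: double_coset_def)

text \<open>Finitely many inequivalent representatives of double cosets UgK that cover the support
  of f. Points where f vanishes are permitted, since they contribute nothing to the sums.\<close>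

definition "double_reps X \<longleftrightarrow> finite X \<and> X \<subseteq> carrier G \<and>
  (\<forall>\<g>\<in>X. \<forall>\<g>'\<in>X. \<g>' \<in> double_coset G U \<g> K --> \<g>' = \<g>) \<and>
  (\<forall>q\<in>carrier G. f q ~= \<zero>\<^bsub>R\<^esub> --> (\<exists>\<g>\<in>X. q \<in> double_coset G U \<g> K))"

text \<open>The part of the H-orbit of gK where f is nonzero is covered by U-orbits of the points
  \<gamma>K. Each such orbit has [U : U \<inter> S \<gamma>] points with equal contributions, each
  carrying the inverse of this number as its volume factor. What is left is an element of the form x
  \<otimes> 1 without denominators.\<close>

lemma lam_F:
 assumes g: "g \<in> carrier G" and X: "double_reps X"
 shows "lam g F\<^sub>f = pt (S g) (\<Oplus>\<^bsub>obj N (S g)\<^esub>\<g>\<in>{\<g>\<in>X. orb g \<g>}. f \<g> \<odot>\<^bsub>obj N (S g)\<^esub> w g \<g>)"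
proof -
 interpret M: Module.module \<Phi> "DV (S g)" by (rule DV_module[OF S_level[OF g]])
 interpret NS: Module.module R "obj N (S g)" by (rule N_module[OF S_level[OF g]])
 have X': "finite X" "X \<subseteq> carrier G" "\<And>\<g> \<g>'. \<g> \<in> X ==> \<g>' \<in> X ==> \<g>' \<in> double_coset G U \<g> K ==> \<g>' = \<g>"
  "\<And>q. q \<in> carrier G ==> f q ~= \<zero>\<^bsub>R\<^esub> ==> \<exists>\<g>\<in>X. q \<in> double_coset G U \<g> K"
  using X unfolding double_reps_def by blast+
 let ?X = "{\<g>\<in>X. orb g \<g>}"
 \<comment> \<open>The U-orbit of \<gamma>K, transported to H/S_g by the orbit-stabilizer
   correspondence.\<close>
 define Orb where "Orb \<g> = (%u. (u \<otimes> hh g \<g>) \<star> S g) ` U" for \<g>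
 have Osub: "Orb \<g> \<subseteq> orbit_cosets g" if "orb g \<g>" for \<g>
  unfolding Orb_def orbit_cosets_def using S_orb(2)[OF g that] H_closed(1) by blast
 \<comment> \<open>The stabilizer of \<gamma>K in U is U \<inter> S \<gamma>; hence the orbit is as
   large as U/(U \<inter> S \<gamma>).\<close>
 have kern: "(u \<otimes> hh g \<g>) \<star> S g = (u' \<otimes> hh g \<g>) \<star> S g \<longleftrightarrow> u \<star> (U \<inter> S \<g>) = u' \<star> (U \<inter> S \<g>)"
  if ob: "orb g \<g>" and u: "u \<in> U" "u' \<in> U" for \<g> u u'
 proof -
  let ?h = "hh g \<g>"
  have h: "?h \<in> H" by (rule S_orb(2)[OF g ob])
  have uH: "u \<in> H" "u' \<in> H" using u by auto
  note c = H_carrier[OF h] uH[THEN H_carrier] g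
  have "(u \<otimes> ?h) \<star> S g = (u' \<otimes> ?h) \<star> S g \<longleftrightarrow> u \<star> S (?h \<otimes> g) = u' \<star> S (?h \<otimes> g)"
   using coset_S_iff[OF H_closed(1)[OF uH(1) h] H_closed(1)[OF uH(2) h] g] coset_S_iff[OF uH hg[OF h g]] c
   by (simp add: G.m_assoc)
  also have "\<dots> \<longleftrightarrow> inv u \<otimes> u' \<in> S \<g>"
   unfolding S_orb(1)[OF g ob, symmetric]
   by (rule G.l_coset_eq_iff[OF levels_sub(2)[OF S_level[OF S_orb(4)[OF g ob]]] c(2,3)])
  also have "\<dots> \<longleftrightarrow> inv u \<otimes> u' \<in> U \<inter> S \<g>"
   using u H_closed K_closed by simp
  also have "\<dots> \<longleftrightarrow> u \<star> (U \<inter> S \<g>) = u' \<star> (U \<inter> S \<g>)"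
   by (rule G.l_coset_eq_iff[OF levels_sub(2)[OF US_level[OF S_orb(4)[OF g ob]]] c(2,3), symmetric])
  finally show ?thesis .
 qed
 have cardO: "card (Orb \<g>) = card ((%u. u \<star> (U \<inter> S \<g>)) ` U)" if "orb g \<g>" for \<g>
  unfolding Orb_def by (rule card_image_eq_kernel[OF kern[OF that]])
 have ne: "card (Orb \<g>) ~= 0" and finO: "finite (Orb \<g>)" if "orb g \<g>" for \<g>
 proof -
  have "finite ((%u. u \<star> (U \<inter> S \<g>)) ` U)"
   by (rule index_finite[OF US_level[OF S_orb(4)[OF g that]] U_level]) auto
  moreover have "U ~= {}" using H_closed(3) K_closed(3) by blast
  ultimately show n: "card (Orb \<g>) ~= 0" unfolding cardO[OF that] card_eq_0_iff image_is_empty by blast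
  show "finite (Orb \<g>)" by (rule ccontr) (use n in simp)
 qed
 have tO: "trace_at g F\<^sub>f (rep D) = (e (f \<g>) \<otimes>\<^bsub>\<Phi>\<^esub> \<rho> (ix (U \<inter> S \<g>) U)) \<odot>\<^bsub>DV (S g)\<^esub> pt (S g) (w g \<g>)"
  if ob: "orb g \<g>" and "D \<in> Orb \<g>" for \<g> D
 proof -
  obtain u where u: "u \<in> U" "D = (u \<otimes> hh g \<g>) \<star> S g" using \<open>D \<in> Orb \<g>\<close> by (auto simp: Orb_def)
  have "u \<otimes> hh g \<g> \<in> H" using u S_orb(2)[OF g ob] H_closed(1) by blast
  then show ?thesis using trace_at_rep[OF g F_closed] trace_at_F[OF g ob u(1)] u(2) by simp
 qed
 have cl: "e (f \<g>) \<otimes>\<^bsub>\<Phi>\<^esub> \<rho> q \<in> carrier \<Phi>" "pt (S g) (w g \<g>) \<in> carrier (DV (S g))" if "orb g \<g>" for \<g> q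
  using f_mem S_orb(4)[OF g that] rho_closed pt_closed[OF S_level[OF g] w_closed[OF g that]] by auto
 have sumO: "(\<Oplus>\<^bsub>DV (S g)\<^esub>D\<in>Orb \<g>. trace_at g F\<^sub>f (rep D)) = pt (S g) (f \<g> \<odot>\<^bsub>obj N (S g)\<^esub> w g \<g>)" if ob: "orb g \<g>" for \<g>
 proof -
  let ?a = "pt (S g) (w g \<g>)" and ?c = "e (f \<g>) \<otimes>\<^bsub>\<Phi>\<^esub> \<rho> (ix (U \<inter> S \<g>) U)" and ?n = "card (Orb \<g>)"
  note \<g> = S_orb(4)[OF g ob]
  have ca: "?c \<odot>\<^bsub>DV (S g)\<^esub> ?a \<in> carrier (DV (S g))" by (rule M.smult_closed[OF cl(1)[OF ob] cl(2)[OF ob]])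
  have "(\<Oplus>\<^bsub>DV (S g)\<^esub>D\<in>Orb \<g>. trace_at g F\<^sub>f (rep D)) = (\<Oplus>\<^bsub>DV (S g)\<^esub>D\<in>Orb \<g>. ?c \<odot>\<^bsub>DV (S g)\<^esub> ?a)"
   by (rule M.finsum_cong'[OF refl]) (use ca tO[OF ob] in auto)
  also have "\<dots> = [?n] \<cdot>\<^bsub>DV (S g)\<^esub> (?c \<odot>\<^bsub>DV (S g)\<^esub> ?a)" by (rule M.add.finprod_const[OF ca])
  also have "\<dots> = ([?n] \<cdot>\<^bsub>\<Phi>\<^esub> \<one>\<^bsub>\<Phi>\<^esub>) \<odot>\<^bsub>DV (S g)\<^esub> (?c \<odot>\<^bsub>DV (S g)\<^esub> ?a)"
   by (rule module_nat_mult[OF M.module_axioms ca])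
  also have "\<dots> = \<rho> (of_nat ?n) \<odot>\<^bsub>DV (S g)\<^esub> (?c \<odot>\<^bsub>DV (S g)\<^esub> ?a)" by (simp only: rho_of_nat)
  also have "\<dots> = (\<rho> (of_nat ?n) \<otimes>\<^bsub>\<Phi>\<^esub> ?c) \<odot>\<^bsub>DV (S g)\<^esub> ?a"
   by (rule M.smult_assoc1[OF rho_closed cl(1)[OF ob] cl(2)[OF ob], symmetric])
  also have "\<rho> (of_nat ?n) \<otimes>\<^bsub>\<Phi>\<^esub> ?c = e (f \<g>) \<otimes>\<^bsub>\<Phi>\<^esub> \<rho> (of_nat ?n * ix (U \<inter> S \<g>) U)"
   unfolding rho_mult using f_mem[OF \<g>] rho_closed by (simp add: \<Phi>.m_lcomm)
  \<comment> \<open>The cancellation: the orbit length times the relative volume of the stabilizer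
    is the relative volume of U itself, which is 1.\<close>
  also have "of_nat ?n * ix (U \<inter> S \<g>) U = ix U U"
   unfolding cardO[OF ob] by (rule haar_index_card[OF US_level[OF \<g>] U_level U_level, symmetric]) auto
  also have "ix U U = 1"
   using haar_index_real[OF U_level U_level] meas_pos[OF U_level] of_rat_eq_1_iff by (metis divide_self less_irrefl)
  also have "e (f \<g>) \<otimes>\<^bsub>\<Phi>\<^esub> \<rho> 1 = e (f \<g>)" using f_mem[OF \<g>] by (simp add: rho_one)
  also have "e (f \<g>) \<odot>\<^bsub>DV (S g)\<^esub> ?a = pt (S g) (f \<g> \<odot>\<^bsub>obj N (S g)\<^esub> w g \<g>)"
   by (rule SE_pure_smult[OF N_module[OF S_level[OF g]] f_mem[OF \<g>] w_closed[OF g ob] \<Phi>.one_closed, symmetric])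
  finally show ?thesis .
 qed
 \<comment> \<open>A common point of two orbits puts \<gamma>' into U\<gamma>K, and members of X are
   inequivalent in this sense.\<close>
 have disj: "disjnt (Orb \<g>) (Orb \<g>')" if \<g>: "\<g> \<in> ?X" "\<g>' \<in> ?X" "\<g> ~= \<g>'" for \<g> \<g>'
 proof (rule ccontr)
  assume "\<not> disjnt (Orb \<g>) (Orb \<g>')"
  then obtain u u' where u: "u \<in> U" "u' \<in> U" "(u \<otimes> hh g \<g>) \<star> S g = (u' \<otimes> hh g \<g>') \<star> S g"
   unfolding Orb_def disjnt_def by blast
  obtain k where k: "hh g \<g> \<in> H" "k \<in> K" "\<g> = hh g \<g> \<otimes> g \<otimes> k" using hh \<g> by blast
  obtain k' where k': "hh g \<g>' \<in> H" "k' \<in> K" "\<g>' = hh g \<g>' \<otimes> g \<otimes> k'" using hh \<g> by blast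
  have uH: "u \<in> H" "u' \<in> H" using u by auto
  let ?a = "hh g \<g> \<otimes> g" and ?a' = "hh g \<g>' \<otimes> g"
  have c: "?a \<in> carrier G" "?a' \<in> carrier G" "u \<in> carrier G" "u' \<in> carrier G" "k \<in> carrier G" "k' \<in> carrier G"
   using hg[OF k(1) g] hg[OF k'(1) g] uH H_carrier K_carrier k(2) k'(2) by auto
  have "(u \<otimes> ?a) \<star> K = (u' \<otimes> ?a') \<star> K"
   using coset_S_iff[OF H_closed(1)[OF uH(1) k(1)] H_closed(1)[OF uH(2) k'(1)] g] u(3) H_carrier k(1) k'(1) uH g
   by (simp add: G.m_assoc)
  then have "u' \<otimes> ?a' \<in> (u \<otimes> ?a) \<star> K"
   using G.l_coset_self[OF K_subgroup, of "u' \<otimes> ?a'"] c by simp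
  then obtain l where l: "l \<in> K" "u' \<otimes> ?a' = u \<otimes> ?a \<otimes> l" by (auto simp: l_coset_def)
  note lG = K_carrier[OF l(1)]
  have \<g>G: "\<g> \<in> carrier G" "\<g>' \<in> carrier G" using X'(2) \<g> by auto
  have ak: "?a = \<g> \<otimes> inv k" by (rule iffD2[OF G.inv_solve_right[OF c(1) \<g>G(1) c(5)] k(3)])
  have "?a' = inv u' \<otimes> (u \<otimes> ?a \<otimes> l)"
   by (rule iffD2[OF G.inv_solve_left l(2)[symmetric]]) (use c lG in simp_all)
  then have "\<g>' = inv u' \<otimes> (u \<otimes> ?a \<otimes> l) \<otimes> k'" using k'(3) by simp
  also have "\<dots> = (inv u' \<otimes> u) \<otimes> \<g> \<otimes> (inv k \<otimes> l \<otimes> k')"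
   unfolding ak using c lG \<g>G by (simp add: G.m_assoc)
  finally have "\<g>' \<in> double_coset G U \<g> K"
   using u k(2) k'(2) l(1) H_closed K_closed by (intro double_cosetI) auto
  then show False using X'(3) \<g> by blast
 qed
 \<comment> \<open>A coset with nonzero contribution is a point of G/K where f does not vanish, so
   it lies in U\<gamma>K for some \<gamma> in X, and this \<gamma> is in the same double coset
   HgK.\<close>
 have cover: "D \<in> (\<Union>\<g>\<in>?X. Orb \<g>)" if D: "D \<in> orbit_cosets g" and n: "F\<^sub>f (rep D \<otimes> g) ~= \<zero>\<^bsub>E\<^esub>" for D
 proof -
  note r = rep_props[OF g D]
  note rG = H_carrier[OF r(1)]
  have rg: "rep D \<otimes> g \<in> carrier G" using rG g by simp
  have "f (rep D \<otimes> g) ~= \<zero>\<^bsub>R\<^esub>"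
  proof
   assume "f (rep D \<otimes> g) = \<zero>\<^bsub>R\<^esub>"
   then show False using n rg EM.smult_l_null[OF jU_closed] by (simp add: F\<^sub>f_def)
  qed
  then obtain \<g> where \<g>: "\<g> \<in> X" "rep D \<otimes> g \<in> double_coset G U \<g> K" using X'(4)[OF rg] by blast
  then obtain u k where uk: "u \<in> U" "k \<in> K" "rep D \<otimes> g = u \<otimes> \<g> \<otimes> k" by (auto simp: double_coset_def)
  have "orb \<g> (rep D \<otimes> g)" unfolding orb_def using uk by blast
  moreover have \<g>G: "\<g> \<in> carrier G" using \<g> X'(2) by blast
  moreover have "orb g (rep D \<otimes> g)" unfolding orb_def using r(1) K_closed(3) rg by (metis G.r_one)
  ultimately have ob: "orb g \<g>" using orb_sym orb_trans g by blast
  obtain l where l: "hh g \<g> \<in> H" "l \<in> K" "\<g> = hh g \<g> \<otimes> g \<otimes> l" using hh[OF ob] .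
  have uH: "u \<in> H" using uk by simp
  note c = H_carrier[OF uH] H_carrier[OF l(1)] K_carrier[OF l(2)] K_carrier[OF uk(2)] g
  have e: "rep D \<otimes> g = (u \<otimes> hh g \<g> \<otimes> g) \<otimes> (l \<otimes> k)"
   using uk(3) c by (subst (asm) l(3)) (simp add: G.m_assoc)
  have "rep D \<otimes> g \<in> (u \<otimes> hh g \<g> \<otimes> g) \<star> K"
   unfolding l_coset_def using e K_closed(1)[OF l(2) uk(2)] by blast
  then have "(u \<otimes> hh g \<g> \<otimes> g) \<star> K = (rep D \<otimes> g) \<star> K"
   using c by (intro G.l_repr_independence[OF _ _ K_subgroup]) auto
  then have "(u \<otimes> hh g \<g>) \<star> S g = D"
   using coset_S_iff[OF H_closed(1)[OF uH l(1)] r(1) g] r(2) by simp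
  then have "D \<in> Orb \<g>" unfolding Orb_def using uk(1) by blast
  then show ?thesis using \<g>(1) ob by blast
 qed
 have finX: "finite ?X" using X'(1) by simp
 have "lam g F\<^sub>f = (\<Oplus>\<^bsub>DV (S g)\<^esub>D\<in>(\<Union>\<g>\<in>?X. Orb \<g>). trace_at g F\<^sub>f (rep D))"
  by (rule lam_superset[OF g F_closed]) (use finX finO Osub cover in blast)+
 also have "\<dots> = (\<Oplus>\<^bsub>DV (S g)\<^esub>\<g>\<in>?X. \<Oplus>\<^bsub>DV (S g)\<^esub>D\<in>Orb \<g>. trace_at g F\<^sub>f (rep D))"
 proof (rule M.add.finprod_UN_disjoint[OF finX])
  show "pairwise (%i j. disjnt (Orb i) (Orb j)) ?X" unfolding pairwise_def using disj by blast
  show "trace_at g F\<^sub>f (rep x) \<in> carrier (DV (S g))" if "i \<in> ?X" "x \<in> Orb i" for i x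
   using trace_at_closed[OF g F_closed rep_props(1)[OF g]] Osub that by auto
 qed (use finO in blast)
 also have "\<dots> = (\<Oplus>\<^bsub>DV (S g)\<^esub>\<g>\<in>?X. pt (S g) (f \<g> \<odot>\<^bsub>obj N (S g)\<^esub> w g \<g>))"
 proof (rule M.finsum_cong'[OF refl])
  show "(%\<g>. pt (S g) (f \<g> \<odot>\<^bsub>obj N (S g)\<^esub> w g \<g>)) \<in> ?X \<rightarrow> carrier (DV (S g))"
   using f_mem X'(2) w_closed[OF g] by (intro funcsetI pt_closed[OF S_level[OF g]] NS.smult_closed) blast+
 qed (use sumO in blast)
 also have "\<dots> = pt (S g) (\<Oplus>\<^bsub>obj N (S g)\<^esub>\<g>\<in>?X. f \<g> \<odot>\<^bsub>obj N (S g)\<^esub> w g \<g>)"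
  by (rule SE_pure_finsum[OF N_module[OF S_level[OF g]] finX _ \<Phi>.one_closed, symmetric])
   (use f_mem X'(2) w_closed[OF g] in \<open>blast intro: funcsetI NS.smult_closed\<close>)
 finally show ?thesis .
qed

text \<open>A zeta element unpacked into finite data: one point per coset of its support and, at
  each point, the expansion from condition (i). The containment of \<open>V p i\<close> in
  \<open>S p\<close> comes from that in the conjugate of L, as L is contained in K.\<close>

definition "zeta_data \<zeta> pts n V x \<longleftrightarrow> \<zeta> \<in> carrier C \<and> finite pts \<and> pts \<subseteq> carrier G \<and>
  (\<forall>p\<in>pts. \<forall>p'\<in>pts. p \<star> K = p' \<star> K --> p = p') \<and>
  (\<forall>q\<in>carrier G. \<zeta> q ~= \<zero>\<^bsub>E\<^esub> --> (\<exists>p\<in>pts. p \<star> K = q \<star> K)) \<and>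
  (\<forall>p\<in>pts. \<forall>i<(n p :: nat). V p i \<in> \<L> \<and> V p i \<subseteq> S p \<and> x p i \<in> carrier (obj N (V p i))) \<and>
  (\<forall>p\<in>pts. \<zeta> p = (\<Oplus>\<^bsub>E\<^esub>i\<in>{..<n p}. \<rho> (ix U (V p i)) \<odot>\<^bsub>E\<^esub> j (V p i) (x p i)))"

lemma zeta_dataD:
 assumes "zeta_data \<zeta> pts n V x"
 shows "\<zeta> \<in> carrier C" "finite pts" "pts \<subseteq> carrier G"
  "\<And>p p'. p \<in> pts ==> p' \<in> pts ==> p \<star> K = p' \<star> K ==> p = p'"
  "\<And>q. q \<in> carrier G ==> \<zeta> q ~= \<zero>\<^bsub>E\<^esub> ==> \<exists>p\<in>pts. p \<star> K = q \<star> K"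
  "\<And>p i. p \<in> pts ==> i < n p ==> V p i \<in> \<L>"
  "\<And>p i. p \<in> pts ==> i < n p ==> V p i \<subseteq> S p"
  "\<And>p i. p \<in> pts ==> i < n p ==> x p i \<in> carrier (obj N (V p i))"
  "\<And>p. p \<in> pts ==> \<zeta> p = (\<Oplus>\<^bsub>E\<^esub>i\<in>{..<n p}. \<rho> (ix U (V p i)) \<odot>\<^bsub>E\<^esub> j (V p i) (x p i))"
 using assms unfolding zeta_data_def by blast+

lemma zeta_push_closed:
 assumes "zeta_data \<zeta> pts n V x" "g \<in> carrier G" "p \<in> pts" "orb g p" "i < n p"
 shows "push N (V p i) (hh g p) (S g) (x p i) \<in> carrier (obj N (S g))"
 using zeta_dataD(6-8)[OF assms(1,3,5)] S_orb[OF assms(2,4)] S_level[OF assms(2)]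
 by (intro push_closed) auto

text \<open>Because V p i already lies in the stabilizer S p, taking the trace involves no
  restriction, only the factor [V:U]. It cancels the factor [U:V] in the expansion of the zeta
  element, so the result is again of the form x \<otimes> 1.\<close>

lemma lam_zeta:
 assumes g: "g \<in> carrier G" and z: "zeta_data \<zeta> pts n V x"
 shows "lam g \<zeta> = pt (S g) (\<Oplus>\<^bsub>obj N (S g)\<^esub>p\<in>{p\<in>pts. orb g p}. \<Oplus>\<^bsub>obj N (S g)\<^esub>i\<in>{..<n p}. push N (V p i) (hh g p) (S g) (x p i))"
proof -
 interpret M: Module.module \<Phi> "DV (S g)" by (rule DV_module[OF S_level[OF g]])
 interpret NS: Module.module R "obj N (S g)" by (rule N_module[OF S_level[OF g]])
 note zd = zeta_dataD[OF z]
 let ?P = "{p\<in>pts. orb g p}"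
 let ?D = "%p. hh g p \<star> S g"
 have finP: "finite ?P" using zd(2) by simp
 have pcoset: "(hh g p \<otimes> g) \<star> K = p \<star> K" if ob: "orb g p" for p
 proof -
  obtain k where k: "hh g p \<in> H" "k \<in> K" "p = hh g p \<otimes> g \<otimes> k" using hh[OF ob] .
  have "p \<in> (hh g p \<otimes> g) \<star> K" unfolding l_coset_def using k(2,3) by blast
  then show ?thesis using hg[OF k(1) g] by (intro G.l_repr_independence[OF _ _ K_subgroup]) auto
 qed
 have inj: "inj_on ?D ?P"
 proof (rule inj_onI)
  fix p p' assume p: "p \<in> ?P" "p' \<in> ?P" "?D p = ?D p'"
  then have "p \<star> K = p' \<star> K"
   using coset_S_iff[OF S_orb(2)[OF g] S_orb(2)[OF g] g, of p p'] pcoset[of p] pcoset[of p'] by simp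
  then show "p = p'" using zd(4) p by blast
 qed
 have Dsub: "?D ` ?P \<subseteq> orbit_cosets g" unfolding orbit_cosets_def using S_orb(2)[OF g] by blast
 have tm: "trace_at g \<zeta> (rep (?D p)) = pt (S g) (\<Oplus>\<^bsub>obj N (S g)\<^esub>i\<in>{..<n p}. push N (V p i) (hh g p) (S g) (x p i))"
  if p: "p \<in> pts" and ob: "orb g p" for p
 proof -
  let ?h = "hh g p"
  note h = S_orb(2)[OF g ob]
  note T = Tr_linear[OF h g]
  have jc: "\<rho> (ix U (V p i)) \<odot>\<^bsub>E\<^esub> j (V p i) (x p i) \<in> carrier E" "j (V p i) (x p i) \<in> carrier E" if "i < n p" for i
   using rho_closed j_closed[OF zd(6)[OF p that] zd(8)[OF p that]] by auto
  have single: "Tr ?h g (\<rho> (ix U (V p i)) \<odot>\<^bsub>E\<^esub> j (V p i) (x p i)) = pt (S g) (push N (V p i) ?h (S g) (x p i))" if i: "i < n p" for i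
  proof -
   note V = zd(6)[OF p i] zd(7)[OF p i] zd(8)[OF p i]
   have VS: "V p i \<inter> S (?h \<otimes> g) = V p i" using V(2) S_orb(1)[OF g ob] by blast
   have pc: "pt (S g) (push N (V p i) ?h (S g) (x p i)) \<in> carrier (DV (S g))"
    by (rule pt_closed[OF S_level[OF g] zeta_push_closed[OF z g p ob i]])
   have "Tr ?h g (\<rho> (ix U (V p i)) \<odot>\<^bsub>E\<^esub> j (V p i) (x p i)) =
     \<rho> (ix U (V p i)) \<odot>\<^bsub>DV (S g)\<^esub> (\<rho> (ix (V p i) U) \<odot>\<^bsub>DV (S g)\<^esub> pt (S g) (push N (V p i) ?h (S g) (x p i)))"
    using linear_maps_smult[OF T rho_closed jc(2)[OF i]] Tr_j[OF h g V(1,3)] pull_one[OF V(1,3)] unfolding VS by simp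
   also have "\<dots> = \<rho> (ix U (V p i) * ix (V p i) U) \<odot>\<^bsub>DV (S g)\<^esub> pt (S g) (push N (V p i) ?h (S g) (x p i))"
    unfolding rho_mult by (rule M.smult_assoc1[OF rho_closed rho_closed pc, symmetric])
   also have "\<dots> = pt (S g) (push N (V p i) ?h (S g) (x p i))"
    unfolding haar_index_inverse[OF U_level V(1)] rho_one by (rule M.smult_one[OF pc])
   finally show ?thesis .
  qed
  have "trace_at g \<zeta> (rep (?D p)) = Tr ?h g (\<zeta> p)"
   using trace_at_rep[OF g zd(1) h] C_orb[OF zd(1) g ob] by (simp add: trace_at_def)
  also have "\<dots> = (\<Oplus>\<^bsub>DV (S g)\<^esub>i\<in>{..<n p}. Tr ?h g (\<rho> (ix U (V p i)) \<odot>\<^bsub>E\<^esub> j (V p i) (x p i)))"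
   unfolding zd(9)[OF p] by (rule linear_maps_finsum[OF E_module M.module_axioms T]) (use jc in auto)
  also have "\<dots> = (\<Oplus>\<^bsub>DV (S g)\<^esub>i\<in>{..<n p}. pt (S g) (push N (V p i) ?h (S g) (x p i)))"
   by (rule M.finsum_cong'[OF refl])
    (use single pt_closed[OF S_level[OF g] zeta_push_closed[OF z g p ob]] in auto)
  also have "\<dots> = pt (S g) (\<Oplus>\<^bsub>obj N (S g)\<^esub>i\<in>{..<n p}. push N (V p i) ?h (S g) (x p i))"
   by (rule SE_pure_finsum[OF N_module[OF S_level[OF g]] finite_lessThan _ \<Phi>.one_closed, symmetric])
    (use zeta_push_closed[OF z g p ob] in auto)
  finally show ?thesis .
 qed
 have sc: "(\<Oplus>\<^bsub>obj N (S g)\<^esub>i\<in>{..<n p}. push N (V p i) (hh g p) (S g) (x p i)) \<in> carrier (obj N (S g))" if "p \<in> ?P" for p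
  by (rule NS.finsum_closed) (use that zeta_push_closed[OF z g] in auto)
 have "lam g \<zeta> = (\<Oplus>\<^bsub>DV (S g)\<^esub>D\<in>?D ` ?P. trace_at g \<zeta> (rep D))"
 proof (rule lam_superset[OF g zd(1) finite_imageI[OF finP] Dsub])
  fix D assume D: "D \<in> orbit_cosets g" and n: "\<zeta> (rep D \<otimes> g) ~= \<zero>\<^bsub>E\<^esub>"
  note r = rep_props[OF g D]
  have rg: "rep D \<otimes> g \<in> carrier G" by (rule hg[OF r(1) g])
  obtain p where p: "p \<in> pts" "p \<star> K = (rep D \<otimes> g) \<star> K" using zd(5)[OF rg n] by blast
  have "p \<in> (rep D \<otimes> g) \<star> K" using G.l_coset_self[OF K_subgroup, of p] p zd(3) by auto
  then have ob: "orb g p" unfolding orb_def l_coset_def using r(1) by blast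
  have "?D p = rep D \<star> S g"
   using coset_S_iff[OF S_orb(2)[OF g ob] r(1) g] pcoset[OF ob] p(2) by simp
  then show "D \<in> ?D ` ?P" using r(2) p(1) ob by blast
 qed
 also have "\<dots> = (\<Oplus>\<^bsub>DV (S g)\<^esub>p\<in>?P. trace_at g \<zeta> (rep (?D p)))"
  by (rule M.finsum_reindex[OF _ inj], rule funcsetI)
   (use Dsub trace_at_closed[OF g zd(1) rep_props(1)[OF g]] in blast)
 also have "\<dots> = (\<Oplus>\<^bsub>DV (S g)\<^esub>p\<in>?P. pt (S g) (\<Oplus>\<^bsub>obj N (S g)\<^esub>i\<in>{..<n p}. push N (V p i) (hh g p) (S g) (x p i)))"
 proof (rule M.finsum_cong'[OF refl])
  show "(%p. pt (S g) (\<Oplus>\<^bsub>obj N (S g)\<^esub>i\<in>{..<n p}. push N (V p i) (hh g p) (S g) (x p i))) \<in> ?P \<rightarrow> carrier (DV (S g))"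
   by (rule funcsetI) (rule pt_closed[OF S_level[OF g] sc])
 qed (use tm in blast)
 also have "\<dots> = pt (S g) (\<Oplus>\<^bsub>obj N (S g)\<^esub>p\<in>?P. \<Oplus>\<^bsub>obj N (S g)\<^esub>i\<in>{..<n p}. push N (V p i) (hh g p) (S g) (x p i))"
  by (rule SE_pure_finsum[OF N_module[OF S_level[OF g]] finP _ \<Phi>.one_closed, symmetric]) (rule funcsetI, rule sc)
 finally show ?thesis .
qed

text \<open>Both sides become equal after tensoring with the fraction field, being the values of
  \<open>lam g\<close> at two functions with the same class in coinvariants. N(S g) is torsion free,
  hence embeds into its extension of scalars.\<close>

lemma integral_identity:
 assumes g: "g \<in> carrier G" and z: "zeta_data \<zeta> pts n V x" and X: "double_reps X"
  and Z: "Z +>\<^bsub>C\<^esub> \<zeta> = Z +>\<^bsub>C\<^esub> F\<^sub>f"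
 shows "(\<Oplus>\<^bsub>obj N (S g)\<^esub>p\<in>{p\<in>pts. orb g p}. \<Oplus>\<^bsub>obj N (S g)\<^esub>i\<in>{..<n p}. push N (V p i) (hh g p) (S g) (x p i)) =
  (\<Oplus>\<^bsub>obj N (S g)\<^esub>\<g>\<in>{\<g>\<in>X. orb g \<g>}. f \<g> \<odot>\<^bsub>obj N (S g)\<^esub> w g \<g>)"
proof (rule SE_pure_inj_eq[OF N_module[OF S_level[OF g]] N_tf[OF S_level[OF g]]])
 interpret NS: Module.module R "obj N (S g)" by (rule N_module[OF S_level[OF g]])
 have X': "finite X" "X \<subseteq> carrier G" using X unfolding double_reps_def by blast+
 have sc: "(\<Oplus>\<^bsub>obj N (S g)\<^esub>i\<in>{..<n p}. push N (V p i) (hh g p) (S g) (x p i)) \<in> carrier (obj N (S g))" if "p \<in> {p\<in>pts. orb g p}" for p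
  by (rule NS.finsum_closed) (use that zeta_push_closed[OF z g] in auto)
 show "(\<Oplus>\<^bsub>obj N (S g)\<^esub>p\<in>{p\<in>pts. orb g p}. \<Oplus>\<^bsub>obj N (S g)\<^esub>i\<in>{..<n p}. push N (V p i) (hh g p) (S g) (x p i)) \<in> carrier (obj N (S g))"
  by (rule NS.finsum_closed) (rule funcsetI, rule sc)
 show "(\<Oplus>\<^bsub>obj N (S g)\<^esub>\<g>\<in>{\<g>\<in>X. orb g \<g>}. f \<g> \<odot>\<^bsub>obj N (S g)\<^esub> w g \<g>) \<in> carrier (obj N (S g))"
  by (rule NS.finsum_closed) (use f_mem X'(2) w_closed[OF g] in \<open>blast intro: funcsetI NS.smult_closed\<close>)
 show "pt (S g) (\<Oplus>\<^bsub>obj N (S g)\<^esub>p\<in>{p\<in>pts. orb g p}. \<Oplus>\<^bsub>obj N (S g)\<^esub>i\<in>{..<n p}. push N (V p i) (hh g p) (S g) (x p i)) =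
   pt (S g) (\<Oplus>\<^bsub>obj N (S g)\<^esub>\<g>\<in>{\<g>\<in>X. orb g \<g>}. f \<g> \<odot>\<^bsub>obj N (S g)\<^esub> w g \<g>)"
  unfolding lam_zeta[OF g z, symmetric] lam_F[OF g X, symmetric]
  by (rule lam_coinvariants[OF g zeta_dataD(1)[OF z] F_closed Z])
qed

lemma finsum_by_orbit:
 assumes P: "Module.module R Q" and A: "finite A" "A \<subseteq> carrier G" and B: "B \<in> A \<rightarrow> carrier Q"
  and Orb: "finite Orb" "r ` A \<subseteq> Orb"
 shows "(\<Oplus>\<^bsub>Q\<^esub>p\<in>A. B p) = (\<Oplus>\<^bsub>Q\<^esub>ob\<in>Orb. \<Oplus>\<^bsub>Q\<^esub>p\<in>{p\<in>A. r p = ob}. B p)"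
proof -
 interpret P: Module.module R Q by fact
 have "A = (\<Union>ob\<in>Orb. {p\<in>A. r p = ob})" using Orb(2) by auto
 then have "(\<Oplus>\<^bsub>Q\<^esub>p\<in>A. B p) = (\<Oplus>\<^bsub>Q\<^esub>p\<in>(\<Union>ob\<in>Orb. {p\<in>A. r p = ob}). B p)" by simp
 also have "\<dots> = (\<Oplus>\<^bsub>Q\<^esub>ob\<in>Orb. \<Oplus>\<^bsub>Q\<^esub>p\<in>{p\<in>A. r p = ob}. B p)"
  by (rule P.add.finprod_UN_disjoint[OF Orb(1)]) (use A(1) B in \<open>auto simp: pairwise_def disjnt_def\<close>)
 finally show ?thesis .
qed

text \<open>By \<open>b_push\<close>, every term at a point p of HgK equals the fixed linear map b g
  (S g) applied to a pushforward in N(S g). Grouping both sums by double cosets HgK, each group is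
  the image of one side of \<open>integral_identity\<close>. The family b abstracts the global
  construction with all other places frozen.\<close>

theorem local_identity:
 assumes z: "zeta_data \<zeta> pts n V x" and X: "double_reps X"
  and Z: "Z +>\<^bsub>C\<^esub> \<zeta> = Z +>\<^bsub>C\<^esub> F\<^sub>f"
  and P: "Module.module R Q"
  and b_lin: "\<And>g V. g \<in> carrier G ==> V \<in> \<L> ==> V \<subseteq> S g ==> b g V \<in> linear_maps R (obj N V) Q"
  and b_push: "\<And>g h k V x. g \<in> carrier G ==> h \<in> H ==> k \<in> K ==> V \<in> \<L> ==> V \<subseteq> S (h \<otimes> g \<otimes> k) ==>
    x \<in> carrier (obj N V) ==> b (h \<otimes> g \<otimes> k) V x = b g (S g) (push N V h (S g) x)"
 shows "(\<Oplus>\<^bsub>Q\<^esub>p\<in>pts. \<Oplus>\<^bsub>Q\<^esub>i\<in>{..<n p}. b p (V p i) (x p i)) = (\<Oplus>\<^bsub>Q\<^esub>\<g>\<in>X. f \<g> \<odot>\<^bsub>Q\<^esub> b \<g> (U \<inter> S \<g>) (\<phi>r \<g>))"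
proof -
 interpret P: Module.module R Q by fact
 note zd = zeta_dataD[OF z]
 have X': "finite X" "X \<subseteq> carrier G" using X unfolding double_reps_def by blast+
 \<comment> \<open>One fixed representative per double coset HpK: equivalent points satisfy the same
   predicate, so the choice operator returns the same element for them.\<close>
 define r where "r q = (SOME ob. ob \<in> carrier G \<and> orb ob q)" for q
 have r: "r q \<in> carrier G \<and> orb (r q) q" if "q \<in> carrier G" for q
  unfolding r_def by (rule someI[of _ q]) (use that orb_refl in blast)
 have r_eq: "r p = r q" if "p \<in> carrier G" "q \<in> carrier G" "orb p q" for p q
 proof -
  have "(%ob. ob \<in> carrier G \<and> orb ob p) = (%ob. ob \<in> carrier G \<and> orb ob q)"
   using that orb_trans orb_sym by blast
  then show ?thesis unfolding r_def by simp
 qed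
 define Orb where "Orb = r ` (pts \<union> X)"
 have Orb: "finite Orb" unfolding Orb_def using zd(2) X'(1) by simp
 have OG: "ob \<in> carrier G" if "ob \<in> Orb" for ob using that r zd(3) X'(2) unfolding Orb_def by blast
 have fib: "r p = ob \<longleftrightarrow> orb ob p" if ob: "ob \<in> Orb" and pG: "p \<in> carrier G" for ob p
 proof
  show "orb ob p" if "r p = ob" using r[OF pG] that by blast
 next
  assume op: "orb ob p"
  obtain q where q: "q \<in> carrier G" "ob = r q" using ob zd(3) X'(2) unfolding Orb_def by blast
  have "orb q ob" using r[OF q(1)] q orb_sym OG ob by blast
  then have "orb q p" using orb_trans q(1) op by blast
  then show "r p = ob" using r_eq[OF q(1) pG] q by simp
 qed
 have b_orb: "b p W y = b g (S g) (push N W (hh g p) (S g) y)"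
  if gG: "g \<in> carrier G" and gp: "orb g p" and W: "W \<in> \<L>" "W \<subseteq> S p" "y \<in> carrier (obj N W)" for g p W y
 proof -
  obtain k where k: "hh g p \<in> H" "k \<in> K" "p = hh g p \<otimes> g \<otimes> k" using hh[OF gp] .
  show ?thesis using b_push[OF gG k(1,2) W(1) _ W(3)] W(2) k(3)[symmetric] by simp
 qed
 have bl: "b p (V p i) (x p i) \<in> carrier Q" if "p \<in> pts" "i < n p" for p i
  using linear_maps_closed[OF b_lin] zd(6-8)[OF that] zd(3) that by blast
 have Bc: "(%p. \<Oplus>\<^bsub>Q\<^esub>i\<in>{..<n p}. b p (V p i) (x p i)) \<in> pts \<rightarrow> carrier Q"
  by (intro funcsetI P.finsum_closed) (use bl in auto)
 have fc: "f \<g> \<odot>\<^bsub>Q\<^esub> b \<g> (U \<inter> S \<g>) (\<phi>r \<g>) \<in> carrier Q" if "\<g> \<in> X" for \<g>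
 proof -
  have \<g>: "\<g> \<in> carrier G" using that X' by blast
  show ?thesis using linear_maps_closed[OF b_lin[OF \<g> US_level[OF \<g>]] \<phi>r_closed[OF \<g>]] f_mem[OF \<g>] by auto
 qed
 have "(\<Oplus>\<^bsub>Q\<^esub>p\<in>pts. \<Oplus>\<^bsub>Q\<^esub>i\<in>{..<n p}. b p (V p i) (x p i)) =
   (\<Oplus>\<^bsub>Q\<^esub>ob\<in>Orb. \<Oplus>\<^bsub>Q\<^esub>p\<in>{p\<in>pts. r p = ob}. \<Oplus>\<^bsub>Q\<^esub>i\<in>{..<n p}. b p (V p i) (x p i))"
  by (rule finsum_by_orbit[OF P zd(2,3) Bc Orb]) (auto simp: Orb_def)
 also have "\<dots> = (\<Oplus>\<^bsub>Q\<^esub>ob\<in>Orb. \<Oplus>\<^bsub>Q\<^esub>\<g>\<in>{\<g>\<in>X. r \<g> = ob}. f \<g> \<odot>\<^bsub>Q\<^esub> b \<g> (U \<inter> S \<g>) (\<phi>r \<g>))"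
 proof (rule P.finsum_cong'[OF refl])
  show "(%ob. \<Oplus>\<^bsub>Q\<^esub>\<g>\<in>{\<g>\<in>X. r \<g> = ob}. f \<g> \<odot>\<^bsub>Q\<^esub> b \<g> (U \<inter> S \<g>) (\<phi>r \<g>)) \<in> Orb \<rightarrow> carrier Q"
   by (intro funcsetI P.finsum_closed) (use fc in auto)
  fix ob assume ob: "ob \<in> Orb"
  note oG = OG[OF ob]
  interpret NS: Module.module R "obj N (S ob)" by (rule N_module[OF S_level[OF oG]])
  note bo = b_lin[OF oG S_level[OF oG] order_refl]
  have e1: "{p\<in>pts. r p = ob} = {p\<in>pts. orb ob p}" using fib[OF ob] zd(3) by blast
  have e2: "{\<g>\<in>X. r \<g> = ob} = {\<g>\<in>X. orb ob \<g>}" using fib[OF ob] X'(2) by blast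
  have pc: "push N (V p i) (hh ob p) (S ob) (x p i) \<in> carrier (obj N (S ob))" if "p \<in> {p\<in>pts. orb ob p}" "i \<in> {..<n p}" for p i
   using zeta_push_closed[OF z oG] that by auto
  have sc: "(\<Oplus>\<^bsub>obj N (S ob)\<^esub>i\<in>{..<n p}. push N (V p i) (hh ob p) (S ob) (x p i)) \<in> carrier (obj N (S ob))"
   if "p \<in> {p\<in>pts. orb ob p}" for p
   by (rule NS.finsum_closed) (use pc[OF that] in auto)
  have "(\<Oplus>\<^bsub>Q\<^esub>p\<in>{p\<in>pts. orb ob p}. \<Oplus>\<^bsub>Q\<^esub>i\<in>{..<n p}. b p (V p i) (x p i)) =
    (\<Oplus>\<^bsub>Q\<^esub>p\<in>{p\<in>pts. orb ob p}. b ob (S ob) (\<Oplus>\<^bsub>obj N (S ob)\<^esub>i\<in>{..<n p}. push N (V p i) (hh ob p) (S ob) (x p i)))"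
  proof (rule P.finsum_cong'[OF refl])
   show "(%p. b ob (S ob) (\<Oplus>\<^bsub>obj N (S ob)\<^esub>i\<in>{..<n p}. push N (V p i) (hh ob p) (S ob) (x p i))) \<in> {p\<in>pts. orb ob p} \<rightarrow> carrier Q"
    by (rule funcsetI) (rule linear_maps_closed[OF bo sc])
   fix p assume p: "p \<in> {p\<in>pts. orb ob p}"
   have "(\<Oplus>\<^bsub>Q\<^esub>i\<in>{..<n p}. b p (V p i) (x p i)) = (\<Oplus>\<^bsub>Q\<^esub>i\<in>{..<n p}. b ob (S ob) (push N (V p i) (hh ob p) (S ob) (x p i)))"
   proof (rule P.finsum_cong'[OF refl])
    show "(%i. b ob (S ob) (push N (V p i) (hh ob p) (S ob) (x p i))) \<in> {..<n p} \<rightarrow> carrier Q"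
     by (rule funcsetI) (rule linear_maps_closed[OF bo pc[OF p]])
    fix i assume i: "i \<in> {..<n p}"
    show "b p (V p i) (x p i) = b ob (S ob) (push N (V p i) (hh ob p) (S ob) (x p i))"
     using p i zd(6-8)[of p i] oG by (intro b_orb) auto
   qed
   also have "\<dots> = b ob (S ob) (\<Oplus>\<^bsub>obj N (S ob)\<^esub>i\<in>{..<n p}. push N (V p i) (hh ob p) (S ob) (x p i))"
    by (rule linear_maps_finsum[OF NS.module_axioms P bo finite_lessThan, symmetric]) (rule funcsetI, rule pc[OF p])
   finally show "(\<Oplus>\<^bsub>Q\<^esub>i\<in>{..<n p}. b p (V p i) (x p i)) = b ob (S ob) (\<Oplus>\<^bsub>obj N (S ob)\<^esub>i\<in>{..<n p}. push N (V p i) (hh ob p) (S ob) (x p i))" .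
  qed
  also have "\<dots> = b ob (S ob) (\<Oplus>\<^bsub>obj N (S ob)\<^esub>p\<in>{p\<in>pts. orb ob p}. \<Oplus>\<^bsub>obj N (S ob)\<^esub>i\<in>{..<n p}. push N (V p i) (hh ob p) (S ob) (x p i))"
   by (rule linear_maps_finsum[OF NS.module_axioms P bo, symmetric]) (use zd(2) sc in auto)
  also have "\<dots> = b ob (S ob) (\<Oplus>\<^bsub>obj N (S ob)\<^esub>\<g>\<in>{\<g>\<in>X. orb ob \<g>}. f \<g> \<odot>\<^bsub>obj N (S ob)\<^esub> w ob \<g>)"
   by (simp only: integral_identity[OF oG z X Z])
  also have "\<dots> = (\<Oplus>\<^bsub>Q\<^esub>\<g>\<in>{\<g>\<in>X. orb ob \<g>}. b ob (S ob) (f \<g> \<odot>\<^bsub>obj N (S ob)\<^esub> w ob \<g>))"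
   by (rule linear_maps_finsum[OF NS.module_axioms P bo])
    (use X' f_mem w_closed[OF oG] in \<open>auto intro!: NS.smult_closed\<close>)
  also have "\<dots> = (\<Oplus>\<^bsub>Q\<^esub>\<g>\<in>{\<g>\<in>X. orb ob \<g>}. f \<g> \<odot>\<^bsub>Q\<^esub> b \<g> (U \<inter> S \<g>) (\<phi>r \<g>))"
  proof (rule P.finsum_cong'[OF refl])
   show "(%\<g>. f \<g> \<odot>\<^bsub>Q\<^esub> b \<g> (U \<inter> S \<g>) (\<phi>r \<g>)) \<in> {\<g>\<in>X. orb ob \<g>} \<rightarrow> carrier Q"
    by (rule funcsetI, rule fc) blast
   fix \<g> assume "\<g> \<in> {\<g>\<in>X. orb ob \<g>}"
   then have \<g>: "\<g> \<in> carrier G" "orb ob \<g>" using X' by auto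
   have "b \<g> (U \<inter> S \<g>) (\<phi>r \<g>) = b ob (S ob) (w ob \<g>)"
    unfolding w_def by (rule b_orb[OF oG \<g>(2) US_level[OF \<g>(1)] _ \<phi>r_closed[OF \<g>(1)]]) blast
   then show "b ob (S ob) (f \<g> \<odot>\<^bsub>obj N (S ob)\<^esub> w ob \<g>) = f \<g> \<odot>\<^bsub>Q\<^esub> b \<g> (U \<inter> S \<g>) (\<phi>r \<g>)"
    using linear_maps_smult[OF bo f_mem[OF \<g>(1)] w_closed[OF oG \<g>(2)]] by simp
  qed
  finally show "(\<Oplus>\<^bsub>Q\<^esub>p\<in>{p\<in>pts. r p = ob}. \<Oplus>\<^bsub>Q\<^esub>i\<in>{..<n p}. b p (V p i) (x p i)) =
    (\<Oplus>\<^bsub>Q\<^esub>\<g>\<in>{\<g>\<in>X. r \<g> = ob}. f \<g> \<odot>\<^bsub>Q\<^esub> b \<g> (U \<inter> S \<g>) (\<phi>r \<g>))"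
   unfolding e1 e2 .
 qed
 also have "\<dots> = (\<Oplus>\<^bsub>Q\<^esub>\<g>\<in>X. f \<g> \<odot>\<^bsub>Q\<^esub> b \<g> (U \<inter> S \<g>) (\<phi>r \<g>))"
  by (rule finsum_by_orbit[OF P X' _ Orb, symmetric]) (use fc in \<open>auto simp: Orb_def\<close>)
 finally show ?thesis .
qed

end

section \<open>Restricted products and restricted tensor products\<close>

locale restricted_family =
 fixes I :: "'i set" and G :: "'i => ('a, 'b) monoid_scheme" and K :: "'i => 'a set"
 assumes local_group: "\<And>v. v \<in> I ==> group (G v)" and local_subgroup: "\<And>v. v \<in> I ==> subgroup (K v) (G v)"
begin

abbreviation "RP \<equiv> restricted_product I G K"

lemma RP_carrier: "g \<in> carrier RP \<longleftrightarrow> g \<in> (\<Pi>\<^sub>E v\<in>I. carrier (G v)) \<and> finite {v\<in>I. g v \<notin> K v}"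
 by (simp add: restricted_product_def)

lemma RP_mult: "g \<otimes>\<^bsub>RP\<^esub> h = (\<lambda>v\<in>I. g v \<otimes>\<^bsub>G v\<^esub> h v)"
 by (simp add: restricted_product_def)

lemma RP_one: "\<one>\<^bsub>RP\<^esub> = (\<lambda>v\<in>I. \<one>\<^bsub>G v\<^esub>)"
 by (simp add: restricted_product_def)

lemma RP_subgroup: "subgroup (carrier RP) (product_group I G)"
proof -
 interpret P: group "product_group I G" using local_group by simp
 have m: "finite {v\<in>I. x v \<otimes>\<^bsub>G v\<^esub> y v \<notin> K v}" if "finite {v\<in>I. x v \<notin> K v}" "finite {v\<in>I. y v \<notin> K v}" for x y
  by (rule finite_subset[OF _ finite_UnI[OF that]]) (use local_subgroup subgroup.m_closed in fastforce)
 have i: "finite {v\<in>I. inv\<^bsub>G v\<^esub> (x v) \<notin> K v}" if "finite {v\<in>I. x v \<notin> K v}" for x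
  by (rule finite_subset[OF _ that]) (use local_subgroup subgroup.m_inv_closed in fastforce)
 show ?thesis
 proof (rule P.subgroupI)
  show "carrier RP \<subseteq> carrier (product_group I G)" by (auto simp: RP_carrier)
  have "finite {v\<in>I. (\<lambda>v\<in>I. \<one>\<^bsub>G v\<^esub>) v \<notin> K v}"
   by (rule finite_subset[of _ "{}"]) (use local_subgroup subgroup.one_closed in fastforce)+
  then have "(\<lambda>v\<in>I. \<one>\<^bsub>G v\<^esub>) \<in> carrier RP"
   using local_group by (simp add: RP_carrier group.is_monoid)
  then show "carrier RP ~= {}" by blast
 next
  fix x y assume x: "x \<in> carrier RP" and y: "y \<in> carrier RP"
  have xc: "x v \<in> carrier (G v)" "y v \<in> carrier (G v)" if "v \<in> I" for v using x y that by (auto simp: RP_carrier)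
  have "{v\<in>I. (\<lambda>v\<in>I. x v \<otimes>\<^bsub>G v\<^esub> y v) v \<notin> K v} = {v\<in>I. x v \<otimes>\<^bsub>G v\<^esub> y v \<notin> K v}" by auto
  then show "x \<otimes>\<^bsub>product_group I G\<^esub> y \<in> carrier RP"
   using m[of x y] x y xc local_group by (simp add: RP_carrier group.is_monoid monoid.m_closed)
 next
  fix x assume x: "x \<in> carrier RP"
  then have xp: "x \<in> (\<Pi>\<^sub>E v\<in>I. carrier (G v))" by (simp add: RP_carrier)
  have e: "inv\<^bsub>product_group I G\<^esub> x = (\<lambda>v\<in>I. inv\<^bsub>G v\<^esub> x v)" by (rule inv_product_group[OF xp local_group])
  have "{v\<in>I. (\<lambda>v\<in>I. inv\<^bsub>G v\<^esub> x v) v \<notin> K v} = {v\<in>I. inv\<^bsub>G v\<^esub> x v \<notin> K v}" by auto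
  then show "inv\<^bsub>product_group I G\<^esub> x \<in> carrier RP"
   using i[of x] x group.inv_closed[OF local_group PiE_mem[OF xp]] unfolding e by (simp add: RP_carrier)
 qed
qed

lemma RP_group: "group RP"
proof -
 interpret P: group "product_group I G" using local_group by simp
 have "RP = (product_group I G)\<lparr>carrier := carrier RP\<rparr>" by (simp add: restricted_product_def)
 then show ?thesis using P.subgroup_imp_group[OF RP_subgroup] by simp
qed

sublocale RP: group RP by (rule RP_group)

lemma RP_inv: "g \<in> carrier RP ==> inv\<^bsub>RP\<^esub> g = (\<lambda>v\<in>I. inv\<^bsub>G v\<^esub> g v)"
proof -
 assume g: "g \<in> carrier RP"
 interpret P: group "product_group I G" using local_group by simp
 have "RP = (product_group I G)\<lparr>carrier := carrier RP\<rparr>" by (simp add: restricted_product_def)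
 then have "inv\<^bsub>RP\<^esub> g = inv\<^bsub>product_group I G\<^esub> g" using P.m_inv_consistent[OF RP_subgroup g] by simp
 then show ?thesis using inv_product_group[of g I G] g local_group by (simp add: RP_carrier)
qed

lemma RP_val: "g \<in> carrier RP ==> v \<in> I ==> g v \<in> carrier (G v)"
 by (auto simp: RP_carrier)

lemma RP_ext: "g \<in> carrier RP ==> h \<in> carrier RP ==> (\<And>v. v \<in> I ==> g v = h v) ==> g = h"
 by (rule PiE_ext[of g I "%v. carrier (G v)"]) (auto simp: RP_carrier)

lemma RP_conj:
 assumes g: "g \<in> carrier RP" and A: "\<And>v. v \<in> I ==> A v \<subseteq> carrier (G v)"
 shows "conj_by RP g (PiE I A) = (\<Pi>\<^sub>E v\<in>I. conj_by (G v) (g v) (A v))"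
proof
 have e: "g \<otimes>\<^bsub>RP\<^esub> x \<otimes>\<^bsub>RP\<^esub> inv\<^bsub>RP\<^esub> g = (\<lambda>v\<in>I. g v \<otimes>\<^bsub>G v\<^esub> x v \<otimes>\<^bsub>G v\<^esub> inv\<^bsub>G v\<^esub> g v)" for x
  by (auto simp: RP_mult RP_inv[OF g])
 show "conj_by RP g (PiE I A) \<subseteq> (\<Pi>\<^sub>E v\<in>I. conj_by (G v) (g v) (A v))"
  unfolding conj_by_def e by (auto intro!: imageI)
 show "(\<Pi>\<^sub>E v\<in>I. conj_by (G v) (g v) (A v)) \<subseteq> conj_by RP g (PiE I A)"
 proof
  fix y assume y: "y \<in> (\<Pi>\<^sub>E v\<in>I. conj_by (G v) (g v) (A v))"
  have "\<exists>a\<in>A v. y v = g v \<otimes>\<^bsub>G v\<^esub> a \<otimes>\<^bsub>G v\<^esub> inv\<^bsub>G v\<^esub> g v" if "v \<in> I" for v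
   using PiE_mem[OF y that] by (auto simp: conj_by_def)
  then obtain a where a: "\<And>v. v \<in> I ==> a v \<in> A v" "\<And>v. v \<in> I ==> y v = g v \<otimes>\<^bsub>G v\<^esub> a v \<otimes>\<^bsub>G v\<^esub> inv\<^bsub>G v\<^esub> g v"
   by metis
  have "y = g \<otimes>\<^bsub>RP\<^esub> restrict a I \<otimes>\<^bsub>RP\<^esub> inv\<^bsub>RP\<^esub> g"
   unfolding e using y a(2) by (auto simp: fun_eq_iff PiE_iff extensional_def)
  moreover have "restrict a I \<in> PiE I A" using a(1) by auto
  ultimately show "y \<in> conj_by RP g (PiE I A)" unfolding conj_by_def by blast
 qed
qed

lemma embed_at_closed:
 assumes "v \<in> I" "\<s> \<in> carrier (G v)"
 shows "embed_at I G v \<s> \<in> carrier RP"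
proof -
 have "finite {w\<in>I. embed_at I G v \<s> w \<notin> K w}"
 proof (rule finite_subset)
  show "{w\<in>I. embed_at I G v \<s> w \<notin> K w} \<subseteq> {v}"
   using subgroup.one_closed[OF local_subgroup] by (auto simp: embed_at_def)
 qed simp
 then show ?thesis using assms local_group by (auto simp: RP_carrier embed_at_def group.is_monoid)
qed

lemma upd_closed:
 assumes "g \<in> carrier RP" "v \<in> I" "\<s> \<in> carrier (G v)"
 shows "g(v := \<s>) \<in> carrier RP"
proof -
 have "finite {w\<in>I. (g(v := \<s>)) w \<notin> K w}"
  by (rule finite_subset[of _ "insert v {w\<in>I. g w \<notin> K w}"]) (use assms in \<open>auto simp: RP_carrier\<close>)
 then show ?thesis using assms by (auto simp: RP_carrier intro!: PiE_upd_same)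
qed

end

lemma component_PiE:
 assumes "\<And>v. v \<in> I ==> W v ~= {}" "v \<in> I"
 shows "component v (PiE I W) = W v"
proof
 show "component v (PiE I W) \<subseteq> W v" using assms(2) by (auto simp: component_def)
 show "W v \<subseteq> component v (PiE I W)"
 proof
  fix a assume a: "a \<in> W v"
  define w where "w = (\<lambda>u\<in>I. if u = v then a else (SOME b. b \<in> W u))"
  have "w \<in> PiE I W" unfolding w_def using a assms(1) by (auto simp: some_in_eq)
  moreover have "w v = a" using assms(2) by (simp add: w_def)
  ultimately show "a \<in> component v (PiE I W)" unfolding component_def by force
 qed
qed

lemma tensor_map_cong:
 assumes "\<And>v. v \<in> J ==> p v = q v"
 shows "tensor_map R J B p = tensor_map R J B q"
proof -
 have "(%f. \<lambda>v\<in>J. p v (f v)) = (%f. \<lambda>v\<in>J. q v (f v))" by (intro ext restrict_ext) (simp add: assms)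
 then show ?thesis by (simp add: tensor_map_def)
qed

lemma tensor_gens_cong_sub:
 assumes "\<And>j. j \<in> J ==> A j = B j"
 shows "tensor_gens R J A \<subseteq> tensor_gens R J B"
proof
 have P: "(\<Pi>\<^sub>E j\<in>J. carrier (A j)) = (\<Pi>\<^sub>E j\<in>J. carrier (B j))" using assms by (intro PiE_cong) simp
 have F: "tensor_free R J A = tensor_free R J B" by (simp add: tensor_free_def P)
 fix s assume "s \<in> tensor_gens R J A"
 then consider f j a b where
    "s = basis_vector R (f(j := a \<oplus>\<^bsub>A j\<^esub> b)) \<ominus>\<^bsub>tensor_free R J B\<^esub>
      (basis_vector R (f(j := a)) \<oplus>\<^bsub>tensor_free R J B\<^esub> basis_vector R (f(j := b)))"
    "f \<in> (\<Pi>\<^sub>E j\<in>J. carrier (B j))" "j \<in> J" "a \<in> carrier (A j)" "b \<in> carrier (A j)"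
   | f j r a where
    "s = basis_vector R (f(j := r \<odot>\<^bsub>A j\<^esub> a)) \<ominus>\<^bsub>tensor_free R J B\<^esub>
      (r \<odot>\<^bsub>tensor_free R J B\<^esub> basis_vector R (f(j := a)))"
    "f \<in> (\<Pi>\<^sub>E j\<in>J. carrier (B j))" "j \<in> J" "r \<in> carrier R" "a \<in> carrier (A j)"
  unfolding tensor_gens_def Let_def F P by blast
 then show "s \<in> tensor_gens R J B"
 proof cases
  case 1
  then show ?thesis unfolding tensor_gens_def Let_def using assms[OF 1(3)] by auto
 next
  case 2
  then show ?thesis unfolding tensor_gens_def Let_def using assms[OF 2(3)] by auto
 qed
qed

text \<open>The factors are given by functions on the whole index type, and expressions such as
  \<open>component v (PiE I W)\<close> are under control only for v in I. Agreement on
  \<open>J\<close> must therefore suffice.\<close>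

lemma pure_tensor_cong:
 assumes "\<And>j. j \<in> J ==> A j = B j" "\<And>j. j \<in> J ==> x j = y j"
 shows "pure_tensor R J A x = pure_tensor R J B y"
proof -
 have "tensor_free R J A = tensor_free R J B" unfolding tensor_free_def using assms(1) by (metis (no_types, lifting) PiE_cong)
 moreover have "tensor_gens R J A = tensor_gens R J B"
  using tensor_gens_cong_sub[of J A B] tensor_gens_cong_sub[of J B A] assms(1) by (metis subset_antisym)
 moreover have "restrict x J = restrict y J" using assms(2) by auto
 ultimately show ?thesis by (simp add: pure_tensor_def tensor_relations_gens)
qed

section \<open>Pure restricted tensors and the action of restriction and trace maps on them\<close>

locale restricted_tensor_data =
 fixes R :: "('r, 'c) ring_scheme" and I :: "'i set" and Hl :: "'i => ('a, 'b) monoid_scheme"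
  and U :: "'i => 'a set" and \<L> :: "'i => 'a set set" and N :: "'i => ('a, 'r, 'n) ric" and \<phi> :: "'i => 'n"
 assumes R: "cring R"
  and local_ric: "\<And>v. v \<in> I ==> ric_on (Hl v) R (\<L> v) (N v)"
  and U_level: "\<And>v. v \<in> I ==> U v \<in> \<L> v"
  and \<phi>: "\<And>v. v \<in> I ==> \<phi> v \<in> carrier (obj (N v) (U v))"
begin

definition "adm W \<longleftrightarrow> (\<forall>v\<in>I. W v \<in> \<L> v) \<and> finite {v\<in>I. W v ~= U v}"
text \<open>The families x that define a pure restricted tensor at the level given by W: almost all
  entries are the distinguished vectors.\<close>

definition "tuple W x \<longleftrightarrow> (\<forall>v\<in>I. x v \<in> carrier (obj (N v) (W v))) \<and> finite {v\<in>I. x v ~= \<phi> v}"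

abbreviation "A W v \<equiv> obj (N v) (component v (PiE I W))"
abbreviation "cls W \<equiv> rt_class R I U N \<phi> (PiE I W)"

lemma adm_comp: "adm W ==> v \<in> I ==> component v (PiE I W) = W v"
proof (rule component_PiE)
 fix v assume "adm W" "v \<in> I"
 then have "subgroup (W v) (Hl v)" using ric_on.level[OF local_ric] by (auto simp: adm_def)
 then show "W v ~= {}" using subgroup.one_closed by blast
qed

lemma adm_module: "adm W ==> v \<in> I ==> Module.module R (obj (N v) (W v))"
 using ric_on.obj_module[OF local_ric] by (auto simp: adm_def)

lemma index_iff: "adm W ==> J \<in> rt_index I U (PiE I W) \<longleftrightarrow> finite J \<and> J \<subseteq> I \<and> {v\<in>I. W v ~= U v} \<subseteq> J"
proof -
 assume W: "adm W"
 have "{v\<in>I. component v (PiE I W) ~= U v} = {v\<in>I. W v ~= U v}" using adm_comp[OF W] by auto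
 then show ?thesis by (simp add: rt_index_def)
qed

lemma family: "adm W ==> J \<subseteq> I ==> tensor_family R J (A W)"
 using adm_module adm_comp R by (intro tensor_family.intro) auto

lemma \<phi>_mem: "adm W ==> J \<in> rt_index I U (PiE I W) ==> v \<in> I ==> v \<notin> J ==> \<phi> v \<in> carrier (A W v)"
 using adm_comp[of W v] \<phi>[of v] index_iff[of W J] by auto

lemma extend_linear_pure:
 assumes W: "adm W" and J: "J \<in> rt_index I U (PiE I W)" "J' \<in> rt_index I U (PiE I W)" "J \<subseteq> J'"
 shows "tensor_extend R (A W) \<phi> J J' \<in> linear_maps R (tensor R J (A W)) (tensor R J' (A W))"
  and "(\<And>j. j \<in> J ==> x j \<in> carrier (A W j)) ==> tensor_extend R (A W) \<phi> J J' (pure_tensor R J (A W) x) =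
   pure_tensor R J' (A W) (%j. if j \<in> J then x j else \<phi> j)"
proof -
 have s: "J \<subseteq> I" "J' \<subseteq> I" using J index_iff[OF W] by auto
 note f = family[OF W s(1)] family[OF W s(2)]
 have p: "\<And>j. j \<in> J' ==> j \<notin> J ==> \<phi> j \<in> carrier (A W j)" using \<phi>_mem[OF W J(1)] s by blast
 show "tensor_extend R (A W) \<phi> J J' \<in> linear_maps R (tensor R J (A W)) (tensor R J' (A W))"
  unfolding tensor_extend_affine by (rule tensor_affine_linear[OF f J(3) linear_maps_ident(1) p])
 show "(\<And>j. j \<in> J ==> x j \<in> carrier (A W j)) ==> tensor_extend R (A W) \<phi> J J' (pure_tensor R J (A W) x) =
   pure_tensor R J' (A W) (%j. if j \<in> J then x j else \<phi> j)"
  unfolding tensor_extend_affine by (rule tensor_affine_pure[OF f J(3) linear_maps_ident(1) p])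
qed

lemma system:
 assumes W: "adm W"
 shows "directed_system R (rt_index I U (PiE I W)) (\<subseteq>) (%J. tensor R J (A W)) (tensor_extend R (A W) \<phi>)"
proof (rule directed_system.intro)
 note ix = index_iff[OF W]
 show "cring R" by (rule R)
 show "rt_index I U (PiE I W) ~= {}" using ix[of "{v\<in>I. W v ~= U v}"] W by (auto simp: adm_def)
 show "\<exists>k\<in>rt_index I U (PiE I W). i \<subseteq> k \<and> j \<subseteq> k" if "i \<in> rt_index I U (PiE I W)" "j \<in> rt_index I U (PiE I W)" for i j
  using that unfolding ix by (intro bexI[of _ "i \<union> j"]) (auto simp: ix)
 show "Module.module R (tensor R i (A W))" if "i \<in> rt_index I U (PiE I W)" for i
  using tensor_family.tensor[OF family[OF W]] that ix by blast
 show "tensor_extend R (A W) \<phi> i j \<in> linear_maps R (tensor R i (A W)) (tensor R j (A W))"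
  if "i \<in> rt_index I U (PiE I W)" "j \<in> rt_index I U (PiE I W)" "i \<subseteq> j" for i j
  by (rule extend_linear_pure(1)[OF W that])
 show "tensor_extend R (A W) \<phi> i i x = x" if i: "i \<in> rt_index I U (PiE I W)" and x: "x \<in> carrier (tensor R i (A W))" for i x
 proof -
  interpret T: tensor_family R i "A W" using family[OF W] i ix by blast
  show ?thesis
  proof (rule T.linear_ext[OF T.tensor extend_linear_pure(1)[OF W i i order_refl] linear_maps_ident(1) _ x])
   fix y assume y: "y \<in> (\<Pi>\<^sub>E j\<in>i. carrier (A W j))"
   have "tensor_extend R (A W) \<phi> i i (pure_tensor R i (A W) y) = pure_tensor R i (A W) (%j. if j \<in> i then y j else \<phi> j)"
    by (rule extend_linear_pure(2)[OF W i i order_refl]) (use y in auto)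
   also have "\<dots> = pure_tensor R i (A W) y" by (rule pure_tensor_cong) auto
   finally show "tensor_extend R (A W) \<phi> i i (pure_tensor R i (A W) y) = pure_tensor R i (A W) y" .
  qed
 qed
 show "tensor_extend R (A W) \<phi> j k (tensor_extend R (A W) \<phi> i j x) = tensor_extend R (A W) \<phi> i k x"
  if ijk: "i \<in> rt_index I U (PiE I W)" "j \<in> rt_index I U (PiE I W)" "k \<in> rt_index I U (PiE I W)" "i \<subseteq> j" "j \<subseteq> k"
   and x: "x \<in> carrier (tensor R i (A W))" for i j k x
 proof -
  interpret T: tensor_family R i "A W" using family[OF W] ijk ix by blast
  interpret Tk: tensor_family R k "A W" using family[OF W] ijk ix by blast
  have ik: "i \<subseteq> k" using ijk by blast
  show ?thesis
  proof (rule T.linear_ext[OF Tk.tensor linear_maps_compose[OF extend_linear_pure(1)[OF W ijk(1,2,4)] extend_linear_pure(1)[OF W ijk(2,3,5)]]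
    extend_linear_pure(1)[OF W ijk(1,3) ik] _ x])
   fix y assume y: "y \<in> (\<Pi>\<^sub>E j\<in>i. carrier (A W j))"
   have yc: "y l \<in> carrier (A W l)" if "l \<in> i" for l using y that by auto
   let ?y = "%l. if l \<in> i then y l else \<phi> l"
   have yc': "?y l \<in> carrier (A W l)" if "l \<in> j" for l
    using yc[of l] \<phi>_mem[OF W ijk(1), of l] that ijk(2) ix by auto
   have "tensor_extend R (A W) \<phi> j k (pure_tensor R j (A W) ?y) = pure_tensor R k (A W) (%l. if l \<in> j then ?y l else \<phi> l)"
    by (rule extend_linear_pure(2)[OF W ijk(2,3,5) yc'])
   also have "\<dots> = pure_tensor R k (A W) ?y" by (rule pure_tensor_cong) (use ijk in auto)
   finally show "tensor_extend R (A W) \<phi> j k (tensor_extend R (A W) \<phi> i j (pure_tensor R i (A W) y)) =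
     tensor_extend R (A W) \<phi> i k (pure_tensor R i (A W) y)"
    by (simp only: extend_linear_pure(2)[OF W ijk(1,2,4) yc] extend_linear_pure(2)[OF W ijk(1,3) ik yc])
  qed
 qed
qed auto

definition "supp W x = {v\<in>I. W v ~= U v \<or> x v ~= \<phi> v}"
text \<open>The pure tensor of all x_v, represented on the smallest admissible set of
  places.\<close>

definition "tc W x = cls W (supp W x, pure_tensor R (supp W x) (A W) x)"

lemma supp_index: "adm W ==> tuple W x ==> supp W x \<in> rt_index I U (PiE I W)"
proof -
 assume "adm W" "tuple W x"
 moreover have "supp W x = {v\<in>I. W v ~= U v} \<union> {v\<in>I. x v ~= \<phi> v}" by (auto simp: supp_def)
 ultimately show ?thesis by (auto simp: index_iff adm_def tuple_def)
qed

lemma tuple_mem: "adm W ==> tuple W x ==> v \<in> I ==> x v \<in> carrier (A W v)"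
 using adm_comp by (simp add: tuple_def)

text \<open>Enlarging the set of places inserts \<phi>_v at each new place, and outside the support
  this already is x_v.\<close>

lemma tc_eq:
 assumes W: "adm W" and x: "tuple W x" and J: "J \<in> rt_index I U (PiE I W)" "supp W x \<subseteq> J"
 shows "tc W x = cls W (J, pure_tensor R J (A W) x)"
proof -
 interpret D: directed_system R "rt_index I U (PiE I W)" "(\<subseteq>)" "%J. tensor R J (A W)" "tensor_extend R (A W) \<phi>"
  by (rule system[OF W])
 note s = supp_index[OF W x]
 have sI: "supp W x \<subseteq> I" by (auto simp: supp_def)
 interpret T: tensor_family R "supp W x" "A W" by (rule family[OF W sI])
 have xc: "x j \<in> carrier (A W j)" if "j \<in> supp W x" for j using tuple_mem[OF W x] sI that by blast
 have "tensor_extend R (A W) \<phi> (supp W x) J (pure_tensor R (supp W x) (A W) x) =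
   pure_tensor R J (A W) (%j. if j \<in> supp W x then x j else \<phi> j)"
  by (rule extend_linear_pure(2)[OF W s J xc])
 also have "\<dots> = pure_tensor R J (A W) x"
  by (rule pure_tensor_cong) (use J index_iff[OF W] in \<open>auto simp: supp_def\<close>)
 finally have e: "tensor_extend R (A W) \<phi> (supp W x) J (pure_tensor R (supp W x) (A W) x) = pure_tensor R J (A W) x" .
 have "cls W (J, pure_tensor R J (A W) x) = tc W x"
  unfolding tc_def rt_class_def e[symmetric]
  by (rule D.cl_transition[OF s J]) (rule T.pure_closed[OF xc])
 then show ?thesis by simp
qed

lemma tc_closed:
 assumes W: "adm W" and x: "tuple W x"
 shows "tc W x \<in> carrier (rt_module R I U N \<phi> (PiE I W))"
proof -
 interpret D: directed_system R "rt_index I U (PiE I W)" "(\<subseteq>)" "%J. tensor R J (A W)" "tensor_extend R (A W) \<phi>"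
  by (rule system[OF W])
 have sI: "supp W x \<subseteq> I" by (auto simp: supp_def)
 interpret T: tensor_family R "supp W x" "A W" by (rule family[OF W sI])
 have xc: "x j \<in> carrier (A W j)" if "j \<in> supp W x" for j using tuple_mem[OF W x] sI that by blast
 show ?thesis unfolding rt_module_def tc_def rt_class_def
  by (rule D.cl_closed[OF supp_index[OF W x] T.pure_closed[OF xc]])
qed

lemma tc_index:
 assumes W: "adm W" and x: "tuple W x" and "(J, t) \<in> tc W x"
 shows "J \<subseteq> I"
proof -
 interpret D: directed_system R "rt_index I U (PiE I W)" "(\<subseteq>)" "%J. tensor R J (A W)" "tensor_extend R (A W) \<phi>"
  by (rule system[OF W])
 have sI: "supp W x \<subseteq> I" by (auto simp: supp_def)
 interpret T: tensor_family R "supp W x" "A W" by (rule family[OF W sI])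
 have xc: "x j \<in> carrier (A W j)" if "j \<in> supp W x" for j using tuple_mem[OF W x] sI that by blast
 show ?thesis
  using D.cl_mem(1)[OF supp_index[OF W x] T.pure_closed[OF xc] assms(3)[unfolded tc_def rt_class_def]]
  by (simp add: index_iff[OF W])
qed

lemma tuple_upd: "tuple W x ==> v \<in> I ==> a \<in> carrier (obj (N v) (W v)) ==> tuple W (x(v := a))"
proof -
 assume a: "tuple W x" "v \<in> I" "a \<in> carrier (obj (N v) (W v))"
 have "{w\<in>I. (x(v := a)) w ~= \<phi> w} \<subseteq> insert v {w\<in>I. x w ~= \<phi> w}" by auto
 then have "finite {w\<in>I. (x(v := a)) w ~= \<phi> w}" by (rule finite_subset) (use a(1) in \<open>simp add: tuple_def\<close>)
 then show ?thesis using a unfolding tuple_def by simp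
qed

lemma tc_linear:
 assumes W: "adm W" and x: "tuple W x" and v: "v \<in> I"
 shows "(%a. tc W (x(v := a))) \<in> linear_maps R (obj (N v) (W v)) (rt_module R I U N \<phi> (PiE I W))"
proof -
 interpret D: directed_system R "rt_index I U (PiE I W)" "(\<subseteq>)" "%J. tensor R J (A W)" "tensor_extend R (A W) \<phi>"
  by (rule system[OF W])
 interpret Nv: Module.module R "obj (N v) (W v)" by (rule adm_module[OF W v])
 \<comment> \<open>The minimal support of the modified tuple depends on a; a fixed set of places
   containing v lets linearity be read off from one tensor product.\<close>
 define J where "J = insert v (supp W x)"
 have JI: "J \<subseteq> I" using v by (auto simp: J_def supp_def)
 have J: "J \<in> rt_index I U (PiE I W)" using supp_index[OF W x] v unfolding J_def index_iff[OF W] by auto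
 interpret T: tensor_family R J "A W" by (rule family[OF W JI])
 have vJ: "v \<in> J" by (simp add: J_def)
 have sJ: "supp W (x(v := a)) \<subseteq> J" for a by (auto simp: J_def supp_def)
 have Av: "A W v = obj (N v) (W v)" using adm_comp[OF W v] by simp
 have xc: "x j \<in> carrier (A W j)" if "j \<in> J" for j using tuple_mem[OF W x] JI that by blast
 have tc: "tc W (x(v := a)) = cls W (J, pure_tensor R J (A W) (x(v := a)))" if "a \<in> carrier (obj (N v) (W v))" for a
  by (rule tc_eq[OF W tuple_upd[OF x v that] J sJ])
 have pc: "pure_tensor R J (A W) (x(v := a)) \<in> carrier (tensor R J (A W))" if "a \<in> carrier (obj (N v) (W v))" for a
  by (rule T.pure_closed) (use xc that Av in auto)
 show ?thesis
 proof (rule linear_mapsI)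
  fix a assume a: "a \<in> carrier (obj (N v) (W v))"
  show "tc W (x(v := a)) \<in> carrier (rt_module R I U N \<phi> (PiE I W))" by (rule tc_closed[OF W tuple_upd[OF x v a]])
  fix b assume b: "b \<in> carrier (obj (N v) (W v))"
  show "tc W (x(v := a \<oplus>\<^bsub>obj (N v) (W v)\<^esub> b)) = tc W (x(v := a)) \<oplus>\<^bsub>rt_module R I U N \<phi> (PiE I W)\<^esub> tc W (x(v := b))"
   using T.pure_add[of x v a b, unfolded Av, OF xc vJ a b] D.Lim_add[OF J pc[OF a] pc[OF b]]
   by (simp only: tc a b Nv.a_closed rt_module_def rt_class_def)
 next
  fix r a assume r: "r \<in> carrier R" and a: "a \<in> carrier (obj (N v) (W v))"
  show "tc W (x(v := r \<odot>\<^bsub>obj (N v) (W v)\<^esub> a)) = r \<odot>\<^bsub>rt_module R I U N \<phi> (PiE I W)\<^esub> tc W (x(v := a))"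
   using T.pure_smult[of x v a r, unfolded Av, OF xc vJ a r] D.Lim_smult[OF r J pc[OF a]]
   by (simp only: tc a r Nv.smult_closed rt_module_def rt_class_def)
 qed
qed

text \<open>A common treatment of restriction and trace maps: \<open>q\<close> stands for the local
  maps, and \<open>S\<close> for the places outside which they fix \<phi>. Representatives must
  involve all of \<open>S\<close> before the tensor product of the local maps is compatible with
  enlarging the set of places.\<close>

lemma rt_map:
 assumes W: "adm W" and W': "adm W'" and x: "tuple W x"
  and q: "\<And>v. v \<in> I ==> q v \<in> linear_maps R (obj (N v) (W v)) (obj (N v) (W' v))"
  and Sf: "finite S" "S \<subseteq> I" "\<And>v. v \<in> I ==> v \<notin> S ==> W v = U v \<and> W' v = U v \<and> q v (\<phi> v) = \<phi> v"
 shows "(\<Union>(J, t)\<in>{(J, t)\<in>tc W x. S \<subseteq> J}. cls W' (J, tensor_map R J (A W') q t)) = tc W' (%v. q v (x v))"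
  and "tuple W' (%v. q v (x v))"
proof -
 interpret D: directed_system R "rt_index I U (PiE I W)" "(\<subseteq>)" "%J. tensor R J (A W)" "tensor_extend R (A W) \<phi>"
  by (rule system[OF W])
 interpret D': directed_system R "rt_index I U (PiE I W')" "(\<subseteq>)" "%J. tensor R J (A W')" "tensor_extend R (A W') \<phi>"
  by (rule system[OF W'])
 have "{v\<in>I. q v (x v) ~= \<phi> v} \<subseteq> S \<union> {v\<in>I. x v ~= \<phi> v}" using Sf(3) by auto
 then have "finite {v\<in>I. q v (x v) ~= \<phi> v}" using Sf(1) x by (auto simp: tuple_def intro: finite_subset)
 then show tq: "tuple W' (%v. q v (x v))"
  using linear_maps_closed[OF q] x by (auto simp: tuple_def)
 have q': "q v \<in> linear_maps R (A W v) (A W' v)" if "v \<in> I" for v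
  using q[OF that] adm_comp[OF W that] adm_comp[OF W' that] by simp
 have ix: "J \<in> rt_index I U (PiE I W')" if "S \<subseteq> J" "J \<in> rt_index I U (PiE I W)" for J
 proof -
  have "{v\<in>I. W' v ~= U v} \<subseteq> S" using Sf(3) by blast
  then show ?thesis using that unfolding index_iff[OF W'] index_iff[OF W] by blast
 qed
 have main: "cls W' (J, tensor_map R J (A W') q t) = tc W' (%v. q v (x v))"
  if Jt: "(J, t) \<in> tc W x" and SJ: "S \<subseteq> J" for J t
 proof -
  note s = supp_index[OF W x]
  have sI: "supp W x \<subseteq> I" by (auto simp: supp_def)
  interpret T: tensor_family R "supp W x" "A W" by (rule family[OF W sI])
  have xs: "x j \<in> carrier (A W j)" if "j \<in> supp W x" for j using tuple_mem[OF W x] sI that by blast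
  have p: "pure_tensor R (supp W x) (A W) x \<in> carrier (tensor R (supp W x) (A W))" by (rule T.pure_closed[OF xs])
  note m = D.cl_mem[OF s p Jt[unfolded tc_def rt_class_def]]
  obtain M where M: "M \<in> rt_index I U (PiE I W)" "J \<subseteq> M" "supp W x \<subseteq> M"
   "tensor_extend R (A W) \<phi> J M t = tensor_extend R (A W) \<phi> (supp W x) M (pure_tensor R (supp W x) (A W) x)"
   using m(3) D.cl_eq_iff[OF m(1,2) s p] by auto
  have MI: "M \<subseteq> I" "J \<subseteq> I" using M(1) m(1) index_iff[OF W] by auto
  have SM: "S \<subseteq> M" using SJ M(2) by blast
  note J' = ix[OF SJ m(1)] and M' = ix[OF SM M(1)]
  interpret TJ: tensor_family R J "A W" by (rule family[OF W MI(2)])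
  interpret TM: tensor_family R M "A W" by (rule family[OF W MI(1)])
  interpret TJ': tensor_family R J "A W'" by (rule family[OF W' MI(2)])
  interpret TM': tensor_family R M "A W'" by (rule family[OF W' MI(1)])
  have qJ: "tensor_map R J (A W') q \<in> linear_maps R (tensor R J (A W)) (tensor R J (A W'))"
   and qM: "tensor_map R M (A W') q \<in> linear_maps R (tensor R M (A W)) (tensor R M (A W'))"
   and pJ: "\<And>y. (\<And>j. j \<in> J ==> y j \<in> carrier (A W j)) ==> tensor_map R J (A W') q (pure_tensor R J (A W) y) =
     pure_tensor R J (A W') (%j. if j \<in> J then q j (y j) else \<phi> j)"
   and pM: "\<And>y. (\<And>j. j \<in> M ==> y j \<in> carrier (A W j)) ==> tensor_map R M (A W') q (pure_tensor R M (A W) y) =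
     pure_tensor R M (A W') (%j. if j \<in> M then q j (y j) else \<phi> j)"
   unfolding tensor_map_affine[where \<phi> = \<phi>]
  proof -
   note qJ' = q'[OF subsetD[OF MI(2)]] and qM' = q'[OF subsetD[OF MI(1)]]
   show "tensor_affine R J J (A W') q \<phi> \<in> linear_maps R (tensor R J (A W)) (tensor R J (A W'))"
    by (rule tensor_affine_linear[OF TJ.tensor_family_axioms TJ'.tensor_family_axioms order_refl qJ']) simp_all
   show "tensor_affine R M M (A W') q \<phi> \<in> linear_maps R (tensor R M (A W)) (tensor R M (A W'))"
    by (rule tensor_affine_linear[OF TM.tensor_family_axioms TM'.tensor_family_axioms order_refl qM']) simp_all
   show "tensor_affine R J J (A W') q \<phi> (pure_tensor R J (A W) y) = pure_tensor R J (A W') (%j. if j \<in> J then q j (y j) else \<phi> j)"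
    if "\<And>j. j \<in> J ==> y j \<in> carrier (A W j)" for y
    by (rule tensor_affine_pure[OF TJ.tensor_family_axioms TJ'.tensor_family_axioms order_refl qJ']) (simp_all add: that)
   show "tensor_affine R M M (A W') q \<phi> (pure_tensor R M (A W) y) = pure_tensor R M (A W') (%j. if j \<in> M then q j (y j) else \<phi> j)"
    if "\<And>j. j \<in> M ==> y j \<in> carrier (A W j)" for y
    by (rule tensor_affine_pure[OF TM.tensor_family_axioms TM'.tensor_family_axioms order_refl qM']) (simp_all add: that)
  qed
  have fix_q: "q j (\<phi> j) = \<phi> j" if "j \<in> M" "j \<notin> J" for j using Sf(3)[of j] SJ MI that by blast
  \<comment> \<open>Naturality of the transition maps: at a place that is added, applying the local
    map to the inserted \<phi> gives \<phi> back.\<close>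
  have comm: "tensor_extend R (A W') \<phi> J M (tensor_map R J (A W') q t) = tensor_map R M (A W') q (tensor_extend R (A W) \<phi> J M t)"
  proof (rule TJ.linear_ext[OF TM'.tensor linear_maps_compose[OF qJ extend_linear_pure(1)[OF W' J' M' M(2)]]
    linear_maps_compose[OF extend_linear_pure(1)[OF W m(1) M(1,2)] qM] _ m(2)])
   fix y assume y: "y \<in> (\<Pi>\<^sub>E j\<in>J. carrier (A W j))"
   have yc: "y j \<in> carrier (A W j)" if "j \<in> J" for j using y that by auto
   have qy: "(if j \<in> J then q j (y j) else \<phi> j) \<in> carrier (A W' j)" if "j \<in> J" for j
    using linear_maps_closed[OF q' yc] that MI(2) by auto
   have yM: "(if j \<in> J then y j else \<phi> j) \<in> carrier (A W j)" if "j \<in> M" for j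
    using yc \<phi>_mem[OF W m(1)] that MI(1) by auto
   have "tensor_extend R (A W') \<phi> J M (tensor_map R J (A W') q (pure_tensor R J (A W) y)) =
     tensor_extend R (A W') \<phi> J M (pure_tensor R J (A W') (%j. if j \<in> J then q j (y j) else \<phi> j))"
    by (rule arg_cong[of _ _ "tensor_extend R (A W') \<phi> J M", OF pJ]) (rule yc)
   also have "\<dots> = pure_tensor R M (A W') (%j. if j \<in> J then if j \<in> J then q j (y j) else \<phi> j else \<phi> j)"
    by (rule extend_linear_pure(2)[OF W' J' M' M(2)]) (rule qy)
   also have "\<dots> = pure_tensor R M (A W') (%j. if j \<in> M then q j (if j \<in> J then y j else \<phi> j) else \<phi> j)"
    by (rule pure_tensor_cong) (use fix_q in auto)
   also have "\<dots> = tensor_map R M (A W') q (tensor_extend R (A W) \<phi> J M (pure_tensor R J (A W) y))"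
    by (subst extend_linear_pure(2)[OF W m(1) M(1,2)], erule yc, rule pM[symmetric], erule yM)
   finally show "tensor_extend R (A W') \<phi> J M (tensor_map R J (A W') q (pure_tensor R J (A W) y)) =
     tensor_map R M (A W') q (tensor_extend R (A W) \<phi> J M (pure_tensor R J (A W) y))" .
  qed
  have xM: "x j \<in> carrier (A W j)" if "j \<in> M" for j using tuple_mem[OF W x] MI that by blast
  have "tensor_extend R (A W) \<phi> J M t = pure_tensor R M (A W) (%j. if j \<in> supp W x then x j else \<phi> j)"
   unfolding M(4) by (rule extend_linear_pure(2)[OF W s M(1,3) xs])
  also have "\<dots> = pure_tensor R M (A W) x" by (rule pure_tensor_cong) (use MI in \<open>auto simp: supp_def\<close>)
  finally have ext: "tensor_extend R (A W) \<phi> J M t = pure_tensor R M (A W) x" .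
  have "cls W' (J, tensor_map R J (A W') q t) = cls W' (M, tensor_extend R (A W') \<phi> J M (tensor_map R J (A W') q t))"
   unfolding rt_class_def by (rule D'.cl_transition[OF J' M' M(2), symmetric]) (rule linear_maps_closed[OF qJ m(2)])
  also have "\<dots> = cls W' (M, tensor_map R M (A W') q (pure_tensor R M (A W) x))"
   unfolding comm ext ..
  also have "tensor_map R M (A W') q (pure_tensor R M (A W) x) =
    pure_tensor R M (A W') (%j. if j \<in> M then q j (x j) else \<phi> j)"
   by (rule pM) (rule xM)
  also have "pure_tensor R M (A W') (%j. if j \<in> M then q j (x j) else \<phi> j) = pure_tensor R M (A W') (%j. q j (x j))"
   by (rule pure_tensor_cong) auto
  also have "cls W' (M, pure_tensor R M (A W') (%j. q j (x j))) = tc W' (%v. q v (x v))"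
  proof (rule tc_eq[OF W' tq M', symmetric])
   show "supp W' (%v. q v (x v)) \<subseteq> M"
   proof
    fix v assume "v \<in> supp W' (%v. q v (x v))"
    then have v: "v \<in> I" "W' v ~= U v \<or> q v (x v) ~= \<phi> v" by (auto simp: supp_def)
    show "v \<in> M"
    proof (rule ccontr)
     assume "v \<notin> M"
     then have "v \<notin> S" "v \<notin> supp W x" using SM M(3) by auto
     then show False using Sf(3)[OF v(1)] v by (auto simp: supp_def)
    qed
   qed
  qed
  finally show ?thesis .
 qed
 \<comment> \<open>A representative on this set of places exists, so the union is over a nonempty
   set and has the claimed common value.\<close>
 define J where "J = S \<union> supp W x"
 have J: "J \<in> rt_index I U (PiE I W)" "supp W x \<subseteq> J"
  using supp_index[OF W x] Sf(1,2) unfolding J_def index_iff[OF W] by auto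
 have JI: "J \<subseteq> I" using J(1) index_iff[OF W] by auto
 interpret TJ: tensor_family R J "A W" by (rule family[OF W JI])
 have "(J, pure_tensor R J (A W) x) \<in> tc W x"
  unfolding tc_eq[OF W x J] rt_class_def
  by (rule D.cl_self[OF J(1) TJ.pure_closed]) (use tuple_mem[OF W x] JI in blast)
 then have mem: "(J, pure_tensor R J (A W) x) \<in> {(J, t)\<in>tc W x. S \<subseteq> J}" by (simp add: J_def)
 show "(\<Union>(J, t)\<in>{(J, t)\<in>tc W x. S \<subseteq> J}. cls W' (J, tensor_map R J (A W') q t)) = tc W' (%v. q v (x v))"
 proof (rule UN_eq_const[OF mem], clarify)
  fix J t assume "(J, t) \<in> tc W x" "S \<subseteq> J"
  then show "cls W' (J, tensor_map R J (A W') q t) = tc W' (%v. q v (x v))" by (rule main)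
 qed
qed

lemma adm_U: "adm U" using U_level by (simp add: adm_def)

lemma tuple_\<phi>: "tuple U \<phi>" using \<phi> by (simp add: tuple_def)

lemma rt_unit_eq: "rt_unit R I U N \<phi> = tc U \<phi>"
 unfolding rt_unit_def
proof (rule UN_eq_const[of "{}"])
 fix J assume "J \<in> {J. finite J \<and> J \<subseteq> I}"
 then have J: "J \<in> rt_index I U (PiE I U)" "J \<subseteq> I" by (auto simp: index_iff[OF adm_U])
 have "pure_tensor R J (%v. obj (N v) (U v)) \<phi> = pure_tensor R J (A U) \<phi>"
  by (rule pure_tensor_cong) (use J(2) adm_comp[OF adm_U] in auto)
 moreover have "supp U \<phi> \<subseteq> J" by (auto simp: supp_def)
 ultimately show "cls U (J, pure_tensor R J (%v. obj (N v) (U v)) \<phi>) = tc U \<phi>"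
  using tc_eq[OF adm_U tuple_\<phi> J(1)] by simp
qed simp

text \<open>Outside a finite set both levels are U_v and h_v lies in U_v, so the local maps fix
  \<phi>_v; for pullbacks this uses that they are pushforwards along the inverse. Hence both maps
  act on pure tensors factor by factor.\<close>

lemma transfer_maps:
 assumes W: "adm W" and W': "adm W'"
  and h: "\<And>v. v \<in> I ==> h v \<in> carrier (Hl v)" "finite {v\<in>I. h v \<notin> U v}"
  and sub: "\<And>v. v \<in> I ==> W v \<subseteq> conj_by (Hl v) (h v) (W' v)"
 shows rt_push: "tuple W x ==> push (restricted_tensor R I U N \<phi>) (PiE I W) h (PiE I W') (tc W x) =
   tc W' (%v. push (N v) (W v) (h v) (W' v) (x v))"
  and rt_push_tuple: "tuple W x ==> tuple W' (%v. push (N v) (W v) (h v) (W' v) (x v))"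
  and rt_pull: "tuple W' y ==> pull (restricted_tensor R I U N \<phi>) (PiE I W) h (PiE I W') (tc W' y) =
   tc W (%v. pull (N v) (W v) (h v) (W' v) (y v))"
  and rt_pull_tuple: "tuple W' y ==> tuple W (%v. pull (N v) (W v) (h v) (W' v) (y v))"
proof -
 let ?S = "rt_support I U (PiE I W) h (PiE I W')"
 have S_eq: "?S = {v\<in>I. W v ~= U v} \<union> {v\<in>I. W' v ~= U v} \<union> {v\<in>I. h v \<notin> U v}"
  unfolding rt_support_def using adm_comp[OF W] adm_comp[OF W'] by auto
 have S: "finite ?S" "?S \<subseteq> I" unfolding S_eq using W W' h(2) by (auto simp: adm_def)
 have lev: "W v \<in> \<L> v" "W' v \<in> \<L> v" if "v \<in> I" for v using W W' that by (auto simp: adm_def)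
 have pl: "pull (N v) (W v) (h v) (W' v) \<in> linear_maps R (obj (N v) (W' v)) (obj (N v) (W v))"
   "push (N v) (W v) (h v) (W' v) \<in> linear_maps R (obj (N v) (W v)) (obj (N v) (W' v))" if v: "v \<in> I" for v
  using ric_on.push_pull_linear[OF local_ric[OF v] lev[OF v] h(1)[OF v] sub[OF v]] by auto
 have out: "W v = U v" "W' v = U v" "h v \<in> U v" if "v \<in> I" "v \<notin> ?S" for v using that unfolding S_eq by auto
 have fixp: "push (N v) (W v) (h v) (W' v) (\<phi> v) = \<phi> v" if v: "v \<in> I" "v \<notin> ?S" for v
  using ric_on.push_mem[OF local_ric[OF v(1)] U_level[OF v(1)] out(3)[OF v] \<phi>[OF v(1)]] out[OF v] by simp
 have fixq: "pull (N v) (W v) (h v) (W' v) (\<phi> v) = \<phi> v" if v: "v \<in> I" "v \<notin> ?S" for v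
 proof -
  interpret L: ric_on "Hl v" R "\<L> v" "N v" by (rule local_ric[OF v(1)])
  note Uv = U_level[OF v(1)]
  have hv: "h v \<in> U v" "h v \<in> carrier (Hl v)" using out(3)[OF v] h(1)[OF v(1)] by auto
  have c: "U v = conj_by (Hl v) (h v) (U v)" using L.conj_by_self[OF L.level[OF Uv] hv(1)] by simp
  have "pull (N v) (U v) (h v) (U v) (\<phi> v) = push (N v) (U v) (inv\<^bsub>Hl v\<^esub> h v) (U v) (\<phi> v)"
   by (rule L.pull_eq_push[OF Uv Uv hv(2) c \<phi>[OF v(1)]])
  also have "\<dots> = \<phi> v"
   by (rule L.push_mem[OF Uv _ \<phi>[OF v(1)]]) (rule subgroup.m_inv_closed[OF L.level[OF Uv] hv(1)])
  finally show ?thesis using out[OF v] by simp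
 qed
 {
  assume x: "tuple W x"
  have J: "J \<subseteq> I" if "(J, t) \<in> tc W x" for J t using tc_index[OF W x that] .
  note m = rt_map[OF W W' x pl(2) S]
  show "push (restricted_tensor R I U N \<phi>) (PiE I W) h (PiE I W') (tc W x) = tc W' (%v. push (N v) (W v) (h v) (W' v) (x v))"
  proof -
   have "push (restricted_tensor R I U N \<phi>) (PiE I W) h (PiE I W') (tc W x) =
     (\<Union>(J, t)\<in>{(J, t)\<in>tc W x. ?S \<subseteq> J}. cls W' (J, tensor_map R J (A W') (%v. push (N v) (component v (PiE I W)) (h v) (component v (PiE I W'))) t))"
    by (simp only: restricted_tensor_def ric.simps)
   also have "\<dots> = (\<Union>(J, t)\<in>{(J, t)\<in>tc W x. ?S \<subseteq> J}. cls W' (J, tensor_map R J (A W') (%v. push (N v) (W v) (h v) (W' v)) t))"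
   proof (rule SUP_cong[OF HOL.refl])
    fix p assume "p \<in> {(J, t)\<in>tc W x. ?S \<subseteq> J}"
    then obtain J t where p: "p = (J, t)" "(J, t) \<in> tc W x" by blast
    show "(case p of (J, t) => cls W' (J, tensor_map R J (A W') (%v. push (N v) (component v (PiE I W)) (h v) (component v (PiE I W'))) t)) = (case p of (J, t) => cls W' (J, tensor_map R J (A W') (%v. push (N v) (W v) (h v) (W' v)) t))"
    proof -
     have "tensor_map R J (A W') (%v. push (N v) (component v (PiE I W)) (h v) (component v (PiE I W'))) =
       tensor_map R J (A W') (%v. push (N v) (W v) (h v) (W' v))"
      by (rule tensor_map_cong) (use J[OF p(2)] adm_comp[OF W] adm_comp[OF W'] in auto)
     then show ?thesis by (simp only: p(1) prod.case)
    qed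
   qed
   also have "\<dots> = tc W' (%v. push (N v) (W v) (h v) (W' v) (x v))"
    by (rule m(1)) (use out fixp in blast)+
   finally show ?thesis .
  qed
  show "tuple W' (%v. push (N v) (W v) (h v) (W' v) (x v))"
   by (rule m(2)) (use out fixp in blast)+
 next
  assume y: "tuple W' y"
  have J: "J \<subseteq> I" if "(J, t) \<in> tc W' y" for J t using tc_index[OF W' y that] .
  note m = rt_map[OF W' W y pl(1) S]
  show "pull (restricted_tensor R I U N \<phi>) (PiE I W) h (PiE I W') (tc W' y) = tc W (%v. pull (N v) (W v) (h v) (W' v) (y v))"
  proof -
   have "pull (restricted_tensor R I U N \<phi>) (PiE I W) h (PiE I W') (tc W' y) =
     (\<Union>(J, t)\<in>{(J, t)\<in>tc W' y. ?S \<subseteq> J}. cls W (J, tensor_map R J (A W) (%v. pull (N v) (component v (PiE I W)) (h v) (component v (PiE I W'))) t))"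
    by (simp only: restricted_tensor_def ric.simps)
   also have "\<dots> = (\<Union>(J, t)\<in>{(J, t)\<in>tc W' y. ?S \<subseteq> J}. cls W (J, tensor_map R J (A W) (%v. pull (N v) (W v) (h v) (W' v)) t))"
   proof (rule SUP_cong[OF HOL.refl])
    fix p assume "p \<in> {(J, t)\<in>tc W' y. ?S \<subseteq> J}"
    then obtain J t where p: "p = (J, t)" "(J, t) \<in> tc W' y" by blast
    show "(case p of (J, t) => cls W (J, tensor_map R J (A W) (%v. pull (N v) (component v (PiE I W)) (h v) (component v (PiE I W'))) t)) = (case p of (J, t) => cls W (J, tensor_map R J (A W) (%v. pull (N v) (W v) (h v) (W' v)) t))"
    proof -
     have "tensor_map R J (A W) (%v. pull (N v) (component v (PiE I W)) (h v) (component v (PiE I W'))) =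
       tensor_map R J (A W) (%v. pull (N v) (W v) (h v) (W' v))"
      by (rule tensor_map_cong) (use J[OF p(2)] adm_comp[OF W] adm_comp[OF W'] in auto)
     then show ?thesis by (simp only: p(1) prod.case)
    qed
   qed
   also have "\<dots> = tc W (%v. pull (N v) (W v) (h v) (W' v) (y v))"
    by (rule m(1)) (use out fixq in blast)+
   finally show ?thesis .
  qed
  show "tuple W (%v. pull (N v) (W v) (h v) (W' v) (y v))"
   by (rule m(2)) (use out fixq in blast)+
 }
qed

end

section \<open>Levels\<close>

lemma topological_group_translations:
 assumes "topological_group G T" "g \<in> carrier G"
 shows "continuous_map T T (%x. g \<otimes>\<^bsub>G\<^esub> x)" "continuous_map T T (%x. x \<otimes>\<^bsub>G\<^esub> g)"
proof -
 have top: "topspace T = carrier G" using assms by (simp add: topological_group_def)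
 have m: "continuous_map (prod_topology T T) T (%(x, y). x \<otimes>\<^bsub>G\<^esub> y)" using assms by (simp add: topological_group_def)
 have "continuous_map T (prod_topology T T) (%x. (g, x))" "continuous_map T (prod_topology T T) (%x. (x, g))"
  using assms(2) top by (simp_all add: continuous_map_paired)
 from this[THEN continuous_map_compose, OF m]
 show "continuous_map T T (%x. g \<otimes>\<^bsub>G\<^esub> x)" "continuous_map T T (%x. x \<otimes>\<^bsub>G\<^esub> g)" by (simp_all add: o_def)
qed

lemma conj_by_compact_open:
 assumes G: "topological_group G T" and A: "compact_open_subgroup G T A" and g: "g \<in> carrier G"
 shows "compact_open_subgroup G T (conj_by G g A)"
proof -
 interpret group G using G by (simp add: topological_group_def)
 have top: "topspace T = carrier G" using G by (simp add: topological_group_def)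
 have c: "continuous_map T T (%x. g \<otimes>\<^bsub>G\<^esub> x \<otimes>\<^bsub>G\<^esub> inv\<^bsub>G\<^esub> g)" if "g \<in> carrier G" for g
  using continuous_map_compose[OF topological_group_translations(1)[OF G that] topological_group_translations(2)[OF G inv_closed[OF that]]]
  by (simp add: o_def)
 have A': "subgroup A G" "compactin T A" "openin T A" "A \<subseteq> carrier G"
  using A subgroup.subset by (auto simp: compact_open_subgroup_def)
 have "conj_by G g A = {x \<in> topspace T. inv\<^bsub>G\<^esub> g \<otimes>\<^bsub>G\<^esub> x \<otimes>\<^bsub>G\<^esub> inv\<^bsub>G\<^esub> (inv\<^bsub>G\<^esub> g) \<in> A}"
  using mem_conj_by[OF g A'(4)] conj_by_closed[OF g A'(4)] top g by auto
 then have "openin T (conj_by G g A)"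
  using openin_continuous_map_preimage[OF c[OF inv_closed[OF g]] A'(3)] by simp
 moreover have "compactin T (conj_by G g A)" unfolding conj_by_def by (rule image_compactin[OF A'(2) c[OF g]])
 ultimately show ?thesis using conj_by_subgroup[OF A'(1) g] by (simp add: compact_open_subgroup_def)
qed

lemma conj_intersections_compact_open:
 assumes G: "topological_group G T" "Hausdorff_space T"
  and \<B>: "\<And>A. A \<in> \<B> ==> compact_open_subgroup G T A" and M: "M \<in> conj_intersections G \<B>"
 shows "compact_open_subgroup G T M"
proof -
 interpret group G using G by (simp add: topological_group_def)
 obtain F where F: "M = \<Inter>F" "finite F" "F ~= {}" "F \<subseteq> {conj_by G g A | g A. g \<in> carrier G \<and> A \<in> \<B>}"
  using M by (auto simp: conj_intersections_def)
 have co: "compact_open_subgroup G T A" if "A \<in> F" for A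
  using conj_by_compact_open[OF G(1) \<B>] F(4) that by blast
 obtain A0 where A0: "A0 \<in> F" using F(3) by blast
 have "openin T M" unfolding F(1) using F(2,3) co by (intro openin_Inter) (auto simp: compact_open_subgroup_def)
 moreover have "closedin T M" unfolding F(1)
  using F(3) co compactin_imp_closedin[OF G(2)] by (intro closedin_Inter) (auto simp: compact_open_subgroup_def)
 then have "compactin T M"
  using closed_compactin[of T A0 M] co[OF A0] A0 F(1) by (auto simp: compact_open_subgroup_def)
 moreover have "subgroup M G" unfolding F(1) using subgroups_Inter[of F] F(3) co by (auto simp: compact_open_subgroup_def)
 ultimately show ?thesis by (simp add: compact_open_subgroup_def)
qed

lemma conj_intersections_Int:
 assumes "M \<in> conj_intersections G \<B>" "M' \<in> conj_intersections G \<B>"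
 shows "M \<inter> M' \<in> conj_intersections G \<B>"
proof -
 obtain F F' where "M = \<Inter>F" "finite F" "F ~= {}" "F \<subseteq> {conj_by G g A | g A. g \<in> carrier G \<and> A \<in> \<B>}"
  "M' = \<Inter>F'" "finite F'" "F' ~= {}" "F' \<subseteq> {conj_by G g A | g A. g \<in> carrier G \<and> A \<in> \<B>}"
  using assms unfolding conj_intersections_def by blast
 then show ?thesis unfolding conj_intersections_def
  by (intro CollectI exI[of _ "F \<union> F'"] conjI) (auto simp only: Inter_Un_distrib finite_Un Un_empty Un_subset_iff)
qed

lemma conj_intersections_base: "A \<in> \<B> ==> g \<in> carrier G ==> conj_by G g A \<in> conj_intersections G \<B>"
 unfolding conj_intersections_def by (intro CollectI exI[of _ "{conj_by G g A}"] conjI) auto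

lemma (in group) conj_by_Inter:
 assumes h: "h \<in> carrier G" and F: "F ~= {}" "\<And>A. A \<in> F ==> A \<subseteq> carrier G"
 shows "conj_by G h (\<Inter>F) = \<Inter>(conj_by G h ` F)"
proof (rule Set.set_eqI)
 fix x
 have IF: "\<Inter>F \<subseteq> carrier G" using F by blast
 show "x \<in> conj_by G h (\<Inter>F) \<longleftrightarrow> x \<in> \<Inter>(conj_by G h ` F)"
 proof (cases "x \<in> carrier G")
  case True
  have "x \<in> conj_by G h A \<longleftrightarrow> inv h \<otimes> x \<otimes> h \<in> A" if "A \<in> F" for A by (rule mem_conj_by[OF h F(2)[OF that] True])
  then show ?thesis using mem_conj_by[OF h IF True] by auto
 next
  case False
  moreover obtain A where "A \<in> F" using F(1) by blast
  ultimately show ?thesis using conj_by_closed[OF h IF] conj_by_closed[OF h F(2)[OF \<open>A \<in> F\<close>]] by blast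
 qed
qed

lemma conj_intersections_conj:
 assumes G: "group G" and \<B>: "\<And>A. A \<in> \<B> ==> A \<subseteq> carrier G" and M: "M \<in> conj_intersections G \<B>" and h: "h \<in> carrier G"
 shows "conj_by G h M \<in> conj_intersections G \<B>"
proof -
 interpret group G by (rule G)
 obtain F where F: "M = \<Inter>F" "finite F" "F ~= {}" "F \<subseteq> {conj_by G g A | g A. g \<in> carrier G \<and> A \<in> \<B>}"
  using M unfolding conj_intersections_def by blast
 have FG: "A \<subseteq> carrier G" if "A \<in> F" for A using F(4) that conj_by_closed \<B> by blast
 have "conj_by G h ` F \<subseteq> {conj_by G g A | g A. g \<in> carrier G \<and> A \<in> \<B>}"
 proof (rule image_subsetI)
  fix C assume "C \<in> F"
  then obtain g A where gA: "C = conj_by G g A" "g \<in> carrier G" "A \<in> \<B>" using F(4) by blast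
  then have "conj_by G h C = conj_by G (h \<otimes>\<^bsub>G\<^esub> g) A" using conj_by_conj_by h \<B> by simp
  then show "conj_by G h C \<in> {conj_by G g A | g A. g \<in> carrier G \<and> A \<in> \<B>}" using gA h by blast
 qed
 moreover have "conj_by G h (\<Inter>F) = \<Inter>(conj_by G h ` F)" by (rule conj_by_Inter[OF h F(3)]) (rule FG)
 ultimately show ?thesis unfolding conj_intersections_def F(1)
  using F(2,3) by (intro CollectI exI[of _ "conj_by G h ` F"] conjI) auto
qed

section \<open>Double cosets and Hecke functions\<close>

context group
begin

lemma double_coset_self:
 "subgroup A G ==> subgroup B G ==> g \<in> carrier G ==> g \<in> double_coset G A g B"
 unfolding double_coset_def
 using subgroup.one_closed[of A G] subgroup.one_closed[of B G] by force

lemma double_coset_sym: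
 assumes A: "subgroup A G" and B: "subgroup B G" and g: "g \<in> carrier G" and h: "h \<in> double_coset G A g B"
 shows "g \<in> double_coset G A h B"
proof -
 obtain a b where ab: "a \<in> A" "b \<in> B" "h = a \<otimes> g \<otimes> b" using h by (auto simp: double_coset_def)
 have c: "a \<in> carrier G" "b \<in> carrier G" using ab A B subgroup.subset by blast+
 have "inv a \<otimes> h \<otimes> inv b = (inv a \<otimes> a) \<otimes> g \<otimes> (b \<otimes> inv b)"
  unfolding ab(3) using c g by (simp only: m_assoc m_closed inv_closed)
 then have "g = inv a \<otimes> h \<otimes> inv b" using c g by simp
 then show ?thesis unfolding double_coset_def
  using subgroup.m_inv_closed[OF A ab(1)] subgroup.m_inv_closed[OF B ab(2)] by blast
qed

lemma double_coset_subset: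
 assumes A: "subgroup A G" and B: "subgroup B G" and g: "g \<in> carrier G" and h: "h \<in> double_coset G A g B"
 shows "double_coset G A h B \<subseteq> double_coset G A g B"
proof
 fix x assume "x \<in> double_coset G A h B"
 then obtain c d where cd: "c \<in> A" "d \<in> B" "x = c \<otimes> h \<otimes> d" by (auto simp: double_coset_def)
 obtain a b where ab: "a \<in> A" "b \<in> B" "h = a \<otimes> g \<otimes> b" using h by (auto simp: double_coset_def)
 have "a \<in> carrier G" "b \<in> carrier G" "c \<in> carrier G" "d \<in> carrier G" using ab cd A B subgroup.subset by blast+
 then have "x = (c \<otimes> a) \<otimes> g \<otimes> (b \<otimes> d)" unfolding cd(3) ab(3) using g by (simp add: m_assoc)
 then show "x \<in> double_coset G A g B" unfolding double_coset_def
  using subgroup.m_closed[OF A cd(1) ab(1)] subgroup.m_closed[OF B ab(2) cd(2)] by blast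
qed

lemma double_coset_carrier:
 assumes "subgroup A G" "subgroup B G" "g \<in> carrier G"
 shows "double_coset G A g B \<subseteq> carrier G"
 using assms(3) subgroup.subset[OF assms(1)] subgroup.subset[OF assms(2)] by (auto simp: double_coset_def)

lemma double_coset_eq:
 assumes A: "subgroup A G" and B: "subgroup B G" and g: "g \<in> carrier G" and h: "h \<in> double_coset G A g B"
 shows "double_coset G A h B = double_coset G A g B"
 using double_coset_subset[OF A B g h] double_coset_carrier[OF A B g] h
  double_coset_subset[OF A B _ double_coset_sym[OF A B g h]] by blast

text \<open>The chosen element depends on k only through its double coset, so the image of the
  choice function meets each double coset in exactly one point.\<close>

lemma double_coset_reps_exist:
 assumes A: "subgroup A G" and B: "subgroup B G" and K: "K \<subseteq> carrier G"
 shows "\<exists>\<G>. double_coset_reps G A K B \<G>"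
proof -
 define r where "r k = (SOME \<g>. \<g> \<in> K \<and> double_coset G A \<g> B = double_coset G A k B)" for k
 have r: "r k \<in> K \<and> double_coset G A (r k) B = double_coset G A k B" if "k \<in> K" for k
  unfolding r_def by (rule someI[of _ k]) (simp add: that)
 have "\<exists>!\<g>. \<g> \<in> r ` K \<and> k \<in> double_coset G A \<g> B" if k: "k \<in> K" for k
 proof (rule ex1I[of _ "r k"])
  show "r k \<in> r ` K \<and> k \<in> double_coset G A (r k) B"
   using k r[OF k] double_coset_self[OF A B subsetD[OF K k]] by simp
  fix \<g> assume \<g>: "\<g> \<in> r ` K \<and> k \<in> double_coset G A \<g> B"
  then obtain k' where k': "k' \<in> K" "\<g> = r k'" by blast
  have "k \<in> double_coset G A k' B" using \<g> k'(2) r[OF k'(1)] by simp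
  then have "double_coset G A k B = double_coset G A k' B" by (rule double_coset_eq[OF A B subsetD[OF K k'(1)]])
  then show "\<g> = r k" unfolding k'(2) r_def by simp
 qed
 moreover have "r ` K \<subseteq> K" using r by blast
 ultimately have "double_coset_reps G A K B (r ` K)" unfolding double_coset_reps_def by (intro conjI ballI)
 then show ?thesis ..
qed

end

definition "coset_rep D = (SOME \<s>. \<s> \<in> D)"

section \<open>Representatives of double cosets in the support of a Hecke function\<close>

locale hecke_data =
 fixes G :: "('a, 'b) monoid_scheme" (structure) and T :: "'a topology" and K U :: "'a set"
  and R :: "('r, 'c) ring_scheme" and f :: "'a => 'r"
 assumes G_top: "topological_group G T" and K: "compact_open_subgroup G T K"
  and U: "subgroup U G" "U \<subseteq> K" and R: "domain R" and f: "f \<in> hecke_functions R G K"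
begin

sublocale left_translation_group G T
 using G_top topological_group_translations(1)[OF G_top]
 by (intro left_translation_group.intro left_translation_group_axioms.intro) (auto simp: topological_group_def)

sublocale R: domain R by (rule R)

lemma K_sg: "subgroup K G" and KG: "k \<in> K ==> k \<in> carrier G" and UK: "u \<in> U ==> u \<in> K"
 using K U(2) subgroup.subset[of K G] by (auto simp: compact_open_subgroup_def)

lemma mem_double_cosets:
 assumes "D \<in> double_cosets G K K" "x \<in> carrier G"
 shows "x \<in> D \<longleftrightarrow> D = double_coset G K x K"
proof
 obtain s where s: "s \<in> carrier G" "D = double_coset G K s K" using assms(1) by (auto simp: double_cosets_def)
 show "D = double_coset G K x K" if "x \<in> D"
  unfolding double_coset_eq[OF K_sg K_sg s(1) that[unfolded s(2)]] by (rule s(2))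
 show "x \<in> D" if "D = double_coset G K x K"
  unfolding that by (rule double_coset_self[OF K_sg K_sg assms(2)])
qed

lemma double_cosets_carrier: "D \<in> double_cosets G K K ==> x \<in> D ==> x \<in> carrier G"
 using double_coset_carrier[OF K_sg K_sg] by (auto simp: double_cosets_def)

definition "support_cosets = {D \<in> double_cosets G K K. \<exists>\<s>\<in>D. f \<s> ~= \<zero>\<^bsub>R\<^esub>}"

lemma hecke_function:
 shows f_closed: "f \<in> carrier G \<rightarrow> carrier R"
  and f_bi: "g \<in> carrier G ==> k \<in> K ==> k' \<in> K ==> f (k \<otimes> g \<otimes> k') = f g"
  and finite_support_cosets: "finite support_cosets"
proof -
 obtain \<D> c where D: "finite \<D>" "\<D> \<subseteq> double_cosets G K K" "c \<in> \<D> \<rightarrow> carrier R"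
  "\<And>g. g \<in> carrier G ==> f g = (\<Oplus>\<^bsub>R\<^esub>D\<in>\<D>. if g \<in> D then c D else \<zero>\<^bsub>R\<^esub>)" and fc: "f \<in> carrier G \<rightarrow>\<^sub>E carrier R"
  using f unfolding hecke_functions_def by blast
 show "f \<in> carrier G \<rightarrow> carrier R" using fc by (auto simp: PiE_iff)
 show "f (k \<otimes> g \<otimes> k') = f g" if g: "g \<in> carrier G" and k: "k \<in> K" "k' \<in> K"
 proof -
  have kg: "k \<otimes> g \<otimes> k' \<in> carrier G" using g k KG by simp
  have "k \<otimes> g \<otimes> k' \<in> double_coset G K g K" unfolding double_coset_def using k by blast
  then have "double_coset G K (k \<otimes> g \<otimes> k') K = double_coset G K g K" by (rule double_coset_eq[OF K_sg K_sg g])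
  then have "k \<otimes> g \<otimes> k' \<in> D \<longleftrightarrow> g \<in> D" if "D \<in> \<D>" for D
   using mem_double_cosets[OF subsetD[OF D(2) that]] g kg by simp
  then show ?thesis unfolding D(4)[OF g] D(4)[OF kg] by (intro R.finsum_cong') (use D(3) in auto)
 qed
 show "finite support_cosets"
 proof (rule finite_subset[OF _ D(1)], rule subsetI)
  fix D assume "D \<in> support_cosets"
  then obtain \<s> where a: "D \<in> double_cosets G K K" "\<s> \<in> D" "f \<s> ~= \<zero>\<^bsub>R\<^esub>" unfolding support_cosets_def by blast
  have \<s>: "\<s> \<in> carrier G" by (rule double_cosets_carrier[OF a(1,2)])
  have "\<exists>D'\<in>\<D>. \<s> \<in> D'"
  proof (rule ccontr)
   assume "\<not> (\<exists>D'\<in>\<D>. \<s> \<in> D')"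
   then have "f \<s> = (\<Oplus>\<^bsub>R\<^esub>D\<in>\<D>. \<zero>\<^bsub>R\<^esub>)" unfolding D(4)[OF \<s>] by (intro R.finsum_cong') auto
   then show False using a(3) by simp
  qed
  then obtain D' where D': "D' \<in> \<D>" "\<s> \<in> D'" by blast
  then show "D \<in> \<D>" using mem_double_cosets[OF a(1) \<s>] mem_double_cosets[OF subsetD[OF D(2) D'(1)] \<s>] a(2) by simp
 qed
qed

text \<open>Every left coset in KsK comes from the compact set Ks, and an open subgroup has finitely
  many left cosets meeting a compact set.\<close>

lemma finite_support: "finite ((%g. g \<star> K) ` {g \<in> carrier G. f g ~= \<zero>\<^bsub>R\<^esub>})"
proof (rule finite_subset)
 have "g \<in> double_coset G K g K" if "g \<in> carrier G" for g by (rule double_coset_self[OF K_sg K_sg that])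
 then show "(%g. g \<star> K) ` {g \<in> carrier G. f g ~= \<zero>\<^bsub>R\<^esub>} \<subseteq> (\<Union>D\<in>support_cosets. (%g. g \<star> K) ` D)"
  unfolding support_cosets_def double_cosets_def by blast
 have "finite ((%g. g \<star> K) ` double_coset G K s K)" if s: "s \<in> carrier G" for s
 proof (rule finite_subset)
  have "compactin T ((%k. k \<otimes> s) ` K)"
   using K topological_group_translations(2)[OF G_top s] by (auto simp: compact_open_subgroup_def intro: image_compactin)
  then show "finite ((%g. g \<star> K) ` (%k. k \<otimes> s) ` K)"
   using finite_lcosets[OF K_sg] K by (auto simp: compact_open_subgroup_def)
  show "(%g. g \<star> K) ` double_coset G K s K \<subseteq> (%g. g \<star> K) ` (%k. k \<otimes> s) ` K"
  proof (rule image_subsetI)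
   fix x assume "x \<in> double_coset G K s K"
   then obtain a b where ab: "a \<in> K" "b \<in> K" "x = a \<otimes> s \<otimes> b" by (auto simp: double_coset_def)
   have "x \<in> (a \<otimes> s) \<star> K" using ab by (auto simp: l_coset_def)
   then have "(a \<otimes> s) \<star> K = x \<star> K" using l_repr_independence[OF _ _ K_sg] KG ab s by simp
   then show "x \<star> K \<in> (%g. g \<star> K) ` (%k. k \<otimes> s) ` K" using ab(1) by auto
  qed
 qed
 then show "finite (\<Union>D\<in>support_cosets. (%g. g \<star> K) ` D)"
  using finite_support_cosets by (auto simp: support_cosets_def double_cosets_def)
qed

abbreviation "Ks s \<equiv> K \<inter> conj_by G s K"

definition "unit_reps D = (SOME \<G>. double_coset_reps G U K (Ks (coset_rep D)) \<G> \<and> finite \<G>)"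

text \<open>The map \<gamma> \<mapsto> \<gamma>s induces a bijection from K/(K \<inter> sKs^{-1}) to
  KsK/K, compatible with left multiplication by U. Representatives of the double cosets of U and K
  \<inter> sKs^{-1} in K, which index the Mackey formula, thus become representatives of the double
  cosets of U and K in KsK, which index the local identity.\<close>

definition "hecke_reps = (\<Union>D\<in>support_cosets. (%\<g>. \<g> \<otimes> coset_rep D) ` unit_reps D)"

lemma Ks_sg: "s \<in> carrier G ==> subgroup (Ks s) G"
 by (rule subgroups_Inter_pair[OF K_sg conj_by_subgroup[OF K_sg]])

text \<open>Distinct representatives lie in distinct cosets of the open subgroup K \<inter>
  sKs^{-1}, of which the compact group K has finitely many.\<close>

lemma finite_unit_reps_exist:
 assumes s: "s \<in> carrier G"
 shows "\<exists>\<G>. double_coset_reps G U K (Ks s) \<G> \<and> finite \<G>"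
proof -
 note sg = Ks_sg[OF s]
 obtain \<G> where \<G>: "double_coset_reps G U K (Ks s) \<G>"
  using double_coset_reps_exist[OF U(1) sg subgroup.subset[OF K_sg]] by blast
 have op: "openin T (Ks s)" "compactin T K"
  using K conj_by_compact_open[OF G_top K s] unfolding compact_open_subgroup_def by blast+
 have "inj_on (%u. u \<star> Ks s) \<G>"
 proof (rule inj_onI)
  fix a b assume a: "a \<in> \<G>" and b: "b \<in> \<G>" and e: "a \<star> Ks s = b \<star> Ks s"
  have ab: "a \<in> K" "a \<in> carrier G" "b \<in> carrier G" using a b \<G> KG unfolding double_coset_reps_def by blast+
  have "a \<in> b \<star> Ks s" using l_coset_self[OF sg ab(2)] e by simp
  then obtain t where "t \<in> Ks s" "a = \<one> \<otimes> b \<otimes> t" using ab(3) by (auto simp: l_coset_def)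
  then have "a \<in> double_coset G U b (Ks s)"
   unfolding double_coset_def using subgroup.one_closed[OF U(1)] by blast
  then show "a = b" using \<G> a b ab(1) double_coset_self[OF U(1) sg ab(2)] unfolding double_coset_reps_def by blast
 qed
 moreover have "(%u. u \<star> Ks s) ` \<G> \<subseteq> (%u. u \<star> Ks s) ` K" using \<G> unfolding double_coset_reps_def by blast
 ultimately have "finite \<G>" using finite_lcosets[OF sg op] by (metis finite_subset finite_imageD)
 then show ?thesis using \<G> by blast
qed

lemma support_coset:
 assumes D: "D \<in> support_cosets"
 shows "coset_rep D \<in> carrier G" "D = double_coset G K (coset_rep D) K"
  "double_coset_reps G U K (Ks (coset_rep D)) (unit_reps D)" "finite (unit_reps D)" "unit_reps D \<subseteq> K"
proof -
 have dc: "D \<in> double_cosets G K K" using D unfolding support_cosets_def by blast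
 have r: "coset_rep D \<in> D" unfolding coset_rep_def by (rule someI_ex) (use D in \<open>auto simp: support_cosets_def\<close>)
 show c: "coset_rep D \<in> carrier G" by (rule double_cosets_carrier[OF dc r])
 show "D = double_coset G K (coset_rep D) K" using mem_double_cosets[OF dc c] r by blast
 have u: "double_coset_reps G U K (Ks (coset_rep D)) (unit_reps D) \<and> finite (unit_reps D)"
  unfolding unit_reps_def by (rule someI_ex[OF finite_unit_reps_exist[OF c]])
 then show "double_coset_reps G U K (Ks (coset_rep D)) (unit_reps D)" "finite (unit_reps D)" by blast+
 show "unit_reps D \<subseteq> K" using u unfolding double_coset_reps_def by blast
qed

lemma unit_rep_mem:
 assumes D: "D \<in> support_cosets" and \<g>: "\<g> \<in> unit_reps D"
 shows "\<g> \<otimes> coset_rep D \<in> D" "\<g> \<in> carrier G" "f (\<g> \<otimes> coset_rep D) = f (coset_rep D)"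
proof -
 note S = support_coset[OF D] and one = subgroup.one_closed[OF K_sg]
 have \<g>K: "\<g> \<in> K" using S(5) \<g> by blast
 then show \<g>G: "\<g> \<in> carrier G" by (rule KG)
 have e: "\<g> \<otimes> coset_rep D = \<g> \<otimes> coset_rep D \<otimes> \<one>" using \<g>G S(1) by simp
 show "\<g> \<otimes> coset_rep D \<in> D" by (subst S(2), subst e) (use \<g>K one in \<open>auto simp: double_coset_def\<close>)
 show "f (\<g> \<otimes> coset_rep D) = f (coset_rep D)" using f_bi[OF S(1) \<g>K one] e by simp
qed

lemma support_coset_unique:
 "D \<in> support_cosets ==> D' \<in> support_cosets ==> x \<in> D ==> x \<in> D' ==> D = D'"
proof -
 assume a: "D \<in> support_cosets" "D' \<in> support_cosets" "x \<in> D" "x \<in> D'"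
 then have d: "D \<in> double_cosets G K K" "D' \<in> double_cosets G K K" unfolding support_cosets_def by blast+
 note x = double_cosets_carrier[OF d(1) a(3)]
 show ?thesis
  using iffD1[OF mem_double_cosets[OF d(1) x] a(3)] iffD1[OF mem_double_cosets[OF d(2) x] a(4)] by (rule HOL.trans[OF _ HOL.sym])
qed

lemma hecke_reps:
 shows "finite hecke_reps" "hecke_reps \<subseteq> carrier G"
  and "a \<in> hecke_reps ==> b \<in> hecke_reps ==> b \<in> double_coset G U a K ==> b = a"
  and "q \<in> carrier G ==> f q ~= \<zero>\<^bsub>R\<^esub> ==> \<exists>\<g>\<in>hecke_reps. q \<in> double_coset G U \<g> K"
proof -
 show "finite hecke_reps" unfolding hecke_reps_def using finite_support_cosets support_coset(4) by auto
 show "hecke_reps \<subseteq> carrier G" unfolding hecke_reps_def using unit_rep_mem(2) support_coset(1) by auto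
next
 assume a: "a \<in> hecke_reps" and b: "b \<in> hecke_reps" and ba: "b \<in> double_coset G U a K"
 obtain D \<g> where D: "D \<in> support_cosets" "\<g> \<in> unit_reps D" "a = \<g> \<otimes> coset_rep D" using a unfolding hecke_reps_def by blast
 obtain D' \<g>' where D': "D' \<in> support_cosets" "\<g>' \<in> unit_reps D'" "b = \<g>' \<otimes> coset_rep D'" using b unfolding hecke_reps_def by blast
 note S = support_coset[OF D(1)]
 have aD: "a \<in> D" and bD': "b \<in> D'" unfolding D(3) D'(3) by (rule unit_rep_mem(1)[OF D(1,2)], rule unit_rep_mem(1)[OF D'(1,2)])
 obtain u k where uk: "u \<in> U" "k \<in> K" "b = u \<otimes> a \<otimes> k" using ba by (auto simp: double_coset_def)
 have "b \<in> double_coset G K a K" unfolding double_coset_def uk(3) using UK[OF uk(1)] uk(2) by blast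
 then have "b \<in> D" using double_coset_eq[OF K_sg K_sg S(1)] aD S(2) by blast
 then have DD: "D' = D" using support_coset_unique[OF D'(1) D(1) bD'] by blast
 define s where "s = coset_rep D"
 have s: "s \<in> carrier G" unfolding s_def by (rule S(1))
 have \<g>: "\<g> \<in> K" "\<g>' \<in> K" using S(5) D(2) D'(2) unfolding DD by blast+
 note c = KG[OF \<g>(1)] KG[OF \<g>(2)] KG[OF UK[OF uk(1)]] KG[OF uk(2)] s
 \<comment> \<open>Comparing \<gamma>'s = u\<gamma>sk shows that \<gamma>' = u\<gamma>t with t =
   sks^{-1}. Solving for t shows that it also lies in K, so \<gamma> and \<gamma>' represent the
   same double coset in K.\<close>
 define t where "t = s \<otimes> k \<otimes> inv s"
 have tG: "t \<in> carrier G" unfolding t_def using c by simp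
 have e: "\<g>' \<otimes> s = u \<otimes> \<g> \<otimes> s \<otimes> k"
  using uk(3) c unfolding D(3) D'(3) DD s_def[symmetric] by (simp add: m_assoc)
 have "\<g>' = \<g>' \<otimes> s \<otimes> inv s" using c by (simp add: m_assoc)
 also have "\<dots> = u \<otimes> \<g> \<otimes> t" unfolding e t_def using c by (simp add: m_assoc)
 finally have \<g>'_eq: "\<g>' = u \<otimes> \<g> \<otimes> t" .
 have "t = inv (u \<otimes> \<g>) \<otimes> \<g>'" using inv_solve_left[of t "u \<otimes> \<g>" \<g>'] \<g>'_eq c tG by simp
 then have "t \<in> K"
  using subgroup.m_closed[OF K_sg subgroup.m_inv_closed[OF K_sg subgroup.m_closed[OF K_sg UK[OF uk(1)] \<g>(1)]] \<g>(2)] by simp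
 moreover have "t \<in> conj_by G s K" unfolding t_def conj_by_def using uk(2) by blast
 ultimately have "\<g>' \<in> double_coset G U \<g> (Ks s)" unfolding double_coset_def using uk(1) \<g>'_eq by blast
 moreover have "\<g>' \<in> double_coset G U \<g>' (Ks s)" by (rule double_coset_self[OF U(1) Ks_sg[OF s] c(2)])
 ultimately have "\<g>' = \<g>" using S(3) D(2) D'(2) \<g>(2) unfolding DD double_coset_reps_def s_def[symmetric] by blast
 then show "b = a" unfolding D(3) D'(3) DD by simp
next
 assume q: "q \<in> carrier G" "f q ~= \<zero>\<^bsub>R\<^esub>"
 define D where "D = double_coset G K q K"
 have qD: "q \<in> D" unfolding D_def by (rule double_coset_self[OF K_sg K_sg q(1)])
 then have D: "D \<in> support_cosets" unfolding support_cosets_def double_cosets_def using q D_def by blast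
 note S = support_coset[OF D]
 define s where "s = coset_rep D"
 have s: "s \<in> carrier G" unfolding s_def by (rule S(1))
 have "q \<in> double_coset G K s K" using qD S(2) unfolding s_def by blast
 then obtain a b where ab: "a \<in> K" "b \<in> K" "q = a \<otimes> s \<otimes> b" by (auto simp: double_coset_def)
 obtain \<g> where \<g>: "\<g> \<in> unit_reps D" "a \<in> double_coset G U \<g> (Ks s)"
  using S(3) ab(1) unfolding double_coset_reps_def s_def by blast
 then obtain u t where ut: "u \<in> U" "t \<in> Ks s" "a = u \<otimes> \<g> \<otimes> t" by (auto simp: double_coset_def)
 obtain k where k: "k \<in> K" "t = s \<otimes> k \<otimes> inv s" using ut(2) by (auto simp: conj_by_def)
 note c = KG[OF UK[OF ut(1)]] unit_rep_mem(2)[OF D \<g>(1)] KG[OF k(1)] KG[OF ab(2)]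
 have "q = u \<otimes> (\<g> \<otimes> s) \<otimes> (k \<otimes> b)"
  unfolding ab(3) ut(3) k(2) using c s by (simp add: m_assoc inv_solve_left[symmetric])
 then have "q \<in> double_coset G U (\<g> \<otimes> s) K"
  unfolding double_coset_def using ut(1) subgroup.m_closed[OF K_sg k(1) ab(2)] by blast
 moreover have "\<g> \<otimes> s \<in> hecke_reps" unfolding hecke_reps_def s_def using D \<g>(1) by blast
 ultimately show "\<exists>\<g>\<in>hecke_reps. q \<in> double_coset G U \<g> K" by blast
qed

end

section \<open>The setting of the theorem\<close>

locale setting =
 fixes I I' :: "'i set"
  and G :: "'i => 'a monoid" and T :: "'i => 'a topology"
  and H :: "'i => 'a set" and haar :: "'i => 'a measure"
  and K L U :: "'i => 'a set"
  and GG HH :: "('i => 'a) monoid"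
  and \<L>G \<L>H :: "('i => 'a) set set"
  and \<L>Hv :: "'i => 'a set set"
  and Kl :: "'i set => ('i => 'a) set"
  and R :: "'r ring" and \<Phi> :: "'k ring" and e :: "'r => 'k" and \<rho> :: "rat => 'k"
  and MH :: "('i => 'a, 'r, 'mh) ric" and MG :: "('i => 'a, 'r, 'mg) ric"
  and \<iota> :: "('i => 'a) set => ('i => 'a) set => 'mh => 'mg"
  and f :: "'i => 'a => 'r"
  and N :: "'i => ('a, 'r, 'n) ric" and \<phi> :: "'i => 'n"
  and \<psi> :: "('i => 'a) set => ('i set \<times> (('i => 'n) => 'r) set) set => 'mh"
 assumes local_groups:
   "\<And>v. v \<in> I ==> locally_profinite (G v) (T v)"
   "\<And>v. v \<in> I ==> subgroup (H v) (G v)"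
   "\<And>v. v \<in> I ==> closedin (T v) (H v)"
   "\<And>v. v \<in> I ==> unimodular ((G v)\<lparr>carrier := H v\<rparr>) (subtopology (T v) (H v))"
   "\<And>v. v \<in> I ==>
     left_haar_measure ((G v)\<lparr>carrier := H v\<rparr>) (subtopology (T v) (H v)) (haar v)"
   "\<And>v. v \<in> I ==> compact_open_subgroup (G v) (T v) (K v)"
   "\<And>v. U v = H v \<inter> K v"
  and global_groups:
   "GG = restricted_product I G K"
   "HH = restricted_product I (%v. (G v)\<lparr>carrier := H v\<rparr>) U"
  and levels_L:
   "I' \<subseteq> I"
   "\<And>v. v \<in> I' ==> compact_open_subgroup (G v) (T v) (L v)"
   "\<And>v. v \<in> I' ==> L v \<lhd> (G v)\<lparr>carrier := K v\<rparr>"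
   "\<And>\<nu>. Kl \<nu> = (\<Pi>\<^sub>E v\<in>I. if v \<in> \<nu> then L v else K v)"
  and collections:
   "level_collection GG (restricted_topology I T K) \<L>G"
   "PiE I K \<in> \<L>G"
   "\<And>v. v \<in> I' ==> Kl {v} \<in> \<L>G"
   "level_collection HH (restricted_topology I (%v. subtopology (T v) (H v)) U) \<L>H"
   "\<And>K'. K' \<in> \<L>G ==> K' \<inter> carrier HH \<in> \<L>H"
   "\<And>v. \<L>Hv v =
     {K' \<inter> H v | K'. K' \<in> conj_intersections (G v) (if v \<in> I' then {K v, L v} else {K v})}"
  and coefficients:
   "domain R" "fraction_field_of R \<Phi> e" "\<rho> \<in> ring_hom rat_ring \<Phi>"
  and functors:
   "comack_functor R HH \<L>H MH"
   "comack_functor R GG \<L>G MG"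
   "mackey_pushforward R GG (carrier HH) \<L>H \<L>G MH MG \<iota>"
  and hecke_elements:
   "\<And>v. v \<in> I' ==> f v \<in> hecke_functions R (G v) (K v)"
  and local_functors:
   "\<And>v. v \<in> I ==> comack_functor R ((G v)\<lparr>carrier := H v\<rparr>) (\<L>Hv v) (N v)"
   "\<And>v V. v \<in> I ==> V \<in> \<L>Hv v ==> torsion_free R (obj (N v) V)"
   "\<And>v. v \<in> I ==> \<phi> v \<in> carrier (obj (N v) (U v))"
  and morphism:
   "ric_morphism R HH (product_levels I U \<L>Hv) (restricted_tensor R I U N \<phi>) MH \<psi>"
  and zeta:
   "\<And>v. v \<in> I' ==>
     \<exists>\<zeta>. zeta_element R \<Phi> e \<rho> (G v) (T v) (H v) (haar v) (\<L>Hv v) (N v) (K v) (L v) (\<phi> v) (f v) \<zeta>"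
begin

abbreviation "\<B> v \<equiv> (if v \<in> I' then {K v, L v} else {K v})"
abbreviation "Hl v \<equiv> (G v)\<lparr>carrier := H v\<rparr>"

lemma R_cring: "cring R"
 using coefficients(1) by (simp add: domain_def)

lemma I'I: "v \<in> I' ==> v \<in> I" using levels_L(1) by blast

lemma top: "v \<in> I ==> topological_group (G v) (T v)" "v \<in> I ==> Hausdorff_space (T v)"
 using local_groups(1) by (auto simp: locally_profinite_def)

lemma grp: "v \<in> I ==> group (G v)"
 using top by (simp add: topological_group_def)

lemma topsp: "v \<in> I ==> topspace (T v) = carrier (G v)"
 using top by (simp add: topological_group_def)

lemma \<B>_co: "v \<in> I ==> A \<in> \<B> v ==> compact_open_subgroup (G v) (T v) A"
 using local_groups(6) levels_L(2) by (auto split: if_splits)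

lemma co_sub: "compact_open_subgroup (G v) (T v) A ==> A \<subseteq> carrier (G v)"
 by (simp add: compact_open_subgroup_def subgroup.subset)

lemma K_sg: "v \<in> I ==> subgroup (K v) (G v)"
 using local_groups(6) by (simp add: compact_open_subgroup_def)

lemma L_sg: "v \<in> I' ==> subgroup (L v) (G v)"
 using levels_L(2) by (simp add: compact_open_subgroup_def)

lemma L_sub_K: "v \<in> I' ==> L v \<subseteq> K v"
 using normal_imp_subgroup[OF levels_L(3)] subgroup.subset by fastforce

lemma H_sub: "v \<in> I ==> H v \<subseteq> carrier (G v)"
 using local_groups(2) subgroup.subset by blast

text \<open>Finite intersections of conjugates are compact open in G_v. Intersecting with the closed
  subgroup H_v keeps them compact, and they are open in the subspace topology, so Haar measure on
  H_v applies to them.\<close>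

lemma local_level:
 assumes v: "v \<in> I" and V: "V \<in> \<L>Hv v"
 shows "V \<subseteq> H v" "subgroup V (G v)" "compact_open_subgroup (Hl v) (subtopology (T v) (H v)) V"
proof -
 interpret group "G v" by (rule grp[OF v])
 obtain M where M: "M \<in> conj_intersections (G v) (\<B> v)" "V = M \<inter> H v" using V collections(6) by auto
 have co: "compact_open_subgroup (G v) (T v) M"
  by (rule conj_intersections_compact_open[OF top[OF v] \<B>_co[OF v] M(1)])
 show VH: "V \<subseteq> H v" using M(2) by blast
 show sg: "subgroup V (G v)" unfolding M(2)
  using co local_groups(2)[OF v] subgroups_Inter_pair by (simp add: compact_open_subgroup_def)
 have "compactin (T v) (M \<inter> H v)"
  using closed_Int_compactin[OF local_groups(3)[OF v], of M] co by (simp add: compact_open_subgroup_def Int_commute)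
 then show "compact_open_subgroup (Hl v) (subtopology (T v) (H v)) V"
  using sg VH subgroup_incl[OF sg local_groups(2)[OF v] VH] co M(2)
  by (auto simp: compact_open_subgroup_def compactin_subtopology openin_subtopology)
qed

lemma local_level_Int: "V \<in> \<L>Hv v ==> W \<in> \<L>Hv v ==> V \<inter> W \<in> \<L>Hv v"
proof -
 assume "V \<in> \<L>Hv v" "W \<in> \<L>Hv v"
 then obtain M M' where M: "M \<in> conj_intersections (G v) (\<B> v)" "V = M \<inter> H v"
  "M' \<in> conj_intersections (G v) (\<B> v)" "W = M' \<inter> H v" unfolding collections(6) by blast
 have "V \<inter> W = (M \<inter> M') \<inter> H v" using M by blast
 then show ?thesis using conj_intersections_Int[OF M(1,3)] unfolding collections(6) by blast
qed

lemma local_level_conj: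
 assumes v: "v \<in> I" and h: "h \<in> H v" and V: "V \<in> \<L>Hv v"
 shows "conj_by (G v) h V \<in> \<L>Hv v"
proof -
 interpret group "G v" by (rule grp[OF v])
 obtain M where M: "M \<in> conj_intersections (G v) (\<B> v)" "V = M \<inter> H v" using V unfolding collections(6) by blast
 have hG: "h \<in> carrier (G v)" using h H_sub[OF v] by blast
 have MG: "M \<subseteq> carrier (G v)"
  by (rule co_sub[OF conj_intersections_compact_open[OF top[OF v] \<B>_co[OF v] M(1)]])
 have "conj_by (G v) h V = conj_by (G v) h M \<inter> H v"
  unfolding M(2) conj_by_Int[OF hG MG H_sub[OF v]] conj_by_self[OF local_groups(2)[OF v] h] ..
 then show ?thesis
  using conj_intersections_conj[OF grp[OF v] co_sub[OF \<B>_co[OF v]] M(1) hG] unfolding collections(6) by blast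
qed

lemma local_level_stab: "v \<in> I ==> g \<in> carrier (G v) ==> H v \<inter> conj_by (G v) g (K v) \<in> \<L>Hv v"
proof -
 assume "v \<in> I" and g: "g \<in> carrier (G v)"
 have "K v \<in> \<B> v" by simp
 from conj_intersections_base[where G = "G v", OF this g] show ?thesis
  unfolding collections(6) by (subst Int_commute) blast
qed

lemma U_level: "v \<in> I ==> U v \<in> \<L>Hv v"
 using local_level_stab[of v "\<one>\<^bsub>G v\<^esub>"] group.conj_by_one[OF grp subgroup.subset[OF K_sg]] local_groups(7)
  group.is_monoid[OF grp] by (simp add: monoid.one_closed)

lemma Hl_group: "v \<in> I ==> group (Hl v)"
 using group.subgroup_imp_group[OF grp local_groups(2)] .

lemma Hl_translation: "v \<in> I ==> left_translation_group (Hl v) (subtopology (T v) (H v))"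
proof -
 assume v: "v \<in> I"
 show ?thesis
 proof (rule left_translation_group.intro[OF Hl_group[OF v] left_translation_group_axioms.intro])
  show "topspace (subtopology (T v) (H v)) = carrier (Hl v)" using H_sub[OF v] topsp[OF v] by (auto simp: topspace_subtopology)
  fix u assume "u \<in> carrier (Hl v)"
  then have u: "u \<in> H v" "u \<in> carrier (G v)" using H_sub[OF v] by auto
  show "continuous_map (subtopology (T v) (H v)) (subtopology (T v) (H v)) (%x. u \<otimes>\<^bsub>Hl v\<^esub> x)"
   using continuous_map_from_subtopology[OF topological_group_translations(1)[OF top(1)[OF v] u(2)], of "H v"]
    subgroup.m_closed[OF local_groups(2)[OF v] u(1)]
   by (auto simp: continuous_map_in_subtopology topspace_subtopology image_subset_iff)
 qed
qed

lemma hecke_data: "v \<in> I' ==> hecke_data (G v) (T v) (K v) (U v) R (f v)"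
 by (rule hecke_data.intro[OF top(1)[OF I'I] local_groups(6)[OF I'I] local_level(2)[OF I'I U_level[OF I'I]] _ coefficients(1) hecke_elements])
  (simp_all add: local_groups(7))

abbreviation "support_cosets v \<equiv> hecke_data.support_cosets (G v) (K v) R (f v)"
abbreviation "unit_reps v \<equiv> hecke_data.unit_reps (G v) (K v) (U v)"
abbreviation "hecke_reps v \<equiv> hecke_data.hecke_reps (G v) (K v) (U v) R (f v)"
abbreviation "Ks v s \<equiv> K v \<inter> conj_by (G v) s (K v)"

lemmas hecke_function = hecke_data.f_closed[OF hecke_data] hecke_data.f_bi[OF hecke_data] hecke_data.finite_support[OF hecke_data]
lemmas finite_support_cosets = hecke_data.finite_support_cosets[OF hecke_data]
lemmas support_coset = hecke_data.support_coset[OF hecke_data]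
lemmas unit_rep_mem = hecke_data.unit_rep_mem[OF hecke_data]
lemmas support_coset_unique = hecke_data.support_coset_unique[OF hecke_data]

lemma local_data:
 assumes v': "v \<in> I'"
 shows "local_data R \<Phi> e \<rho> (G v) (T v) (H v) (K v) (haar v) (\<L>Hv v) (N v) (\<phi> v) (f v)"
proof (rule local_data.intro)
 note v = I'I[OF v']
 show "fraction_scalars R \<Phi> e" by (rule fraction_scalars.intro[OF coefficients(1,2)])
 note t = Hl_translation[OF v] and lv = local_level[OF v]
 interpret Gv: group "G v" by (rule grp[OF v])
 have conj: "conj_by (Hl v) h A = conj_by (G v) h A" if "h \<in> H v" for h A
  using that by (simp add: conj_by_def Gv.m_inv_consistent[OF local_groups(2)[OF v]])
 show "local_data_axioms R \<Phi> \<rho> (G v) (T v) (H v) (K v) (haar v) (\<L>Hv v) (N v) (\<phi> v) (f v)"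
 proof (rule local_data_axioms.intro)
  show "\<L>Hv v ~= {}" using U_level[OF v] by blast
  show "0 < measure (haar v) V" if "V \<in> \<L>Hv v" for V
   by (rule left_translation_group.haar_pos[OF t local_groups(5)[OF v] lv(3)[OF that]])
  show "finite ((%u. u \<star>\<^bsub>G v\<^esub> V) ` W)" if "V \<in> \<L>Hv v" "W \<in> \<L>Hv v" "V \<subseteq> W" for V W
   using left_translation_group.haar_index_eq(1)[OF t local_groups(5)[OF v] lv(3)[OF that(1)] lv(3)[OF that(2)] that(3)] by simp
  show "measure (haar v) W = real (card ((%u. u \<star>\<^bsub>G v\<^esub> V) ` W)) * measure (haar v) V"
   if "V \<in> \<L>Hv v" "W \<in> \<L>Hv v" "V \<subseteq> W" for V W
   using left_translation_group.haar_index_eq(2)[OF t local_groups(5)[OF v] lv(3)[OF that(1)] lv(3)[OF that(2)] that(3)] by simp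
  show "measure (haar v) (conj_by (G v) h V) = measure (haar v) V" if h: "h \<in> H v" and V: "V \<in> \<L>Hv v" for h V
  proof -
   note c = local_level_conj[OF v h V]
   show ?thesis
    using left_translation_group.haar_conj_invariant[OF t local_groups(5)[OF v] local_groups(4)[OF v] lv(3)[OF V], of h,
      unfolded conj[OF h], OF _ lv(3)[OF c] lv(3)[OF local_level_Int[OF V c]]] h by simp
  qed
  show "ric_functor R (Hl v) (\<L>Hv v) (N v)" "cohomological (Hl v) (\<L>Hv v) (N v)"
   using local_functors(1)[OF v] by (simp_all add: comack_functor_def)
  show "\<phi> v \<in> carrier (obj (N v) (H v \<inter> K v))" using local_functors(3)[OF v] local_groups(7) by simp
 qed (fact coefficients(3) top[OF v] local_groups(2)[OF v] local_groups(6)[OF v] lv(1) lv(2) local_level_Int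
   local_level_conj[OF v] local_level_stab[OF v] local_functors(2)[OF v] hecke_function[OF v'])+
qed

section \<open>The local identity at a place v, in the form used for the global classes\<close>

definition "stab v g = H v \<inter> conj_by (G v) g (K v)"

definition "reps v X \<longleftrightarrow> finite X \<and> X \<subseteq> carrier (G v) \<and>
  (\<forall>\<g>\<in>X. \<forall>\<g>'\<in>X. \<g>' \<in> double_coset (G v) (U v) \<g> (K v) --> \<g>' = \<g>) \<and>
  (\<forall>q\<in>carrier (G v). f v q ~= \<zero>\<^bsub>R\<^esub> --> (\<exists>\<g>\<in>X. q \<in> double_coset (G v) (U v) \<g> (K v)))"

text \<open>The transformation behaviour of [g]_* composed with the pushforward from V to g K
  g^{-1}: left translation by H can be absorbed into the level of H, and right translation by K has
  no effect. These are the families to which the local identity applies.\<close>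

definition "equivariant v (P :: ('r, 'p) module) b \<longleftrightarrow> Module.module R P \<and>
  (\<forall>g\<in>carrier (G v). \<forall>V\<in>\<L>Hv v. V \<subseteq> stab v g --> b g V \<in> linear_maps R (obj (N v) V) P) \<and>
  (\<forall>g\<in>carrier (G v). \<forall>h\<in>H v. \<forall>k\<in>K v. \<forall>V\<in>\<L>Hv v. V \<subseteq> stab v (h \<otimes>\<^bsub>G v\<^esub> g \<otimes>\<^bsub>G v\<^esub> k) -->
   (\<forall>x\<in>carrier (obj (N v) V). b (h \<otimes>\<^bsub>G v\<^esub> g \<otimes>\<^bsub>G v\<^esub> k) V x = b g (stab v g) (push (N v) V h (stab v g) x)))"

lemma finsum_Sigma:
 assumes P: "Module.module R P" and A: "finite A" and B: "\<And>a i. a \<in> A ==> i < n a ==> B a i \<in> carrier P"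
 shows "(\<Oplus>\<^bsub>P\<^esub>p\<in>(SIGMA a:A. {..<(n a :: nat)}). B (fst p) (snd p)) = (\<Oplus>\<^bsub>P\<^esub>a\<in>A. \<Oplus>\<^bsub>P\<^esub>i\<in>{..<n a}. B a i)"
proof -
 interpret P: Module.module R P by (rule P)
 have eq: "(SIGMA a:A. {..<n a}) = (\<Union>a\<in>A. Pair a ` {..<n a})" by auto
 have "(\<Oplus>\<^bsub>P\<^esub>p\<in>(\<Union>a\<in>A. Pair a ` {..<n a}). B (fst p) (snd p)) = (\<Oplus>\<^bsub>P\<^esub>a\<in>A. \<Oplus>\<^bsub>P\<^esub>p\<in>Pair a ` {..<n a}. B (fst p) (snd p))"
  by (rule P.add.finprod_UN_disjoint[OF A]) (use B in \<open>auto simp: pairwise_def disjnt_def\<close>)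
 also have "\<dots> = (\<Oplus>\<^bsub>P\<^esub>a\<in>A. \<Oplus>\<^bsub>P\<^esub>i\<in>{..<n a}. B a i)"
 proof (rule P.finsum_cong'[OF refl])
  fix a assume a: "a \<in> A"
  show "(\<Oplus>\<^bsub>P\<^esub>p\<in>Pair a ` {..<n a}. B (fst p) (snd p)) = (\<Oplus>\<^bsub>P\<^esub>i\<in>{..<n a}. B a i)"
   by (subst P.finsum_reindex) (use B[OF a] in \<open>auto simp: inj_on_def\<close>)
 qed (use B in \<open>auto intro!: P.finsum_closed\<close>)
 finally show ?thesis unfolding eq .
qed

text \<open>The output of one zeta element, freed of fraction field and measure. The finite data are
  chosen before the representatives X, the target P and the family b, so the same data can serve all
  levels K[\<nu>] and all choices at the other places. The containment in the conjugate of L is kept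
  because it allows the classes to live at level L_v. The elements of P are fixed to the type of M_G
  since P is quantified inside the statement.\<close>

lemma local_main:
 assumes v': "v \<in> I'"
 shows "\<exists>(J :: ('a \<times> nat) set) g V x. finite J \<and>
   (\<forall>c\<in>J. g c \<in> carrier (G v) \<and> V c \<in> \<L>Hv v \<and> V c \<subseteq> conj_by (G v) (g c) (L v) \<and> x c \<in> carrier (obj (N v) (V c))) \<and>
   (\<forall>X (P :: ('r, 'mg) module) b. reps v X \<and> equivariant v P b -->
    (\<Oplus>\<^bsub>P\<^esub>c\<in>J. b (g c) (V c) (x c)) =
    (\<Oplus>\<^bsub>P\<^esub>\<g>\<in>X. f v \<g> \<odot>\<^bsub>P\<^esub> b \<g> (U v \<inter> stab v \<g>) (pull (N v) (U v \<inter> stab v \<g>) \<one>\<^bsub>G v\<^esub> (U v) (\<phi> v))))"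
proof -
 note v = I'I[OF v']
 interpret D: local_data R \<Phi> e \<rho> "G v" "T v" "H v" "K v" "haar v" "\<L>Hv v" "N v" "\<phi> v" "f v"
  by (rule local_data[OF v'])
 have S: "D.S g = stab v g" for g by (simp add: D.S_def stab_def)
 obtain \<zeta> where "zeta_element R \<Phi> e \<rho> (G v) (T v) (H v) (haar v) (\<L>Hv v) (N v) (K v) (L v) (\<phi> v) (f v) \<zeta>"
  using zeta[OF v'] by blast
 then have z: "\<zeta> \<in> carrier D.C" "\<forall>g\<in>carrier (G v). \<exists>(n::nat) V x.
      (\<forall>i<n. V i \<in> \<L>Hv v \<and> V i \<subseteq> conj_by (G v) g (L v) \<and> x i \<in> carrier (obj (N v) (V i))) \<and>
      \<zeta> g = (\<Oplus>\<^bsub>D.E\<^esub>i\<in>{..<n}. \<rho> (D.ix D.U (V i)) \<odot>\<^bsub>D.E\<^esub> D.j (V i) (x i))"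
  "D.Z +>\<^bsub>D.C\<^esub> \<zeta> = D.Z +>\<^bsub>D.C\<^esub> D.F\<^sub>f"
  unfolding zeta_element_def Let_def D.F\<^sub>f_def by blast+
 define Q where "Q g n V x \<longleftrightarrow>
   (\<forall>i<(n::nat). V i \<in> \<L>Hv v \<and> V i \<subseteq> conj_by (G v) g (L v) \<and> x i \<in> carrier (obj (N v) (V i))) \<and>
   \<zeta> g = (\<Oplus>\<^bsub>D.E\<^esub>i\<in>{..<n}. \<rho> (D.ix D.U (V i)) \<odot>\<^bsub>D.E\<^esub> D.j (V i) (x i))" for g n V x
 have "\<forall>g\<in>carrier (G v). \<exists>n V x. Q g n V x" using z(2) unfolding Q_def .
 then obtain n V x where "\<And>g. g \<in> carrier (G v) ==> Q g (n g) (V g) (x g)" by metis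
 note nVx = this[unfolded Q_def]
 \<comment> \<open>One point for each coset in the support of the zeta element; equal cosets then
   give equal points.\<close>
 define r where "r D = (SOME g. g \<in> carrier (G v) \<and> g \<star>\<^bsub>G v\<^esub> K v = D)" for D
 have r: "r D \<in> carrier (G v) \<and> r D \<star>\<^bsub>G v\<^esub> K v = D" if "D \<in> D.cosets \<zeta>" for D
  unfolding r_def by (rule someI_ex) (use that in \<open>auto simp: D.cosets_def\<close>)
 define pts where "pts = r ` D.cosets \<zeta>"
 have ptsG: "pts \<subseteq> carrier (G v)" using r unfolding pts_def by blast
 have pts_fin: "finite pts" unfolding pts_def using D.C_fin[OF z(1)] by simp
 have LK: "conj_by (G v) p (L v) \<subseteq> conj_by (G v) p (K v)" for p
  using L_sub_K[OF v'] by (auto simp: conj_by_def)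
 have zd: "D.zeta_data \<zeta> pts n V x"
  unfolding D.zeta_data_def
 proof (intro conjI ballI allI impI)
  show "p = p'" if "p \<in> pts" "p' \<in> pts" "p \<star>\<^bsub>G v\<^esub> K v = p' \<star>\<^bsub>G v\<^esub> K v" for p p'
   using that(1,2) r that(3) unfolding pts_def by (elim imageE) simp
  show "\<exists>p\<in>pts. p \<star>\<^bsub>G v\<^esub> K v = q \<star>\<^bsub>G v\<^esub> K v" if "q \<in> carrier (G v)" "\<zeta> q ~= \<zero>\<^bsub>D.E\<^esub>" for q
   using D.C_supp[of \<zeta> q] that r unfolding pts_def by blast
  show "V p i \<subseteq> D.S p" if "p \<in> pts" "i < n p" for p i
   using nVx[of p] that ptsG local_level(1)[OF v] LK[of p] unfolding D.S_def by blast
 qed (use z(1) pts_fin ptsG nVx in blast)+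
 let ?J = "SIGMA p:pts. {..<n p}"
 show ?thesis
 proof (intro exI[of _ ?J] exI[of _ fst] exI[of _ "%c. V (fst c) (snd c)"] exI[of _ "%c. x (fst c) (snd c)"] conjI ballI allI impI)
  show "finite ?J" by (rule finite_SigmaI[OF pts_fin finite_lessThan])
  fix c assume "c \<in> ?J"
  then have c: "fst c \<in> pts" "snd c < n (fst c)" by (cases c, simp)+
  then have cG: "fst c \<in> carrier (G v)" using ptsG by blast
  then show "fst c \<in> carrier (G v)" .
  show "V (fst c) (snd c) \<in> \<L>Hv v" "V (fst c) (snd c) \<subseteq> conj_by (G v) (fst c) (L v)"
   "x (fst c) (snd c) \<in> carrier (obj (N v) (V (fst c) (snd c)))"
   using conjunct1[OF nVx[OF cG], rule_format, OF c(2)] by blast+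
 next
  fix X and P :: "('r, 'mg) module" and b
  assume Xb: "reps v X \<and> equivariant v P b"
  have "reps v X" using Xb by (rule conjunct1)
  then have X: "D.double_reps X" unfolding reps_def D.double_reps_def local_groups(7) .
  note eq = conjunct2[OF Xb, unfolded equivariant_def, folded S]
  have P: "Module.module R P" using Xb by (simp add: equivariant_def)
  have b1: "b g W \<in> linear_maps R (obj (N v) W) P" if "g \<in> carrier (G v)" "W \<in> \<L>Hv v" "W \<subseteq> D.S g" for g W
   using conjunct1[OF conjunct2[OF eq]] that by blast
  have b2: "b (h \<otimes>\<^bsub>G v\<^esub> g \<otimes>\<^bsub>G v\<^esub> k) W y = b g (D.S g) (push (N v) W h (D.S g) y)"
   if "g \<in> carrier (G v)" "h \<in> H v" "k \<in> K v" "W \<in> \<L>Hv v" "W \<subseteq> D.S (h \<otimes>\<^bsub>G v\<^esub> g \<otimes>\<^bsub>G v\<^esub> k)" "y \<in> carrier (obj (N v) W)" for g h k W y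
   using conjunct2[OF conjunct2[OF eq]] that by blast
  have bc: "b a (V a i) (x a i) \<in> carrier P" if "a \<in> pts" "i < n a" for a i
   using linear_maps_closed[OF b1] D.zeta_dataD(6-8)[OF zd that] ptsG that(1) by blast
  show "(\<Oplus>\<^bsub>P\<^esub>c\<in>?J. b (fst c) (V (fst c) (snd c)) (x (fst c) (snd c))) =
    (\<Oplus>\<^bsub>P\<^esub>\<g>\<in>X. f v \<g> \<odot>\<^bsub>P\<^esub> b \<g> (U v \<inter> stab v \<g>) (pull (N v) (U v \<inter> stab v \<g>) \<one>\<^bsub>G v\<^esub> (U v) (\<phi> v)))"
  proof -
   have "(\<Oplus>\<^bsub>P\<^esub>c\<in>?J. b (fst c) (V (fst c) (snd c)) (x (fst c) (snd c))) = (\<Oplus>\<^bsub>P\<^esub>p\<in>pts. \<Oplus>\<^bsub>P\<^esub>i\<in>{..<n p}. b p (V p i) (x p i))"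
    by (rule finsum_Sigma[where B = "%a i. b a (V a i) (x a i)", OF P pts_fin]) (rule bc)
   also have "\<dots> = (\<Oplus>\<^bsub>P\<^esub>\<g>\<in>X. f v \<g> \<odot>\<^bsub>P\<^esub> b \<g> (U v \<inter> stab v \<g>) (pull (N v) (U v \<inter> stab v \<g>) \<one>\<^bsub>G v\<^esub> (U v) (\<phi> v)))"
    unfolding local_groups(7)[of v] S[symmetric] by (rule D.local_identity[OF zd X z(3) P b1 b2])
   finally show ?thesis .
  qed
 qed
qed

end

section \<open>Global levels, pure tensors in M_H, and the elements of M_G obtained from
  them\<close>

context setting
begin

abbreviation "GR \<equiv> restricted_product I G K"
abbreviation GR_mult (infixl "\<bowtie>" 70) where "g \<bowtie> h \<equiv> g \<otimes>\<^bsub>GR\<^esub> h"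
abbreviation GR_one ("\<e>") where "\<e> \<equiv> \<one>\<^bsub>GR\<^esub>"
abbreviation "MK \<nu> \<equiv> obj MG (Kl \<nu>)"
abbreviation "HR \<equiv> restricted_product I Hl U"

lemma U_sub: "v \<in> I ==> subgroup (U v) (Hl v)"
 using group.subgroup_incl[OF grp local_level(2)[OF _ U_level] local_groups(2) local_level(1)[OF _ U_level]] by blast

sublocale RG: restricted_family I G K
 by (rule restricted_family.intro) (simp_all add: grp K_sg)

sublocale RH: restricted_family I Hl U
 by (rule restricted_family.intro) (simp_all add: Hl_group U_sub)

lemma local_ric: "v \<in> I ==> ric_on (Hl v) R (\<L>Hv v) (N v)"
proof (rule ric_on.intro[OF Hl_group ric_on_axioms.intro])
 assume v: "v \<in> I"
 show "ric_functor R (Hl v) (\<L>Hv v) (N v)" using local_functors(1)[OF v] by (simp add: comack_functor_def)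
 show "subgroup V (Hl v)" if "V \<in> \<L>Hv v" for V
  by (rule group.subgroup_incl[OF grp[OF v] local_level(2)[OF v that] local_groups(2)[OF v] local_level(1)[OF v that]])
qed

sublocale RT: restricted_tensor_data R I Hl U \<L>Hv N \<phi>
 by (rule restricted_tensor_data.intro) (simp_all add: R_cring local_ric U_level local_functors(3))

sublocale MGr: ric_on GR R \<L>G MG
 using functors(2) collections(1) unfolding global_groups
 by (intro ric_on.intro ric_on_axioms.intro RG.RP_group)
  (auto simp: comack_functor_def level_collection_def compact_open_subgroup_def)

sublocale MHr: ric_on HR R \<L>H MH
 using functors(1) collections(4) unfolding global_groups
 by (intro ric_on.intro ric_on_axioms.intro RH.RP_group)
  (auto simp: comack_functor_def level_collection_def compact_open_subgroup_def)

lemma HR_iff: "h \<in> carrier HR \<longleftrightarrow> h \<in> carrier GR \<and> (\<forall>v\<in>I. h v \<in> H v)"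
proof -
 have "{v\<in>I. h v \<notin> U v} = {v\<in>I. h v \<notin> K v}" if "\<forall>v\<in>I. h v \<in> H v" using that local_groups(7) by auto
 then show ?thesis unfolding RH.RP_carrier RG.RP_carrier using H_sub by (auto simp: PiE_iff)
qed

lemma HR_ops:
 "h \<otimes>\<^bsub>HR\<^esub> h' = h \<bowtie> h'" "\<one>\<^bsub>HR\<^esub> = \<e>"
 by (simp_all add: RH.RP_mult RG.RP_mult RH.RP_one RG.RP_one)

lemma conj_Hl: "v \<in> I ==> h \<in> H v ==> conj_by (Hl v) h A = conj_by (G v) h A"
 using group.m_inv_consistent[OF grp local_groups(2)] by (simp add: conj_by_def)

lemma conj_HR: "h \<in> carrier HR ==> conj_by HR h A = conj_by GR h A"
proof -
 assume h: "h \<in> carrier HR"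
 have "inv\<^bsub>HR\<^esub> h = inv\<^bsub>GR\<^esub> h"
  unfolding RH.RP_inv[OF h] RG.RP_inv[OF conjunct1[OF HR_iff[THEN iffD1, OF h]]]
  using h group.m_inv_consistent[OF grp local_groups(2)] unfolding HR_iff by (intro restrict_ext) simp
 then show ?thesis by (simp add: conj_by_def HR_ops)
qed

definition "Kc \<nu> v = (if v \<in> \<nu> then L v else K v)"

lemma Kl_eq: "Kl \<nu> = PiE I (Kc \<nu>)" unfolding levels_L(4) Kc_def ..

lemma \<L>G_Int: "A \<in> \<L>G ==> B \<in> \<L>G ==> A \<inter> B \<in> \<L>G"
 using collections(1) unfolding level_collection_def by blast

lemma \<L>G_conj: "g \<in> carrier GR ==> A \<in> \<L>G ==> conj_by GR g A \<in> \<L>G"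
 using collections(1) unfolding level_collection_def global_groups by blast

text \<open>K[\<nu>] is the intersection of K with the groups that have L_v in one place, and the
  collection is closed under intersection.\<close>

lemma Kl_level: "finite \<nu> ==> \<nu> \<subseteq> I' ==> Kl \<nu> \<in> \<L>G"
proof (induction \<nu> rule: finite_induct)
 case empty
 then show ?case using collections(2) by (simp add: levels_L(4))
next
 case (insert v \<nu>)
 have "Kl (insert v \<nu>) = Kl {v} \<inter> Kl \<nu>"
  unfolding Kl_eq PiE_Int by (rule PiE_cong) (use insert.prems L_sub_K in \<open>auto simp: Kc_def\<close>)
 then show ?case using insert \<L>G_Int collections(3) by auto
qed

lemma Kc_sub: "\<nu> \<subseteq> I' ==> v \<in> I ==> subgroup (Kc \<nu> v) (G v)"
 unfolding Kc_def using K_sg L_sg by auto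

lemma Kc_carrier: "\<nu> \<subseteq> I' ==> v \<in> I ==> Kc \<nu> v \<subseteq> carrier (G v)"
 using Kc_sub subgroup.subset by blast

lemma finite_Inter_level: "finite F ==> F ~= {} ==> F \<subseteq> \<L>G ==> \<Inter>F \<in> \<L>G"
 by (induction F rule: finite_ne_induct) (auto intro: \<L>G_Int)

text \<open>A product of finite intersections of conjugates is an intersection of products of conjugates;
 the coordinates are treated one after the other.\<close>

lemma product_level:
 assumes "finite S" "S \<subseteq> I" "finite S'" "S' \<subseteq> I" "S \<inter> S' = {}"
  and "\<And>v. v \<in> S ==> M v \<in> conj_intersections (G v) (\<B> v)"
  and "\<And>v. v \<in> S' ==> \<exists>g A. g \<in> carrier (G v) \<and> A \<in> \<B> v \<and> M v = conj_by (G v) g A"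
  and "\<And>v. v \<in> I ==> v \<notin> S ==> v \<notin> S' ==> M v = K v"
 shows "PiE I M \<in> \<L>G"
 using assms
proof (induction S arbitrary: S' M rule: finite_induct)
 case empty
 have "\<exists>g A. g \<in> carrier (G v) \<and> A \<in> \<B> v \<and> M v = conj_by (G v) g A \<and> (v \<notin> S' --> g = \<one>\<^bsub>G v\<^esub> \<and> A = K v)" if v: "v \<in> I" for v
 proof (cases "v \<in> S'")
  case False
  then show ?thesis using empty.prems(7)[OF v] group.conj_by_one[OF grp[OF v] subgroup.subset[OF K_sg[OF v]]]
    group.is_monoid[OF grp[OF v]] by (intro exI[of _ "\<one>\<^bsub>G v\<^esub>"] exI[of _ "K v"]) (auto simp: monoid.one_closed)
 qed (use empty.prems(6) in blast)
 then obtain g A where gA: "\<And>v. v \<in> I ==> g v \<in> carrier (G v) \<and> A v \<in> \<B> v \<and> M v = conj_by (G v) (g v) (A v) \<and>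
   (v \<notin> S' --> g v = \<one>\<^bsub>G v\<^esub> \<and> A v = K v)" by metis
 \<comment> \<open>The places where the conjugated group is L_v instead of K_v. Outside
   \<open>S'\<close> the conjugating element is taken to be 1, so the family g belongs to the
   restricted product and the product is the conjugate of K[\<nu>] by g.\<close>
 define \<nu> where "\<nu> = {v\<in>S'. v \<in> I' \<and> A v ~= K v}"
 have \<nu>: "finite \<nu>" "\<nu> \<subseteq> I'" unfolding \<nu>_def using empty.prems(2) by auto
 have AK: "A v = Kc \<nu> v" if "v \<in> I" for v using gA[OF that] by (auto simp: Kc_def \<nu>_def split: if_splits)
 have "finite {v\<in>I. restrict g I v \<notin> K v}"
  by (rule finite_subset[OF _ empty.prems(2)]) (use gA subgroup.one_closed[OF K_sg] in fastforce)
 then have gR: "restrict g I \<in> carrier GR" using gA by (simp add: RG.RP_carrier)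
 have "PiE I M = (\<Pi>\<^sub>E v\<in>I. conj_by (G v) (restrict g I v) (Kc \<nu> v))"
  by (rule PiE_cong) (use gA AK in auto)
 also have "\<dots> = conj_by GR (restrict g I) (Kl \<nu>)"
  unfolding Kl_eq by (rule RG.RP_conj[OF gR Kc_carrier[OF \<nu>(2)], symmetric])
 finally show ?case using \<L>G_conj[OF gR Kl_level[OF \<nu>]] by simp
next
 case (insert v S)
 obtain F where F: "M v = \<Inter>F" "finite F" "F ~= {}" "F \<subseteq> {conj_by (G v) g A | g A. g \<in> carrier (G v) \<and> A \<in> \<B> v}"
  using insert.prems(5)[of v] unfolding conj_intersections_def by blast
 have v: "v \<in> I" using insert.prems by blast
 \<comment> \<open>The coordinate v moves from \<open>S\<close> to \<open>S'\<close>: its finite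
   intersection is replaced by one of the conjugates being intersected. The product is the
   intersection of these finitely many products.\<close>
 have lev: "PiE I (M(v := A)) \<in> \<L>G" if A: "A \<in> F" for A
 proof (rule insert.IH[of "insert v S'"])
  show "\<exists>g B. g \<in> carrier (G w) \<and> B \<in> \<B> w \<and> (M(v := A)) w = conj_by (G w) g B" if "w \<in> insert v S'" for w
  proof (cases "w = v")
   case True
   have "A \<in> {conj_by (G v) g A | g A. g \<in> carrier (G v) \<and> A \<in> \<B> v}" using F(4) A by (rule subsetD)
   then show ?thesis unfolding True fun_upd_same by (elim CollectE exE conjE) (intro exI conjI)
  qed (use insert.prems(6) that in auto)
 qed (use insert.prems insert.hyps in auto)
 have "PiE I M = \<Inter>((%A. PiE I (M(v := A))) ` F)"
 proof
  have "PiE I M \<subseteq> PiE I (M(v := A))" if "A \<in> F" for A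
   by (rule PiE_mono) (use Inter_lower[OF that] F(1) in simp)
  then show "PiE I M \<subseteq> \<Inter>((%A. PiE I (M(v := A))) ` F)" by blast
  show "\<Inter>((%A. PiE I (M(v := A))) ` F) \<subseteq> PiE I M"
  proof
   fix y assume y: "y \<in> \<Inter>((%A. PiE I (M(v := A))) ` F)"
   obtain A0 where A0: "A0 \<in> F" using F(3) by blast
   have "y v \<in> A" if "A \<in> F" for A
   proof -
    have "y \<in> PiE I (M(v := A))" using y that by blast
    then show ?thesis using PiE_mem[OF _ v, of y "M(v := A)"] by simp
   qed
   then have "y v \<in> M v" using F(1) by blast
   moreover have "y \<in> PiE I (M(v := A0))" using y A0 by blast
   ultimately show "y \<in> PiE I M" by (auto simp: PiE_iff split: if_splits)
  qed
 qed
 also have "\<dots> \<in> \<L>G" by (rule finite_Inter_level) (use F lev in auto)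
 finally show ?case .
qed

text \<open>Write W_v as the intersection of H_v with M_v, taking M_v = K_v wherever W_v = U_v. By
  \<open>product_level\<close> the product of the M_v is a level of G, and intersecting it with H
  gives the product of the W_v.\<close>

lemma adm_level:
 assumes W: "RT.adm W"
 shows "PiE I W \<in> \<L>H" "PiE I W \<in> product_levels I U \<L>Hv"
proof -
 let ?S = "{v\<in>I. W v ~= U v}"
 have S: "finite ?S" using W by (simp add: RT.adm_def)
 have "\<exists>M. (v \<in> ?S --> M \<in> conj_intersections (G v) (\<B> v)) \<and> W v = M \<inter> H v \<and> (v \<notin> ?S --> M = K v)" if v: "v \<in> I" for v
 proof (cases "v \<in> ?S")
  case True
  have "W v \<in> \<L>Hv v" using W v by (simp add: RT.adm_def)
  then show ?thesis using True unfolding collections(6) by blast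
 next
  case False
  then show ?thesis using v local_groups(7) by (intro exI[of _ "K v"]) auto
 qed
 then have ex: "\<forall>v\<in>I. \<exists>M. (v \<in> ?S --> M \<in> conj_intersections (G v) (\<B> v)) \<and> W v = M \<inter> H v \<and> (v \<notin> ?S --> M = K v)"
  by (intro ballI)
 obtain M where M: "\<forall>v\<in>I. (v \<in> ?S --> M v \<in> conj_intersections (G v) (\<B> v)) \<and> W v = M v \<inter> H v \<and> (v \<notin> ?S --> M v = K v)"
  using bchoice[OF ex] by (rule exE)
 have M1: "M v \<in> conj_intersections (G v) (\<B> v)" if "v \<in> ?S" for v
 proof -
  have "v \<in> I" using that by simp
  then show ?thesis by (rule bspec[OF M, THEN conjunct1, THEN mp, OF _ that])
 qed
 have M2: "W v = M v \<inter> H v" if "v \<in> I" for v by (rule bspec[OF M that, THEN conjunct2, THEN conjunct1])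
 have M3: "M v = K v" if "v \<in> I" "v \<notin> ?S" for v by (rule bspec[OF M that(1), THEN conjunct2, THEN conjunct2, THEN mp, OF that(2)])
 have MG: "PiE I M \<in> \<L>G" by (rule product_level[OF S _ finite.emptyI, of M]) (use M1 M3 in blast)+
 have "PiE I W = PiE I M \<inter> carrier HR"
 proof
  show "PiE I M \<inter> carrier HR \<subseteq> PiE I W" using M2 HR_iff by (auto simp: PiE_iff)
  show "PiE I W \<subseteq> PiE I M \<inter> carrier HR"
  proof
   fix y assume y: "y \<in> PiE I W"
   then have yM: "y \<in> PiE I M" and yH: "\<forall>v\<in>I. y v \<in> H v" using M2 by (auto simp: PiE_iff)
   have "y \<in> carrier GR" using MGr.level_carrier[OF MG] yM by blast
   then show "y \<in> PiE I M \<inter> carrier HR" using yM yH HR_iff by blast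
  qed
 qed
 then show "PiE I W \<in> \<L>H" using collections(5)[OF MG] global_groups(2) by simp
 show "PiE I W \<in> product_levels I U \<L>Hv" using W by (auto simp: RT.adm_def product_levels_def)
qed

text \<open>The image in M_H of the pure tensor of the x_v under the given morphism.\<close>

definition "\<Theta> W x = \<psi> (PiE I W) (RT.tc W x)"

lemma psi_linear: "RT.adm W ==> \<psi> (PiE I W) \<in> linear_maps R (rt_module R I U N \<phi> (PiE I W)) (obj MH (PiE I W))"
 using morphism adm_level(2)[of W] by (simp add: ric_morphism_def restricted_tensor_def)

lemma \<Theta>_closed: "RT.adm W ==> RT.tuple W x ==> \<Theta> W x \<in> carrier (obj MH (PiE I W))"
 unfolding \<Theta>_def by (rule linear_maps_closed[OF psi_linear RT.tc_closed])

lemma \<Theta>_linear: "RT.adm W ==> RT.tuple W x ==> v \<in> I ==>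
  (%a. \<Theta> W (x(v := a))) \<in> linear_maps R (obj (N v) (W v)) (obj MH (PiE I W))"
 unfolding \<Theta>_def by (rule linear_maps_compose[OF RT.tc_linear psi_linear])

lemma \<Theta>_cong: "(\<And>v. v \<in> I ==> x v = y v) ==> \<Theta> W x = \<Theta> W y"
proof -
 assume e: "\<And>v. v \<in> I ==> x v = y v"
 then have "RT.supp W x = RT.supp W y" by (auto simp: RT.supp_def)
 moreover have "pure_tensor R (RT.supp W y) (RT.A W) x = pure_tensor R (RT.supp W y) (RT.A W) y"
  by (rule pure_tensor_cong) (auto simp: RT.supp_def e)
 ultimately show ?thesis by (simp add: \<Theta>_def RT.tc_def)
qed

lemma level_in_carrier: "RT.adm W ==> v \<in> I ==> W v \<subseteq> carrier (Hl v)"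
 using local_level(1) by (auto simp: RT.adm_def)

lemma product_conj_HR:
 assumes "RT.adm W'" "h \<in> carrier HR" "\<And>v. v \<in> I ==> W v \<subseteq> conj_by (G v) (h v) (W' v)"
 shows "PiE I W \<subseteq> conj_by HR h (PiE I W')" "PiE I W \<subseteq> conj_by GR h (PiE I W')"
proof -
 have "W v \<subseteq> conj_by (Hl v) (h v) (W' v)" if "v \<in> I" for v
  using assms(2,3) that conj_Hl unfolding HR_iff by simp
 then show "PiE I W \<subseteq> conj_by HR h (PiE I W')"
  using RH.RP_conj[OF assms(2), of W'] level_in_carrier[OF assms(1)] PiE_mono by (metis (no_types, lifting))
 then show "PiE I W \<subseteq> conj_by GR h (PiE I W')" using conj_HR[OF assms(2)] by simp
qed

text \<open>Naturality of the morphism \<open>\<psi>\<close>, combined with the fact that the maps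
  of the restricted tensor product act on pure tensors factor by factor.\<close>

lemma \<Theta>_transfer:
 assumes W: "RT.adm W" and W': "RT.adm W'" and h: "h \<in> carrier HR"
  and sub: "\<And>v. v \<in> I ==> W v \<subseteq> conj_by (G v) (h v) (W' v)"
 shows \<Theta>_push: "RT.tuple W x ==> push MH (PiE I W) h (PiE I W') (\<Theta> W x) = \<Theta> W' (%v. push (N v) (W v) (h v) (W' v) (x v))"
  and \<Theta>_push_tuple: "RT.tuple W x ==> RT.tuple W' (%v. push (N v) (W v) (h v) (W' v) (x v))"
  and \<Theta>_pull: "RT.tuple W' y ==> pull MH (PiE I W) h (PiE I W') (\<Theta> W' y) = \<Theta> W (%v. pull (N v) (W v) (h v) (W' v) (y v))"
  and \<Theta>_pull_tuple: "RT.tuple W' y ==> RT.tuple W (%v. pull (N v) (W v) (h v) (W' v) (y v))"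
proof -
 have lh: "level_hom HR (PiE I W) h (PiE I W')"
  by (rule MHr.level_homI[OF adm_level(1)[OF W] adm_level(1)[OF W'] h product_conj_HR(1)[OF W' h sub]])
 have hc: "h v \<in> carrier (Hl v)" "W v \<subseteq> conj_by (Hl v) (h v) (W' v)" if "v \<in> I" for v
  using h that sub[OF that] conj_Hl[OF that] unfolding HR_iff by simp_all
 have hf: "finite {v\<in>I. h v \<notin> U v}" using h unfolding RH.RP_carrier by blast
 note m = RT.transfer_maps[OF W W' hc(1) hf hc(2)]
 have mor: "(\<forall>x\<in>carrier (obj (restricted_tensor R I U N \<phi>) (PiE I W')).
    \<psi> (PiE I W) (pull (restricted_tensor R I U N \<phi>) (PiE I W) h (PiE I W') x) = pull MH (PiE I W) h (PiE I W') (\<psi> (PiE I W') x)) \<and>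
  (\<forall>x\<in>carrier (obj (restricted_tensor R I U N \<phi>) (PiE I W)).
    \<psi> (PiE I W') (push (restricted_tensor R I U N \<phi>) (PiE I W) h (PiE I W') x) = push MH (PiE I W) h (PiE I W') (\<psi> (PiE I W) x))"
  using morphism lh adm_level(2)[OF W] adm_level(2)[OF W'] unfolding ric_morphism_def global_groups by blast
 have oeq: "obj (restricted_tensor R I U N \<phi>) = rt_module R I U N \<phi>" by (simp add: restricted_tensor_def)
 show "push MH (PiE I W) h (PiE I W') (\<Theta> W x) = \<Theta> W' (%v. push (N v) (W v) (h v) (W' v) (x v))" if x: "RT.tuple W x"
  using conjunct2[OF mor, rule_format, of "RT.tc W x"] RT.tc_closed[OF W x] m(1)[OF _ _ x] unfolding \<Theta>_def oeq by simp
 show "RT.tuple W' (%v. push (N v) (W v) (h v) (W' v) (x v))" if x: "RT.tuple W x" by (rule m(2)[OF _ _ x])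
 show "pull MH (PiE I W) h (PiE I W') (\<Theta> W' y) = \<Theta> W (%v. pull (N v) (W v) (h v) (W' v) (y v))" if y: "RT.tuple W' y"
  using conjunct1[OF mor, rule_format, of "RT.tc W' y"] RT.tc_closed[OF W' y] m(3)[OF _ _ y] unfolding \<Theta>_def oeq by simp
 show "RT.tuple W (%v. pull (N v) (W v) (h v) (W' v) (y v))" if y: "RT.tuple W' y" by (rule m(4)[OF _ _ y])
qed

lemma pushforward_facts:
 shows iota_linear: "V \<in> \<L>H ==> A \<in> \<L>G ==> V \<subseteq> A ==> \<iota> V A \<in> linear_maps R (obj MH V) (obj MG A)"
  and iota_push: "V \<in> \<L>H ==> V' \<in> \<L>H ==> A \<in> \<L>G ==> A' \<in> \<L>G ==> h \<in> carrier HR ==> V \<subseteq> A ==> V' \<subseteq> A' ==>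
    V' \<subseteq> conj_by GR h V ==> A' \<subseteq> conj_by GR h A ==> x \<in> carrier (obj MH V') ==>
    \<iota> V A (push MH V' h V x) = push MG A' h A (\<iota> V' A' x)"
  and iota_mackey: "V \<in> \<L>H ==> A \<in> \<L>G ==> A' \<in> \<L>G ==> V \<subseteq> A ==> A' \<subseteq> A ==> double_coset_reps GR V A A' \<G> ==>
    x \<in> carrier (obj MH V) ==> pull MG A' \<e> A (\<iota> V A x) =
       (\<Oplus>\<^bsub>obj MG A'\<^esub>\<g>\<in>\<G>. push MG (conj_by GR \<g> A') \<g> A'
        (\<iota> (V \<inter> conj_by GR \<g> A') (conj_by GR \<g> A') (pull MH (V \<inter> conj_by GR \<g> A') \<e> V x)))"
proof -
 have P: "pushforward R GR (carrier HR) \<L>H \<L>G MH MG \<iota>" using functors(3) unfolding mackey_pushforward_def global_groups by blast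
 show "V \<in> \<L>H ==> A \<in> \<L>G ==> V \<subseteq> A ==> \<iota> V A \<in> linear_maps R (obj MH V) (obj MG A)"
  using P unfolding pushforward_def by blast
 show "\<iota> V A (push MH V' h V x) = push MG A' h A (\<iota> V' A' x)"
  if a: "V \<in> \<L>H" "V' \<in> \<L>H" "A \<in> \<L>G" "A' \<in> \<L>G" "h \<in> carrier HR" "V \<subseteq> A" "V' \<subseteq> A'"
    "V' \<subseteq> conj_by GR h V" "A' \<subseteq> conj_by GR h A" "x \<in> carrier (obj MH V')"
 proof -
  have hG: "h \<in> carrier GR" using a(5) HR_iff by blast
  have VG: "V \<subseteq> carrier GR" "V' \<subseteq> carrier GR"
   using MHr.level_carrier[OF a(1)] MHr.level_carrier[OF a(2)] HR_iff by blast+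
  have "conj_by GR (inv\<^bsub>GR\<^esub> h) V' \<subseteq> V" "conj_by GR (inv\<^bsub>GR\<^esub> h) A' \<subseteq> A"
   using a(8,9) RG.RP.conj_by_inv_subset[OF hG VG(2,1)]
    RG.RP.conj_by_inv_subset[OF hG MGr.level_carrier[OF a(4)] MGr.level_carrier[OF a(3)]] by blast+
  then show ?thesis using conjunct2[OF P[unfolded pushforward_def], rule_format, OF a(1-5)] a(6,7,10) by blast
 qed
 have Mk: "\<forall>V\<in>\<L>H. \<forall>K'\<in>\<L>G. \<forall>L'\<in>\<L>G. \<forall>\<G>. V \<subseteq> K' \<and> L' \<subseteq> K' \<and> double_coset_reps GR V K' L' \<G> -->
    (\<forall>x\<in>carrier (obj MH V). pull MG L' \<e> K' (\<iota> V K' x) =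
       (\<Oplus>\<^bsub>obj MG L'\<^esub>\<g>\<in>\<G>. let C = conj_by GR \<g> L'; V\<g> = V \<inter> C in
        push MG C \<g> L' (\<iota> V\<g> C (pull MH V\<g> \<e> V x))))"
  using functors(3) unfolding mackey_pushforward_def global_groups by (elim conjE)
 show "pull MG A' \<e> A (\<iota> V A x) =
       (\<Oplus>\<^bsub>obj MG A'\<^esub>\<g>\<in>\<G>. push MG (conj_by GR \<g> A') \<g> A'
        (\<iota> (V \<inter> conj_by GR \<g> A') (conj_by GR \<g> A') (pull MH (V \<inter> conj_by GR \<g> A') \<e> V x)))"
  if a: "V \<in> \<L>H" "A \<in> \<L>G" "A' \<in> \<L>G" "V \<subseteq> A" "A' \<subseteq> A" "double_coset_reps GR V A A' \<G>" "x \<in> carrier (obj MH V)"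
  using Mk[rule_format, OF a(1-3) conjI[OF a(4) conjI[OF a(5,6)]] a(7)] unfolding Let_def .
qed

definition "valid \<nu> g W x \<longleftrightarrow> finite \<nu> \<and> \<nu> \<subseteq> I' \<and> g \<in> carrier GR \<and> RT.adm W \<and> RT.tuple W x \<and>
  (\<forall>v\<in>I. W v \<subseteq> conj_by (G v) (g v) (Kc \<nu> v))"

text \<open>The building block of all classes: push the image of a pure tensor from level W of H to
  level g K[\<nu>] g^{-1} of G, then move it to K[\<nu>] by g. The predicate \<open>valid\<close>
  contains what is needed for this to make sense, place by place.\<close>

definition "B \<nu> g W x = push MG (conj_by GR g (Kl \<nu>)) g (Kl \<nu>) (\<iota> (PiE I W) (conj_by GR g (Kl \<nu>)) (\<Theta> W x))"

lemma validD:
 assumes "valid \<nu> g W x"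
 shows "Kl \<nu> \<in> \<L>G" "g \<in> carrier GR" "RT.adm W" "RT.tuple W x" "conj_by GR g (Kl \<nu>) \<in> \<L>G" "PiE I W \<in> \<L>H"
  "PiE I W \<subseteq> conj_by GR g (Kl \<nu>)" "finite \<nu>" "\<nu> \<subseteq> I'" "\<And>v. v \<in> I ==> W v \<subseteq> conj_by (G v) (g v) (Kc \<nu> v)"
  "conj_by GR g (Kl \<nu>) = (\<Pi>\<^sub>E v\<in>I. conj_by (G v) (g v) (Kc \<nu> v))"
proof -
 have a: "finite \<nu>" "\<nu> \<subseteq> I'" "g \<in> carrier GR" "RT.adm W" "RT.tuple W x" "\<forall>v\<in>I. W v \<subseteq> conj_by (G v) (g v) (Kc \<nu> v)"
  using assms unfolding valid_def by blast+
 show "Kl \<nu> \<in> \<L>G" by (rule Kl_level[OF a(1,2)])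
 then show "conj_by GR g (Kl \<nu>) \<in> \<L>G" by (rule \<L>G_conj[OF a(3)])
 show "PiE I W \<in> \<L>H" by (rule adm_level(1)[OF a(4)])
 show c: "conj_by GR g (Kl \<nu>) = (\<Pi>\<^sub>E v\<in>I. conj_by (G v) (g v) (Kc \<nu> v))"
  unfolding Kl_eq by (rule RG.RP_conj[OF a(3) Kc_carrier[OF a(2)]])
 show "PiE I W \<subseteq> conj_by GR g (Kl \<nu>)" unfolding c using a(6) by (auto simp: PiE_iff)
 show "W v \<subseteq> conj_by (G v) (g v) (Kc \<nu> v)" if "v \<in> I" for v using a(6) that by blast
qed (use assms in \<open>simp_all add: valid_def\<close>)

lemma iota_\<Theta>_closed: "valid \<nu> g W x ==> \<iota> (PiE I W) (conj_by GR g (Kl \<nu>)) (\<Theta> W x) \<in> carrier (obj MG (conj_by GR g (Kl \<nu>)))"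
 using linear_maps_closed[OF iota_linear \<Theta>_closed] validD[of \<nu> g W x] by blast

lemma B_closed: "valid \<nu> g W x ==> B \<nu> g W x \<in> carrier (MK \<nu>)"
 unfolding B_def by (rule MGr.push_closed[OF validD(5,1,2) order_refl iota_\<Theta>_closed])

lemma B_linear:
 assumes "valid \<nu> g W x" "v \<in> I"
 shows "(%a. B \<nu> g W (x(v := a))) \<in> linear_maps R (obj (N v) (W v)) (MK \<nu>)"
 unfolding B_def using validD[OF assms(1)] assms(2)
 by (intro linear_maps_compose[OF linear_maps_compose[OF \<Theta>_linear iota_linear] MGr.push_linear]) auto

text \<open>The factor h passes through the pushforward and becomes the covariant map of h on the
  tensor, while k lies in K[\<nu>] and acts trivially on M_G(K[\<nu>]).\<close>

lemma B_shift:
 assumes v': "valid \<nu> g' W' x'" and v: "valid \<nu> g W x" and h: "h \<in> carrier HR" and k: "k \<in> Kl \<nu>"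
  and g': "g' = h \<bowtie> g \<bowtie> k"
  and W: "\<And>v. v \<in> I ==> W' v \<subseteq> conj_by (G v) (h v) (W v)"
  and x: "\<And>v. v \<in> I ==> x v = push (N v) (W' v) (h v) (W v) (x' v)"
 shows "B \<nu> g' W' x' = B \<nu> g W x"
proof -
 note V = validD[OF v] and V' = validD[OF v']
 let ?A = "Kl \<nu>" and ?C = "conj_by GR g (Kl \<nu>)" and ?C' = "conj_by GR g' (Kl \<nu>)"
 have hG: "h \<in> carrier GR" using h HR_iff by blast
 note AG = MGr.level_carrier[OF V(1)]
 have kG: "k \<in> carrier GR" using k AG by blast
 have Ak: "conj_by GR k ?A = ?A" by (rule RG.RP.conj_by_self[OF MGr.level[OF V(1)] k])
 have C': "?C' = conj_by GR h ?C"
 proof -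
  have "?C' = conj_by GR (h \<bowtie> g) (conj_by GR k ?A)"
   unfolding g' using RG.RP.conj_by_conj_by[OF RG.RP.m_closed[OF hG V(2)] kG AG] by simp
  then show ?thesis unfolding Ak using RG.RP.conj_by_conj_by[OF hG V(2) AG] by simp
 qed
 let ?z = "\<iota> (PiE I W') ?C' (\<Theta> W' x')"
 note z = iota_\<Theta>_closed[OF v']
 have "push MG ?C' h ?C ?z = \<iota> (PiE I W) ?C (push MH (PiE I W') h (PiE I W) (\<Theta> W' x'))"
  by (rule iota_push[symmetric])
   (use V V' h C' \<Theta>_closed[OF V'(3,4)] product_conj_HR(2)[OF V(3) h W] in auto)
 also have "push MH (PiE I W') h (PiE I W) (\<Theta> W' x') = \<Theta> W (%v. push (N v) (W' v) (h v) (W v) (x' v))"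
  by (rule \<Theta>_push[OF V'(3) V(3) h W V'(4)])
 also have "\<dots> = \<Theta> W x" by (rule \<Theta>_cong) (simp add: x)
 finally have e: "push MG ?C' h ?C ?z = \<iota> (PiE I W) ?C (\<Theta> W x)" .
 have gk: "g \<bowtie> k \<in> carrier GR" using V(2) kG by simp
 have Cgk: "?C \<subseteq> conj_by GR (g \<bowtie> k) ?A"
  using RG.RP.conj_by_conj_by[OF V(2) kG AG] Ak by simp
 have "B \<nu> g' W' x' = push MG ?C' (h \<bowtie> (g \<bowtie> k)) ?A ?z"
  unfolding B_def g' using hG kG V(2) by (simp add: RG.RP.m_assoc)
 also have "\<dots> = push MG ?C (g \<bowtie> k) ?A (push MG ?C' h ?C ?z)"
  by (rule MGr.push_comp[symmetric, OF V'(5) V(5) V(1) hG gk _ Cgk z]) (simp add: C')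
 also have "\<dots> = push MG ?A k ?A (push MG ?C g ?A (\<iota> (PiE I W) ?C (\<Theta> W x)))"
  unfolding e by (rule MGr.push_comp[symmetric, OF V(5) V(1) V(1) V(2) kG order_refl _ iota_\<Theta>_closed[OF v]]) (simp add: Ak)
 also have "\<dots> = B \<nu> g W x"
  unfolding B_def by (rule MGr.push_mem[OF V(1) k]) (rule B_closed[OF v, unfolded B_def])
 finally show ?thesis .
qed

lemma one_HR: "\<e> \<in> carrier HR"
 using RH.RP.one_closed unfolding HR_ops .

lemma local_one: "v \<in> I ==> \<e> v = \<one>\<^bsub>G v\<^esub>" by (simp add: RG.RP_one)

text \<open>The compatibility axiom of a pushforward for h = 1 and unchanged V.\<close>

lemma iota_enlarge:
 assumes "V \<in> \<L>H" "A \<in> \<L>G" "A' \<in> \<L>G" "V \<subseteq> A" "A \<subseteq> A'" "x \<in> carrier (obj MH V)"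
 shows "push MG A \<e> A' (\<iota> V A x) = \<iota> V A' x"
proof -
 have VG: "V \<subseteq> carrier GR" using MGr.level_carrier[OF assms(2)] assms(4) by blast
 have "\<iota> V A' (push MH V \<e> V x) = push MG A \<e> A' (\<iota> V A x)"
  by (rule iota_push[OF assms(1,1,3,2) one_HR])
   (use assms RG.RP.conj_by_one[OF VG] RG.RP.conj_by_one[OF MGr.level_carrier[OF assms(3)]] in auto)
 then show ?thesis using MHr.push_one[OF assms(1,6)] unfolding HR_ops by simp
qed

text \<open>Moving by g and then projecting from K[\<mu>] to K[\<nu>] is the same as first enlarging
  the conjugated level and then moving by g; the enlargement is absorbed by the pushforward.
  Validity at the deeper level implies validity at the coarser one.\<close>

lemma B_push:
 assumes v: "valid \<mu> g W x" and \<nu>: "\<nu> \<subseteq> \<mu>"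
 shows "valid \<nu> g W x" "push MG (Kl \<mu>) \<e> (Kl \<nu>) (B \<mu> g W x) = B \<nu> g W x"
proof -
 note V = validD[OF v]
 have Kc: "Kc \<mu> w \<subseteq> Kc \<nu> w" if "w \<in> I" for w unfolding Kc_def using V(9) \<nu> L_sub_K by auto
 have sub: "W w \<subseteq> conj_by (G w) (g w) (Kc \<nu> w)" if "w \<in> I" for w
  using V(10)[OF that] group.conj_by_mono[OF grp[OF that] Kc[OF that], of "g w"] by blast
 show v2: "valid \<nu> g W x" using v \<nu> sub unfolding valid_def using finite_subset by blast
 note V2 = validD[OF v2]
 have AA: "Kl \<mu> \<subseteq> Kl \<nu>" unfolding Kl_eq using Kc by (auto simp: PiE_iff)
 have CC: "conj_by GR g (Kl \<mu>) \<subseteq> conj_by GR g (Kl \<nu>)" by (rule RG.RP.conj_by_mono[OF AA])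
 let ?z = "\<iota> (PiE I W) (conj_by GR g (Kl \<mu>)) (\<Theta> W x)"
 note one = RG.RP.conj_by_one[OF MGr.level_carrier[OF V2(1)]] RG.RP.conj_by_one[OF MGr.level_carrier[OF V2(5)]]
 have "push MG (Kl \<mu>) \<e> (Kl \<nu>) (B \<mu> g W x) = push MG (conj_by GR g (Kl \<mu>)) (g \<bowtie> \<e>) (Kl \<nu>) ?z"
  unfolding B_def by (rule MGr.push_comp[OF V(5) V(1) V2(1) V(2) RG.RP.one_closed order_refl _ iota_\<Theta>_closed[OF v]]) (simp add: one AA)
 also have "\<dots> = push MG (conj_by GR g (Kl \<mu>)) (\<e> \<bowtie> g) (Kl \<nu>) ?z" using V(2) by simp
 also have "\<dots> = push MG (conj_by GR g (Kl \<nu>)) g (Kl \<nu>) (push MG (conj_by GR g (Kl \<mu>)) \<e> (conj_by GR g (Kl \<nu>)) ?z)"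
  by (rule MGr.push_comp[symmetric, OF V(5) V2(5) V2(1) RG.RP.one_closed V(2) _ order_refl iota_\<Theta>_closed[OF v]]) (simp add: one CC)
 also have "\<dots> = B \<nu> g W x"
  unfolding B_def iota_enlarge[OF V(6) V(5) V2(5) V(7) CC \<Theta>_closed[OF V(3,4)]] ..
 finally show "push MG (Kl \<mu>) \<e> (Kl \<nu>) (B \<mu> g W x) = B \<nu> g W x" .
qed

lemma valid_upd:
 assumes v: "valid \<nu> g W x" and w: "w \<in> I" and \<g>: "\<g> \<in> carrier (G w)" and V: "V \<in> \<L>Hv w"
  "V \<subseteq> conj_by (G w) \<g> (Kc \<nu> w)" and a: "a \<in> carrier (obj (N w) V)"
 shows "valid \<nu> (g(w := \<g>)) (W(w := V)) (x(w := a))"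
proof -
 note D = validD[OF v]
 have "finite {v\<in>I. (W(w := V)) v ~= U v}"
  by (rule finite_subset[of _ "insert w {v\<in>I. W v ~= U v}"]) (use D(3) in \<open>auto simp: RT.adm_def\<close>)
 then have "RT.adm (W(w := V))" using D(3) V(1) by (auto simp: RT.adm_def)
 moreover have "finite {v\<in>I. (x(w := a)) v ~= \<phi> v}"
  by (rule finite_subset[of _ "insert w {v\<in>I. x v ~= \<phi> v}"]) (use D(4) in \<open>auto simp: RT.tuple_def\<close>)
 then have "RT.tuple (W(w := V)) (x(w := a))" using D(4) a by (auto simp: RT.tuple_def)
 moreover have "g(w := \<g>) \<in> carrier GR" by (rule RG.upd_closed[OF D(2) w \<g>])
 ultimately show ?thesis using D(8-10) V(2) unfolding valid_def by auto
qed

lemma embed_mult: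
 assumes "w \<in> I" "g \<in> carrier GR" "a \<in> carrier (G w)" "b \<in> carrier (G w)"
 shows "embed_at I G w a \<bowtie> g \<bowtie> embed_at I G w b = g(w := a \<otimes>\<^bsub>G w\<^esub> g w \<otimes>\<^bsub>G w\<^esub> b)"
proof (rule RG.RP_ext)
 note E = RG.embed_at_closed[OF assms(1,3)] RG.embed_at_closed[OF assms(1,4)]
 have gw: "g w \<in> carrier (G w)" by (rule RG.RP_val[OF assms(2,1)])
 show "embed_at I G w a \<bowtie> g \<bowtie> embed_at I G w b \<in> carrier GR" using E assms(2) by simp
 have "a \<otimes>\<^bsub>G w\<^esub> g w \<otimes>\<^bsub>G w\<^esub> b \<in> carrier (G w)"
  using grp[OF assms(1)] gw assms(3,4) by (simp add: group.is_monoid monoid.m_closed)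
 then show "g(w := a \<otimes>\<^bsub>G w\<^esub> g w \<otimes>\<^bsub>G w\<^esub> b) \<in> carrier GR" by (rule RG.upd_closed[OF assms(2,1)])
 fix v assume v: "v \<in> I"
 have "g v \<in> carrier (G v)" by (rule RG.RP_val[OF assms(2) v])
 then show "(embed_at I G w a \<bowtie> g \<bowtie> embed_at I G w b) v = (g(w := a \<otimes>\<^bsub>G w\<^esub> g w \<otimes>\<^bsub>G w\<^esub> b)) v"
  using v grp[OF v] by (simp add: RG.RP_mult embed_at_def group.is_monoid monoid.l_one monoid.r_one)
qed

text \<open>At a place w outside \<nu> the component of K[\<nu>] is K_w. Varying only the data at w
  gives an equivariant family, by \<open>B_shift\<close> applied to h and k embedded at w; at all
  other places the shift is by 1 and changes nothing.\<close>

lemma equivariant_B: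
 assumes v: "valid \<nu> g W x" and w: "w \<in> I'" "w \<notin> \<nu>"
 shows "equivariant w (MK \<nu>) (%\<g> V a. B \<nu> (g(w := \<g>)) (W(w := V)) (x(w := a)))"
 unfolding equivariant_def
proof (intro conjI ballI impI)
 note D = validD[OF v] and wI = I'I[OF w(1)]
 interpret Gw: group "G w" by (rule grp[OF wI])
 interpret Nw: ric_on "Hl w" R "\<L>Hv w" "N w" by (rule local_ric[OF wI])
 have Kw: "Kc \<nu> w = K w" using w by (simp add: Kc_def)
 have HG: "h \<in> H w ==> h \<in> carrier (G w)" for h using H_sub[OF wI] by blast
 have KG: "k \<in> K w ==> k \<in> carrier (G w)" for k using subgroup.subset[OF K_sg[OF wI]] by blast
 show "Module.module R (MK \<nu>)" by (rule MGr.obj_module[OF D(1)])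
 have val: "valid \<nu> (g(w := \<g>)) (W(w := V)) (x(w := a))"
  if "\<g> \<in> carrier (G w)" "V \<in> \<L>Hv w" "V \<subseteq> stab w \<g>" "a \<in> carrier (obj (N w) V)" for \<g> V a
  by (rule valid_upd[OF v wI that(1,2) _ that(4)]) (use that(3) Kw in \<open>auto simp: stab_def\<close>)
 show "(%a. B \<nu> (g(w := \<g>)) (W(w := V)) (x(w := a))) \<in> linear_maps R (obj (N w) V) (MK \<nu>)"
  if \<g>: "\<g> \<in> carrier (G w)" and V: "V \<in> \<L>Hv w" "V \<subseteq> stab w \<g>" for \<g> V
 proof -
  interpret NV: Module.module R "obj (N w) V" by (rule Nw.obj_module[OF V(1)])
  show ?thesis using B_linear[OF val[OF \<g> V NV.zero_closed] wI] by simp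
 qed
 fix \<g> h k V a
 assume \<g>: "\<g> \<in> carrier (G w)" and h: "h \<in> H w" and k: "k \<in> K w" and V: "V \<in> \<L>Hv w"
  "V \<subseteq> stab w (h \<otimes>\<^bsub>G w\<^esub> \<g> \<otimes>\<^bsub>G w\<^esub> k)" and a: "a \<in> carrier (obj (N w) V)"
 let ?\<g> = "h \<otimes>\<^bsub>G w\<^esub> \<g> \<otimes>\<^bsub>G w\<^esub> k" and ?h = "embed_at I G w h" and ?k = "embed_at I G w k"
 let ?a = "push (N w) V h (stab w \<g>) a"
 note hG = HG[OF h] and kG = KG[OF k]
 have \<g>G: "?\<g> \<in> carrier (G w)" using hG \<g> kG by simp
 have KwG: "K w \<subseteq> carrier (G w)" using KG by blast
 have st: "stab w ?\<g> = conj_by (G w) h (stab w \<g>)"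
 proof -
  have "conj_by (G w) ?\<g> (K w) = conj_by (G w) (h \<otimes>\<^bsub>G w\<^esub> \<g>) (K w)"
   using Gw.conj_by_conj_by[OF Gw.m_closed[OF hG \<g>] kG KwG] Gw.conj_by_self[OF K_sg[OF wI] k] by simp
  also have "\<dots> = conj_by (G w) h (conj_by (G w) \<g> (K w))" using Gw.conj_by_conj_by[OF hG \<g> KwG] by simp
  finally show ?thesis unfolding stab_def
   using Gw.conj_by_Int[OF hG H_sub[OF wI] Gw.conj_by_closed[OF \<g> KwG]] Gw.conj_by_self[OF local_groups(2)[OF wI] h] by simp
 qed
 have sl: "stab w \<g> \<in> \<L>Hv w" unfolding stab_def by (rule local_level_stab[OF wI \<g>])
 have ac: "?a \<in> carrier (obj (N w) (stab w \<g>))"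
  using V st h by (intro Nw.push_closed[OF V(1) sl _ _ a]) (simp_all add: conj_Hl[OF wI h])
 have hR: "?h \<in> carrier HR"
  unfolding HR_iff using RG.embed_at_closed[OF wI hG] h subgroup.one_closed[OF local_groups(2)] by (auto simp: embed_at_def)
 have kR: "?k \<in> Kl \<nu>" unfolding Kl_eq using k Kw subgroup.one_closed[OF Kc_sub[OF D(9)]] by (auto simp: embed_at_def)
 show "B \<nu> (g(w := ?\<g>)) (W(w := V)) (x(w := a)) = B \<nu> (g(w := \<g>)) (W(w := stab w \<g>)) (x(w := ?a))"
 proof (rule B_shift[OF val[OF \<g>G V a] val[OF \<g> sl order_refl ac] hR kR])
  show "g(w := ?\<g>) = ?h \<bowtie> g(w := \<g>) \<bowtie> ?k"
   using embed_mult[OF wI RG.upd_closed[OF D(2) wI \<g>] hG kG] by simp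
  fix u assume u: "u \<in> I"
  have Wu: "W u \<in> \<L>Hv u" using D(3) u by (simp add: RT.adm_def)
  show "(W(w := V)) u \<subseteq> conj_by (G u) (?h u) ((W(w := stab w \<g>)) u)"
   using V(2) st u group.conj_by_one[OF grp[OF u] subgroup.subset[OF local_level(2)[OF u Wu]]] wI
   by (auto simp: embed_at_def)
  interpret Nu: ric_on "Hl u" R "\<L>Hv u" "N u" by (rule local_ric[OF u])
  have "push (N u) (W u) \<one>\<^bsub>G u\<^esub> (W u) (x u) = x u"
   using Nu.push_one[OF Wu, of "x u"] D(4) u by (simp add: RT.tuple_def)
  then show "(x(w := ?a)) u = push (N u) ((W(w := V)) u) (?h u) ((W(w := stab w \<g>)) u) ((x(w := a)) u)"
   using u wI by (simp add: embed_at_def)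
 qed
qed

end

section \<open>Hecke operators\<close>

lemma linear_maps_sum:
 assumes M: "Module.module R M" and P: "Module.module R P" and D: "finite D"
  and F: "\<And>d. d \<in> D ==> F d \<in> linear_maps R M P"
 shows "(%x. \<Oplus>\<^bsub>P\<^esub>d\<in>D. F d x) \<in> linear_maps R M P"
proof -
 interpret M: Module.module R M by (rule M)
 interpret P: Module.module R P by (rule P)
 have c: "F d x \<in> carrier P" if "d \<in> D" "x \<in> carrier M" for d x using linear_maps_closed[OF F that(2)] that(1) .
 show ?thesis
 proof (rule linear_mapsI)
  show "(\<Oplus>\<^bsub>P\<^esub>d\<in>D. F d x) \<in> carrier P" if "x \<in> carrier M" for x by (rule P.finsum_closed) (use c that in blast)
  show "(\<Oplus>\<^bsub>P\<^esub>d\<in>D. F d (x \<oplus>\<^bsub>M\<^esub> y)) = (\<Oplus>\<^bsub>P\<^esub>d\<in>D. F d x) \<oplus>\<^bsub>P\<^esub> (\<Oplus>\<^bsub>P\<^esub>d\<in>D. F d y)"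
   if "x \<in> carrier M" "y \<in> carrier M" for x y
  proof -
   have "(\<Oplus>\<^bsub>P\<^esub>d\<in>D. F d (x \<oplus>\<^bsub>M\<^esub> y)) = (\<Oplus>\<^bsub>P\<^esub>d\<in>D. F d x \<oplus>\<^bsub>P\<^esub> F d y)"
    by (rule P.finsum_cong'[OF refl]) (use c that linear_maps_add[OF F] in auto)
   then show ?thesis using P.finsum_addf[of "%d. F d x" D "%d. F d y"] c that by auto
  qed
  show "(\<Oplus>\<^bsub>P\<^esub>d\<in>D. F d (r \<odot>\<^bsub>M\<^esub> x)) = r \<odot>\<^bsub>P\<^esub> (\<Oplus>\<^bsub>P\<^esub>d\<in>D. F d x)" if "r \<in> carrier R" "x \<in> carrier M" for r x
  proof -
   have "(\<Oplus>\<^bsub>P\<^esub>d\<in>D. F d (r \<odot>\<^bsub>M\<^esub> x)) = (\<Oplus>\<^bsub>P\<^esub>d\<in>D. r \<odot>\<^bsub>P\<^esub> F d x)"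
    by (rule P.finsum_cong'[OF refl]) (use c that linear_maps_smult[OF F] in auto)
   then show ?thesis using P.finsum_smult_ldistr[OF D that(1), of "%d. F d x"] c that by auto
  qed
 qed
qed

context ric_on
begin

text \<open>The adjoint correspondence [A \<sigma> A]_* becomes restriction to A \<inter>
  \<sigma>A\<sigma>^{-1} followed by the covariant map of \<sigma>: the middle pullback along
  \<sigma>^{-1} is an isomorphism and equals the pushforward along \<sigma>.\<close>

lemma hecke_star_eq:
 assumes A: "A \<in> \<L>" and \<s>: "\<s> \<in> carrier G" and B: "A \<inter> conj_by G \<s> A \<in> \<L>" and A1: "A \<inter> conj_by G (inv \<s>) A \<in> \<L>"
  and z: "z \<in> carrier (obj M A)"
 shows "hecke_star G M A \<s> A z = push M (A \<inter> conj_by G \<s> A) \<s> A (pull M (A \<inter> conj_by G \<s> A) \<one> A z)"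
proof -
 let ?B = "A \<inter> conj_by G \<s> A" and ?A1 = "A \<inter> conj_by G (inv \<s>) A"
 have i: "inv \<s> \<in> carrier G" using \<s> by simp
 note AG = level_carrier[OF A]
 have "conj_by G \<s> ?A1 = conj_by G \<s> A \<inter> A"
  using conj_by_Int[OF \<s> AG conj_by_closed[OF i AG]] conj_by_conj_by[OF \<s> i AG] conj_by_one[OF AG] \<s> by simp
 then have B_eq: "?B = conj_by G \<s> ?A1" by blast
 then have A1_eq: "?A1 = conj_by G (inv \<s>) ?B" by (rule conj_by_inv_level[OF B A1 \<s>])
 have sub: "?B \<subseteq> conj_by G \<one> A" "?A1 \<subseteq> conj_by G \<one> A" using conj_by_one[OF AG] by auto
 let ?w = "pull M ?B \<one> A z"
 have w: "?w \<in> carrier (obj M ?B)" by (rule pull_closed[OF B A one_closed sub(1) z])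
 have "hecke_star G M A \<s> A z = push M ?A1 \<one> A (pull M ?A1 (inv \<s>) ?B ?w)"
  unfolding hecke_star_def hecke_def Let_def inv_inv[OF \<s>] ..
 also have "pull M ?A1 (inv \<s>) ?B ?w = push M ?B \<s> ?A1 ?w"
  using pull_eq_push[OF A1 B i A1_eq w] inv_inv[OF \<s>] by simp
 also have "push M ?A1 \<one> A (push M ?B \<s> ?A1 ?w) = push M ?B (\<s> \<otimes> \<one>) A ?w"
  by (rule push_comp[OF B A1 A \<s> one_closed _ sub(2) w]) (use B_eq in simp)
 finally show ?thesis using \<s> by simp
qed

text \<open>The isomorphism given by conjugation commutes with restriction; it is rewritten as a
  pullback, so that only contravariant functoriality is involved. This transports the Mackey formula
  from level A to its conjugate.\<close>

lemma pull_push_conj: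
 assumes A: "A \<in> \<L>" and B: "B \<in> \<L>" "B \<subseteq> A" and g: "g \<in> carrier G" and C: "conj_by G g A \<in> \<L>" "conj_by G g B \<in> \<L>"
  and y: "y \<in> carrier (obj M (conj_by G g A))"
 shows "pull M B \<one> A (push M (conj_by G g A) g A y) = push M (conj_by G g B) g B (pull M (conj_by G g B) \<one> (conj_by G g A) y)"
proof -
 let ?C = "conj_by G g A" and ?L = "conj_by G g B"
 have i: "inv g \<in> carrier G" using g by simp
 have A_eq: "A = conj_by G (inv g) ?C" by (rule conj_by_inv_level[OF C(1) A g refl])
 have B_eq: "B = conj_by G (inv g) ?L" by (rule conj_by_inv_level[OF C(2) B(1) g refl])
 have LC: "?L \<subseteq> conj_by G \<one> ?C" using conj_by_mono[OF B(2)] conj_by_one[OF level_carrier[OF C(1)]] by simp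
 have BA: "B \<subseteq> conj_by G \<one> A" using B(2) conj_by_one[OF level_carrier[OF A]] by simp
 have "pull M B \<one> A (push M ?C g A y) = pull M B \<one> A (pull M A (inv g) ?C y)"
  unfolding push_eq_pull[OF C(1) A g refl y] ..
 also have "\<dots> = pull M B (\<one> \<otimes> inv g) ?C y"
  by (rule pull_comp[OF B(1) A C(1) one_closed i BA equalityD1[OF A_eq] y])
 also have "\<one> \<otimes> inv g = inv g \<otimes> \<one>" using i by simp
 also have "pull M B (inv g \<otimes> \<one>) ?C y = pull M B (inv g) ?L (pull M ?L \<one> ?C y)"
  by (rule pull_comp[symmetric, OF B(1) C(2,1) i one_closed equalityD1[OF B_eq] LC y])
 also have "\<dots> = push M ?L g B (pull M ?L \<one> ?C y)"
  by (rule push_eq_pull[symmetric, OF C(2) B(1) g refl pull_closed[OF C(2,1) one_closed LC y]])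
 finally show ?thesis .
qed

end

section \<open>Hecke operators on the elements B\<close>

context setting
begin

lemma \<L>H_Int_conj:
 assumes "V \<in> \<L>H" "A \<in> \<L>G" shows "V \<inter> A \<in> \<L>H"
proof -
 have "V \<inter> A = V \<inter> (A \<inter> carrier HH)"
  using MHr.level_carrier[OF assms(1)] unfolding global_groups by blast
 then show ?thesis using collections(4) assms(1) collections(5)[OF assms(2)] unfolding level_collection_def by simp
qed

text \<open>After \<open>hecke_star_eq\<close>, the restriction from A is carried to the conjugate
  level g A g^{-1}, where the Mackey axiom of the pushforward expands it. The maps \<gamma>, g and
  \<sigma> are then composed, and the levels are enlarged to the full conjugates of A.\<close>

lemma hecke_star_iota:
 assumes A: "A \<in> \<L>G" and g: "g \<in> carrier GR" and \<s>: "\<s> \<in> carrier GR" and V: "V \<in> \<L>H" "V \<subseteq> conj_by GR g A"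
  and x: "x \<in> carrier (obj MH V)"
  and \<G>: "finite \<G>" "double_coset_reps GR V (conj_by GR g A) (conj_by GR g (A \<inter> conj_by GR \<s> A)) \<G>"
 shows "hecke_star GR MG A \<s> A (push MG (conj_by GR g A) g A (\<iota> V (conj_by GR g A) x)) =
  (\<Oplus>\<^bsub>obj MG A\<^esub>\<g>\<in>\<G>. push MG (conj_by GR (\<g> \<bowtie> g \<bowtie> \<s>) A) (\<g> \<bowtie> g \<bowtie> \<s>) A
    (\<iota> (V \<inter> conj_by GR \<g> (conj_by GR g (A \<inter> conj_by GR \<s> A))) (conj_by GR (\<g> \<bowtie> g \<bowtie> \<s>) A)
     (pull MH (V \<inter> conj_by GR \<g> (conj_by GR g (A \<inter> conj_by GR \<s> A))) \<e> V x)))"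
  (is "_ = (\<Oplus>\<^bsub>_\<^esub>\<g>\<in>\<G>. ?t \<g>)")
proof -
 let ?B = "A \<inter> conj_by GR \<s> A" and ?C = "conj_by GR g A"
 let ?L = "conj_by GR g ?B"
 have AG: "A \<subseteq> carrier GR" by (rule MGr.level_carrier[OF A])
 have B: "?B \<in> \<L>G" by (rule \<L>G_Int[OF A \<L>G_conj[OF \<s> A]])
 have A1: "A \<inter> conj_by GR (inv\<^bsub>GR\<^esub> \<s>) A \<in> \<L>G" by (rule \<L>G_Int[OF A \<L>G_conj[OF RG.RP.inv_closed[OF \<s>] A]])
 have C: "?C \<in> \<L>G" and L: "?L \<in> \<L>G" by (rule \<L>G_conj[OF g A], rule \<L>G_conj[OF g B])
 have LC: "?L \<subseteq> ?C" by (rule RG.RP.conj_by_mono) blast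
 have BG: "?B \<subseteq> carrier GR" using AG by blast
 have \<G>G: "\<g> \<in> carrier GR" if "\<g> \<in> \<G>" for \<g>
  using that \<G>(2) MGr.level_carrier[OF C] unfolding double_coset_reps_def by blast
 define gs where "gs = g \<bowtie> \<s>"
 have gs: "gs \<in> carrier GR" unfolding gs_def using g \<s> by simp
 have Lgs: "?L \<subseteq> conj_by GR gs A"
  using RG.RP.conj_by_mono[of ?B "conj_by GR \<s> A" g] RG.RP.conj_by_conj_by[OF g \<s> AG] unfolding gs_def by simp
 let ?y = "\<iota> V ?C x"
 have y: "?y \<in> carrier (obj MG ?C)" by (rule linear_maps_closed[OF iota_linear[OF V(1) C V(2)] x])
 have LC1: "?L \<subseteq> conj_by GR \<e> ?C" using LC RG.RP.conj_by_one[OF MGr.level_carrier[OF C]] by simp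
 have z: "push MG ?C g A ?y \<in> carrier (obj MG A)" by (rule MGr.push_closed[OF C A g order_refl y])
 let ?V = "%\<g>. V \<inter> conj_by GR \<g> ?L"
 let ?x = "%\<g>. pull MH (?V \<g>) \<e> V x"
 let ?D = "%\<g>. conj_by GR \<g> ?L"
 have D: "?D \<g> \<in> \<L>G" if "\<g> \<in> \<G>" for \<g> by (rule \<L>G_conj[OF \<G>G[OF that] L])
 have VD: "?V \<g> \<in> \<L>H" if "\<g> \<in> \<G>" for \<g> by (rule \<L>H_Int_conj[OF V(1) D[OF that]])
 have V1: "V = conj_by HR \<one>\<^bsub>HR\<^esub> V" by (rule RH.RP.conj_by_one[OF MHr.level_carrier[OF V(1)], symmetric])
 have xc: "?x \<g> \<in> carrier (obj MH (?V \<g>))" if "\<g> \<in> \<G>" for \<g>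
  using MHr.pull_closed[OF VD[OF that] V(1) RH.RP.one_closed _ x] V1 unfolding HR_ops by blast
 have ic: "\<iota> (?V \<g>) (?D \<g>) (?x \<g>) \<in> carrier (obj MG (?D \<g>))" if "\<g> \<in> \<G>" for \<g>
  by (rule linear_maps_closed[OF iota_linear[OF VD[OF that] D[OF that]] xc[OF that]]) blast
 have pc: "push MG (?D \<g>) \<g> ?L (\<iota> (?V \<g>) (?D \<g>) (?x \<g>)) \<in> carrier (obj MG ?L)" if "\<g> \<in> \<G>" for \<g>
  by (rule MGr.push_closed[OF D[OF that] L \<G>G[OF that] order_refl ic[OF that]])
 have summand: "push MG ?L gs A (push MG (?D \<g>) \<g> ?L (\<iota> (?V \<g>) (?D \<g>) (?x \<g>))) = ?t \<g>" if \<g>: "\<g> \<in> \<G>" for \<g>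
 proof -
  define k where "k = \<g> \<bowtie> g \<bowtie> \<s>"
  have k: "k = \<g> \<bowtie> gs" "k \<in> carrier GR" unfolding k_def gs_def using \<G>G[OF \<g>] g \<s> by (simp_all add: RG.RP.m_assoc)
  have kA: "conj_by GR k A \<in> \<L>G" by (rule \<L>G_conj[OF k(2) A])
  have Dk: "?D \<g> \<subseteq> conj_by GR k A"
   using RG.RP.conj_by_mono[OF Lgs, of \<g>] RG.RP.conj_by_conj_by[OF \<G>G[OF \<g>] gs AG] unfolding k(1) by simp
  have Dk1: "?D \<g> \<subseteq> conj_by GR \<e> (conj_by GR k A)" using Dk RG.RP.conj_by_one[OF MGr.level_carrier[OF kA]] by simp
  have "push MG ?L gs A (push MG (?D \<g>) \<g> ?L (\<iota> (?V \<g>) (?D \<g>) (?x \<g>))) = push MG (?D \<g>) k A (\<iota> (?V \<g>) (?D \<g>) (?x \<g>))"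
   unfolding k(1) by (rule MGr.push_comp[OF D[OF \<g>] L A \<G>G[OF \<g>] gs order_refl Lgs ic[OF \<g>]])
  also have "\<dots> = push MG (?D \<g>) (\<e> \<bowtie> k) A (\<iota> (?V \<g>) (?D \<g>) (?x \<g>))" using k(2) by simp
  also have "\<dots> = push MG (conj_by GR k A) k A (push MG (?D \<g>) \<e> (conj_by GR k A) (\<iota> (?V \<g>) (?D \<g>) (?x \<g>)))"
   by (rule MGr.push_comp[symmetric, OF D[OF \<g>] kA A RG.RP.one_closed k(2) Dk1 order_refl ic[OF \<g>]])
  also have "push MG (?D \<g>) \<e> (conj_by GR k A) (\<iota> (?V \<g>) (?D \<g>) (?x \<g>)) = \<iota> (?V \<g>) (conj_by GR k A) (?x \<g>)"
   by (rule iota_enlarge[OF VD[OF \<g>] D[OF \<g>] kA _ Dk xc[OF \<g>]]) blast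
  finally show ?thesis unfolding k_def .
 qed
 have "hecke_star GR MG A \<s> A (push MG ?C g A ?y) = push MG ?B \<s> A (pull MG ?B \<e> A (push MG ?C g A ?y))"
  by (rule MGr.hecke_star_eq[OF A \<s> B A1 z])
 also have "\<dots> = push MG ?B \<s> A (push MG ?L g ?B (pull MG ?L \<e> ?C ?y))"
  unfolding MGr.pull_push_conj[OF A B Int_lower1 g C L y] ..
 also have "\<dots> = push MG ?L gs A (pull MG ?L \<e> ?C ?y)"
  unfolding gs_def
  by (rule MGr.push_comp[OF L B A g \<s> order_refl Int_lower2 MGr.pull_closed[OF L C RG.RP.one_closed LC1 y]])
 also have "\<dots> = push MG ?L gs A (\<Oplus>\<^bsub>obj MG ?L\<^esub>\<g>\<in>\<G>. push MG (?D \<g>) \<g> ?L (\<iota> (?V \<g>) (?D \<g>) (?x \<g>)))"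
  unfolding iota_mackey[OF V(1) C L V(2) LC \<G>(2) x] ..
 also have "\<dots> = (\<Oplus>\<^bsub>obj MG A\<^esub>\<g>\<in>\<G>. push MG ?L gs A (push MG (?D \<g>) \<g> ?L (\<iota> (?V \<g>) (?D \<g>) (?x \<g>))))"
  by (rule linear_maps_finsum[OF MGr.obj_module[OF L] MGr.obj_module[OF A] MGr.push_linear[OF L A gs Lgs] \<G>(1)]) (use pc in blast)
 also have "\<dots> = (\<Oplus>\<^bsub>obj MG A\<^esub>\<g>\<in>\<G>. ?t \<g>)"
 proof -
  interpret MA: Module.module R "obj MG A" by (rule MGr.obj_module[OF A])
  show ?thesis
  proof (rule MA.finsum_cong'[OF refl _ summand])
   show "?t \<in> \<G> \<rightarrow> carrier (obj MG A)"
    unfolding Pi_iff summand[symmetric] by (use summand MGr.push_closed[OF L A gs Lgs pc] in force)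
  qed
 qed
 finally show ?thesis .
qed

lemma hecke_star_linear:
 assumes A: "A \<in> \<L>G" and \<s>: "\<s> \<in> carrier GR"
 shows "hecke_star GR MG A \<s> A \<in> linear_maps R (obj MG A) (obj MG A)"
proof -
 let ?B = "A \<inter> conj_by GR (inv\<^bsub>GR\<^esub> (inv\<^bsub>GR\<^esub> \<s>)) A" and ?A1 = "A \<inter> conj_by GR (inv\<^bsub>GR\<^esub> \<s>) A"
 have i: "inv\<^bsub>GR\<^esub> \<s> \<in> carrier GR" using \<s> by simp
 note AG = MGr.level_carrier[OF A]
 have B: "?B \<in> \<L>G" and A1: "?A1 \<in> \<L>G"
  by (rule \<L>G_Int[OF A \<L>G_conj[OF RG.RP.inv_closed[OF i] A]], rule \<L>G_Int[OF A \<L>G_conj[OF i A]])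
 note one = RG.RP.conj_by_one[OF AG]
 have "conj_by GR (inv\<^bsub>GR\<^esub> \<s>) ?B = conj_by GR (inv\<^bsub>GR\<^esub> \<s>) A \<inter> A"
  using RG.RP.conj_by_Int[OF i AG RG.RP.conj_by_closed[OF \<s> AG]] RG.RP.conj_by_conj_by[OF i \<s> AG] one \<s> by simp
 then have s: "?A1 \<subseteq> conj_by GR (inv\<^bsub>GR\<^esub> \<s>) ?B" by blast
 have "(%z. push MG ?A1 \<e> A (pull MG ?A1 (inv\<^bsub>GR\<^esub> \<s>) ?B (pull MG ?B \<e> A z))) \<in> linear_maps R (obj MG A) (obj MG A)"
  by (rule linear_maps_compose[OF linear_maps_compose[OF MGr.pull_linear[OF B A RG.RP.one_closed] MGr.pull_linear[OF A1 B i s]]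
     MGr.push_linear[OF A1 A RG.RP.one_closed]]) (simp_all only: one Int_lower1)
 then show ?thesis unfolding hecke_star_def hecke_def Let_def .
qed

lemma U_sg: "v \<in> I ==> subgroup (U v) (G v)"
 using local_level(2)[OF _ U_level] by blast

lemma Ks_sg: "v \<in> I ==> s \<in> carrier (G v) ==> subgroup (Ks v s) (G v)"
 by (rule group.subgroups_Inter_pair[OF grp K_sg group.conj_by_subgroup[OF grp K_sg]])

lemma reps_hecke_reps: "v \<in> I' ==> reps v (hecke_reps v)"
 unfolding reps_def using hecke_data.hecke_reps(1,2)[OF hecke_data]
 by (intro conjI ballI impI) (assumption | rule hecke_data.hecke_reps(3,4)[OF hecke_data])+

text \<open>With s embedded at v, the smaller group differs from g K[\<nu>] g^{-1} only in the
  coordinate v, where it is K_v \<inter> s K_v s^{-1}. An element k is therefore adjusted from the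
  left and the right by putting all coordinates away from v into the right factor, and only the
  local double cosets at v matter.\<close>

lemma embed_reps:
 assumes val: "valid \<nu> g W x" and v: "v \<in> I'" "v \<notin> \<nu>" and gv: "g v = \<one>\<^bsub>G v\<^esub>" and Wv: "W v = U v"
  and s: "s \<in> carrier (G v)" and \<G>: "double_coset_reps (G v) (U v) (K v) (Ks v s) \<G>"
 defines "C \<equiv> (%w. conj_by (G w) (g w) (Kc \<nu> w))"
 defines "C' \<equiv> (%w. if w = v then Ks v s else C w)"
 shows "conj_by GR g (Kl \<nu> \<inter> conj_by GR (embed_at I G v s) (Kl \<nu>)) = PiE I C'"
  and "double_coset_reps GR (PiE I W) (PiE I C) (PiE I C') (embed_at I G v ` \<G>)"
proof -
 note D = validD[OF val] and vI = I'I[OF v(1)]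
 let ?\<s> = "embed_at I G v s"
 have \<s>: "?\<s> \<in> carrier GR" by (rule RG.embed_at_closed[OF vI s])
 have Kv: "Kc \<nu> v = K v" using v(2) by (simp add: Kc_def)
 have KcG: "Kc \<nu> w \<subseteq> carrier (G w)" if "w \<in> I" for w by (rule Kc_carrier[OF D(9) that])
 have Cv: "C v = K v" unfolding C_def gv Kv by (rule group.conj_by_one[OF grp[OF vI] subgroup.subset[OF K_sg[OF vI]]])
 have "Kl \<nu> \<inter> conj_by GR ?\<s> (Kl \<nu>) = (\<Pi>\<^sub>E w\<in>I. Kc \<nu> w \<inter> conj_by (G w) (?\<s> w) (Kc \<nu> w))"
  unfolding Kl_eq RG.RP_conj[OF \<s> KcG, simplified] PiE_Int by simp
 then have "conj_by GR g (Kl \<nu> \<inter> conj_by GR ?\<s> (Kl \<nu>)) =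
   (\<Pi>\<^sub>E w\<in>I. conj_by (G w) (g w) (Kc \<nu> w \<inter> conj_by (G w) (?\<s> w) (Kc \<nu> w)))"
  using RG.RP_conj[OF D(2), of "%w. Kc \<nu> w \<inter> conj_by (G w) (?\<s> w) (Kc \<nu> w)"] KcG by (simp add: le_infI1)
 also have "\<dots> = PiE I C'"
 proof (rule PiE_cong)
  fix w assume w: "w \<in> I"
  have one: "conj_by (G w) \<one>\<^bsub>G w\<^esub> X = X" if "X \<subseteq> carrier (G w)" for X by (rule group.conj_by_one[OF grp[OF w] that])
  show "conj_by (G w) (g w) (Kc \<nu> w \<inter> conj_by (G w) (?\<s> w) (Kc \<nu> w)) = C' w"
  proof (cases "w = v")
   case True
   then show ?thesis using one[of "K w \<inter> conj_by (G w) s (K w)"] KcG[OF w] Kv w gv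
    by (simp add: C'_def embed_at_def le_infI1)
  next
   case False
   then show ?thesis using one[OF KcG[OF w]] w by (simp add: C'_def C_def embed_at_def)
  qed
 qed
 finally show "conj_by GR g (Kl \<nu> \<inter> conj_by GR ?\<s> (Kl \<nu>)) = PiE I C'" .
 have Csg: "subgroup (C w) (G w)" if "w \<in> I" for w
  unfolding C_def by (rule group.conj_by_subgroup[OF grp[OF that] Kc_sub[OF D(9) that] RG.RP_val[OF D(2) that]])
 have \<G>K: "\<G> \<subseteq> K v" using \<G> unfolding double_coset_reps_def by blast
 have Wsg: "subgroup (W w) (G w)" if "w \<in> I" for w using D(3) local_level(2) that by (simp add: RT.adm_def)
 have KsG: "Ks v s \<subseteq> carrier (G v)" "K v \<subseteq> carrier (G v)" "U v \<subseteq> carrier (G v)"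
  using subgroup.subset[OF Ks_sg[OF vI s]] subgroup.subset[OF K_sg[OF vI]] subgroup.subset[OF U_sg[OF vI]] by blast+
 have CC: "PiE I C \<subseteq> carrier GR" using MGr.level_carrier[OF D(5)] D(11) unfolding C_def by simp
 show "double_coset_reps GR (PiE I W) (PiE I C) (PiE I C') (embed_at I G v ` \<G>)"
  unfolding double_coset_reps_def
 proof (intro conjI ballI)
  show "embed_at I G v ` \<G> \<subseteq> PiE I C"
   using \<G>K Cv subgroup.one_closed[OF Csg] by (auto simp: embed_at_def)
  fix k assume k: "k \<in> PiE I C"
  then have kv: "k v \<in> K v" using PiE_mem[OF k vI] Cv by simp
  obtain \<g> where \<g>: "\<g> \<in> \<G>" "k v \<in> double_coset (G v) (U v) \<g> (Ks v s)"
   and un: "\<And>\<g>'. \<g>' \<in> \<G> ==> k v \<in> double_coset (G v) (U v) \<g>' (Ks v s) ==> \<g>' = \<g>"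
   using \<G> kv unfolding double_coset_reps_def by blast
  obtain a b where ab: "a \<in> U v" "b \<in> Ks v s" "k v = a \<otimes>\<^bsub>G v\<^esub> \<g> \<otimes>\<^bsub>G v\<^esub> b" using \<g>(2) by (auto simp: double_coset_def)
  show "\<exists>!\<delta>. \<delta> \<in> embed_at I G v ` \<G> \<and> k \<in> double_coset GR (PiE I W) \<delta> (PiE I C')"
  proof (rule ex1I[of _ "embed_at I G v \<g>"])
   have 1: "embed_at I G v a \<in> PiE I W" using ab(1) Wv subgroup.one_closed[OF Wsg] by (auto simp: embed_at_def)
   have 2: "k(v := b) \<in> PiE I C'" using k ab(2) vI by (auto simp: C'_def PiE_iff extensional_def)
   have c: "a \<in> carrier (G v)" "b \<in> carrier (G v)" "\<g> \<in> carrier (G v)" using ab \<g>(1) \<G>K KsG by blast+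
   have kG: "k \<in> carrier GR" using k CC by blast
   note cl = RG.embed_at_closed[OF vI c(1)] RG.embed_at_closed[OF vI c(3)] RG.upd_closed[OF kG vI c(2)]
   have "k = embed_at I G v a \<bowtie> embed_at I G v \<g> \<bowtie> k(v := b)"
   proof (rule RG.RP_ext[OF kG])
    show "embed_at I G v a \<bowtie> embed_at I G v \<g> \<bowtie> k(v := b) \<in> carrier GR"
     by (intro RG.RP.m_closed cl)
    fix w assume w: "w \<in> I"
    have "k w \<in> carrier (G w)" by (rule RG.RP_val[OF kG w])
    then show "k w = (embed_at I G v a \<bowtie> embed_at I G v \<g> \<bowtie> k(v := b)) w"
     using w grp[OF w] ab(3) by (simp add: RG.RP_mult embed_at_def group.is_monoid monoid.l_one)
   qed
   then show "embed_at I G v \<g> \<in> embed_at I G v ` \<G> \<and> k \<in> double_coset GR (PiE I W) (embed_at I G v \<g>) (PiE I C')"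
    using 1 2 \<g>(1) unfolding double_coset_def by blast
   fix \<delta> assume \<delta>: "\<delta> \<in> embed_at I G v ` \<G> \<and> k \<in> double_coset GR (PiE I W) \<delta> (PiE I C')"
   then obtain \<g>' a' b' where \<g>': "\<g>' \<in> \<G>" "\<delta> = embed_at I G v \<g>'" "a' \<in> PiE I W" "b' \<in> PiE I C'"
    "k = a' \<bowtie> \<delta> \<bowtie> b'" unfolding double_coset_def by blast
   have "k v = a' v \<otimes>\<^bsub>G v\<^esub> \<g>' \<otimes>\<^bsub>G v\<^esub> b' v" unfolding \<g>'(5) \<g>'(2) using vI by (simp add: RG.RP_mult embed_at_def)
   moreover have "a' v \<in> U v" "b' v \<in> Ks v s" using PiE_mem[OF \<g>'(3) vI] PiE_mem[OF \<g>'(4) vI] Wv by (simp_all add: C'_def)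
   ultimately have "k v \<in> double_coset (G v) (U v) \<g>' (Ks v s)" unfolding double_coset_def by blast
   then show "\<delta> = embed_at I G v \<g>" using un \<g>'(1,2) by blast
  qed
 qed
qed

text \<open>The term of the representative \<gamma> on the Hecke side of the local identity, for the
  family of \<open>equivariant_B\<close> at the place v.\<close>

definition "shifted \<nu> g W x v \<g> =
 B \<nu> (g(v := \<g>)) (W(v := U v \<inter> stab v \<g>)) (x(v := pull (N v) (U v \<inter> stab v \<g>) \<one>\<^bsub>G v\<^esub> (U v) (\<phi> v)))"

lemma shifted_valid:
 assumes val: "valid \<nu> g W x" and v: "v \<in> I'" "v \<notin> \<nu>" and \<g>: "\<g> \<in> carrier (G v)"
 shows "valid \<nu> (g(v := \<g>)) (W(v := U v \<inter> stab v \<g>)) (x(v := pull (N v) (U v \<inter> stab v \<g>) \<one>\<^bsub>G v\<^esub> (U v) (\<phi> v)))"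
proof (rule valid_upd[OF val I'I[OF v(1)] \<g>])
 note vI = I'I[OF v(1)]
 interpret Nv: ric_on "Hl v" R "\<L>Hv v" "N v" by (rule local_ric[OF vI])
 show lev: "U v \<inter> stab v \<g> \<in> \<L>Hv v"
  using local_level_Int[OF U_level[OF vI] local_level_stab[OF vI \<g>]] unfolding stab_def .
 show "U v \<inter> stab v \<g> \<subseteq> conj_by (G v) \<g> (Kc \<nu> v)" using v(2) by (auto simp: Kc_def stab_def)
 have "U v = conj_by (Hl v) \<one>\<^bsub>Hl v\<^esub> (U v)"
  by (rule group.conj_by_one[OF Hl_group[OF vI] Nv.level_carrier[OF U_level[OF vI]], symmetric])
 then show "pull (N v) (U v \<inter> stab v \<g>) \<one>\<^bsub>G v\<^esub> (U v) (\<phi> v) \<in> carrier (obj (N v) (U v \<inter> stab v \<g>))"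
  using Nv.pull_closed[OF lev U_level[OF vI] Nv.one_closed _ local_functors(3)[OF vI]] by simp
qed

text \<open>In the Mackey expansion, a representative \<gamma> lies in K_v, so at v the level
  becomes the intersection of U_v with the stabilizer of \<gamma>s K_v. At the other places the
  level and the tensor are unchanged, because W_w is already contained in the conjugate of the
  component of K[\<nu>].\<close>

lemma hecke_star_B:
 assumes val: "valid \<nu> g W x" and v: "v \<in> I'" "v \<notin> \<nu>" and gv: "g v = \<one>\<^bsub>G v\<^esub>" and Wv: "W v = U v" and xv: "x v = \<phi> v"
  and s: "s \<in> carrier (G v)" and \<G>: "finite \<G>" "double_coset_reps (G v) (U v) (K v) (Ks v s) \<G>"
 shows "hecke_star GR MG (Kl \<nu>) (embed_at I G v s) (Kl \<nu>) (B \<nu> g W x) =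
  (\<Oplus>\<^bsub>MK \<nu>\<^esub>\<g>\<in>\<G>. shifted \<nu> g W x v (\<g> \<otimes>\<^bsub>G v\<^esub> s))"
proof -
 note D = validD[OF val] and vI = I'I[OF v(1)]
 interpret Gv: group "G v" by (rule grp[OF vI])
 interpret A: Module.module R "MK \<nu>" by (rule MGr.obj_module[OF D(1)])
 let ?E = "embed_at I G v" and ?A = "Kl \<nu>"
 let ?\<s> = "?E s"
 define C where "C w = conj_by (G w) (g w) (Kc \<nu> w)" for w
 define C' where "C' w = (if w = v then Ks v s else C w)" for w
 note E = embed_reps[OF val v gv Wv s \<G>(2), folded C_def, folded C'_def]
 have gA: "conj_by GR g ?A = PiE I C" unfolding D(11) C_def ..
 have \<s>: "?\<s> \<in> carrier GR" by (rule RG.embed_at_closed[OF vI s])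
 have KG: "K v \<subseteq> carrier (G v)" by (rule subgroup.subset[OF K_sg[OF vI]])
 have \<G>K: "\<g> \<in> K v" if "\<g> \<in> \<G>" for \<g> using \<G>(2) that unfolding double_coset_reps_def by blast
 have \<G>G: "\<g> \<in> carrier (G v)" if "\<g> \<in> \<G>" for \<g> using \<G>K[OF that] KG by blast
 have \<Theta>c: "\<Theta> W x \<in> carrier (obj MH (PiE I W))" by (rule \<Theta>_closed[OF D(3,4)])
 define tt where "tt \<delta> = push MG (conj_by GR (\<delta> \<bowtie> g \<bowtie> ?\<s>) ?A) (\<delta> \<bowtie> g \<bowtie> ?\<s>) ?A
    (\<iota> (PiE I W \<inter> conj_by GR \<delta> (PiE I C')) (conj_by GR (\<delta> \<bowtie> g \<bowtie> ?\<s>) ?A)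
     (pull MH (PiE I W \<inter> conj_by GR \<delta> (PiE I C')) \<e> (PiE I W) (\<Theta> W x)))" for \<delta>
 have tt: "tt (?E \<g>) = shifted \<nu> g W x v (\<g> \<otimes>\<^bsub>G v\<^esub> s)" if \<g>: "\<g> \<in> \<G>" for \<g>
 proof -
  let ?\<g> = "\<g> \<otimes>\<^bsub>G v\<^esub> s"
  have \<g>s: "?\<g> \<in> carrier (G v)" using \<G>G[OF \<g>] s by simp
  have prod: "?E \<g> \<bowtie> g \<bowtie> ?\<s> = g(v := ?\<g>)"
   using embed_mult[OF vI D(2) \<G>G[OF \<g>] s] \<G>G[OF \<g>] gv by simp
  let ?W = "W(v := U v \<inter> stab v ?\<g>)"
  let ?x = "x(v := pull (N v) (U v \<inter> stab v ?\<g>) \<one>\<^bsub>G v\<^esub> (U v) (\<phi> v))"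
  note sv = validD[OF shifted_valid[OF val v \<g>s]]
  have C'G: "C' w \<subseteq> carrier (G w)" if "w \<in> I" for w
   using subgroup.subset[OF Ks_sg[OF vI s]] group.conj_by_closed[OF grp[OF that] RG.RP_val[OF D(2) that] Kc_carrier[OF D(9) that]]
   unfolding C'_def C_def by auto
  have "conj_by GR (?E \<g>) (PiE I C') = (\<Pi>\<^sub>E w\<in>I. conj_by (G w) (?E \<g> w) (C' w))"
   by (rule RG.RP_conj[OF RG.embed_at_closed[OF vI \<G>G[OF \<g>]] C'G])
  then have "PiE I W \<inter> conj_by GR (?E \<g>) (PiE I C') = (\<Pi>\<^sub>E w\<in>I. W w \<inter> conj_by (G w) (?E \<g> w) (C' w))"
   by (simp add: PiE_Int)
  also have "\<dots> = PiE I ?W"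
  proof (rule PiE_cong)
   fix w assume w: "w \<in> I"
   show "W w \<inter> conj_by (G w) (?E \<g> w) (C' w) = ?W w"
   proof (cases "w = v")
    case True
    have "conj_by (G v) \<g> (Ks v s) = K v \<inter> conj_by (G v) ?\<g> (K v)"
     unfolding Gv.conj_by_Int[OF \<G>G[OF \<g>] KG Gv.conj_by_closed[OF s KG]]
      Gv.conj_by_self[OF K_sg[OF vI] \<G>K[OF \<g>]] Gv.conj_by_conj_by[OF \<G>G[OF \<g>] s KG] ..
    then show ?thesis using True w Wv local_groups(7)[of v] by (auto simp: embed_at_def C'_def stab_def)
   next
    case False
    have "conj_by (G w) \<one>\<^bsub>G w\<^esub> (C w) = C w" using group.conj_by_one[OF grp[OF w]] C'G[OF w] False unfolding C'_def by simp
    then show ?thesis using False w D(10)[OF w] by (auto simp: embed_at_def C'_def C_def)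
   qed
  qed
  finally have Weq: "PiE I W \<inter> conj_by GR (?E \<g>) (PiE I C') = PiE I ?W" .
  have sub: "?W w \<subseteq> conj_by (G w) (\<e> w) (W w)" if w: "w \<in> I" for w
  proof -
   have "W w \<in> \<L>Hv w" using D(3) w by (simp add: RT.adm_def)
   then have "conj_by (G w) (\<e> w) (W w) = W w"
    using group.conj_by_one[OF grp[OF w] subgroup.subset[OF local_level(2)[OF w]]] local_one[OF w] by simp
   then show ?thesis using Wv by auto
  qed
  have "pull MH (PiE I ?W) \<e> (PiE I W) (\<Theta> W x) = \<Theta> ?W (%w. pull (N w) (?W w) (\<e> w) (W w) (x w))"
   by (rule \<Theta>_pull[OF sv(3) D(3) one_HR sub D(4)])
  also have "\<dots> = \<Theta> ?W ?x"
  proof (rule \<Theta>_cong)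
   fix w assume w: "w \<in> I"
   interpret Nw: ric_on "Hl w" R "\<L>Hv w" "N w" by (rule local_ric[OF w])
   have "W w \<in> \<L>Hv w" "x w \<in> carrier (obj (N w) (W w))" using D(3,4) w by (simp_all add: RT.adm_def RT.tuple_def)
   then have "pull (N w) (W w) \<one>\<^bsub>G w\<^esub> (W w) (x w) = x w" using Nw.pull_one by simp
   then show "pull (N w) (?W w) (\<e> w) (W w) (x w) = ?x w" using local_one[OF w] Wv xv by simp
  qed
  finally show ?thesis unfolding tt_def shifted_def B_def Weq prod by simp
 qed
 have "hecke_star GR MG ?A ?\<s> ?A (B \<nu> g W x) = (\<Oplus>\<^bsub>obj MG ?A\<^esub>\<delta>\<in>?E ` \<G>. tt \<delta>)"
  unfolding B_def tt_def E(1)[symmetric]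
  by (rule hecke_star_iota[OF D(1,2) \<s> D(6,7) \<Theta>c finite_imageI[OF \<G>(1)]]) (unfold gA E(1), rule E(2))
 also have "\<dots> = (\<Oplus>\<^bsub>obj MG ?A\<^esub>\<g>\<in>\<G>. tt (?E \<g>))"
 proof (rule A.finsum_reindex)
  have "inj ?E" using vI by (intro injI) (drule fun_cong[of _ _ v], simp add: embed_at_def)
  then show "inj_on ?E \<G>" by (rule inj_on_subset) simp
  show "tt \<in> ?E ` \<G> \<rightarrow> carrier (obj MG ?A)"
   using B_closed[OF shifted_valid[OF val v]] \<G>G s unfolding Pi_iff by (auto simp: tt shifted_def)
 qed
 also have "\<dots> = (\<Oplus>\<^bsub>obj MG ?A\<^esub>\<g>\<in>\<G>. shifted \<nu> g W x v (\<g> \<otimes>\<^bsub>G v\<^esub> s))"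
  by (rule A.finsum_cong'[OF refl _ tt]) (use B_closed[OF shifted_valid[OF val v]] \<G>G s in \<open>auto simp: shifted_def\<close>)
 finally show ?thesis .
qed

abbreviation "hecke_op v \<nu> \<equiv> hecke_operator R I G K MG v (f v) (Kl \<nu>)"

lemma hecke_op_eq: "hecke_op v \<nu> = (%y. \<Oplus>\<^bsub>MK \<nu>\<^esub>D\<in>support_cosets v.
  f v (coset_rep D) \<odot>\<^bsub>MK \<nu>\<^esub> hecke_star GR MG (Kl \<nu>) (embed_at I G v (coset_rep D)) (Kl \<nu>) y)"
 if "v \<in> I'"
 unfolding hecke_operator_def hecke_data.support_cosets_def[OF hecke_data[OF that]] coset_rep_def Let_def by (rule ext) (rule refl)

lemma hecke_coeff: "v \<in> I' ==> g \<in> carrier (G v) ==> f v g \<in> carrier R"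
 using hecke_function(1) by blast

lemma hecke_op_linear:
 assumes v: "v \<in> I'" and \<nu>: "finite \<nu>" "\<nu> \<subseteq> I'"
 shows "hecke_op v \<nu> \<in> linear_maps R (MK \<nu>) (MK \<nu>)"
proof -
 note A = Kl_level[OF \<nu>] and m = MGr.obj_module[OF Kl_level[OF \<nu>]]
 show ?thesis
  unfolding hecke_op_eq[OF v]
  by (rule linear_maps_sum[OF m m finite_support_cosets[OF v]])
   (rule linear_maps_smult_left[OF m hecke_star_linear[OF A RG.embed_at_closed[OF I'I[OF v] support_coset(1)[OF v]]]
     hecke_coeff[OF v support_coset(1)[OF v]]])
qed

text \<open>f is constant on each double coset of K_v, so its coefficient can be moved inside the
  Mackey expansion as f(\<gamma>s). The sums over the double cosets in the support then combine into
  one sum over \<open>hecke_reps\<close>. The conditions at v say that this slot still holds the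
  unmodified data.\<close>

lemma hecke_op_B:
 assumes val: "valid \<nu> g W x" and v: "v \<in> I'" "v \<notin> \<nu>" and gv: "g v = \<one>\<^bsub>G v\<^esub>" and Wv: "W v = U v" and xv: "x v = \<phi> v"
 shows "hecke_op v \<nu> (B \<nu> g W x) =
  (\<Oplus>\<^bsub>MK \<nu>\<^esub>\<g>\<in>hecke_reps v. f v \<g> \<odot>\<^bsub>MK \<nu>\<^esub> shifted \<nu> g W x v \<g>)"
proof -
 note D = validD[OF val] and vI = I'I[OF v(1)]
 interpret Gv: group "G v" by (rule grp[OF vI])
 interpret A: Module.module R "MK \<nu>" by (rule MGr.obj_module[OF D(1)])
 let ?b = "shifted \<nu> g W x v" and ?S = "support_cosets v" and ?\<G> = "unit_reps v"
 note S = support_coset[OF v(1)] and u = unit_rep_mem[OF v(1)]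
 have bc: "?b \<g> \<in> carrier (MK \<nu>)" if "\<g> \<in> carrier (G v)" for \<g>
  unfolding shifted_def by (rule B_closed[OF shifted_valid[OF val v that]])
 have fc: "f v \<g> \<odot>\<^bsub>MK \<nu>\<^esub> ?b \<g> \<in> carrier (MK \<nu>)" if "\<g> \<in> carrier (G v)" for \<g>
  using bc[OF that] hecke_coeff[OF v(1) that] by simp
 have mem: "\<g> \<otimes>\<^bsub>G v\<^esub> coset_rep D \<in> carrier (G v)" if "D \<in> ?S" "\<g> \<in> ?\<G> D" for D \<g>
  using u(2)[OF that] S(1)[OF that(1)] by simp
 have inner: "f v (coset_rep D) \<odot>\<^bsub>MK \<nu>\<^esub> hecke_star GR MG (Kl \<nu>) (embed_at I G v (coset_rep D)) (Kl \<nu>) (B \<nu> g W x) =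
   (\<Oplus>\<^bsub>MK \<nu>\<^esub>\<g>\<in>(%\<g>. \<g> \<otimes>\<^bsub>G v\<^esub> coset_rep D) ` ?\<G> D. f v \<g> \<odot>\<^bsub>MK \<nu>\<^esub> ?b \<g>)" if D': "D \<in> ?S" for D
 proof -
  have "f v (coset_rep D) \<odot>\<^bsub>MK \<nu>\<^esub> hecke_star GR MG (Kl \<nu>) (embed_at I G v (coset_rep D)) (Kl \<nu>) (B \<nu> g W x) =
    f v (coset_rep D) \<odot>\<^bsub>MK \<nu>\<^esub> (\<Oplus>\<^bsub>MK \<nu>\<^esub>\<g>\<in>?\<G> D. ?b (\<g> \<otimes>\<^bsub>G v\<^esub> coset_rep D))"
   unfolding hecke_star_B[OF val v gv Wv xv S(1)[OF D'] S(4)[OF D'] S(3)[OF D']] ..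
  also have "\<dots> = (\<Oplus>\<^bsub>MK \<nu>\<^esub>\<g>\<in>?\<G> D. f v (coset_rep D) \<odot>\<^bsub>MK \<nu>\<^esub> ?b (\<g> \<otimes>\<^bsub>G v\<^esub> coset_rep D))"
   by (rule A.finsum_smult_ldistr[OF S(4)[OF D'] hecke_coeff[OF v(1) S(1)[OF D']]]) (use bc mem[OF D'] in blast)
  also have "\<dots> = (\<Oplus>\<^bsub>MK \<nu>\<^esub>\<g>\<in>?\<G> D. f v (\<g> \<otimes>\<^bsub>G v\<^esub> coset_rep D) \<odot>\<^bsub>MK \<nu>\<^esub> ?b (\<g> \<otimes>\<^bsub>G v\<^esub> coset_rep D))"
   by (rule A.finsum_cong'[OF refl]) (use fc mem[OF D'] u(3)[OF D'] in auto)
  also have "\<dots> = (\<Oplus>\<^bsub>MK \<nu>\<^esub>\<g>\<in>(%\<g>. \<g> \<otimes>\<^bsub>G v\<^esub> coset_rep D) ` ?\<G> D. f v \<g> \<odot>\<^bsub>MK \<nu>\<^esub> ?b \<g>)"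
  proof (rule A.finsum_reindex[symmetric])
   show "(%\<g>. f v \<g> \<odot>\<^bsub>MK \<nu>\<^esub> ?b \<g>) \<in> (%\<g>. \<g> \<otimes>\<^bsub>G v\<^esub> coset_rep D) ` ?\<G> D \<rightarrow> carrier (MK \<nu>)"
    using fc mem[OF D'] by blast
   show "inj_on (%\<g>. \<g> \<otimes>\<^bsub>G v\<^esub> coset_rep D) (?\<G> D)"
    by (rule inj_onI) (use Gv.right_cancel S(1)[OF D'] u(2)[OF D'] in blast)
  qed
  finally show ?thesis .
 qed
 have "hecke_op v \<nu> (B \<nu> g W x) =
   (\<Oplus>\<^bsub>MK \<nu>\<^esub>D\<in>?S. \<Oplus>\<^bsub>MK \<nu>\<^esub>\<g>\<in>(%\<g>. \<g> \<otimes>\<^bsub>G v\<^esub> coset_rep D) ` ?\<G> D. f v \<g> \<odot>\<^bsub>MK \<nu>\<^esub> ?b \<g>)"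
  unfolding hecke_op_eq[OF v(1)] by (rule A.finsum_cong'[OF refl _ inner]) (use fc mem in \<open>auto intro!: A.finsum_closed\<close>)
 also have "\<dots> = (\<Oplus>\<^bsub>MK \<nu>\<^esub>\<g>\<in>hecke_reps v. f v \<g> \<odot>\<^bsub>MK \<nu>\<^esub> ?b \<g>)"
  unfolding hecke_data.hecke_reps_def[OF hecke_data[OF v(1)]]
 proof (rule A.add.finprod_UN_disjoint[symmetric, OF finite_support_cosets[OF v(1)]])
  show "finite ((%\<g>. \<g> \<otimes>\<^bsub>G v\<^esub> coset_rep D) ` ?\<G> D)" if "D \<in> ?S" for D using S(4)[OF that] by simp
  show "pairwise (%D D'. disjnt ((%\<g>. \<g> \<otimes>\<^bsub>G v\<^esub> coset_rep D) ` ?\<G> D) ((%\<g>. \<g> \<otimes>\<^bsub>G v\<^esub> coset_rep D') ` ?\<G> D')) ?S"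
  proof (rule pairwiseI)
   fix D D' assume DD: "D \<in> ?S" "D' \<in> ?S" "D ~= D'"
   have "(%\<g>. \<g> \<otimes>\<^bsub>G v\<^esub> coset_rep D) ` ?\<G> D \<subseteq> D" "(%\<g>. \<g> \<otimes>\<^bsub>G v\<^esub> coset_rep D') ` ?\<G> D' \<subseteq> D'"
    using u(1) DD by blast+
   moreover have "D \<inter> D' = {}" using support_coset_unique[OF v(1) DD(1,2)] DD(3) by blast
   ultimately show "disjnt ((%\<g>. \<g> \<otimes>\<^bsub>G v\<^esub> coset_rep D) ` ?\<G> D) ((%\<g>. \<g> \<otimes>\<^bsub>G v\<^esub> coset_rep D') ` ?\<G> D')"
    unfolding disjnt_def by blast
  qed
  show "f v \<g> \<odot>\<^bsub>MK \<nu>\<^esub> ?b \<g> \<in> carrier (MK \<nu>)"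
   if "D \<in> ?S" "\<g> \<in> (%\<g>. \<g> \<otimes>\<^bsub>G v\<^esub> coset_rep D) ` ?\<G> D" for D \<g> using that fc mem by blast
 qed
 finally show ?thesis .
qed

end

section \<open>The Euler system classes\<close>

context setting
begin

context
 fixes J :: "'i => ('a \<times> nat) set" and gv :: "'i => 'a \<times> nat => 'a" and Vv :: "'i => 'a \<times> nat => 'a set"
  and xv :: "'i => 'a \<times> nat => 'n"
 assumes J_fin: "\<And>v. v \<in> I' ==> finite (J v)"
  and J_data: "\<And>v j. v \<in> I' ==> j \<in> J v ==> gv v j \<in> carrier (G v) \<and> Vv v j \<in> \<L>Hv v \<and>
   Vv v j \<subseteq> conj_by (G v) (gv v j) (L v) \<and> xv v j \<in> carrier (obj (N v) (Vv v j))"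
  and J_sum: "\<And>v X (P :: ('r, 'mg) module) b. v \<in> I' ==> reps v X ==> equivariant v P b ==>
   (\<Oplus>\<^bsub>P\<^esub>j\<in>J v. b (gv v j) (Vv v j) (xv v j)) =
   (\<Oplus>\<^bsub>P\<^esub>\<g>\<in>X. f v \<g> \<odot>\<^bsub>P\<^esub> b \<g> (U v \<inter> stab v \<g>) (pull (N v) (U v \<inter> stab v \<g>) \<one>\<^bsub>G v\<^esub> (U v) (\<phi> v)))"
begin

definition "tg \<k> c = (\<lambda>w\<in>I. if w \<in> \<k> then gv w (c w) else \<one>\<^bsub>G w\<^esub>)"
definition "tW \<k> c w = (if w \<in> \<k> then Vv w (c w) else U w)"
definition "tx \<k> c w = (if w \<in> \<k> then xv w (c w) else \<phi> w)"

text \<open>The first argument is the level, the second the set of places where the zeta data have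
  been inserted. The Euler system consists of the diagonal terms; projection lowers the first
  argument, Hecke operators enlarge the second, and the two sides of the norm relation meet in
  \<open>cls \<nu> \<mu>\<close>.\<close>

definition "cls \<nu> \<k> = (\<Oplus>\<^bsub>MK \<nu>\<^esub>c\<in>PiE \<k> J. B \<nu> (tg \<k> c) (tW \<k> c) (tx \<k> c))"

text \<open>At the places of \<k> the local levels lie in conjugates of L_v, by the support
  condition on zeta elements, and elsewhere they are U_v inside K_v. This gives validity at level
  K[\<k>], and \<open>B_push\<close> passes to the coarser level K[\<nu>].\<close>

lemma tuple_valid:
 assumes \<k>: "finite \<k>" "\<k> \<subseteq> I'" and c: "c \<in> PiE \<k> J" and \<nu>: "\<nu> \<subseteq> \<k>"
 shows "valid \<nu> (tg \<k> c) (tW \<k> c) (tx \<k> c)"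
proof (rule B_push(1)[OF _ \<nu>])
 have d: "gv w (c w) \<in> carrier (G w)" "Vv w (c w) \<in> \<L>Hv w" "Vv w (c w) \<subseteq> conj_by (G w) (gv w (c w)) (L w)"
  "xv w (c w) \<in> carrier (obj (N w) (Vv w (c w)))" if "w \<in> \<k>" for w
  using J_data[of w "c w"] PiE_mem[OF c that] \<k>(2) that by blast+
 have fin: "finite {w\<in>I. w \<in> \<k> \<and> Q w}" for Q by (rule finite_subset[OF _ \<k>(1)]) blast
 have "tg \<k> c \<in> carrier GR"
  unfolding RG.RP_carrier
 proof
  show "tg \<k> c \<in> (\<Pi>\<^sub>E v\<in>I. carrier (G v))"
   using d(1) group.is_monoid[OF grp] by (auto simp: tg_def monoid.one_closed)
  show "finite {v\<in>I. tg \<k> c v \<notin> K v}"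
   by (rule finite_subset[OF _ \<k>(1)]) (use subgroup.one_closed[OF K_sg] in \<open>auto simp: tg_def split: if_splits\<close>)
 qed
 moreover have "RT.adm (tW \<k> c)"
  unfolding RT.adm_def
 proof
  show "\<forall>v\<in>I. tW \<k> c v \<in> \<L>Hv v" using d(2) U_level by (simp add: tW_def)
  show "finite {v\<in>I. tW \<k> c v ~= U v}" by (rule finite_subset[OF _ \<k>(1)]) (auto simp: tW_def split: if_splits)
 qed
 moreover have "RT.tuple (tW \<k> c) (tx \<k> c)"
  unfolding RT.tuple_def
 proof
  show "\<forall>v\<in>I. tx \<k> c v \<in> carrier (obj (N v) (tW \<k> c v))" using d(4) local_functors(3) by (simp add: tx_def tW_def)
  show "finite {v\<in>I. tx \<k> c v ~= \<phi> v}" by (rule finite_subset[OF _ \<k>(1)]) (auto simp: tx_def split: if_splits)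
 qed
 moreover have "tW \<k> c w \<subseteq> conj_by (G w) (tg \<k> c w) (Kc \<k> w)" if "w \<in> I" for w
  using d(3) that group.conj_by_one[OF grp[OF that] subgroup.subset[OF K_sg[OF that]]] local_groups(7)[of w]
  by (simp add: tW_def tg_def Kc_def)
 ultimately show "valid \<k> (tg \<k> c) (tW \<k> c) (tx \<k> c)" using \<k> unfolding valid_def by blast
qed

lemma tuple_upd:
 assumes "v \<in> I" "v \<notin> \<k>"
 shows "tg (insert v \<k>) (c(v := j)) = (tg \<k> c)(v := gv v j)"
  "tW (insert v \<k>) (c(v := j)) = (tW \<k> c)(v := Vv v j)"
  "tx (insert v \<k>) (c(v := j)) = (tx \<k> c)(v := xv v j)"
 using assms by (auto simp: tg_def tW_def tx_def fun_eq_iff)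

lemma PiE_J_fin: "finite \<k> ==> \<k> \<subseteq> I' ==> finite (PiE \<k> J)"
 by (rule finite_PiE) (use J_fin in auto)

lemma cls_closed: "finite \<k> ==> \<k> \<subseteq> I' ==> \<nu> \<subseteq> \<k> ==> cls \<nu> \<k> \<in> carrier (MK \<nu>)"
proof -
 assume a: "finite \<k>" "\<k> \<subseteq> I'" "\<nu> \<subseteq> \<k>"
 interpret A: Module.module R "MK \<nu>"
  by (rule MGr.obj_module[OF Kl_level]) (use a finite_subset in blast)+
 show ?thesis unfolding cls_def by (rule A.finsum_closed) (use B_closed[OF tuple_valid[OF a(1,2) _ a(3)]] in blast)
qed

text \<open>The slot at v still contains (1, U_v, \<phi>_v). The Hecke operator spreads it out over
  the Mackey representatives, and the local identity replaces this sum by the sum over the zeta data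
  at v. Choices on \<k> together with one at v are the choices on the enlarged set.\<close>

lemma hecke_cls:
 assumes \<k>: "finite \<k>" "\<k> \<subseteq> I'" and \<nu>: "\<nu> \<subseteq> \<k>" and v: "v \<in> I'" "v \<notin> \<k>"
 shows "hecke_op v \<nu> (cls \<nu> \<k>) = cls \<nu> (insert v \<k>)"
proof -
 have \<nu>f: "finite \<nu>" "\<nu> \<subseteq> I'" using \<k> \<nu> finite_subset by blast+
 have vI: "v \<in> I" by (rule I'I[OF v(1)])
 have v\<nu>: "v \<notin> \<nu>" using v(2) \<nu> by blast
 note m = MGr.obj_module[OF Kl_level[OF \<nu>f]]
 interpret A: Module.module R "MK \<nu>" by (rule m)
 note val = tuple_valid[OF \<k> _ \<nu>]
 let ?\<k> = "insert v \<k>"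
 have \<k>': "finite ?\<k>" "?\<k> \<subseteq> I'" "\<nu> \<subseteq> ?\<k>" using \<k> v \<nu> by auto
 let ?b = "%c. B \<nu> (tg ?\<k> c) (tW ?\<k> c) (tx ?\<k> c)"
 have upd: "c(v := j) \<in> PiE ?\<k> J" if "c \<in> PiE \<k> J" "j \<in> J v" for c j
  using that by (auto simp: PiE_iff extensional_def)
 have bc: "?b c \<in> carrier (MK \<nu>)" if "c \<in> PiE ?\<k> J" for c by (rule B_closed[OF tuple_valid[OF \<k>'(1,2) that \<k>'(3)]])
 have inner: "hecke_op v \<nu> (B \<nu> (tg \<k> c) (tW \<k> c) (tx \<k> c)) = (\<Oplus>\<^bsub>MK \<nu>\<^esub>d\<in>(%j. c(v := j)) ` J v. ?b d)"
  if c: "c \<in> PiE \<k> J" for c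
 proof -
  have "hecke_op v \<nu> (B \<nu> (tg \<k> c) (tW \<k> c) (tx \<k> c)) =
    (\<Oplus>\<^bsub>MK \<nu>\<^esub>\<g>\<in>hecke_reps v. f v \<g> \<odot>\<^bsub>MK \<nu>\<^esub> shifted \<nu> (tg \<k> c) (tW \<k> c) (tx \<k> c) v \<g>)"
   by (rule hecke_op_B[OF val[OF c] v(1) v\<nu>]) (use v(2) vI in \<open>simp_all add: tg_def tW_def tx_def\<close>)
  also have "\<dots> = (\<Oplus>\<^bsub>MK \<nu>\<^esub>j\<in>J v. B \<nu> ((tg \<k> c)(v := gv v j)) ((tW \<k> c)(v := Vv v j)) ((tx \<k> c)(v := xv v j)))"
   unfolding shifted_def
   by (rule J_sum[OF v(1) reps_hecke_reps[OF v(1)] equivariant_B[OF val[OF c] v(1) v\<nu>], symmetric])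
  also have "\<dots> = (\<Oplus>\<^bsub>MK \<nu>\<^esub>j\<in>J v. ?b (c(v := j)))"
   unfolding tuple_upd[OF vI v(2)] ..
  also have "\<dots> = (\<Oplus>\<^bsub>MK \<nu>\<^esub>d\<in>(%j. c(v := j)) ` J v. ?b d)"
  proof (rule A.finsum_reindex[symmetric])
   show "?b \<in> (%j. c(v := j)) ` J v \<rightarrow> carrier (MK \<nu>)" using bc upd[OF c] by blast
   show "inj_on (%j. c(v := j)) (J v)" by (rule inj_onI) (drule fun_cong[of _ _ v], simp)
  qed
  finally show ?thesis .
 qed
 have PiE_eq: "PiE ?\<k> J = (\<Union>c\<in>PiE \<k> J. (%j. c(v := j)) ` J v)"
  unfolding PiE_insert_eq by auto
 have "hecke_op v \<nu> (cls \<nu> \<k>) = (\<Oplus>\<^bsub>MK \<nu>\<^esub>c\<in>PiE \<k> J. hecke_op v \<nu> (B \<nu> (tg \<k> c) (tW \<k> c) (tx \<k> c)))"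
  unfolding cls_def
  by (rule linear_maps_finsum[OF m m hecke_op_linear[OF v(1) \<nu>f] PiE_J_fin[OF \<k>]]) (use B_closed[OF val] in blast)
 also have "\<dots> = (\<Oplus>\<^bsub>MK \<nu>\<^esub>c\<in>PiE \<k> J. \<Oplus>\<^bsub>MK \<nu>\<^esub>d\<in>(%j. c(v := j)) ` J v. ?b d)"
 proof (rule A.finsum_cong'[OF refl _ inner], intro funcsetI A.finsum_closed)
  show "?b d \<in> carrier (MK \<nu>)" if "c \<in> PiE \<k> J" "d \<in> (%j. c(v := j)) ` J v" for c d
   using bc upd[OF that(1)] that(2) by blast
 qed
 also have "\<dots> = cls \<nu> ?\<k>"
  unfolding cls_def PiE_eq
 proof (rule A.add.finprod_UN_disjoint[symmetric, OF PiE_J_fin[OF \<k>]])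
  show "finite ((%j. c(v := j)) ` J v)" for c using J_fin[OF v(1)] by simp
  show "pairwise (%c d. disjnt ((%j. c(v := j)) ` J v) ((%j. d(v := j)) ` J v)) (PiE \<k> J)"
  proof (rule pairwiseI)
   fix c d assume c: "c \<in> PiE \<k> J" and d: "d \<in> PiE \<k> J" and cd: "c ~= d"
   \<comment> \<open>Overwriting the value at v loses no information: v is outside \<k>, so both
     functions are undefined there.\<close>
   have "c(v := i) ~= d(v := j)" for i j
   proof
    assume e: "c(v := i) = d(v := j)"
    have "c w = d w" for w
    proof (cases "w = v")
     case True
     then show ?thesis using PiE_arb[OF c v(2)] PiE_arb[OF d v(2)] by simp
    next
     case False
     then show ?thesis using fun_cong[OF e, of w] by simp
    qed
    then show False using cd by blast
   qed
   then show "disjnt ((%j. c(v := j)) ` J v) ((%j. d(v := j)) ` J v)" unfolding disjnt_def by blast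
  qed
  show "?b d \<in> carrier (MK \<nu>)" if "c \<in> PiE \<k> J" "d \<in> (%j. c(v := j)) ` J v" for c d
   using bc upd that by blast
 qed
 finally show ?thesis .
qed

text \<open>Each operator inserts the zeta data at its own place, so the outcome depends only on the
  set of places, whatever the order of the list.\<close>

lemma foldr_cls:
 assumes \<nu>: "finite \<nu>" "\<nu> \<subseteq> I'" and vs: "distinct vs" "set vs \<inter> \<nu> = {}" "set vs \<subseteq> I'"
 shows "foldr (%v. hecke_op v \<nu>) vs (cls \<nu> \<nu>) = cls \<nu> (\<nu> \<union> set vs)"
 using vs
proof (induction vs)
 case (Cons v vs)
 have "foldr (%v. hecke_op v \<nu>) vs (cls \<nu> \<nu>) = cls \<nu> (\<nu> \<union> set vs)" by (rule Cons.IH) (use Cons.prems in auto)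
 moreover have "hecke_op v \<nu> (cls \<nu> (\<nu> \<union> set vs)) = cls \<nu> (insert v (\<nu> \<union> set vs))"
  by (rule hecke_cls) (use Cons.prems \<nu> in auto)
 ultimately show ?case by simp
qed simp

text \<open>The projection is linear and each summand is moved by \<open>B_push\<close>; the zeta
  data at all places of \<mu> are retained.\<close>

lemma push_cls:
 assumes \<mu>: "finite \<mu>" "\<mu> \<subseteq> I'" and \<nu>: "\<nu> \<subseteq> \<mu>"
 shows "push MG (Kl \<mu>) \<e> (Kl \<nu>) (cls \<mu> \<mu>) = cls \<nu> \<mu>"
proof -
 have \<nu>f: "finite \<nu>" "\<nu> \<subseteq> I'" using \<mu> \<nu> finite_subset by blast+
 note lev = Kl_level[OF \<mu>] Kl_level[OF \<nu>f]
 interpret A: Module.module R "MK \<nu>" by (rule MGr.obj_module[OF lev(2)])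
 note val = tuple_valid[OF \<mu> _ order_refl]
 have "Kl \<mu> \<subseteq> Kl \<nu>" unfolding Kl_eq by (rule PiE_mono) (use L_sub_K \<mu> \<nu> in \<open>auto simp: Kc_def\<close>)
 then have s: "Kl \<mu> \<subseteq> conj_by GR \<e> (Kl \<nu>)" using RG.RP.conj_by_one[OF MGr.level_carrier[OF lev(2)]] by simp
 have "push MG (Kl \<mu>) \<e> (Kl \<nu>) (cls \<mu> \<mu>) =
   (\<Oplus>\<^bsub>MK \<nu>\<^esub>c\<in>PiE \<mu> J. push MG (Kl \<mu>) \<e> (Kl \<nu>) (B \<mu> (tg \<mu> c) (tW \<mu> c) (tx \<mu> c)))"
  unfolding cls_def
  by (rule linear_maps_finsum[OF MGr.obj_module[OF lev(1)] MGr.obj_module[OF lev(2)] MGr.push_linear[OF lev RG.RP.one_closed s] PiE_J_fin[OF \<mu>]])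
   (use B_closed[OF val] in blast)
 also have "\<dots> = cls \<nu> \<mu>"
  unfolding cls_def
  by (rule A.finsum_cong'[OF refl _ B_push(2)[OF val \<nu>]]) (use B_closed[OF tuple_valid[OF \<mu> _ \<nu>]] in blast)
 finally show ?thesis .
qed

lemma cls_empty: "cls {} {} = \<iota> (PiE I U) (PiE I K) (\<psi> (PiE I U) (rt_unit R I U N \<phi>))"
proof -
 have lev: "Kl {} \<in> \<L>G" by (rule Kl_level) auto
 interpret A: Module.module R "obj MG (Kl {})" by (rule MGr.obj_module[OF lev])
 \<comment> \<open>For no places there is exactly one choice, the function that is undefined
   everywhere, so the sum has a single term, with trivial g, level U and the unit tensor.\<close>
 let ?c = "%_. undefined"
 have K: "Kl {} = PiE I K" unfolding levels_L(4) by simp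
 have one: "conj_by GR \<e> (PiE I K) = PiE I K" by (rule RG.RP.conj_by_one[OF MGr.level_carrier[OF lev[unfolded K]]])
 have t: "tg {} ?c = \<e>" "tW {} ?c = U" "tx {} ?c = \<phi>" by (auto simp: tg_def tW_def tx_def RG.RP_one)
 have val: "valid {} \<e> U \<phi>" using tuple_valid[of "{}" ?c "{}"] unfolding t by simp
 have "cls {} {} = B {} \<e> U \<phi>"
  unfolding cls_def PiE_empty_domain using B_closed[OF val] by (simp add: t)
 also have "\<dots> = \<iota> (PiE I U) (PiE I K) (\<Theta> U \<phi>)"
  unfolding B_def K one using MGr.push_one[OF lev] iota_\<Theta>_closed[OF val] unfolding K one by blast
 finally show ?thesis unfolding \<Theta>_def RT.rt_unit_eq .
qed

end

lemma classes_exist: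
 "\<exists>y :: 'i set => 'mg.
   (\<forall>\<nu>. finite \<nu> \<and> \<nu> \<subseteq> I' --> y \<nu> \<in> carrier (MK \<nu>)) \<and>
   y {} = \<iota> (PiE I U) (PiE I K) (\<psi> (PiE I U) (rt_unit R I U N \<phi>)) \<and>
   (\<forall>\<mu> \<nu>. finite \<mu> \<and> \<mu> \<subseteq> I' \<and> \<nu> \<subseteq> \<mu> -->
    (\<forall>vs. distinct vs \<and> set vs = \<mu> - \<nu> -->
      foldr (%v. hecke_operator R I G K MG v (f v) (Kl \<nu>)) vs (y \<nu>) = push MG (Kl \<mu>) \<e> (Kl \<nu>) (y \<mu>)))"
proof -
 \<comment> \<open>The output of \<open>local_main\<close> is bundled so that it can be chosen
   simultaneously at all places. One choice serves every \<nu>, which makes the resulting classes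
   comparable.\<close>
 define LM where "LM v J g V x \<longleftrightarrow> finite J \<and>
   (\<forall>c\<in>J. g c \<in> carrier (G v) \<and> V c \<in> \<L>Hv v \<and> V c \<subseteq> conj_by (G v) (g c) (L v) \<and> x c \<in> carrier (obj (N v) (V c))) \<and>
   (\<forall>X (P :: ('r, 'mg) module) b. reps v X \<and> equivariant v P b -->
    (\<Oplus>\<^bsub>P\<^esub>c\<in>J. b (g c) (V c) (x c)) =
    (\<Oplus>\<^bsub>P\<^esub>\<g>\<in>X. f v \<g> \<odot>\<^bsub>P\<^esub> b \<g> (U v \<inter> stab v \<g>) (pull (N v) (U v \<inter> stab v \<g>) \<one>\<^bsub>G v\<^esub> (U v) (\<phi> v))))"
  for v and J :: "('a \<times> nat) set" and g V x
 have "\<forall>v\<in>I'. \<exists>J g V x. LM v J g V x" using local_main unfolding LM_def by (rule ballI)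
 then obtain J g V x where "\<And>v. v \<in> I' ==> LM v (J v) (g v) (V v) (x v)" by metis
 note d = this[unfolded LM_def]
 have J1: "finite (J v)" if "v \<in> I'" for v using d[OF that] by (elim conjE)
 have J2: "g v j \<in> carrier (G v) \<and> V v j \<in> \<L>Hv v \<and> V v j \<subseteq> conj_by (G v) (g v j) (L v) \<and> x v j \<in> carrier (obj (N v) (V v j))"
  if "v \<in> I'" "j \<in> J v" for v j
  by (rule bspec[OF d[OF that(1), THEN conjunct2, THEN conjunct1] that(2)])
 have J3: "(\<Oplus>\<^bsub>P\<^esub>j\<in>J v. b (g v j) (V v j) (x v j)) =
   (\<Oplus>\<^bsub>P\<^esub>\<g>\<in>X. f v \<g> \<odot>\<^bsub>P\<^esub> b \<g> (U v \<inter> stab v \<g>) (pull (N v) (U v \<inter> stab v \<g>) \<one>\<^bsub>G v\<^esub> (U v) (\<phi> v)))"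
  if "v \<in> I'" "reps v X" "equivariant v P b" for v X and P :: "('r, 'mg) module" and b
  by (rule d[OF that(1), THEN conjunct2, THEN conjunct2, rule_format, OF conjI[OF that(2,3)]])
 \<comment> \<open>The diagonal terms: zeta data at exactly the places where the level is
   L_v.\<close>
 define y where "y \<nu> = cls J g V x \<nu> \<nu>" for \<nu>
 show ?thesis
 proof (intro exI[of _ y] conjI allI impI)
  show "y \<nu> \<in> carrier (MK \<nu>)" if "finite \<nu> \<and> \<nu> \<subseteq> I'" for \<nu>
   unfolding y_def by (rule cls_closed[OF J1 J2 J3]) (use that in auto)
  show "y {} = \<iota> (PiE I U) (PiE I K) (\<psi> (PiE I U) (rt_unit R I U N \<phi>))"
   unfolding y_def by (rule cls_empty[OF J1 J2 J3])
  fix \<mu> \<nu> vs assume \<mu>: "finite \<mu> \<and> \<mu> \<subseteq> I' \<and> \<nu> \<subseteq> \<mu>" and vs: "distinct vs \<and> set vs = \<mu> - \<nu>"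
  have \<nu>: "finite \<nu>" "\<nu> \<subseteq> I'" using \<mu> finite_subset by blast+
  have "foldr (%v. hecke_op v \<nu>) vs (y \<nu>) = cls J g V x \<nu> (\<nu> \<union> set vs)"
   unfolding y_def by (rule foldr_cls[OF J1 J2 J3 \<nu>]) (use \<mu> vs in auto)
  also have "\<nu> \<union> set vs = \<mu>" using \<mu> vs by blast
  also have "cls J g V x \<nu> \<mu> = push MG (Kl \<mu>) \<e> (Kl \<nu>) (y \<mu>)"
   unfolding y_def by (rule push_cls[OF J1 J2 J3, symmetric]) (use \<mu> in auto)
  finally show "foldr (%v. hecke_op v \<nu>) vs (y \<nu>) = push MG (Kl \<mu>) \<e> (Kl \<nu>) (y \<mu>)" .
 qed
qed

end

theorem theorem3p4p2:
  fixes I I' :: "'i set"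
    and G :: "'i \<Rightarrow> 'a monoid" and T :: "'i \<Rightarrow> 'a topology"
    and H :: "'i \<Rightarrow> 'a set" and haar :: "'i \<Rightarrow> 'a measure"
    and K L U :: "'i \<Rightarrow> 'a set"
    and GG HH :: "('i \<Rightarrow> 'a) monoid"
    and \<Upsilon>G \<Upsilon>H :: "('i \<Rightarrow> 'a) set set"
    and \<Upsilon>Hv :: "'i \<Rightarrow> 'a set set"
    and Kl :: "'i set \<Rightarrow> ('i \<Rightarrow> 'a) set"
    and R :: "'r ring" and \<Phi> :: "'k ring" and e :: "'r \<Rightarrow> 'k" and \<rho> :: "rat \<Rightarrow> 'k"
    and MH :: "('i \<Rightarrow> 'a, 'r, 'mh) ric" and MG :: "('i \<Rightarrow> 'a, 'r, 'mg) ric"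
    and \<iota> :: "('i \<Rightarrow> 'a) set \<Rightarrow> ('i \<Rightarrow> 'a) set \<Rightarrow> 'mh \<Rightarrow> 'mg"
    and xU :: 'mh and yK :: 'mg
    and \<HH> :: "'i \<Rightarrow> 'a \<Rightarrow> 'r"
    and N :: "'i \<Rightarrow> ('a, 'r, 'n) ric" and \<phi> :: "'i \<Rightarrow> 'n"
    and \<psi> :: "('i \<Rightarrow> 'a) set \<Rightarrow> ('i set \<times> (('i \<Rightarrow> 'n) \<Rightarrow> 'r) set) set \<Rightarrow> 'mh"
  assumes local_groups:
      "\<And>v. v \<in> I \<Longrightarrow> locally_profinite (G v) (T v)"
      "\<And>v. v \<in> I \<Longrightarrow> unimodular (G v) (T v)"
      "\<And>v. v \<in> I \<Longrightarrow> subgroup (H v) (G v)"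
      "\<And>v. v \<in> I \<Longrightarrow> closedin (T v) (H v)"
      "\<And>v. v \<in> I \<Longrightarrow> unimodular ((G v)\<lparr>carrier := H v\<rparr>) (subtopology (T v) (H v))"
      "\<And>v. v \<in> I \<Longrightarrow>
         left_haar_measure ((G v)\<lparr>carrier := H v\<rparr>) (subtopology (T v) (H v)) (haar v)"
      "\<And>v. v \<in> I \<Longrightarrow> compact_open_subgroup (G v) (T v) (K v)"
      "\<And>v. U v = H v \<inter> K v"
    and global_groups:
      "GG = restricted_product I G K"
      "HH = restricted_product I (\<lambda>v. (G v)\<lparr>carrier := H v\<rparr>) U"
    and levels_L:
      "I' \<subseteq> I" "finite (I - I')"
      "\<And>v. v \<in> I' \<Longrightarrow> compact_open_subgroup (G v) (T v) (L v)"
      "\<And>v. v \<in> I' \<Longrightarrow> L v \<lhd> (G v)\<lparr>carrier := K v\<rparr>"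
      "\<And>\<nu>. Kl \<nu> = (\<Pi>\<^sub>E v\<in>I. if v \<in> \<nu> then L v else K v)"
    and collections:
      "level_collection GG (restricted_topology I T K) \<Upsilon>G"
      "PiE I K \<in> \<Upsilon>G"
      "\<And>v. v \<in> I' \<Longrightarrow> Kl {v} \<in> \<Upsilon>G"
      "level_collection HH (restricted_topology I (\<lambda>v. subtopology (T v) (H v)) U) \<Upsilon>H"
      "\<And>K'. K' \<in> \<Upsilon>G \<Longrightarrow> K' \<inter> carrier HH \<in> \<Upsilon>H"
      "\<And>v. \<Upsilon>Hv v =
         {K' \<inter> H v | K'. K' \<in> conj_intersections (G v) (if v \<in> I' then {K v, L v} else {K v})}"
    and coefficients:
      "domain R" "fraction_field_of R \<Phi> e" "\<rho> \<in> ring_hom rat_ring \<Phi>"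
    and functors:
      "comack_functor R HH \<Upsilon>H MH"
      "comack_functor R GG \<Upsilon>G MG"
      "mackey_pushforward R GG (carrier HH) \<Upsilon>H \<Upsilon>G MH MG \<iota>"
      "xU \<in> carrier (obj MH (PiE I U))"
      "yK = \<iota> (PiE I U) (PiE I K) xU"
    and hecke_elements:
      "\<And>v. v \<in> I' \<Longrightarrow> \<HH> v \<in> hecke_functions R (G v) (K v)"
      "\<And>v. v \<in> I' \<Longrightarrow> \<exists>g\<in>carrier (G v). \<HH> v g \<noteq> \<zero>\<^bsub>R\<^esub>"
    and local_functors:
      "\<And>v. v \<in> I \<Longrightarrow> comack_functor R ((G v)\<lparr>carrier := H v\<rparr>) (\<Upsilon>Hv v) (N v)"
      "\<And>v V. v \<in> I \<Longrightarrow> V \<in> \<Upsilon>Hv v \<Longrightarrow> torsion_free R (obj (N v) V)"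
      "\<And>v. v \<in> I \<Longrightarrow> \<phi> v \<in> carrier (obj (N v) (U v))"
    and morphism:
      "ric_morphism R HH (product_levels I U \<Upsilon>Hv) (restricted_tensor R I U N \<phi>) MH \<psi>"
      "\<psi> (PiE I U) (rt_unit R I U N \<phi>) = xU"
    and zeta:
      "\<And>v. v \<in> I' \<Longrightarrow>
         \<exists>\<zeta>. zeta_element R \<Phi> e \<rho> (G v) (T v) (H v) (haar v) (\<Upsilon>Hv v) (N v) (K v) (L v) (\<phi> v) (\<HH> v) \<zeta>"
  shows
    "\<exists>y :: 'i set \<Rightarrow> 'mg.
       (\<forall>\<nu>. finite \<nu> \<and> \<nu> \<subseteq> I' \<longrightarrow> y \<nu> \<in> carrier (obj MG (Kl \<nu>))) \<and>
       y {} = yK \<and>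
       (\<forall>\<mu> \<nu>. finite \<mu> \<and> \<mu> \<subseteq> I' \<and> \<nu> \<subseteq> \<mu> \<longrightarrow>
          (\<forall>vs. distinct vs \<and> set vs = \<mu> - \<nu> \<longrightarrow>
             foldr (\<lambda>v. hecke_operator R I G K MG v (\<HH> v) (Kl \<nu>)) vs (y \<nu>) =
               push MG (Kl \<mu>) \<one>\<^bsub>GG\<^esub> (Kl \<nu>) (y \<mu>)))"
proof -
 note unit = morphism(2) and yK = functors(5)
 interpret setting I I' G T H haar K L U GG HH \<Upsilon>G \<Upsilon>H \<Upsilon>Hv Kl R \<Phi> e \<rho> MH MG \<iota> \<HH> N \<phi> \<psi>
  by (rule setting.intro) (fact assms)+
 \<comment> \<open>The unit tensor maps to the class at level U, whose pushforward is the prescribed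
   class at level K; this identifies the value at the empty set.\<close>
 show ?thesis using classes_exist unfolding unit yK[symmetric] global_groups(1) .
qed

end
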